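(* Let $0<m<L$, $l\in\mathbb N_0$, and let a linear system $x_{k+1}=A_Gx_k+B_Gu_k$, $z_k=C_{G1}x_k+D_{G1}u_k$, $v_k=C_{G2}x_k$ with $u_k\in\mathbb R^{n_u}$, $z_k\in\mathbb R^d$, $v_k\in\mathbb R^{n_v}$ be given. Let $\rho\in(0,1)$ be such that the associated generalized plant (see context) admits a stabilizing controller, and let $T_1,T_2,T_3$, the matrices $A,B_1,B,C_1(\Lambda),D_1(\Lambda),E,C,F$, the matrix-valued functions $\mathbf W_1,\mathbf W_2,\mathbf Y,\mathbf A,\mathbf B_1,\mathbf C_1,\mathbf D_1$ and the basis matrices $U,\mathbf V$ be as defined in the context. Then either one of the following two equivalent conditions implies that the extremum control rate satisfies $\rho_{\rm ec}\le\rho$: 1. There exist $\Lambda\in\mathbf\Lambda^r_\rho$ and a system $Z=\left[\begin{array}{c|c}A_Z&B_Z\\\hline C_Z&D_Z\end{array}\right]$ such that $A_Z$ is Schur and $\Pi(\Lambda)T_1+T_2ZT_3$ is SNR. 2. There exist symmetric matrices $X$, $W$ and $\Lambda\in\mathbf\Lambda^r_\rho$ satisfying $$\begin{pmatrix}X&\mathbf W_1\\\mathbf W_1^T&\mathbf Y\end{pmatrix}\succ0,$$ $$U^T\Big[\begin{pmatrix}A&B_1\end{pmatrix}^TX\begin{pmatrix}A&B_1\end{pmatrix}-\begin{pmatrix}I&0\end{pmatrix}^TX\begin{pmatrix}I&0\end{pmatrix}+\begin{pmatrix}C_1(\Lambda)&D_1(\Lambda)\end{pmatrix}^T\begin{pmatrix}0&I_d\end{pmatrix}+\begin{pmatrix}0&I_d\end{pmatrix}^T\begin{pmatrix}C_1(\Lambda)&D_1(\Lambda)\end{pmatrix}\Big]U\prec0,$$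 $$\mathbf V^T\Big[\begin{pmatrix}I&0\end{pmatrix}^T\mathbf Y\begin{pmatrix}I&0\end{pmatrix}-\begin{pmatrix}\mathbf A^T&\mathbf C_1^T\end{pmatrix}^T\mathbf Y^{-1}\begin{pmatrix}\mathbf A^T&\mathbf C_1^T\end{pmatrix}-\begin{pmatrix}0&I_d\end{pmatrix}^T\begin{pmatrix}\mathbf B_1^T&\mathbf D_1^T\end{pmatrix}-\begin{pmatrix}\mathbf B_1^T&\mathbf D_1^T\end{pmatrix}^T\begin{pmatrix}0&I_d\end{pmatrix}\Big]\mathbf V\succ0.$$
   Context: Basics: a square matrix is Schur if all its eigenvalues have absolute value $<1$. $M\succ0$ ($\prec0$) means real symmetric positive (negative) definite. $\left[\begin{array}{c|c}A&B\\\hline C&D\end{array}\right]$ denotes the linear operator $w\mapsto z$ on signals over $\mathbb N_0$ defined by $x_{k+1}=Ax_k+Bw_k$, $z_k=Cx_k+Dw_k$, $x_0=0$; it is stable if $A$ is Schur. Products and sums are composition and addition of operators. A stable system $G$ with $d$ inputs and outputs is strictly negative real (SNR) if there is $\varepsilon>0$ with $\langle Gw,w\rangle_2\le-\varepsilon\|w\|_2^2$ for all square-summable $w:\mathbb N_0\to\mathbb R^d$, where $\langle x,y\rangle_2=\sum_{k\ge0}x_k^Ty_k$. $\mathcal S_{m,L}$ is the class of all $C^1$-functions $f:\mathbb R^d\to\mathbb R$ with $[\nabla f(x)-\nabla f(y)]^T(x-y)\ge m\|x-y\|^2$ and $\|\nabla f(x)-\nabla f(y)\|\le L\|x-y\|$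 for all $x,y$. Extremum control: a controller is a linear time-invariant system (any state dimension) $\xi_{k+1}=A_K\xi_k+B_{K1}w_k+B_{K2}v_k$, $u_k=C_K\xi_k+D_{K2}v_k$ driven by $w_k=\nabla f(z_k)$ and $v_k$. Interconnected with the given system it yields a linear system from $w$ to $z$, $$\mathcal A=\begin{pmatrix}A_G+B_GD_{K2}C_{G2}&B_GC_K\\ B_{K2}C_{G2}&A_K\end{pmatrix},\ \mathcal B=\begin{pmatrix}0\\ B_{K1}\end{pmatrix},\ \mathcal C=\begin{pmatrix}C_{G1}+D_{G1}D_{K2}C_{G2}&D_{G1}C_K\end{pmatrix},$$ in feedback with $w_k=\nabla f(z_k)$; w.l.o.g. $(\mathcal A,\mathcal C)$ is taken detectable (i.e. $\mathcal A+M\mathcal C$ Schur for some $M$), non-detectable parts, which do not influence $z$, being removed. The controller achieves $\rho$-convergence if, for an invertible $T$ and some matrices $A_a,B_a,C_a,D_a$, one has $T^{-1}\mathcal AT=\begin{pmatrix}I_d&0\\ B_a&A_a\end{pmatrix}$, $T^{-1}\mathcal B=\begin{pmatrix}I_d\\0\end{pmatrix}$, $\mathcal CT=(D_a\ C_a)$, and there exists $K\ge0$ such that $\|z_k-z_*\|\le K\rho^k\|x_0-x_*\|$ for all $k\in\mathbb N_0$, for any $f\in\mathcal S_{m,L}$ with minimizer $z_*$, any initial condition $x_0$ of the interconnection $x_{k+1}=\mathcal Ax_k+\mathcal B\nabla f(z_k)$, $z_k=\mathcal Cx_k$, and any $x_*$ with $x_*=\mathcal Ax_*$, $z_*=\mathcal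 Cx_*$. The extremum control rate $\rho_{\rm ec}$ is the infimum of all $\rho\in(0,1)$ for which some controller achieves $\rho$-convergence ($\infty$ if none). Generalized plant: $$\tilde A=\rho^{-1}\begin{pmatrix}I_d&mC_{G1}\\0&A_G\end{pmatrix},\ \tilde B_1=\rho^{-1}\begin{pmatrix}I_d\\0\end{pmatrix},\ \tilde B=\rho^{-1}\begin{pmatrix}mD_{G1}\\ B_G\end{pmatrix},\ \tilde C_1=(L-m)\begin{pmatrix}0&C_{G1}\end{pmatrix},$$ $$\tilde D_1=-I_d,\ \tilde E=(L-m)D_{G1},\ \tilde C=\begin{pmatrix}I_d&0\\0&C_{G2}\end{pmatrix},\ \tilde F=0.$$ It admits a stabilizing controller iff there exist $\tilde M,\tilde L$ with $\tilde A+\tilde B\tilde M$ and $\tilde A+\tilde L\tilde C$ Schur; fix such matrices and set $$T_1=\left[\begin{array}{cc|c}\tilde A+\tilde B\tilde M&-\tilde B\tilde M&\tilde B_1\\0&\tilde A+\tilde L\tilde C&\tilde B_1+\tilde L\tilde F\\\hline\tilde C_1+\tilde E\tilde M&-\tilde E\tilde M&\tilde D_1\end{array}\right],\ T_2=\left[\begin{array}{c|c}\tilde A+\tilde B\tilde M&\tilde B\\\hline\tilde C_1+\tilde E\tilde M&\tilde E\end{array}\right],\ T_3=\left[\begin{array}{c|c}\tilde A+\tilde L\tilde C&\tilde B_1+\tilde L\tilde F\\\hline\tilde C&\tilde F\end{array}\right].$$ $Z$ has $d+n_v$ inputs, $n_u$ outputs and any finite state dimension. Multipliers: for $\Lambda=(\Lambda_l,\dots,\Lambda_0)$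 with $\Lambda_i\in\mathbb R^{d\times d}$, $\Pi(\Lambda)=\left[\begin{array}{c|c}A_f&B_f\\\hline C_f(\Lambda)&D_f(\Lambda)\end{array}\right]$, where $A_f\in\mathbb R^{ld\times ld}$ has identity blocks $I_d$ on the first block superdiagonal and zeros elsewhere, $B_f=(0,\dots,0,I_d)^T$, $C_f(\Lambda)=(\Lambda_l\ \cdots\ \Lambda_1)$, $D_f(\Lambda)=\Lambda_0$. $\mathbf\Lambda^r_\rho$ is the set of all tuples with $\Lambda_i=\lambda_iI_d$, $\lambda_i\in\mathbb R$, $\lambda_i\le0$ for $i=1,\dots,l$, $\sum_{i=0}^l\lambda_i\rho^i\ge0$ and $\sum_{i=0}^l\lambda_i\rho^{-i}\ge0$. Realization: fix a state-space representation, with inputs $(w,u)$ and outputs $(z,y)$, $$\begin{pmatrix}\Pi(\Lambda)T_1&T_2\\ T_3&0\end{pmatrix}=\left[\begin{array}{c|cc}A&B_1&B\\\hline C_1(\Lambda)&D_1(\Lambda)&E\\ C&F&0\end{array}\right]=\left[\begin{array}{cc|cc}A_1&0&B_{11}&0\\0&A_2&0&B_{22}\\\hline C_{11}(\Lambda)&C_{12}&D_1(\Lambda)&E\\ C_{21}&0&F&0\end{array}\right]$$ with $A_1,A_2$ Schur and $C_{11}(\Lambda),D_1(\Lambda)$ affine in $\Lambda$; for example $$A_1=\begin{pmatrix}A_f&B_f(\tilde C_1+\tilde E\tilde M)&-B_f\tilde E\tilde M\\0&\tilde A+\tilde B\tilde M&-\tilde B\tilde M\\0&0&\tilde A+\tilde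 L\tilde C\end{pmatrix},\ B_{11}=\begin{pmatrix}B_f\tilde D_1\\\tilde B_1\\\tilde B_1+\tilde L\tilde F\end{pmatrix},\ A_2=\tilde A+\tilde B\tilde M,\ B_{22}=\tilde B,$$ $C_{11}(\Lambda)=\big(C_f(\Lambda)\ \ D_f(\Lambda)(\tilde C_1+\tilde E\tilde M)\ \ -D_f(\Lambda)\tilde E\tilde M\big)$, $C_{12}=\tilde C_1+\tilde E\tilde M$, $D_1(\Lambda)=D_f(\Lambda)\tilde D_1$, $E=\tilde E$, $C_{21}=(0\ \ 0\ \ \tilde C)$, $F=\tilde F$. Variables: $W=\begin{pmatrix}W_{11}&W_{12}\\ W_{12}^T&W_{22}\end{pmatrix}$ is symmetric with the same size and partition as $A$ and $X$ is symmetric of the size of $A$. Set $$\mathbf W_1=\begin{pmatrix}W_{11}&W_{12}\\0&I\end{pmatrix},\ \mathbf W_2=\begin{pmatrix}I&0\\-W_{12}^T&W_{22}\end{pmatrix},\ \mathbf Y=\mathbf W_1^T\mathbf W_2,\ \mathbf A=\mathbf W_1^TA\mathbf W_2,\ \mathbf B_1=\mathbf W_1^TB_1,\ \mathbf C_1=C_1(\Lambda)\mathbf W_2,\ \mathbf D_1=D_1(\Lambda).$$ (One has $\mathbf Y=\mathrm{diag}(W_{11},W_{22})$.) $U$ is a matrix whose columns form a basis of $\ker\begin{pmatrix}C&F\end{pmatrix}$, and $\mathbf V=\begin{pmatrix}I&0\\0&V_1\\0&V_2\end{pmatrix}$, where the columns of $\begin{pmatrix}V_1\\ V_2\end{pmatrix}$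 form a basis of $\ker\begin{pmatrix}B_{22}^T&E^T\end{pmatrix}$, so that the columns of $\mathbf V$ form a basis of $\ker\begin{pmatrix}B^T&E^T\end{pmatrix}$. *)

theory Defs
  imports
    "Jordan_Normal_Form.Char_Poly"
    "Jordan_Normal_Form.Matrix_Kernel"
    "Jordan_Normal_Form.Gauss_Jordan_Elimination"
    "HOL-Library.Extended_Real"
begin

section \<open>Matrices and vectors\<close>

definition append_columns :: "'a::zero mat \<Rightarrow> 'a mat \<Rightarrow> 'a mat" (infixr "@\<^sub>c" 65) where
  "A @\<^sub>c B = four_block_mat A B (0\<^sub>m 0 (dim_col A)) (0\<^sub>m 0 (dim_col B))"

text \<open>Only used for invertible matrices.\<close>

definition minv :: "real mat \<Rightarrow> real mat" where
  "minv M = the (mat_inverse M)"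

definition schur :: "real mat \<Rightarrow> bool" where
  "schur A \<longleftrightarrow> square_mat A \<and>
     (\<forall>a. eigenvalue (map_mat complex_of_real A) a \<longrightarrow> cmod a < 1)"

definition sym_mat :: "real mat \<Rightarrow> bool" where
  "sym_mat M \<longleftrightarrow> square_mat M \<and> transpose_mat M = M"

definition pos_def :: "real mat \<Rightarrow> bool" where
  "pos_def M \<longleftrightarrow> sym_mat M \<and>
     (\<forall>x \<in> carrier_vec (dim_row M). x \<noteq> 0\<^sub>v (dim_row M) \<longrightarrow> x \<bullet> (M *\<^sub>v x) > 0)"

definition neg_def :: "real mat \<Rightarrow> bool" where
  "neg_def M \<longleftrightarrow> sym_mat M \<and>
     (\<forall>x \<in> carrier_vec (dim_row M). x \<noteq> 0\<^sub>v (dim_row M) \<longrightarrow> x \<bullet> (M *\<^sub>v x) < 0)"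

text \<open>The columns of \<open>U\<close> are pairwise distinct and form a
  basis of the kernel of \<open>M\<close>. A trivial kernel corresponds to \<open>U\<close> having no columns.\<close>

definition kernel_basis_mat :: "real mat \<Rightarrow> real mat \<Rightarrow> bool" where
  "kernel_basis_mat M U \<longleftrightarrow> dim_row U = dim_col M \<and> distinct (cols U) \<and>
     kernel.basis (dim_col M) M (set (cols U))"

definition vnorm :: "real vec \<Rightarrow> real" where
  "vnorm v = sqrt (v \<bullet> v)"


section \<open>Signals and linear systems\<close>

type_synonym signal = "nat \<Rightarrow> real vec"

definition signals :: "nat \<Rightarrow> signal set" where
  "signals p = {w. \<forall>k. w k \<in> carrier_vec p}"

definition l2_signals :: "nat \<Rightarrow> signal set" where
  "l2_signals p = {w \<in> signals p. summable (\<lambda>k. (vnorm (w k))\<^sup>2)}"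

definition inner_l2 :: "signal \<Rightarrow> signal \<Rightarrow> real" where
  "inner_l2 x y = (\<Sum>k. x k \<bullet> y k)"

record state_space =
  ssA :: "real mat"
  ssB :: "real mat"
  ssC :: "real mat"
  ssD :: "real mat"

definition mk_ss :: "real mat \<Rightarrow> real mat \<Rightarrow> real mat \<Rightarrow> real mat \<Rightarrow> state_space" where
  "mk_ss A B C D = \<lparr>ssA = A, ssB = B, ssC = C, ssD = D\<rparr>"

text \<open>State dimension \<open>n\<close>, \<open>p\<close> inputs, \<open>q\<close> outputs.\<close>

definition ss_dims :: "nat \<Rightarrow> nat \<Rightarrow> nat \<Rightarrow> state_space \<Rightarrow> bool" where
  "ss_dims n p q G \<longleftrightarrow> ssA G \<in> carrier_mat n n \<and> ssB G \<in> carrier_mat n p \<and>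
     ssC G \<in> carrier_mat q n \<and> ssD G \<in> carrier_mat q p"

primrec ss_state :: "state_space \<Rightarrow> signal \<Rightarrow> signal" where
  "ss_state G w 0 = 0\<^sub>v (dim_row (ssA G))"
| "ss_state G w (Suc k) = ssA G *\<^sub>v ss_state G w k + ssB G *\<^sub>v w k"

definition ss_op :: "state_space \<Rightarrow> signal \<Rightarrow> signal" where
  "ss_op G w = (\<lambda>k. ssC G *\<^sub>v ss_state G w k + ssD G *\<^sub>v w k)"

definition add_op :: "(signal \<Rightarrow> signal) \<Rightarrow> (signal \<Rightarrow> signal) \<Rightarrow> signal \<Rightarrow> signal" where
  "add_op G H = (\<lambda>w k. G w k + H w k)"

text \<open>Stability of an operator: it is given by some state-space representation with a Schur
  state matrix.\<close>

definition stable_op :: "nat \<Rightarrow> nat \<Rightarrow> (signal \<Rightarrow> signal) \<Rightarrow> bool" where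
  "stable_op p q G \<longleftrightarrow>
     (\<exists>n S. ss_dims n p q S \<and> schur (ssA S) \<and> (\<forall>w \<in> signals p. G w = ss_op S w))"

definition SNR :: "nat \<Rightarrow> (signal \<Rightarrow> signal) \<Rightarrow> bool" where
  "SNR d G \<longleftrightarrow> stable_op d d G \<and>
     (\<exists>\<epsilon>>0. \<forall>w \<in> l2_signals d. inner_l2 (G w) w \<le> - \<epsilon> * inner_l2 w w)"


section \<open>The function class\<close>

text \<open>\<open>g\<close> is the (Frechet) gradient at \<open>x\<close> of a function on \<open>carrier_vec d\<close>.\<close>

definition is_gradient_at :: "nat \<Rightarrow> (real vec \<Rightarrow> real) \<Rightarrow> real vec \<Rightarrow> real vec \<Rightarrow> bool" where
  "is_gradient_at d f x g \<longleftrightarrow> g \<in> carrier_vec d \<and>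
     (\<forall>e>0. \<exists>\<delta>>0. \<forall>y \<in> carrier_vec d. vnorm (y - x) < \<delta> \<longrightarrow>
        \<bar>f y - f x - g \<bullet> (y - x)\<bar> \<le> e * vnorm (y - x))"

definition grad :: "nat \<Rightarrow> (real vec \<Rightarrow> real) \<Rightarrow> real vec \<Rightarrow> real vec" where
  "grad d f x = (THE g. is_gradient_at d f x g)"

definition C1_function :: "nat \<Rightarrow> (real vec \<Rightarrow> real) \<Rightarrow> bool" where
  "C1_function d f \<longleftrightarrow>
     (\<forall>x \<in> carrier_vec d. \<exists>g. is_gradient_at d f x g) \<and>
     (\<forall>x \<in> carrier_vec d. \<forall>e>0. \<exists>\<delta>>0. \<forall>y \<in> carrier_vec d.
        vnorm (y - x) < \<delta> \<longrightarrow> vnorm (grad d f y - grad d f x) < e)"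

definition S_class :: "nat \<Rightarrow> real \<Rightarrow> real \<Rightarrow> (real vec \<Rightarrow> real) set" where
  "S_class d m L = {f. C1_function d f \<and>
     (\<forall>x \<in> carrier_vec d. \<forall>y \<in> carrier_vec d.
        (grad d f x - grad d f y) \<bullet> (x - y) \<ge> m * (vnorm (x - y))\<^sup>2 \<and>
        vnorm (grad d f x - grad d f y) \<le> L * vnorm (x - y))}"

definition is_minimizer :: "nat \<Rightarrow> (real vec \<Rightarrow> real) \<Rightarrow> real vec \<Rightarrow> bool" where
  "is_minimizer d f z \<longleftrightarrow> z \<in> carrier_vec d \<and> (\<forall>y \<in> carrier_vec d. f z \<le> f y)"


section \<open>Extremum control\<close>

record plant =
  AG :: "real mat"
  BG :: "real mat"
  CG1 :: "real mat"
  DG1 :: "real mat"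
  CG2 :: "real mat"

definition plant_dims :: "nat \<Rightarrow> nat \<Rightarrow> nat \<Rightarrow> nat \<Rightarrow> plant \<Rightarrow> bool" where
  "plant_dims nG nu nv d G \<longleftrightarrow>
     AG G \<in> carrier_mat nG nG \<and> BG G \<in> carrier_mat nG nu \<and>
     CG1 G \<in> carrier_mat d nG \<and> DG1 G \<in> carrier_mat d nu \<and> CG2 G \<in> carrier_mat nv nG"

record controller =
  AK :: "real mat"
  BK1 :: "real mat"
  BK2 :: "real mat"
  CK :: "real mat"
  DK2 :: "real mat"

definition controller_dims :: "nat \<Rightarrow> nat \<Rightarrow> nat \<Rightarrow> nat \<Rightarrow> controller \<Rightarrow> bool" where
  "controller_dims nK nu nv d K \<longleftrightarrow>
     AK K \<in> carrier_mat nK nK \<and> BK1 K \<in> carrier_mat nK d \<and> BK2 K \<in> carrier_mat nK nv \<and>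
     CK K \<in> carrier_mat nu nK \<and> DK2 K \<in> carrier_mat nu nv"

definition clA :: "plant \<Rightarrow> controller \<Rightarrow> real mat" where
  "clA G K = four_block_mat (AG G + BG G * DK2 K * CG2 G) (BG G * CK K) (BK2 K * CG2 G) (AK K)"

definition clB :: "plant \<Rightarrow> controller \<Rightarrow> real mat" where
  "clB G K = 0\<^sub>m (dim_row (AG G)) (dim_col (BK1 K)) @\<^sub>r BK1 K"

definition clC :: "plant \<Rightarrow> controller \<Rightarrow> real mat" where
  "clC G K = (CG1 G + DG1 G * DK2 K * CG2 G) @\<^sub>c (DG1 G * CK K)"

definition detectable :: "real mat \<Rightarrow> real mat \<Rightarrow> bool" where
  "detectable A C \<longleftrightarrow> (\<exists>M \<in> carrier_mat (dim_row A) (dim_row C). schur (A + M * C))"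

text \<open>\<open>(A1, B1, C1)\<close> is a detectable system, of state dimension \<open>n1\<close>, that results from
  \<open>(A, B, C)\<close> by a change of coordinates \<open>S\<close> and the removal of \<open>n2\<close> states that do not influence
  the output. If \<open>(A, C)\<close> is itself detectable, then \<open>S = I\<close>, \<open>n2 = 0\<close> is allowed, so that
  \<open>(A1, B1, C1) = (A, B, C)\<close> is possible.\<close>

definition detectable_part ::
  "nat \<Rightarrow> real mat \<Rightarrow> real mat \<Rightarrow> real mat \<Rightarrow> nat \<Rightarrow> real mat \<Rightarrow> real mat \<Rightarrow> real mat \<Rightarrow> bool" where
  "detectable_part d A B C n1 A1 B1 C1 \<longleftrightarrow>
     A1 \<in> carrier_mat n1 n1 \<and> B1 \<in> carrier_mat n1 d \<and> C1 \<in> carrier_mat d n1 \<and>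
     detectable A1 C1 \<and>
     (\<exists>n2 S A21 A2 B2. dim_row A = n1 + n2 \<and>
        S \<in> carrier_mat (n1 + n2) (n1 + n2) \<and> invertible_mat S \<and>
        A21 \<in> carrier_mat n2 n1 \<and> A2 \<in> carrier_mat n2 n2 \<and> B2 \<in> carrier_mat n2 d \<and>
        minv S * A * S = four_block_mat A1 (0\<^sub>m n1 n2) A21 A2 \<and>
        minv S * B = B1 @\<^sub>r B2 \<and>
        C * S = C1 @\<^sub>c 0\<^sub>m d n2)"

definition integrator_form :: "nat \<Rightarrow> nat \<Rightarrow> real mat \<Rightarrow> real mat \<Rightarrow> real mat \<Rightarrow> bool" where
  "integrator_form d n A B C \<longleftrightarrow>
     (\<exists>na T Aa Ba Ca Da. n = d + na \<and> T \<in> carrier_mat n n \<and> invertible_mat T \<and>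
        Aa \<in> carrier_mat na na \<and> Ba \<in> carrier_mat na d \<and>
        Ca \<in> carrier_mat d na \<and> Da \<in> carrier_mat d d \<and>
        minv T * A * T = four_block_mat (1\<^sub>m d) (0\<^sub>m d na) Ba Aa \<and>
        minv T * B = 1\<^sub>m d @\<^sub>r 0\<^sub>m na d \<and>
        C * T = Da @\<^sub>c Ca)"

definition gradient_loop ::
  "nat \<Rightarrow> nat \<Rightarrow> real mat \<Rightarrow> real mat \<Rightarrow> real mat \<Rightarrow> (real vec \<Rightarrow> real) \<Rightarrow> signal \<Rightarrow> bool" where
  "gradient_loop d n A B C f x \<longleftrightarrow> x 0 \<in> carrier_vec n \<and>
     (\<forall>k. x (Suc k) = A *\<^sub>v x k + B *\<^sub>v grad d f (C *\<^sub>v x k))"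

definition achieves_convergence ::
  "nat \<Rightarrow> real \<Rightarrow> real \<Rightarrow> plant \<Rightarrow> real \<Rightarrow> controller \<Rightarrow> bool" where
  "achieves_convergence d m L G \<rho> K \<longleftrightarrow>
     (\<exists>n A B C. detectable_part d (clA G K) (clB G K) (clC G K) n A B C \<and>
        integrator_form d n A B C \<and>
        (\<exists>c\<ge>0. \<forall>f \<in> S_class d m L. \<forall>zs xs x.
           is_minimizer d f zs \<and> xs \<in> carrier_vec n \<and> xs = A *\<^sub>v xs \<and> zs = C *\<^sub>v xs \<and>
           gradient_loop d n A B C f x \<longrightarrow>
           (\<forall>k. vnorm (C *\<^sub>v x k - zs) \<le> c * \<rho> ^ k * vnorm (x 0 - xs))))"

definition rho_ec :: "nat \<Rightarrow> nat \<Rightarrow> nat \<Rightarrow> real \<Rightarrow> real \<Rightarrow> plant \<Rightarrow> ereal" where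
  "rho_ec d nu nv m L G =
     Inf {ereal \<rho> | \<rho>. 0 < \<rho> \<and> \<rho> < 1 \<and>
       (\<exists>nK K. controller_dims nK nu nv d K \<and> achieves_convergence d m L G \<rho> K)}"


section \<open>Generalized plant\<close>

record gen_plant =
  gA :: "real mat"
  gB1 :: "real mat"
  gB :: "real mat"
  gC1 :: "real mat"
  gD1 :: "real mat"
  gE :: "real mat"
  gC :: "real mat"
  gF :: "real mat"

definition gen_plant_of :: "nat \<Rightarrow> nat \<Rightarrow> nat \<Rightarrow> real \<Rightarrow> real \<Rightarrow> real \<Rightarrow> plant \<Rightarrow> gen_plant" where
  "gen_plant_of nG nv d m L \<rho> G = \<lparr>
     gA = (1 / \<rho>) \<cdot>\<^sub>m four_block_mat (1\<^sub>m d) (m \<cdot>\<^sub>m CG1 G) (0\<^sub>m nG d) (AG G),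
     gB1 = (1 / \<rho>) \<cdot>\<^sub>m (1\<^sub>m d @\<^sub>r 0\<^sub>m nG d),
     gB = (1 / \<rho>) \<cdot>\<^sub>m ((m \<cdot>\<^sub>m DG1 G) @\<^sub>r BG G),
     gC1 = (L - m) \<cdot>\<^sub>m (0\<^sub>m d d @\<^sub>c CG1 G),
     gD1 = - 1\<^sub>m d,
     gE = (L - m) \<cdot>\<^sub>m DG1 G,
     gC = four_block_mat (1\<^sub>m d) (0\<^sub>m d nG) (0\<^sub>m nv d) (CG2 G),
     gF = 0\<^sub>m (d + nv) d \<rparr>"

definition T1_ss :: "gen_plant \<Rightarrow> real mat \<Rightarrow> real mat \<Rightarrow> state_space" where
  "T1_ss P Mt Lt = mk_ss
     (four_block_mat (gA P + gB P * Mt) (- (gB P * Mt))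
        (0\<^sub>m (dim_row (gA P)) (dim_col (gA P))) (gA P + Lt * gC P))
     (gB1 P @\<^sub>r (gB1 P + Lt * gF P))
     ((gC1 P + gE P * Mt) @\<^sub>c (- (gE P * Mt)))
     (gD1 P)"

definition T2_ss :: "gen_plant \<Rightarrow> real mat \<Rightarrow> state_space" where
  "T2_ss P Mt = mk_ss (gA P + gB P * Mt) (gB P) (gC1 P + gE P * Mt) (gE P)"

definition T3_ss :: "gen_plant \<Rightarrow> real mat \<Rightarrow> state_space" where
  "T3_ss P Lt = mk_ss (gA P + Lt * gC P) (gB1 P + Lt * gF P) (gC P) (gF P)"


section \<open>Multipliers\<close>

text \<open>A tuple \<open>(\<Lambda>\<^sub>l, \<dots>, \<Lambda>\<^sub>0)\<close> is a list of length \<open>l + 1\<close> indexed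
  such that \<open>\<Lambda> ! i\<close> is \<open>\<Lambda>\<^sub>i\<close>.\<close>

definition tuples :: "nat \<Rightarrow> nat \<Rightarrow> real mat list set" where
  "tuples d l = {\<Lambda>. length \<Lambda> = l + 1 \<and> set \<Lambda> \<subseteq> carrier_mat d d}"

definition multiplier :: "nat \<Rightarrow> nat \<Rightarrow> real mat list \<Rightarrow> state_space" where
  "multiplier d l \<Lambda> = mk_ss
     (mat (l * d) (l * d) (\<lambda>(i, j). if j = i + d then 1 else 0))
     (mat (l * d) d (\<lambda>(i, j). if i + d = l * d + j then 1 else 0))
     (mat d (l * d) (\<lambda>(i, j). (\<Lambda> ! (l - j div d)) $$ (i, j mod d)))
     (\<Lambda> ! 0)"

definition Lambda_r :: "nat \<Rightarrow> nat \<Rightarrow> real \<Rightarrow> real mat list set" where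
  "Lambda_r d l \<rho> = {map (\<lambda>i. lam i \<cdot>\<^sub>m 1\<^sub>m d) [0..<l + 1] | lam.
     (\<forall>i \<in> {1..l}. lam i \<le> 0) \<and>
     (\<Sum>i\<le>l. lam i * \<rho> ^ i) \<ge> 0 \<and> (\<Sum>i\<le>l. lam i * (1 / \<rho>) ^ i) \<ge> 0}"

definition affine_in_tuple :: "nat \<Rightarrow> nat \<Rightarrow> (real mat list \<Rightarrow> real mat) \<Rightarrow> bool" where
  "affine_in_tuple d l F \<longleftrightarrow>
     (\<forall>\<Lambda> \<in> tuples d l. \<forall>\<Lambda>' \<in> tuples d l. \<forall>t.
        F (map2 (\<lambda>M N. t \<cdot>\<^sub>m M + (1 - t) \<cdot>\<^sub>m N) \<Lambda> \<Lambda>') = t \<cdot>\<^sub>m F \<Lambda> + (1 - t) \<cdot>\<^sub>m F \<Lambda>')"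


section \<open>Structured realization\<close>

text \<open>The data of a block-structured representation with inputs \<open>(w, u)\<close> and outputs
  \<open>(z, y)\<close>; \<open>rC11\<close> and \<open>rD1\<close> depend on the tuple of multiplier coefficients.\<close>

record realization =
  rA1 :: "real mat"
  rA2 :: "real mat"
  rB11 :: "real mat"
  rB22 :: "real mat"
  rC11 :: "real mat list \<Rightarrow> real mat"
  rC12 :: "real mat"
  rD1 :: "real mat list \<Rightarrow> real mat"
  rE :: "real mat"
  rC21 :: "real mat"
  rF :: "real mat"

definition realization_dims ::
  "nat \<Rightarrow> nat \<Rightarrow> nat \<Rightarrow> nat \<Rightarrow> nat \<Rightarrow> nat \<Rightarrow> realization \<Rightarrow> bool" where
  "realization_dims d l nu nv n1 n2 R \<longleftrightarrow>
     rA1 R \<in> carrier_mat n1 n1 \<and> rA2 R \<in> carrier_mat n2 n2 \<and>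
     rB11 R \<in> carrier_mat n1 d \<and> rB22 R \<in> carrier_mat n2 nu \<and>
     (\<forall>\<Lambda> \<in> tuples d l. rC11 R \<Lambda> \<in> carrier_mat d n1 \<and> rD1 R \<Lambda> \<in> carrier_mat d d) \<and>
     rC12 R \<in> carrier_mat d n2 \<and> rE R \<in> carrier_mat d nu \<and>
     rC21 R \<in> carrier_mat (d + nv) n1 \<and> rF R \<in> carrier_mat (d + nv) d"

definition rA :: "realization \<Rightarrow> real mat" where
  "rA R = four_block_mat (rA1 R) (0\<^sub>m (dim_row (rA1 R)) (dim_row (rA2 R)))
            (0\<^sub>m (dim_row (rA2 R)) (dim_row (rA1 R))) (rA2 R)"

definition rB1 :: "realization \<Rightarrow> real mat" where
  "rB1 R = rB11 R @\<^sub>r 0\<^sub>m (dim_row (rA2 R)) (dim_col (rB11 R))"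

definition rB :: "realization \<Rightarrow> real mat" where
  "rB R = 0\<^sub>m (dim_row (rA1 R)) (dim_col (rB22 R)) @\<^sub>r rB22 R"

definition rC1 :: "realization \<Rightarrow> real mat list \<Rightarrow> real mat" where
  "rC1 R \<Lambda> = rC11 R \<Lambda> @\<^sub>c rC12 R"

definition rC :: "realization \<Rightarrow> real mat" where
  "rC R = rC21 R @\<^sub>c 0\<^sub>m (dim_row (rC21 R)) (dim_row (rA2 R))"

definition full_ss :: "realization \<Rightarrow> real mat list \<Rightarrow> state_space" where
  "full_ss R \<Lambda> = mk_ss (rA R) (rB1 R @\<^sub>c rB R) (rC1 R \<Lambda> @\<^sub>r rC R)
     (four_block_mat (rD1 R \<Lambda>) (rE R) (rF R) (0\<^sub>m (dim_row (rF R)) (dim_col (rE R))))"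

definition is_realization ::
  "nat \<Rightarrow> nat \<Rightarrow> nat \<Rightarrow> gen_plant \<Rightarrow> real mat \<Rightarrow> real mat \<Rightarrow> realization \<Rightarrow> bool" where
  "is_realization d l nu P Mt Lt R \<longleftrightarrow>
     (\<forall>\<Lambda> \<in> tuples d l. \<forall>w \<in> signals d. \<forall>u \<in> signals nu.
        ss_op (full_ss R \<Lambda>) (\<lambda>k. w k @\<^sub>v u k) =
        (\<lambda>k. add_op (\<lambda>w. ss_op (multiplier d l \<Lambda>) (ss_op (T1_ss P Mt Lt) w))
                    (\<lambda>_. ss_op (T2_ss P Mt) u) w k
             @\<^sub>v ss_op (T3_ss P Lt) w k))"


section \<open>The two conditions\<close>

definition SNR_condition ::
  "nat \<Rightarrow> nat \<Rightarrow> nat \<Rightarrow> nat \<Rightarrow> real \<Rightarrow> gen_plant \<Rightarrow> real mat \<Rightarrow> real mat \<Rightarrow> bool" where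
  "SNR_condition d l nu nv \<rho> P Mt Lt \<longleftrightarrow>
     (\<exists>\<Lambda> \<in> Lambda_r d l \<rho>. \<exists>nZ Z. ss_dims nZ (d + nv) nu Z \<and> schur (ssA Z) \<and>
        SNR d (add_op (ss_op (multiplier d l \<Lambda>) \<circ> ss_op (T1_ss P Mt Lt))
                      (ss_op (T2_ss P Mt) \<circ> ss_op Z \<circ> ss_op (T3_ss P Lt))))"

text \<open>The matrix functions below depend on the blocks of the symmetric matrix
  \<open>W = four_block_mat W11 W12 W12\<^sup>T W22\<close>.\<close>

definition bW1 :: "real mat \<Rightarrow> real mat \<Rightarrow> real mat" where
  "bW1 W11 W12 = four_block_mat W11 W12
     (0\<^sub>m (dim_col W12) (dim_col W11)) (1\<^sub>m (dim_col W12))"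

definition bW2 :: "real mat \<Rightarrow> real mat \<Rightarrow> real mat" where
  "bW2 W12 W22 = four_block_mat (1\<^sub>m (dim_row W12)) (0\<^sub>m (dim_row W12) (dim_col W22))
     (- transpose_mat W12) W22"

definition LMI_condition ::
  "nat \<Rightarrow> nat \<Rightarrow> nat \<Rightarrow> nat \<Rightarrow> real \<Rightarrow> realization \<Rightarrow> real mat \<Rightarrow> real mat \<Rightarrow> bool" where
  "LMI_condition d l n1 n2 \<rho> R U V \<longleftrightarrow>
     (\<exists>X W11 W12 W22. \<exists>\<Lambda> \<in> Lambda_r d l \<rho>.
        X \<in> carrier_mat (n1 + n2) (n1 + n2) \<and> sym_mat X \<and>
        W11 \<in> carrier_mat n1 n1 \<and> W12 \<in> carrier_mat n1 n2 \<and> W22 \<in> carrier_mat n2 n2 \<and>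
        sym_mat (four_block_mat W11 W12 (transpose_mat W12) W22) \<and>
        (let n = n1 + n2;
             W1 = bW1 W11 W12;
             W2 = bW2 W12 W22;
             Y = transpose_mat W1 * W2;
             bA = transpose_mat W1 * rA R * W2;
             bB1 = transpose_mat W1 * rB1 R;
             bC1 = rC1 R \<Lambda> * W2;
             bD1 = rD1 R \<Lambda>;
             AB = rA R @\<^sub>c rB1 R;
             CD = rC1 R \<Lambda> @\<^sub>c rD1 R \<Lambda>;
             I0 = 1\<^sub>m n @\<^sub>c 0\<^sub>m n d;
             OI = 0\<^sub>m d n @\<^sub>c 1\<^sub>m d;
             ACt = transpose_mat bA @\<^sub>c transpose_mat bC1;
             BDt = transpose_mat bB1 @\<^sub>c transpose_mat bD1
         in
           pos_def (four_block_mat X W1 (transpose_mat W1) Y) \<and>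
           neg_def (transpose_mat U *
             (transpose_mat AB * X * AB - transpose_mat I0 * X * I0
              + transpose_mat CD * OI + transpose_mat OI * CD) * U) \<and>
           pos_def (transpose_mat V *
             (transpose_mat I0 * Y * I0 - transpose_mat ACt * minv Y * ACt
              - transpose_mat OI * BDt - transpose_mat BDt * OI) * V)))"

end

theory Submission
  imports Defs "Jordan_Normal_Form.Spectral_Radius" "Jordan_Normal_Form.DL_Rank"
begin

text \<open>
  The synthesis conditions are two forms of one game. By the Kalman--Yakubovich--Popov lemma, strict negative
  realness of the loop with \<open>Z\<close> yields a storage function on the joint state \<open>(x, z)\<close>. Its restriction \<open>X\<close> to
  \<open>z = 0\<close> certifies the inequality on the kernel of \<open>(C F)\<close>, and its partial minimum \<open>N\<close> over \<open>z\<close> guarantees a good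
  control reply to every \<open>(x, w)\<close>. Conversely, \<open>N x + (X - N) (x - z)\<close> is a storage function if the reply can be
  chosen as a linear function of the measurement, which is possible since the two conditions are those of a
  quadratic game with a saddle point. Dualising the reply condition and writing \<open>N = W\<^sub>1 W\<^sub>2\<^sup>-\<^sup>1\<close> gives the
  matrix inequalities.

  For the convergence rate, the impulse response shows \<open>\<lambda>\<^sub>0 > 0\<close>, so that the multiplier has a stable inverse and
  commutes with \<open>T\<^sub>2\<close>. Hence \<open>Q = \<Pi>\<^sup>-\<^sup>1 Z\<close> is a stable Youla parameter. For the resulting observer based
  controller, the loop is weighted with \<open>\<rho>\<^sup>-\<^sup>k\<close>. Its storage function does not increase along trajectories because
  the gradient satisfies the Zames--Falb inequality on every finite horizon.
\<close>

section \<open>Linear maps and quadratic forms\<close>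

text \<open>The form \<open>N x + (X - N) (x - z)\<close> restricts to \<open>X\<close> at
  \<open>z = 0\<close> and has the partial minimum \<open>N\<close>, attained at
  \<open>z = x\<close>. So every pair with \<open>0 < N < X\<close> is the trace of a candidate
  storage function on the joint state, with \<open>Z\<close> of the same order as the plant. The
  obstacle is information: the reply may use only \<open>z\<close> and the measured output, whereas
  the condition on \<open>N\<close> lets it depend on the whole of \<open>(x, w)\<close>. All
  inequalities are strict; compactness of the unit sphere turns them into the uniform margins that
  the game and the summation over time need. In the filtered loop the multiplier and the Youla
  parameter \<open>Q\<close> occur as a product. Scalar coefficients let the multiplier pass
  \<open>T2\<close>, and the product becomes the single unknown \<open>Z\<close>; to return to
  \<open>Q\<close> the multiplier has to be inverted stably. In dimension \<open>d = 0\<close> there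
  is no impulse to test with, and this case is treated apart. The weighted signals of the gradient
  loop are not known to be square summable in advance, so the rate cannot be read off from the SNR
  inequality; it comes from a storage function and sums over finite horizons.\<close>

notation mult_mat_vec (infixl "*v" 70)
notation append_vec (infixr "@v" 65)
notation smult_vec (infixl "*s" 70)
notation zero_vec ("0v")

abbreviation (input) vecs where "vecs \<equiv> carrier_vec"
abbreviation (input) mats where "mats \<equiv> carrier_mat"

abbreviation sq :: "real vec \<Rightarrow> real" where "sq x \<equiv> x \<bullet> x"

text \<open>Linear maps are kept as functions on the carrier. Maps between block vectors can then be
  written with \<open>append_vec\<close>, \<open>vec_first\<close> and \<open>vec_last\<close>
  instead of block matrices, and \<open>matf\<close> produces a matrix only where a state space
  demands one.\<close>

definition lin :: "nat \<Rightarrow> nat \<Rightarrow> (real vec \<Rightarrow> real vec) \<Rightarrow> bool" where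
  "lin n m f \<longleftrightarrow> (\<forall>x \<in> vecs n. f x \<in> vecs m) \<and>
     (\<forall>x \<in> vecs n. \<forall>y \<in> vecs n. f (x + y) = f x + f y) \<and>
     (\<forall>c. \<forall>x \<in> vecs n. f (c *s x) = c *s f x)"

lemma linD:
  assumes "lin n m f"
  shows "x \<in> vecs n \<Longrightarrow> f x \<in> vecs m"
    and "x \<in> vecs n \<Longrightarrow> y \<in> vecs n \<Longrightarrow> f (x + y) = f x + f y"
    and "x \<in> vecs n \<Longrightarrow> f (c *s x) = c *s f x"
  using assms by (auto simp: lin_def)

lemma lin_zero_arg:
  assumes "lin n m f" shows "f (0v n) = 0v m"
proof -
  have "f (0 *s 0v n) = 0 *s f (0v n)" by (rule linD(3)[OF assms]) simp
  moreover have "0 *s 0v n = (0v n :: real vec)" by auto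
  moreover have "0 *s f (0v n) = 0v m" using linD(1)[OF assms, of "0v n"] by auto
  ultimately show ?thesis by simp
qed

lemma lin_diff_arg:
  assumes f: "lin n m f" and x: "x \<in> vecs n" and y: "y \<in> vecs n"
  shows "f (x - y) = f x - f y"
proof -
  have "x - y = x + (-1) *s y" using x y by auto
  hence "f (x - y) = f x + (-1) *s f y"
    using linD[OF f] x y by simp
  also have "\<dots> = f x - f y" using linD(1)[OF f] x y by auto
  finally show ?thesis .
qed

lemma lin_id: "lin n n (\<lambda>x. x)"
  by (auto simp: lin_def)

lemma lin_zero: "lin n m (\<lambda>x. 0v m)"
  by (auto simp: lin_def)

lemma lin_comp: "lin n m f \<Longrightarrow> lin m k g \<Longrightarrow> lin n k (\<lambda>x. g (f x))"
  by (auto simp: lin_def)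

lemma lin_mult_mat: "A \<in> mats m n \<Longrightarrow> lin n m (mult_mat_vec A)"
  by (auto simp: lin_def mult_add_distrib_mat_vec mult_mat_vec)

lemma lin_mat: "A \<in> mats k m \<Longrightarrow> lin n m f \<Longrightarrow> lin n k (\<lambda>x. A *v f x)"
  by (rule lin_comp[OF _ lin_mult_mat])

lemma lin_add:
  assumes f: "lin n m f" and g: "lin n m g" shows "lin n m (\<lambda>x. f x + g x)"
  unfolding lin_def
proof (intro conjI ballI allI)
  fix x y :: "real vec" and c :: real assume x: "x \<in> vecs n"
  show "f x + g x \<in> vecs m" using linD[OF f] linD[OF g] x by auto
  have "f x \<in> vecs m" "g x \<in> vecs m" using linD[OF f] linD[OF g] x by auto
  thus "f (c *s x) + g (c *s x) = c *s (f x + g x)"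
    by (simp add: linD[OF f] linD[OF g] x smult_add_distrib_vec[of _ m])
  assume y: "y \<in> vecs n"
  have "f y \<in> vecs m" "g y \<in> vecs m" using linD[OF f] linD[OF g] y by auto
  thus "f (x + y) + g (x + y) = f x + g x + (f y + g y)"
    using \<open>f x \<in> _\<close> \<open>g x \<in> _\<close>
    unfolding linD(2)[OF f x y] linD(2)[OF g x y]
    by (intro eq_vecI) (auto dest!: carrier_vecD)
qed

lemma lin_smult:
  assumes f: "lin n m f" shows "lin n m (\<lambda>x. c *s f x)"
  unfolding lin_def
  using linD[OF f] by (auto simp: smult_add_distrib_vec[of _ m] smult_smult_assoc ac_simps)

lemma lin_uminus:
  assumes f: "lin n m f" shows "lin n m (\<lambda>x. - f x)"
proof -
  have "lin n m (\<lambda>x. (-1) *s f x)" by (rule lin_smult[OF f])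
  moreover have "(-1) *s v = - v" for v :: "real vec" by auto
  ultimately show ?thesis by simp
qed

lemma lin_minus:
  assumes f: "lin n m f" and g: "lin n m g" shows "lin n m (\<lambda>x. f x - g x)"
proof -
  have l: "lin n m (\<lambda>x. f x + - g x)" by (rule lin_add[OF f lin_uminus[OF g]])
  have "f x - g x = f x + - g x" if "x \<in> vecs n" for x
    using linD(1)[OF f that] linD(1)[OF g that] by auto
  with l show ?thesis by (simp add: lin_def)
qed

lemma append_vec_smult: "c *s (a @v b) = c *s a @v c *s (b :: real vec)"
  by (intro eq_vecI) auto

lemma lin_append:
  assumes f: "lin n m f" and g: "lin n k g" shows "lin n (m + k) (\<lambda>x. f x @v g x)"
  unfolding lin_def
proof (intro conjI ballI allI)
  fix x y :: "real vec" and c :: real assume x: "x \<in> vecs n"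
  show "f x @v g x \<in> vecs (m + k)" using linD[OF f] linD[OF g] x by auto
  show "f (c *s x) @v g (c *s x) = c *s (f x @v g x)"
    using linD[OF f] linD[OF g] x by (simp add: append_vec_smult)
  assume y: "y \<in> vecs n"
  show "f (x + y) @v g (x + y) = (f x @v g x) + (f y @v g y)"
    using linD[OF f] linD[OF g] x y by (simp add: append_vec_add[of _ m _ _ k])
qed

lemma lin_first:
  assumes f: "lin n (m + k) f" shows "lin n m (\<lambda>x. vec_first (f x) m)"
proof -
  have d: "dim_vec (f x) = m + k" if "x \<in> vecs n" for x
    using linD(1)[OF f that] by auto
  show ?thesis unfolding lin_def
    by (auto simp: linD[OF f] vec_first_def d intro!: eq_vecI)
qed

lemma lin_last:
  assumes f: "lin n (m + k) f" shows "lin n k (\<lambda>x. vec_last (f x) k)"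
proof -
  have d: "dim_vec (f x) = m + k" if "x \<in> vecs n" for x
    using linD(1)[OF f that] by auto
  show ?thesis unfolding lin_def
    by (auto simp: linD[OF f] vec_last_def d intro!: eq_vecI)
qed

lemmas lin_first_id = lin_first[OF lin_id] and lin_last_id = lin_last[OF lin_id]

lemma lin_cong: "(\<And>x. x \<in> vecs n \<Longrightarrow> f x = g x) \<Longrightarrow> lin n m f \<longleftrightarrow> lin n m g"
  unfolding lin_def by (intro conj_cong ball_cong all_cong) auto

lemma vec_first_append [simp]: "dim_vec a = n \<Longrightarrow> vec_first (a @v b) n = a"
  by (intro eq_vecI) (auto simp: vec_first_def)

lemma vec_last_append [simp]: "dim_vec b = n \<Longrightarrow> vec_last (a @v b) n = b"
  by (intro eq_vecI) (auto simp: vec_last_def)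

definition matf :: "nat \<Rightarrow> nat \<Rightarrow> (real vec \<Rightarrow> real vec) \<Rightarrow> real mat" where
  "matf n m f = mat m n (\<lambda>(i, j). f (unit_vec n j) $ i)"

lemma matf_carrier [simp]: "matf n m f \<in> mats m n"
  by (simp add: matf_def)

lemma mult_mat_unit_vec:
  assumes "(A :: real mat) \<in> mats m n" "k < n"
  shows "A *v unit_vec n k = col A k"
  using assms by (intro eq_vecI) auto

lemma smult_mat_mult_vec:
  "A \<in> mats m n \<Longrightarrow> x \<in> vecs n \<Longrightarrow> (c \<cdot>\<^sub>m A) *v x = c *s (A *v (x :: real vec))"
  by (intro eq_vecI) (auto simp: scalar_prod_def sum_distrib_left mult_ac)

lemma matf_mult:
  assumes f: "lin n m f" and x: "x \<in> vecs n"
  shows "matf n m f *v x = f x"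
proof -
  \<comment> \<open>\<open>y k\<close> keeps the first \<open>k\<close> coordinates of
    \<open>x\<close>; the induction adds one unit vector at a time.\<close>
  define y where "y k = vec n (\<lambda>j. if j < k then x $ j else 0)" for k
  have yc: "y k \<in> vecs n" for k by (simp add: y_def)
  have l: "lin n m (mult_mat_vec (matf n m f))" by (rule lin_mult_mat) simp
  have "matf n m f *v y k = f (y k)" if "k \<le> n" for k
    using that
  proof (induction k)
    case 0
    have "y 0 = 0v n" by (auto simp: y_def)
    thus ?case using lin_zero_arg[OF f] lin_zero_arg[OF l] by simp
  next
    case (Suc k)
    hence k: "k < n" by simp
    have e: "y (Suc k) = y k + x $ k *s unit_vec n k"
      by (intro eq_vecI) (auto simp: y_def unit_vec_def less_Suc_eq)
    have "matf n m f *v unit_vec n k = col (matf n m f) k"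
      using k by (intro mult_mat_unit_vec[of _ m]) auto
    also have "\<dots> = f (unit_vec n k)"
      using k linD(1)[OF f, of "unit_vec n k"] by (auto simp: matf_def)
    finally have u: "matf n m f *v unit_vec n k = f (unit_vec n k)" .
    show ?case unfolding e
      using Suc k yc[of k] linD[OF f] linD[OF l] u by (simp)
  qed
  moreover have "y n = x" using x by (auto simp: y_def)
  ultimately show ?thesis by (metis order_refl)
qed

lemma mat_eq_by_mult:
  assumes A: "(A :: real mat) \<in> mats m n" and B: "B \<in> mats m n"
    and eq: "\<And>x. x \<in> vecs n \<Longrightarrow> A *v x = B *v x"
  shows "A = B"
proof (rule eq_matI)
  fix i j assume ij: "i < dim_row B" "j < dim_col B"
  have "A *v unit_vec n j = B *v unit_vec n j" by (rule eq) simp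
  hence "col A j = col B j" using ij A B mult_mat_unit_vec[of _ m n j] by (metis carrier_matD(2))
  thus "A $$ (i, j) = B $$ (i, j)" using ij A B
    by (metis carrier_matD index_col)
qed (use A B in auto)

section \<open>Quadratic forms with a symmetric representing matrix\<close>

definition qform :: "nat \<Rightarrow> (real vec \<Rightarrow> real) \<Rightarrow> bool" where
  "qform n q \<longleftrightarrow> (\<exists>M \<in> mats n n. M\<^sup>T = M \<and>
     (\<forall>x \<in> vecs n. q x = x \<bullet> (M *v x)))"

lemma scalar_prod_sym_mat:
  assumes "(M :: real mat) \<in> mats n n" "M\<^sup>T = M"
    "x \<in> vecs n" "y \<in> vecs n"
  shows "y \<bullet> (M *v x) = x \<bullet> (M *v y)"
  using transpose_vec_mult_scalar[OF assms(1,3,4)] assms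
  by (metis comm_scalar_prod mult_mat_vec_carrier)

lemma qform_lin:
  assumes f: "lin n m f" and g: "lin n m g"
  shows "qform n (\<lambda>x. f x \<bullet> g x)"
proof -
  define F where "F = matf n m f"
  define G where "G = matf n m g"
  have F: "F \<in> mats m n" and G: "G \<in> mats m n" by (auto simp: F_def G_def)
  \<comment> \<open>The symmetric part of \<open>F^T G\<close> represents the same form.\<close>
  define M where "M = (1/2) \<cdot>\<^sub>m (F\<^sup>T * G + G\<^sup>T * F)"
  have M: "M \<in> mats n n" using F G by (auto simp: M_def)
  have tM: "M\<^sup>T = M"
    using F G
    by (intro eq_matI) (auto simp: M_def scalar_prod_def mult_ac)
  have "f x \<bullet> g x = x \<bullet> (M *v x)" if x: "x \<in> vecs n" for x
  proof -
    have Fx: "F *v x = f x" "G *v x = g x" using matf_mult[OF f x] matf_mult[OF g x]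
      by (auto simp: F_def G_def)
    have c: "f x \<in> vecs m" "g x \<in> vecs m" using linD f g x by auto
    have "M *v x = (1/2) *s (F\<^sup>T *v g x + G\<^sup>T *v f x)"
      unfolding M_def using F G x
      by (simp add: add_mult_distrib_mat_vec[of _ n n] assoc_mult_mat_vec[of _ n m _ n] smult_mat_mult_vec[of _ n n] Fx)
    hence "x \<bullet> (M *v x) = (1/2) * (x \<bullet> (F\<^sup>T *v g x) + x \<bullet> (G\<^sup>T *v f x))"
      using F G x c by (simp add: scalar_prod_add_distrib[of _ n])
    also have "x \<bullet> (F\<^sup>T *v g x) = f x \<bullet> g x"
      using transpose_vec_mult_scalar[OF F x c(2)] c F x Fx
      by (metis comm_scalar_prod mult_mat_vec_carrier transpose_carrier_mat)
    also have "x \<bullet> (G\<^sup>T *v f x) = f x \<bullet> g x"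
      using transpose_vec_mult_scalar[OF G x c(1)] c G x Fx
      by (metis comm_scalar_prod mult_mat_vec_carrier transpose_carrier_mat)
    finally show ?thesis by simp
  qed
  with M tM show ?thesis unfolding qform_def by blast
qed

text \<open>Access to a form without its matrix: \<open>g\<close> is half of the gradient, and the
  last property is the polarisation identity.\<close>

lemma qformE:
  assumes "qform n q"
  obtains g where "lin n n g" "\<And>x. x \<in> vecs n \<Longrightarrow> q x = x \<bullet> g x"
    "\<And>x y. x \<in> vecs n \<Longrightarrow> y \<in> vecs n \<Longrightarrow> x \<bullet> g y = y \<bullet> g x"
    "\<And>x y. x \<in> vecs n \<Longrightarrow> y \<in> vecs n \<Longrightarrow> q (x + y) = q x + q y + 2 * (x \<bullet> g y)"
proof -
  from assms obtain M where M: "M \<in> mats n n" "M\<^sup>T = M"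
    and q: "\<And>x. x \<in> vecs n \<Longrightarrow> q x = x \<bullet> (M *v x)" unfolding qform_def by blast
  have l: "lin n n (mult_mat_vec M)" by (rule lin_mult_mat[OF M(1)])
  have s: "x \<bullet> (M *v y) = y \<bullet> (M *v x)" if "x \<in> vecs n" "y \<in> vecs n" for x y
    using scalar_prod_sym_mat[OF M] that by blast
  show ?thesis
  proof (rule that[OF l q s])
    fix x y :: "real vec" assume xy: "x \<in> vecs n" "y \<in> vecs n"
    have c: "M *v x \<in> vecs n" "M *v y \<in> vecs n" using M xy by auto
    show "q (x + y) = q x + q y + 2 * (x \<bullet> (M *v y))"
      using xy M c s[OF xy]
      by (simp add: q mult_add_distrib_mat_vec[of _ n n] scalar_prod_add_distrib[of _ n]
          add_scalar_prod_distrib[of _ n])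
  qed auto
qed

lemma qform_cong: "(\<And>x. x \<in> vecs n \<Longrightarrow> p x = q x) \<Longrightarrow> qform n p \<longleftrightarrow> qform n q"
  unfolding qform_def by auto

lemma qform_comp:
  assumes f: "lin n m f" and q: "qform m q" shows "qform n (\<lambda>x. q (f x))"
proof -
  obtain g where g: "lin m m g" "\<And>x. x \<in> vecs m \<Longrightarrow> q x = x \<bullet> g x"
    using qformE[OF q] by metis
  have "qform n (\<lambda>x. f x \<bullet> g (f x))" by (rule qform_lin[OF f lin_comp[OF f g(1)]])
  thus ?thesis using linD(1)[OF f] g(2) by (subst qform_cong) auto
qed

lemma qform_add:
  assumes p: "qform n p" and q: "qform n q" shows "qform n (\<lambda>x. p x + q x)"
proof -
  obtain g where g: "lin n n g" "\<And>x. x \<in> vecs n \<Longrightarrow> p x = x \<bullet> g x"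
    using qformE[OF p] by metis
  obtain h where h: "lin n n h" "\<And>x. x \<in> vecs n \<Longrightarrow> q x = x \<bullet> h x"
    using qformE[OF q] by metis
  have "qform n (\<lambda>x. x \<bullet> (g x + h x))" by (rule qform_lin[OF lin_id lin_add[OF g(1) h(1)]])
  moreover have "x \<bullet> (g x + h x) = p x + q x" if "x \<in> vecs n" for x
    using that g(2)[OF that] h(2)[OF that] linD(1)[OF g(1) that] linD(1)[OF h(1) that]
    by (simp add: scalar_prod_add_distrib[of _ n])
  ultimately show ?thesis by (subst qform_cong) auto
qed

lemma qform_scale:
  assumes p: "qform n p" shows "qform n (\<lambda>x. c * p x)"
proof -
  obtain g where g: "lin n n g" "\<And>x. x \<in> vecs n \<Longrightarrow> p x = x \<bullet> g x"
    using qformE[OF p] by metis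
  have "qform n (\<lambda>x. x \<bullet> (c *s g x))" by (rule qform_lin[OF lin_id lin_smult[OF g(1)]])
  moreover have "x \<bullet> (c *s g x) = c * p x" if "x \<in> vecs n" for x
    using that g(2)[OF that] linD(1)[OF g(1) that] by simp
  ultimately show ?thesis by (subst qform_cong) auto
qed

lemma qform_minus: "qform n p \<Longrightarrow> qform n q \<Longrightarrow> qform n (\<lambda>x. p x - q x)"
  using qform_add[OF _ qform_scale[of n q "-1"]] by simp

lemma qform_uminus: "qform n p \<Longrightarrow> qform n (\<lambda>x. - p x)"
  using qform_scale[of n p "-1"] by simp

lemma qform_zero: "qform n (\<lambda>x. 0)"
  using qform_scale[OF qform_lin[OF lin_id lin_id], of n 0] by simp

lemma qform_sq: "lin n m f \<Longrightarrow> qform n (\<lambda>x. sq (f x))"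
  by (rule qform_lin)

lemma sq_nonneg: "sq x \<ge> 0"
  by (simp add: scalar_prod_def sum_nonneg)

lemma sq_eq_0: "x \<in> vecs n \<Longrightarrow> sq x = 0 \<longleftrightarrow> x = 0v n"
  by (auto simp: scalar_prod_def sum_nonneg_eq_0_iff)

lemma sq_pos: "x \<in> vecs n \<Longrightarrow> x \<noteq> 0v n \<Longrightarrow> sq x > 0"
  using sq_nonneg[of x] sq_eq_0[of x n] by linarith

lemma sq_smult: "sq (c *s x) = c\<^sup>2 * sq x"
  by (simp add: scalar_prod_def sum_distrib_left power2_eq_square mult_ac)

lemma qform_smult:
  assumes "qform n q" "x \<in> vecs n" shows "q (c *s x) = c\<^sup>2 * q x"
proof -
  obtain g where g: "lin n n g" "\<And>x. x \<in> vecs n \<Longrightarrow> q x = x \<bullet> g x"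
    using qformE[OF assms(1)] by metis
  thus ?thesis using assms(2) linD[OF g(1)] by (simp add: power2_eq_square)
qed

lemma qform_zero_arg: "qform n q \<Longrightarrow> q (0v n) = 0"
  unfolding qform_def by fastforce

lemma qform_minus_arg:
  assumes "qform n q" "x \<in> vecs n" shows "q (- x) = q x"
proof -
  have "- x = (-1) *s x" by auto
  thus ?thesis using qform_smult[OF assms, of "-1"] by simp
qed

lemma young:
  assumes "x \<in> vecs n" "y \<in> vecs n" "c > 0"
  shows "2 * (x \<bullet> y) \<le> c * sq x + sq y / c"
proof -
  have "0 \<le> sq (c *s x - y)" by (rule sq_nonneg)
  also have "\<dots> = c * (c * sq x) - 2 * (c * (x \<bullet> y)) + sq y"
    using assms by (simp add: scalar_prod_minus_distrib[of _ n] minus_scalar_prod_distrib[of _ n]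
      comm_scalar_prod[of y n x] algebra_simps)
  finally have "2 * (c * (x \<bullet> y)) \<le> c * (c * sq x) + sq y" by simp
  hence "c * (2 * (x \<bullet> y)) \<le> c * (c * sq x + sq y / c)" using assms(3)
    by (simp add: distrib_left)
  thus ?thesis using assms(3) by simp
qed

lemma sq_add_le:
  assumes "x \<in> vecs n" "y \<in> vecs n"
  shows "sq (x + y) \<le> 2 * sq x + 2 * sq y"
  using young[OF assms, of 1] assms
  by (simp add: scalar_prod_add_distrib[of _ n] add_scalar_prod_distrib[of _ n] comm_scalar_prod[of y n x])

lemma sq_append: "a \<in> vecs n \<Longrightarrow> b \<in> vecs m \<Longrightarrow> sq (a @v b) = sq a + sq b"
  by (rule scalar_prod_append)

section \<open>Coordinatewise convergence and compactness of the unit sphere\<close>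

definition vconv :: "nat \<Rightarrow> (nat \<Rightarrow> real vec) \<Rightarrow> real vec \<Rightarrow> bool" where
  "vconv n X x \<longleftrightarrow> (\<forall>k. X k \<in> vecs n) \<and> x \<in> vecs n \<and>
     (\<forall>i < n. (\<lambda>k. X k $ i) \<longlonglongrightarrow> x $ i)"

lemma vconv_scalar_prod:
  assumes "vconv n X x" "vconv n Y y"
  shows "(\<lambda>k. X k \<bullet> Y k) \<longlonglongrightarrow> x \<bullet> y"
proof -
  have d: "dim_vec (Y k) = n" "dim_vec y = n" for k using assms by (auto simp: vconv_def)
  show ?thesis using assms
    unfolding scalar_prod_def vconv_def d by (auto intro!: tendsto_sum tendsto_mult)
qed

lemma vconv_const: "x \<in> vecs n \<Longrightarrow> vconv n (\<lambda>k. x) x"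
  by (simp add: vconv_def)

lemma vconv_lin:
  assumes f: "lin n m f" and X: "vconv n X x" shows "vconv m (\<lambda>k. f (X k)) (f x)"
proof -
  define M where "M = matf n m f"
  have M: "M \<in> mats m n" by (simp add: M_def)
  have c: "X k \<in> vecs n" "x \<in> vecs n" for k using X by (auto simp: vconv_def)
  have fM: "f (X k) = M *v X k" "f x = M *v x" for k
    using matf_mult[OF f] c by (auto simp: M_def)
  show ?thesis unfolding vconv_def
  proof (intro conjI allI impI)
    fix i assume "i < m"
    have "(\<lambda>k. row M i \<bullet> X k) \<longlonglongrightarrow> row M i \<bullet> x"
      by (rule vconv_scalar_prod[OF vconv_const X]) (use M in auto)
    thus "(\<lambda>k. f (X k) $ i) \<longlonglongrightarrow> f x $ i" using M \<open>i < m\<close> by (simp add: fM)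
  qed (use c linD(1)[OF f] in auto)
qed

lemma vconv_qform:
  assumes q: "qform n q" and X: "vconv n X x" shows "(\<lambda>k. q (X k)) \<longlonglongrightarrow> q x"
proof -
  obtain g where g: "lin n n g" "\<And>x. x \<in> vecs n \<Longrightarrow> q x = x \<bullet> g x"
    using qformE[OF q] by metis
  show ?thesis using vconv_scalar_prod[OF X vconv_lin[OF g(1) X]] X g(2)
    by (simp add: vconv_def)
qed

lemma vconv_append:
  "vconv n X x \<Longrightarrow> vconv m Y y \<Longrightarrow> vconv (n + m) (\<lambda>k. X k @v Y k) (x @v y)"
  unfolding vconv_def
proof (intro conjI allI impI)
  assume X: "(\<forall>k. X k \<in> vecs n) \<and> x \<in> vecs n \<and> (\<forall>i<n. (\<lambda>k. X k $ i) \<longlonglongrightarrow> x $ i)"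
    and Y: "(\<forall>k. Y k \<in> vecs m) \<and> y \<in> vecs m \<and> (\<forall>i<m. (\<lambda>k. Y k $ i) \<longlonglongrightarrow> y $ i)"
  fix i assume i: "i < n + m"
  have d: "dim_vec (X k) = n" "dim_vec (Y k) = m" "dim_vec x = n" "dim_vec y = m" for k
    using X Y by auto
  show "(\<lambda>k. (X k @v Y k) $ i) \<longlonglongrightarrow> (x @v y) $ i"
    using X Y i by (cases "i < n") (auto simp: d)
qed auto

text \<open>Bolzano-Weierstrass, one coordinate at a time: each further coordinate has a monotone
  subsequence, which converges because it is bounded.\<close>

lemma bounded_convergent_subseq:
  assumes X: "\<And>k. X k \<in> vecs n" and b: "\<And>k. sq (X k) \<le> c"
  shows "\<exists>r x. strict_mono (r :: nat \<Rightarrow> nat) \<and> vconv n (X \<circ> r) x"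
proof -
  \<comment> \<open>The bound \<open>1 + c\<close> comes from \<open>2 * |a| <= 1 + a^2\<close>; it
    keeps square roots out.\<close>
  have bi: "\<bar>X k $ i\<bar> \<le> 1 + c" if "i < n" for i k
  proof -
    have "(X k $ i)\<^sup>2 \<le> sq (X k)"
      using X[of k] that unfolding scalar_prod_def power2_eq_square
      by (intro member_le_sum[of i _ "\<lambda>i. X k $ i * X k $ i"]) auto
    hence "(X k $ i)\<^sup>2 \<le> c" using b[of k] by linarith
    moreover have "2 * \<bar>X k $ i\<bar> \<le> 1 + (X k $ i)\<^sup>2"
      using sum_squares_bound[of 1 "\<bar>X k $ i\<bar>"] by simp
    moreover have "0 \<le> \<bar>X k $ i\<bar>" by simp
    ultimately show ?thesis by linarith
  qed
  have "\<exists>r l. strict_mono (r :: nat \<Rightarrow> nat) \<and> (\<forall>i < m. (\<lambda>k. X (r k) $ i) \<longlonglongrightarrow> l i)" if "m \<le> n" for m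
    using that
  proof (induction m)
    case 0
    show ?case by (intro exI[of _ id]) (auto simp: strict_mono_def)
  next
    case (Suc m)
    then obtain r l where r: "strict_mono r" "\<forall>i < m. (\<lambda>k. X (r k) $ i) \<longlonglongrightarrow> l i" by auto
    obtain s where s: "strict_mono s" "monoseq (\<lambda>k. X (r (s k)) $ m)"
      using seq_monosub[of "\<lambda>k. X (r k) $ m"] by auto
    have "Bseq (\<lambda>k. X (r (s k)) $ m)"
      using bi[of m] Suc.prems by (intro BseqI'[of _ "1 + c"]) auto
    then obtain a where a: "(\<lambda>k. X (r (s k)) $ m) \<longlonglongrightarrow> a"
      using Bseq_monoseq_convergent[OF _ s(2)] by (auto simp: convergent_def)
    have "(\<lambda>k. X (r (s k)) $ i) \<longlonglongrightarrow> l i" if "i < m" for i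
      using LIMSEQ_subseq_LIMSEQ[OF r(2)[rule_format, OF that] s(1)] by (simp add: o_def)
    with a have "\<forall>i < Suc m. (\<lambda>k. X ((r \<circ> s) k) $ i) \<longlonglongrightarrow> (l(m := a)) i"
      by (auto simp: less_Suc_eq)
    thus ?case using strict_mono_o[OF r(1) s(1)] by blast
  qed
  from this[of n] obtain r l where r: "strict_mono r" "\<forall>i < n. (\<lambda>k. X (r k) $ i) \<longlonglongrightarrow> l i"
    by auto
  have "vconv n (X \<circ> r) (vec n l)" using X r(2) by (auto simp: vconv_def)
  with r(1) show ?thesis by blast
qed

lemma normalize_vec:
  assumes "x \<in> vecs n" "x \<noteq> 0v n"
  obtains c where "c > 0" "sq (c *s x) = 1"
proof
  have p: "sq x > 0" by (rule sq_pos[OF assms])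
  thus "1 / sqrt (sq x) > 0" by simp
  show "sq ((1 / sqrt (sq x)) *s x) = 1" unfolding sq_smult using p by (simp add: power_divide)
qed

lemma unit_sphere_compact:
  assumes X: "\<And>k. X k \<in> vecs n" and u: "\<And>k. sq (X k) = 1"
  obtains r x where "strict_mono (r :: nat \<Rightarrow> nat)" "vconv n (X \<circ> r) x" "x \<in> vecs n" "x \<noteq> 0v n"
proof -
  obtain r x where rx: "strict_mono (r :: nat \<Rightarrow> nat)" "vconv n (X \<circ> r) x"
    using bounded_convergent_subseq[of X n 1] X u by auto
  have "(\<lambda>k. sq ((X \<circ> r) k)) \<longlonglongrightarrow> sq x" by (rule vconv_scalar_prod[OF rx(2) rx(2)])
  hence "sq x = 1" by (simp add: u LIMSEQ_const_iff)
  moreover have "x \<in> vecs n" using rx by (auto simp: vconv_def)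
  ultimately show ?thesis using rx that by (metis scalar_prod_left_zero zero_neq_one)
qed

text \<open>Common core of the compactness arguments by contradiction. A scale-invariant bad
  property that occurs for every \<open>k\<close> occurs on the unit sphere, and the normalised
  counterexamples accumulate at a nonzero vector, to which the strict hypothesis can be
  applied.\<close>

lemma unit_sphere_counterexamples:
  assumes "\<And>k :: nat. \<exists>x \<in> vecs n. x \<noteq> 0v n \<and> Q k x"
    and hom: "\<And>k x c. x \<in> vecs n \<Longrightarrow> c > 0 \<Longrightarrow> Q k x \<Longrightarrow> Q k (c *s x)"
  obtains X r x where "\<And>k. X k \<in> vecs n" "\<And>k. sq (X k) = 1" "\<And>k. Q k (X k)"
    "strict_mono (r :: nat \<Rightarrow> nat)" "vconv n (X \<circ> r) x" "x \<in> vecs n" "x \<noteq> 0v n"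
proof -
  have "\<exists>x \<in> vecs n. sq x = 1 \<and> Q k x" for k
  proof -
    obtain x where x: "x \<in> vecs n" "x \<noteq> 0v n" "Q k x" using assms(1) by blast
    obtain c where c: "c > 0" "sq (c *s x) = 1" using normalize_vec[OF x(1,2)] by blast
    show ?thesis using hom[OF x(1) c(1) x(3)] c x(1) by (intro bexI[of _ "c *s x"]) auto
  qed
  then obtain X where X: "\<And>k. X k \<in> vecs n" "\<And>k. sq (X k) = 1" "\<And>k. Q k (X k)" by metis
  obtain r x where "strict_mono (r :: nat \<Rightarrow> nat)" "vconv n (X \<circ> r) x" "x \<in> vecs n" "x \<noteq> 0v n"
    using unit_sphere_compact[of X n] X by metis
  with X that show ?thesis by blast
qed

text \<open>Unit vectors with \<open>|q| > k\<close> would have a convergent subsequence, along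
  which the continuous \<open>q\<close> stays bounded.\<close>

lemma qform_bounded:
  assumes q: "qform n q"
  obtains c where "c > 0" "\<And>x. x \<in> vecs n \<Longrightarrow> \<bar>q x\<bar> \<le> c * sq x"
proof -
  have "\<exists>k :: nat. \<forall>x \<in> vecs n. \<bar>q x\<bar> \<le> real k * sq x"
  proof (rule ccontr)
    assume "\<not> ?thesis"
    hence "\<exists>x \<in> vecs n. \<bar>q x\<bar> > real k * sq x" for k by (meson linorder_not_le)
    moreover have "q (0v n) = 0" using qform_zero_arg[OF q] .
    ultimately have ex: "\<exists>x \<in> vecs n. x \<noteq> 0v n \<and> \<bar>q x\<bar> > real k * sq x" for k
      by (metis abs_zero less_irrefl mult_zero_right scalar_prod_left_zero zero_carrier_vec)
    obtain X r x where X: "\<And>k. sq (X k) = 1" "\<And>k. \<bar>q (X k)\<bar> > real k * sq (X k)"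
      "strict_mono (r :: nat \<Rightarrow> nat)" "vconv n (X \<circ> r) x"
      by (rule unit_sphere_counterexamples[of n "\<lambda>k x. \<bar>q x\<bar> > real k * sq x"])
        (use ex in \<open>auto simp: qform_smult[OF q] sq_smult abs_mult mult.left_commute\<close>)
    have "(\<lambda>k. q ((X \<circ> r) k)) \<longlonglongrightarrow> q x" by (rule vconv_qform[OF q X(4)])
    hence "Bseq (\<lambda>k. q ((X \<circ> r) k))" using convergent_imp_Bseq convergentI by blast
    then obtain K where K: "\<And>k. \<bar>q (X (r k))\<bar> \<le> K" by (auto simp: Bseq_def)
    obtain k where "real k > K" using reals_Archimedean2 by blast
    moreover have "real k \<le> real (r k)" using seq_suble[OF X(3)] by simp
    ultimately show False using K[of k] X(2)[of "r k"] X(1)[of "r k"] by simp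
  qed
  then obtain k :: nat where "\<forall>x \<in> vecs n. \<bar>q x\<bar> \<le> real k * sq x" by blast
  hence "\<bar>q x\<bar> \<le> (real k + 1) * sq x" if "x \<in> vecs n" for x
    using that sq_nonneg[of x] by (fastforce simp: algebra_simps)
  thus ?thesis using that[of "real k + 1"] by simp
qed

lemma lin_bounded:
  assumes f: "lin n m f"
  obtains c where "c > 0" "\<And>x. x \<in> vecs n \<Longrightarrow> sq (f x) \<le> c * sq x"
  using qform_bounded[OF qform_lin[OF f f]] by (metis abs_le_D1)

text \<open>Finsler's lemma. If no penalty weight \<open>k\<close> were large enough, normalised
  counterexamples would converge to a nonzero vector with \<open>C x = 0\<close> and
  \<open>q x \<ge> 0\<close>, which \<open>neg\<close> excludes.\<close>

lemma finsler:
  assumes q: "qform n q" and C: "lin n m C"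
    and neg: "\<And>x. x \<in> vecs n \<Longrightarrow> x \<noteq> 0v n \<Longrightarrow> C x = 0v m \<Longrightarrow> q x < 0"
  obtains \<kappa> where "\<kappa> > 0" "\<And>x. x \<in> vecs n \<Longrightarrow> x \<noteq> 0v n \<Longrightarrow> q x < \<kappa> * sq (C x)"
proof -
  have qC: "qform n (\<lambda>x. sq (C x))" by (rule qform_lin[OF C C])
  have "\<exists>k :: nat. \<forall>x \<in> vecs n. x \<noteq> 0v n \<longrightarrow> q x < real k * sq (C x)"
  proof (rule ccontr)
    assume "\<not> ?thesis"
    hence ex: "\<exists>x \<in> vecs n. x \<noteq> 0v n \<and> q x \<ge> real k * sq (C x)" for k by (meson linorder_not_le)
    obtain X r x where X: "\<And>k. X k \<in> vecs n" "\<And>k. sq (X k) = 1" "\<And>k. q (X k) \<ge> real k * sq (C (X k))"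
      "strict_mono (r :: nat \<Rightarrow> nat)" "vconv n (X \<circ> r) x" "x \<in> vecs n" "x \<noteq> 0v n"
      using unit_sphere_counterexamples[of n "\<lambda>k x. q x \<ge> real k * sq (C x)"] ex
      by (auto simp: qform_smult[OF q] qform_smult[OF qC])
    have lq: "(\<lambda>k. q (X (r k))) \<longlonglongrightarrow> q x" using vconv_qform[OF q X(5)] by (simp add: o_def)
    have lC: "(\<lambda>k. sq (C (X (r k)))) \<longlonglongrightarrow> sq (C x)" using vconv_qform[OF qC X(5)] by (simp add: o_def)
    have qx: "q x \<ge> 0"
      by (rule LIMSEQ_le_const[OF lq]) (metis X(3) mult_nonneg_nonneg of_nat_0_le_iff order_trans sq_nonneg)
    obtain c where c: "c > 0" "\<And>x. x \<in> vecs n \<Longrightarrow> \<bar>q x\<bar> \<le> c * sq x" using qform_bounded[OF q] by blast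
    \<comment> \<open>On the sphere \<open>q\<close> is at most \<open>c\<close>, so the penalised
      term decays like \<open>c / k\<close> and the limit lies in the kernel of
      \<open>C\<close>.\<close>
    have b: "sq (C (X (r k))) \<le> c * inverse (real k)" if "k \<ge> 1" for k
    proof -
      have k: "real k \<le> real (r k)" using seq_suble[OF X(4)] by simp
      have "real k * sq (C (X (r k))) \<le> q (X (r k))"
        using X(3)[of "r k"] mult_right_mono[OF k sq_nonneg[of "C (X (r k))"]] by linarith
      also have "\<dots> \<le> c" using c(2)[of "X (r k)"] X(1,2)[of "r k"] by simp
      finally show ?thesis using that by (simp add: field_simps)
    qed
    have "sq (C x) \<le> c * 0"
      by (rule LIMSEQ_le[OF lC tendsto_mult_left[OF lim_inverse_n, of c]])
        (use b in \<open>auto intro!: exI[of _ 1]\<close>)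
    hence "sq (C x) = 0" using sq_nonneg[of "C x"] by simp
    hence "C x = 0v m" using sq_eq_0[OF linD(1)[OF C X(6)]] by simp
    with neg[OF X(6,7)] qx show False by simp
  qed
  then obtain k :: nat where k: "\<forall>x \<in> vecs n. x \<noteq> 0v n \<longrightarrow> q x < real k * sq (C x)" by blast
  have "q x < (real k + 1) * sq (C x)" if "x \<in> vecs n" "x \<noteq> 0v n" for x
    using k that sq_nonneg[of "C x"] by (fastforce simp: algebra_simps)
  thus ?thesis using that[of "real k + 1"] by simp
qed

text \<open>Strict positivity is uniform on the compact unit sphere. In the synthesis this extracts
  a dissipation margin from a strict inequality.\<close>

lemma pos_margin:
  assumes q: "qform n q" and pos: "\<And>x. x \<in> vecs n \<Longrightarrow> x \<noteq> 0v n \<Longrightarrow> q x > 0"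
  obtains \<delta> where "\<delta> > 0" "\<And>x. x \<in> vecs n \<Longrightarrow> q x \<ge> \<delta> * sq x"
proof -
  have "\<exists>k :: nat. \<forall>x \<in> vecs n. x \<noteq> 0v n \<longrightarrow> q x \<ge> (1 / real (Suc k)) * sq x"
  proof (rule ccontr)
    assume "\<not> ?thesis"
    hence ex: "\<exists>x \<in> vecs n. x \<noteq> 0v n \<and> q x < (1 / real (Suc k)) * sq x" for k by (meson linorder_not_le)
    obtain X r x where X: "\<And>k. sq (X k) = 1" "\<And>k. q (X k) < (1 / real (Suc k)) * sq (X k)"
      "strict_mono (r :: nat \<Rightarrow> nat)" "vconv n (X \<circ> r) x" "x \<in> vecs n" "x \<noteq> 0v n"
      by (rule unit_sphere_counterexamples[of n "\<lambda>k x. q x < (1 / real (Suc k)) * sq x"])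
        (use ex in \<open>auto simp: qform_smult[OF q] sq_smult simp del: of_nat_Suc
          simp flip: times_divide_eq_right\<close>)
    have lq: "(\<lambda>k. q (X (r k))) \<longlonglongrightarrow> q x" using vconv_qform[OF q X(4)] by (simp add: o_def)
    have "q (X (r k)) \<le> 1 / real (Suc k)" for k
    proof -
      have "1 / real (Suc (r k)) \<le> 1 / real (Suc k)" using seq_suble[OF X(3), of k] by (simp add: frac_le)
      thus ?thesis using X(1,2)[of "r k"] by simp
    qed
    hence "q x \<le> 0"
      by (intro LIMSEQ_le[OF lq LIMSEQ_inverse_real_of_nat[unfolded inverse_eq_divide]]) auto
    with pos[OF X(5,6)] show False by simp
  qed
  then obtain k where k: "\<And>x. x \<in> vecs n \<Longrightarrow> x \<noteq> 0v n \<Longrightarrow> q x \<ge> (1 / real (Suc k)) * sq x" by blast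
  have "q x \<ge> (1 / real (Suc k)) * sq x" if "x \<in> vecs n" for x
    using k[OF that] qform_zero_arg[OF q] by (cases "x = 0v n") auto
  thus ?thesis using that[of "1 / real (Suc k)"] by simp
qed

text \<open>An injective endomorphism of a finite-dimensional space is invertible; in the
  applications injectivity is read off from a positive form.\<close>

lemma pos_def_inverse:
  assumes g: "lin n n g" and pos: "\<And>x. x \<in> vecs n \<Longrightarrow> x \<noteq> 0v n \<Longrightarrow> g x \<noteq> 0v n"
  obtains h where "lin n n h" "\<And>x. x \<in> vecs n \<Longrightarrow> g (h x) = x"
    "\<And>x. x \<in> vecs n \<Longrightarrow> h (g x) = x"
proof -
  define M where "M = matf n n g"
  have M: "M \<in> mats n n" by (simp add: M_def)
  have Mg: "M *v x = g x" if "x \<in> vecs n" for x using matf_mult[OF g that] by (simp add: M_def)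
  have "det M \<noteq> 0" using det_0_iff_vec_prod_zero[OF M] pos Mg by auto
  from det_non_zero_imp_unit[OF M this] obtain B where B: "B \<in> mats n n" "B * M = 1\<^sub>m n" "M * B = 1\<^sub>m n"
    unfolding Units_def ring_mat_def by auto
  show ?thesis
  proof (rule that[of "\<lambda>x. B *v x"])
    show "lin n n (mult_mat_vec B)" by (rule lin_mult_mat[OF B(1)])
    fix x :: "real vec" assume x: "x \<in> vecs n"
    show "g (B *v x) = x"
      using Mg[of "B *v x"] B x assoc_mult_mat_vec[OF M B(1) x] by simp
    show "B *v g x = x"
      using Mg[of x] B x assoc_mult_mat_vec[OF B(1) M x] by simp
  qed
qed

lemma scalar_prod_append_left:
  assumes "a \<in> vecs n" "b \<in> vecs m" "u \<in> vecs (n + m)"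
  shows "(a @v b) \<bullet> u = a \<bullet> vec_first u n + b \<bullet> (vec_last u m :: real vec)"
  using scalar_prod_append[OF assms(1,2) vec_first_carrier[of u n] vec_last_carrier[of u m]]
    vec_first_last_append[OF assms(3)] by simp

lemma vec_add_diff_cancel:
  "(a :: real vec) \<in> vecs n \<Longrightarrow> b \<in> vecs n \<Longrightarrow> a + (b - a) = b"
  by (intro eq_vecI) auto

lemma append_eq_add:
  assumes "a \<in> vecs n" "b \<in> vecs m" "c \<in> vecs m"
  shows "(a @v b) = (a @v c) + (0v n @v (b - c :: real vec))"
  using assms by (subst append_vec_add[of _ n _ _ m]) (auto simp: vec_add_diff_cancel)

text \<open>Completion of the square in the second argument. \<open>R x\<close> is the stationary
  point, so the mixed term with every deviation \<open>w - R x\<close> vanishes.\<close>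

lemma partial_min:
  assumes \<Phi>: "qform (n + m) \<Phi>"
    and pos: "\<And>w. w \<in> vecs m \<Longrightarrow> w \<noteq> 0v m \<Longrightarrow> \<Phi> (0v n @v w) > 0"
  obtains R where "lin n m R" "\<And>x w. x \<in> vecs n \<Longrightarrow> w \<in> vecs m \<Longrightarrow>
     \<Phi> (x @v w) = \<Phi> (x @v R x) + \<Phi> (0v n @v (w - R x))"
proof -
  obtain g where g: "lin (n + m) (n + m) g" "\<And>x. x \<in> vecs (n + m) \<Longrightarrow> \<Phi> x = x \<bullet> g x"
    "\<And>x y. x \<in> vecs (n + m) \<Longrightarrow> y \<in> vecs (n + m) \<Longrightarrow> \<Phi> (x + y) = \<Phi> x + \<Phi> y + 2 * (x \<bullet> g y)"
    "\<And>x y. x \<in> vecs (n + m) \<Longrightarrow> y \<in> vecs (n + m) \<Longrightarrow> x \<bullet> g y = y \<bullet> g x"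
    using qformE[OF \<Phi>] by metis
  define G where "G w = vec_last (g (0v n @v w)) m" for w
  define A where "A x = vec_last (g (x @v 0v m)) m" for x
  have Gl: "lin m m G" unfolding G_def
    by (rule lin_last[OF lin_comp[OF lin_append[OF lin_zero lin_id] g(1)]])
  have Al: "lin n m A" unfolding A_def
    by (rule lin_last[OF lin_comp[OF lin_append[OF lin_id lin_zero] g(1)]])
  have G0: "G w \<noteq> 0v m" if w: "w \<in> vecs m" "w \<noteq> 0v m" for w
  proof
    assume "G w = 0v m"
    hence "\<Phi> (0v n @v w) = 0"
      using w linD(1)[OF g(1), of "0v n @v w"]
      by (simp add: g(2) scalar_prod_append_left[of _ n _ m] flip: G_def)
    with pos[OF w] show False by simp
  qed
  obtain h where h: "lin m m h" "\<And>x. x \<in> vecs m \<Longrightarrow> G (h x) = x"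
    using pos_def_inverse[OF Gl G0] by metis
  \<comment> \<open>Solves the stationarity equation \<open>A x + G (R x) = 0\<close>; here
    \<open>G\<close> is the block of the second argument with itself, invertible by
    positivity.\<close>
  define R where "R x = - h (A x)" for x
  have R: "lin n m R" unfolding R_def by (rule lin_uminus[OF lin_comp[OF Al h(1)]])
  have last0: "vec_last (g (x @v R x)) m = 0v m" if x: "x \<in> vecs n" for x
  proof -
    have c: "A x \<in> vecs m" "h (A x) \<in> vecs m" "R x \<in> vecs m"
      using linD(1)[OF Al x] linD(1)[OF h(1)] linD(1)[OF R x] by auto
    have "x @v R x = (x @v 0v m) + (0v n @v R x)"
      using append_eq_add[of x n "R x" m "0v m"] x c by simp
    hence "g (x @v R x) = g (x @v 0v m) + g (0v n @v R x)"
      using linD(2)[OF g(1)] x c by simp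
    hence "vec_last (g (x @v R x)) m = A x + G (R x)"
      using linD(1)[OF g(1), of "x @v 0v m"] linD(1)[OF g(1), of "0v n @v R x"] x c
      by (intro eq_vecI) (auto simp: A_def G_def vec_last_def)
    also have "G (R x) = - A x"
      using h(2)[OF c(1)] lin_diff_arg[OF Gl, of "0v m" "h (A x)"] lin_zero_arg[OF Gl] c
      by (simp add: R_def)
    finally show ?thesis using c by simp
  qed
  show ?thesis
  proof (rule that[OF R])
    fix x w :: "real vec" assume x: "x \<in> vecs n" and w: "w \<in> vecs m"
    have Rx: "R x \<in> vecs m" by (rule linD(1)[OF R x])
    have "(0v n @v (w - R x)) \<bullet> g (x @v R x) = 0"
      using last0[OF x] x w Rx linD(1)[OF g(1), of "x @v R x"]
      by (simp add: scalar_prod_append_left[of _ n _ m])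
    moreover have "\<Phi> (x @v w) = \<Phi> ((x @v R x) + (0v n @v (w - R x)))"
      by (subst append_eq_add[OF x w Rx]) simp
    ultimately show "\<Phi> (x @v w) = \<Phi> (x @v R x) + \<Phi> (0v n @v (w - R x))"
      using x w Rx g(3)[of "x @v R x" "0v n @v (w - R x)"]
        g(4)[of "x @v R x" "0v n @v (w - R x)"] by simp
  qed
qed

text \<open>By polarisation the matrix entries are combinations of values of the form. Pointwise
  convergence of the values therefore gives convergence of the matrices, and the limit is again a
  quadratic form.\<close>

lemma qform_limit:
  assumes P: "\<And>N. qform n (P N)" and conv: "\<And>x. x \<in> vecs n \<Longrightarrow> convergent (\<lambda>N. P N x)"
  obtains Q where "qform n Q" "\<And>x. x \<in> vecs n \<Longrightarrow> (\<lambda>N :: nat. P N x) \<longlonglongrightarrow> Q x"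
proof -
  have "\<exists>M. M \<in> mats n n \<and> M\<^sup>T = M \<and>
     (\<forall>x \<in> vecs n. P N x = x \<bullet> (M *v x))" for N
    using P[of N] unfolding qform_def by blast
  then obtain M where M: "\<And>N. M N \<in> mats n n" "\<And>N. (M N)\<^sup>T = M N"
    and PM: "\<And>N x. x \<in> vecs n \<Longrightarrow> P N x = x \<bullet> (M N *v x)" by metis
  have entry: "M N $$ (i, j) = (P N (unit_vec n i + unit_vec n j) - P N (unit_vec n i) - P N (unit_vec n j)) / 2"
    if ij: "i < n" "j < n" for i j N
  proof -
    have s: "M N $$ (j, i) = M N $$ (i, j)" using M(1)[of N] M(2)[of N] ij
      by (metis carrier_matD index_transpose_mat(1))
    have u: "unit_vec n a \<bullet> (M N *v unit_vec n b) = M N $$ (a, b)" if "a < n" "b < n" for a b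
      using M(1)[of N] that by (simp add: mult_mat_unit_vec[of _ n n])
    have "P N (unit_vec n i + unit_vec n j) = P N (unit_vec n i) + P N (unit_vec n j) + 2 * M N $$ (i, j)"
      using ij M(1)[of N] s
      by (simp add: PM mult_add_distrib_mat_vec[of _ n n] scalar_prod_add_distrib[of _ n]
          add_scalar_prod_distrib[of _ n] u)
    thus ?thesis by simp
  qed
  have cM: "convergent (\<lambda>N. M N $$ (i, j))" if "i < n" "j < n" for i j
    unfolding entry[OF that] divide_inverse
    by (intro convergent_mult_const_right_iff[THEN iffD2] convergent_diff conv convergent_const
      convergent_mult) auto
  define L where "L = mat n n (\<lambda>(i, j). lim (\<lambda>N. M N $$ (i, j)))"
  have L: "L \<in> mats n n" by (simp add: L_def)
  have "L\<^sup>T = L"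
  proof (rule eq_matI)
    fix i j assume "i < dim_row L" "j < dim_col L"
    hence ij: "i < n" "j < n" by (auto simp: L_def)
    have "M N $$ (j, i) = M N $$ (i, j)" for N using M(1)[of N] M(2)[of N] ij
      by (metis carrier_matD index_transpose_mat(1))
    thus "L\<^sup>T $$ (i, j) = L $$ (i, j)" using ij by (simp add: L_def)
  qed (auto simp: L_def)
  moreover have "(\<lambda>N. P N x) \<longlonglongrightarrow> x \<bullet> (L *v x)" if x: "x \<in> vecs n" for x
  proof -
    have e: "x \<bullet> (K *v x) = (\<Sum>i<n. x $ i * (\<Sum>j<n. K $$ (i, j) * x $ j))" if "K \<in> mats n n" for K
      using that x by (auto simp: scalar_prod_def atLeast0LessThan)
    have l: "(\<lambda>N. M N $$ (i, j)) \<longlonglongrightarrow> L $$ (i, j)" if "i < n" "j < n" for i j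
      using cM[OF that] that by (simp add: L_def convergent_LIMSEQ_iff)
    show ?thesis unfolding PM[OF x] e[OF M(1)] e[OF L]
      by (intro tendsto_sum tendsto_mult tendsto_const l) auto
  qed
  ultimately show ?thesis
    using L by (intro that[of "\<lambda>x. x \<bullet> (L *v x)"]) (auto simp: qform_def)
qed

text \<open>Monotone convergence of forms; it serves for the Lyapunov sums and for the
  finite-horizon optimal values.\<close>

lemma qform_limit_incseq:
  assumes P: "\<And>N. qform n (P N)"
    and mono: "\<And>N x. x \<in> vecs n \<Longrightarrow> P N x \<le> P (Suc N) x"
    and bd: "\<And>N x. x \<in> vecs n \<Longrightarrow> P N x \<le> b x"
  obtains Q where "qform n Q" "\<And>x. x \<in> vecs n \<Longrightarrow> (\<lambda>N :: nat. P N x) \<longlonglongrightarrow> Q x"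
    "\<And>N x. x \<in> vecs n \<Longrightarrow> P N x \<le> Q x" "\<And>x. x \<in> vecs n \<Longrightarrow> Q x \<le> b x"
proof -
  have inc: "incseq (\<lambda>N. P N x)" if "x \<in> vecs n" for x
    by (rule incseq_SucI) (rule mono[OF that])
  have conv: "convergent (\<lambda>N. P N x)" if "x \<in> vecs n" for x
    using incseq_convergent[OF inc[OF that], of "b x"] bd[OF that] convergentI by metis
  obtain Q where Q: "qform n Q" "\<And>x. x \<in> vecs n \<Longrightarrow> (\<lambda>N. P N x) \<longlonglongrightarrow> Q x"
    using qform_limit[of n P, OF P conv] by metis
  show ?thesis
  proof (rule that[OF Q])
    show "P N x \<le> Q x" if "x \<in> vecs n" for N x
      using incseq_le[OF inc[OF that] Q(2)[OF that]] .
    show "Q x \<le> b x" if "x \<in> vecs n" for x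
      using LIMSEQ_le_const2[OF Q(2)[OF that]] bd[OF that] by blast
  qed
qed

text \<open>The controller plays \<open>r\<close> after observing \<open>C h\<close>. Regularising makes the game strictly convex in
  \<open>r\<close>, and penalising \<open>C h - s\<close> makes it strictly concave in \<open>h\<close>, so the saddle point depends linearly on
  the observation \<open>s\<close>.\<close>

lemma quadratic_game:
  assumes \<Phi>: "qform (a + b) \<Phi>" and C: "lin a c C"
    and convex: "\<And>r. r \<in> vecs b \<Longrightarrow> \<Phi> (0v a @v r) \<ge> 0"
    and concave: "\<And>h. h \<in> vecs a \<Longrightarrow> h \<noteq> 0v a \<Longrightarrow> C h = 0v c \<Longrightarrow> \<Phi> (h @v 0v b) < 0"
    and reply: "\<And>h. h \<in> vecs a \<Longrightarrow> h \<noteq> 0v a \<Longrightarrow> \<exists>r \<in> vecs b. \<Phi> (h @v r) < 0"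
  obtains \<Theta> where "lin c b \<Theta>"
    "\<And>h. h \<in> vecs a \<Longrightarrow> h \<noteq> 0v a \<Longrightarrow> \<Phi> (h @v \<Theta> (C h)) < 0"
proof -
  \<comment> \<open>Compactness again: one regularisation weight \<open>1 / real (Suc k)\<close>
    serves all \<open>h\<close> at once.\<close>
  have "\<exists>k :: nat. \<forall>h \<in> vecs a. h \<noteq> 0v a \<longrightarrow>
     (\<exists>r \<in> vecs b. \<Phi> (h @v r) + (1 / real (Suc k)) * sq r < 0)"
  proof (rule ccontr)
    assume "\<not> ?thesis"
    hence ex: "\<exists>h \<in> vecs a. h \<noteq> 0v a \<and>
       (\<forall>r \<in> vecs b. \<Phi> (h @v r) + (1 / real (Suc k)) * sq r \<ge> 0)" for k
      by (meson linorder_not_le)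
    have hom: "\<forall>r \<in> vecs b. \<Phi> (t *s h @v r) + (1 / real (Suc k)) * sq r \<ge> 0"
      if h: "h \<in> vecs a" "t > 0"
        and nn: "\<forall>r \<in> vecs b. \<Phi> (h @v r) + (1 / real (Suc k)) * sq r \<ge> 0" for h t k
    proof
      fix r :: "real vec" assume r: "r \<in> vecs b"
      have "t *s h @v r = t *s (h @v (1 / t) *s r)"
        using h(2) by (simp add: append_vec_smult smult_smult_assoc)
      hence "\<Phi> (t *s h @v r) = t\<^sup>2 * \<Phi> (h @v (1 / t) *s r)"
        using qform_smult[OF \<Phi>] h(1) r by simp
      moreover have "sq r = t\<^sup>2 * sq ((1 / t) *s r)" using h(2) by (simp add: sq_smult power_divide)
      ultimately have eq: "\<Phi> (t *s h @v r) + (1 / real (Suc k)) * sq r =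
          t\<^sup>2 * (\<Phi> (h @v (1 / t) *s r) + (1 / real (Suc k)) * sq ((1 / t) *s r))"
        by (metis distrib_left mult.left_commute)
      have "0 \<le> \<Phi> (h @v (1 / t) *s r) + (1 / real (Suc k)) * sq ((1 / t) *s r)"
        by (rule nn[rule_format]) (use r in simp)
      from mult_nonneg_nonneg[OF zero_le_power2 this]
      show "\<Phi> (t *s h @v r) + (1 / real (Suc k)) * sq r \<ge> 0" unfolding eq .
    qed
    obtain X r h where X: "\<And>k. X k \<in> vecs a"
      "\<And>k. \<forall>r \<in> vecs b. \<Phi> (X k @v r) + (1 / real (Suc k)) * sq r \<ge> 0"
      "strict_mono (r :: nat \<Rightarrow> nat)" "vconv a (X \<circ> r) h" "h \<in> vecs a" "h \<noteq> 0v a"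
      by (rule unit_sphere_counterexamples[of a
        "\<lambda>k h. \<forall>r \<in> vecs b. \<Phi> (h @v r) + (1 / real (Suc k)) * sq r \<ge> 0", OF ex hom]) blast+
    obtain u where u: "u \<in> vecs b" "\<Phi> (h @v u) < 0" using reply[OF X(5,6)] by blast
    have l: "(\<lambda>k. \<Phi> ((X \<circ> r) k @v u)) \<longlonglongrightarrow> \<Phi> (h @v u)"
      by (rule vconv_qform[OF \<Phi> vconv_append[OF X(4) vconv_const[OF u(1)]]])
    have lk: "(\<lambda>k. 1 / real (Suc (r k))) \<longlonglongrightarrow> 0"
      using LIMSEQ_subseq_LIMSEQ[OF LIMSEQ_inverse_real_of_nat X(3)] by (simp add: o_def inverse_eq_divide)
    have "(\<lambda>k. \<Phi> ((X \<circ> r) k @v u) + (1 / real (Suc (r k))) * sq u) \<longlonglongrightarrow> \<Phi> (h @v u) + 0 * sq u"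
      by (intro tendsto_add l tendsto_mult_right lk)
    from LIMSEQ_le_const[OF this, of 0] X(2) u show False by (auto simp: o_def)
  qed
  then obtain k :: nat where k: "\<forall>h \<in> vecs a. h \<noteq> 0v a \<longrightarrow>
     (\<exists>r \<in> vecs b. \<Phi> (h @v r) + (1 / real (Suc k)) * sq r < 0)" by blast
  define \<epsilon> where "\<epsilon> = 1 / real (Suc k)"
  have \<epsilon>: "\<epsilon> > 0" by (simp add: \<epsilon>_def)
  define F where "F v = \<Phi> v + \<epsilon> * sq (vec_last v b)" for v
  have F: "qform (a + b) F" unfolding F_def
    by (intro qform_add \<Phi> qform_scale qform_sq[OF lin_last_id])
  have Fe: "F (h @v r) = \<Phi> (h @v r) + \<epsilon> * sq r" if "r \<in> vecs b" for h r
    using that by (simp add: F_def)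
  have Fpos: "F (0v a @v r) \<ge> 0" if "r \<in> vecs b" for r
    using convex[OF that] \<epsilon> sq_nonneg[of r] by (simp add: Fe that)
  have Fpos': "F (0v a @v r) > 0" if "r \<in> vecs b" "r \<noteq> 0v b" for r
    using convex[OF that(1)] \<epsilon> mult_pos_pos[OF \<epsilon> sq_pos[OF that]] by (simp add: Fe that)
  obtain R where R: "lin a b R" and FR: "\<And>h r. h \<in> vecs a \<Longrightarrow> r \<in> vecs b \<Longrightarrow>
     F (h @v r) = F (h @v R h) + F (0v a @v (r - R h))"
    using partial_min[OF F Fpos'] by metis
  \<comment> \<open>The value of the regularised game when the reply may depend on all of
    \<open>h\<close>.\<close>
  define m where "m h = F (h @v R h)" for h
  have m: "qform a m" unfolding m_def by (rule qform_comp[OF lin_append[OF lin_id R] F])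
  have mneg: "m h < 0" if h: "h \<in> vecs a" "h \<noteq> 0v a" for h
  proof -
    obtain r where r: "r \<in> vecs b" "F (h @v r) < 0" using k h Fe by (auto simp: \<epsilon>_def)
    have "F (0v a @v (r - R h)) \<ge> 0" using Fpos r linD(1)[OF R h(1)] by simp
    with FR[OF h(1) r(1)] r(2) show ?thesis by (simp add: m_def)
  qed
  have q0: "qform a (\<lambda>h. \<Phi> (h @v 0v b))" by (rule qform_comp[OF lin_append[OF lin_id lin_zero] \<Phi>])
  obtain \<kappa> where \<kappa>: "\<kappa> > 0" "\<And>h. h \<in> vecs a \<Longrightarrow> h \<noteq> 0v a \<Longrightarrow> \<Phi> (h @v 0v b) < \<kappa> * sq (C h)"
    using finsler[OF q0 C concave] by metis
  \<comment> \<open>The negated fully informed value plus a price for contradicting the observation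
    \<open>s\<close>. Its minimiser \<open>H s\<close> acts as a worst-case estimate of
    \<open>h\<close> given \<open>s\<close>.\<close>
  define \<Psi> where "\<Psi> v = - m (vec_last v a) + \<kappa> * sq (C (vec_last v a) - vec_first v c)" for v
  have \<Psi>: "qform (c + a) \<Psi>" unfolding \<Psi>_def
    by (intro qform_add qform_uminus qform_comp[OF lin_last_id m] qform_scale
        qform_sq[OF lin_minus[OF lin_comp[OF lin_last_id C] lin_first_id]])
  have \<Psi>e: "\<Psi> (s @v h) = - m h + \<kappa> * sq (C h - s)" if "s \<in> vecs c" "h \<in> vecs a" for s h
    using that by (simp add: \<Psi>_def)
  have \<Psi>pos: "\<Psi> (0v c @v h) > 0" if "h \<in> vecs a" "h \<noteq> 0v a" for h
    using mneg[OF that] \<kappa>(1) mult_nonneg_nonneg[OF less_imp_le[OF \<kappa>(1)] sq_nonneg[of "C h - 0v c"]]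
    by (simp add: \<Psi>e that)
  obtain H where H: "lin c a H" and \<Psi>H: "\<And>s h. s \<in> vecs c \<Longrightarrow> h \<in> vecs a \<Longrightarrow>
     \<Psi> (s @v h) = \<Psi> (s @v H s) + \<Psi> (0v c @v (h - H s))"
    using partial_min[OF \<Psi> \<Psi>pos] by metis
  show ?thesis
  \<comment> \<open>Certainty equivalence: the fully informed reply is applied to the
    estimate.\<close>
  proof (rule that[of "\<lambda>s. R (H s)"])
    show "lin c b (\<lambda>s. R (H s))" by (rule lin_comp[OF H R])
    fix h :: "real vec" assume h: "h \<in> vecs a" "h \<noteq> 0v a"
    define s where "s = C h"
    define h' where "h' = H s"
    define e where "e = h - h'"
    have sc: "s \<in> vecs c" by (simp add: s_def linD(1)[OF C h(1)])
    have h'c: "h' \<in> vecs a" by (simp add: h'_def linD(1)[OF H sc])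
    have ec: "e \<in> vecs a" using h h'c by (simp add: e_def)
    have Rc: "R h \<in> vecs b" "R h' \<in> vecs b" "R e \<in> vecs b"
      using linD(1)[OF R] h h'c ec by auto
    have Re: "R h' - R h = - R e"
      unfolding e_def lin_diff_arg[OF R h(1) h'c] using Rc by (intro eq_vecI) auto
    have neg: "0v a @v (- R e) = - (0v a @v R e)" by (intro eq_vecI) auto
    have "F (h @v R h') = m h + F (0v a @v R e)"
      using FR[OF h(1) Rc(2)] Re neg qform_minus_arg[OF F, of "0v a @v R e"] Rc by (simp add: m_def)
    moreover have "m h = - \<Psi> (s @v h)"
      using \<Psi>e[OF sc h(1)] sc by (simp add: s_def)
    moreover have "\<Psi> (s @v h) = \<Psi> (s @v h') + \<Psi> (0v c @v e)"
      using \<Psi>H[OF sc h(1)] by (simp add: h'_def e_def)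
    moreover have "\<Psi> (0v c @v e) = - m e + \<kappa> * sq (C e)"
      using \<Psi>e[of "0v c" e] ec linD(1)[OF C ec] by simp
    moreover have "\<Phi> (e @v 0v b) = m e + F (0v a @v R e)"
    proof -
      have "F (e @v 0v b) = m e + F (0v a @v (0v b - R e))"
        using FR[OF ec, of "0v b"] by (simp add: m_def)
      thus ?thesis using neg qform_minus_arg[OF F, of "0v a @v R e"] Rc by (simp add: Fe)
    qed
    moreover have "\<Psi> (s @v h') = - m h' + \<kappa> * sq (C h' - s)" by (rule \<Psi>e[OF sc h'c])
    \<comment> \<open>The payoff splits into a part at the estimate \<open>h'\<close> and a part at
      the error \<open>e\<close> with zero reply. The former is nonpositive by \<open>mneg\<close>,
      the latter by the choice of \<open>\<kappa>\<close>, and one of them is strict because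
      \<open>h = h' + e\<close> is nonzero.\<close>
    ultimately have eq: "F (h @v R h') = m h' - \<kappa> * sq (C h' - s) + (\<Phi> (e @v 0v b) - \<kappa> * sq (C e))"
      by simp
    have \<kappa>s: "\<kappa> * sq (C h' - s) \<ge> 0" using \<kappa>(1) sq_nonneg by (simp add: less_imp_le)
    have mle: "m h' \<le> 0"
      using mneg[OF h'c] qform_zero_arg[OF m] by (cases "h' = 0v a") auto
    have "F (h @v R h') < 0"
    proof (cases "e = 0v a")
      case True
      have "h = h' + e" using h h'c by (simp add: e_def vec_add_diff_cancel)
      hence "h' \<noteq> 0v a" using h h'c True by auto
      from mneg[OF h'c this] show ?thesis using eq \<kappa>s True qform_zero_arg[OF q0] lin_zero_arg[OF C] by simp
    next
      case False
      from \<kappa>(2)[OF ec False] show ?thesis using eq \<kappa>s mle by simp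
    qed
    moreover have "\<epsilon> * sq (R h') \<ge> 0" using \<epsilon> sq_nonneg by (simp add: less_imp_le)
    ultimately show "\<Phi> (h @v R (H (C h))) < 0" using Fe[OF Rc(2), of h] by (simp add: h'_def s_def)
  qed
qed

section \<open>Schur stability\<close>

text \<open>For \<open>r\<close> strictly between the spectral radius and 1, the matrix divided by
  \<open>r\<close> still has spectral radius below 1, so its powers are bounded. Undoing the scaling
  gives geometric decay.\<close>

lemma schur_power_bound:
  assumes A: "A \<in> mats n n" and s: "schur A" and n: "n > 0"
  obtains r c where "0 < r" "r < 1" "\<And>k i j. i < n \<Longrightarrow> j < n \<Longrightarrow> \<bar>(A ^\<^sub>m k) $$ (i, j)\<bar> \<le> c * r ^ k"
proof -
  define cA where "cA = map_mat complex_of_real A"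
  have cA: "cA \<in> mats n n" using A by (simp add: cA_def)
  have "spectral_radius cA < 1"
    using spectral_radius_mem_max(1)[OF cA n] s
    unfolding spectrum_def schur_def cA_def by auto
  then obtain r where r: "spectral_radius cA < r" "0 < r" "r < 1"
    using dense[of "max 0 (spectral_radius cA)" 1] by auto
  define B where "B = complex_of_real (1 / r) \<cdot>\<^sub>m cA"
  have B: "B \<in> mats n n" using cA by (simp add: B_def)
  have eB: "cmod \<mu> < 1" if \<mu>: "eigenvalue B \<mu>" for \<mu>
  proof -
    obtain v where v: "v \<in> vecs n" "v \<noteq> 0v n" "B *v v = \<mu> *s v"
      using \<mu> B unfolding eigenvalue_def eigenvector_def by auto
    have "cA = complex_of_real r \<cdot>\<^sub>m B" using r(2) by (intro eq_matI) (auto simp: B_def)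
    moreover have "(complex_of_real r \<cdot>\<^sub>m B) *v v = complex_of_real r *s (B *v v)"
      using B v(1) by (intro eq_vecI) (auto simp: scalar_prod_def sum_distrib_left mult_ac)
    ultimately have "cA *v v = (complex_of_real r * \<mu>) *s v" using v by (simp add: smult_smult_assoc)
    hence "eigenvalue cA (complex_of_real r * \<mu>)"
      unfolding eigenvalue_def eigenvector_def using v cA by auto
    hence "cmod (complex_of_real r * \<mu>) \<le> spectral_radius cA"
      using spectral_radius_mem_max(2)[OF cA n] by (auto simp: spectrum_def)
    hence "r * cmod \<mu> \<le> spectral_radius cA" using r by (simp add: norm_mult)
    hence "r * cmod \<mu> < r * 1" using r(1) by linarith
    thus ?thesis using r(2) by simp
  qed
  have "spectral_radius B < 1"
    using spectral_radius_mem_max(1)[OF B n] eB unfolding spectrum_def by auto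
  from spectral_radius_jnf_norm_bound_less_1_upper_triangular[OF B this]
  obtain c where c: "\<And>k. norm_bound (B ^\<^sub>m k) c" by blast
  have pow: "(A ^\<^sub>m k) \<in> mats n n" "B ^\<^sub>m k \<in> mats n n" for k using A B by auto
  have eq: "map_mat complex_of_real (A ^\<^sub>m k) = complex_of_real (r ^ k) \<cdot>\<^sub>m (B ^\<^sub>m k)" for k
  proof (induction k)
    case 0
    show ?case using A B cA by (intro eq_matI) auto
  next
    case (Suc k)
    have "cA = complex_of_real r \<cdot>\<^sub>m B" using r(2) by (intro eq_matI) (auto simp: B_def)
    hence "map_mat complex_of_real (A ^\<^sub>m Suc k) =
        (complex_of_real (r ^ k) \<cdot>\<^sub>m (B ^\<^sub>m k)) * (complex_of_real r \<cdot>\<^sub>m B)"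
      using pow[of k] A Suc by (simp add: of_real_hom.mat_hom_mult[of _ n n _ n] cA_def)
    also have "\<dots> = complex_of_real (r ^ Suc k) \<cdot>\<^sub>m (B ^\<^sub>m Suc k)"
      using pow[of k] B by (intro eq_matI) (auto simp: scalar_prod_def sum_distrib_left mult_ac)
    finally show ?case .
  qed
  show ?thesis
  proof (rule that[OF r(2,3)])
    fix k i j assume ij: "i < n" "j < n"
    have "complex_of_real ((A ^\<^sub>m k) $$ (i, j)) = map_mat complex_of_real (A ^\<^sub>m k) $$ (i, j)"
      using ij A by simp
    also have "\<dots> = complex_of_real (r ^ k) * (B ^\<^sub>m k) $$ (i, j)"
      unfolding eq using ij B by simp
    finally have "\<bar>(A ^\<^sub>m k) $$ (i, j)\<bar> = r ^ k * cmod ((B ^\<^sub>m k) $$ (i, j))"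
      using r by (metis abs_of_pos norm_mult norm_of_real zero_less_power)
    also have "\<dots> \<le> r ^ k * c" using c[of k] ij B r(2) by (simp add: norm_bound_def)
    finally show "\<bar>(A ^\<^sub>m k) $$ (i, j)\<bar> \<le> c * r ^ k" by (simp add: mult.commute)
  qed
qed

text \<open>\<open>P x\<close> is the total energy of the free orbit from \<open>x\<close>. It is
  finite by geometric decay, quadratic as a limit of quadratic partial sums, and one step removes
  exactly the first term \<open>sq x\<close>.\<close>

lemma schur_lyapunov:
  assumes A: "A \<in> mats n n" and s: "schur A"
  obtains P where "qform n P" "\<And>x. x \<in> vecs n \<Longrightarrow> sq x \<le> P x"
    "\<And>x. x \<in> vecs n \<Longrightarrow> P (A *v x) = P x - sq x"
proof (cases "n = 0")
  case True
  show ?thesis by (rule that[of "\<lambda>x. 0"]) (auto simp: True qform_zero scalar_prod_def)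
next
  case False
  hence n: "n > 0" by simp
  obtain r c where r: "0 < r" "r < 1"
    and c: "\<And>k i j. i < n \<Longrightarrow> j < n \<Longrightarrow> \<bar>(A ^\<^sub>m k) $$ (i, j)\<bar> \<le> c * r ^ k"
    by (rule schur_power_bound[OF A s n], rule that)
  have pow: "A ^\<^sub>m k \<in> mats n n" for k using A by auto
  define P where "P N x = (\<Sum>k<N. sq (A ^\<^sub>m k *v x))" for N :: nat and x
  have P: "qform n (P N)" for N
  proof (induction N)
    case 0
    show ?case by (simp add: P_def qform_zero)
  next
    case (Suc N)
    have "qform n (\<lambda>x. P N x + sq (A ^\<^sub>m N *v x))"
      by (intro qform_add Suc qform_sq[OF lin_mult_mat[OF pow]])
    moreover have "P (Suc N) = (\<lambda>x. P N x + sq (A ^\<^sub>m N *v x))" by (auto simp: P_def)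
    ultimately show ?case by simp
  qed
  define b where "b x = real n * (c * (\<Sum>j<n. \<bar>x $ j\<bar>))\<^sup>2 * (1 / (1 - r\<^sup>2))" for x :: "real vec"
  have bd: "P N x \<le> b x" if x: "x \<in> vecs n" for N x
  proof -
    have "sq (A ^\<^sub>m k *v x) \<le> real n * (c * (\<Sum>j<n. \<bar>x $ j\<bar>))\<^sup>2 * (r\<^sup>2) ^ k" for k
    proof -
      have e: "\<bar>(A ^\<^sub>m k *v x) $ i\<bar> \<le> c * (\<Sum>j<n. \<bar>x $ j\<bar>) * r ^ k" if i: "i < n" for i
      proof -
        have "\<bar>(A ^\<^sub>m k *v x) $ i\<bar> = \<bar>\<Sum>j<n. (A ^\<^sub>m k) $$ (i, j) * x $ j\<bar>"
          using i x A by (auto simp: scalar_prod_def atLeast0LessThan)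
        also have "\<dots> \<le> (\<Sum>j<n. \<bar>(A ^\<^sub>m k) $$ (i, j)\<bar> * \<bar>x $ j\<bar>)"
          using sum_abs[of "\<lambda>j. (A ^\<^sub>m k) $$ (i, j) * x $ j"] by (simp add: abs_mult)
        also have "\<dots> \<le> (\<Sum>j<n. (c * r ^ k) * \<bar>x $ j\<bar>)"
          by (intro sum_mono mult_right_mono c i) auto
        also have "\<dots> = c * (\<Sum>j<n. \<bar>x $ j\<bar>) * r ^ k" by (simp add: sum_distrib_left mult_ac)
        finally show ?thesis .
      qed
      have "sq (A ^\<^sub>m k *v x) = (\<Sum>i<n. ((A ^\<^sub>m k *v x) $ i)\<^sup>2)"
        using A unfolding scalar_prod_def by (auto simp: power2_eq_square atLeast0LessThan)
      also have "\<dots> \<le> (\<Sum>i<n. (c * (\<Sum>j<n. \<bar>x $ j\<bar>) * r ^ k)\<^sup>2)"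
      proof (rule sum_mono)
        fix i assume "i \<in> {..<n}"
        hence "\<bar>(A ^\<^sub>m k *v x) $ i\<bar> \<le> c * (\<Sum>j<n. \<bar>x $ j\<bar>) * r ^ k" using e by blast
        from power_mono[OF this, of 2]
        show "((A ^\<^sub>m k *v x) $ i)\<^sup>2 \<le> (c * (\<Sum>j<n. \<bar>x $ j\<bar>) * r ^ k)\<^sup>2" by simp
      qed
      finally show ?thesis by (simp add: power_mult_distrib power_mult[symmetric] mult_ac)
    qed
    hence "P N x \<le> (\<Sum>k<N. real n * (c * (\<Sum>j<n. \<bar>x $ j\<bar>))\<^sup>2 * (r\<^sup>2) ^ k)"
      unfolding P_def by (intro sum_mono) auto
    also have "\<dots> = real n * (c * (\<Sum>j<n. \<bar>x $ j\<bar>))\<^sup>2 * (\<Sum>k<N. (r\<^sup>2) ^ k)"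
      by (simp add: sum_distrib_left)
    also have "\<dots> \<le> b x" unfolding b_def
    proof (rule mult_left_mono)
      have r2: "0 < r\<^sup>2" "r\<^sup>2 < 1" using r by (auto simp: power_less_one_iff)
      have "(\<Sum>k<N. (r\<^sup>2) ^ k) \<le> (\<Sum>k. (r\<^sup>2) ^ k)"
        using r2 by (intro sum_le_suminf summable_geometric) auto
      also have "\<dots> = 1 / (1 - r\<^sup>2)" using r2 by (intro suminf_geometric) auto
      finally show "(\<Sum>k<N. (r\<^sup>2) ^ k) \<le> 1 / (1 - r\<^sup>2)" .
    qed simp
    finally show ?thesis .
  qed
  have mono: "P N x \<le> P (Suc N) x" for N x by (simp add: P_def sq_nonneg)
  obtain Q where Q: "qform n Q" "\<And>x. x \<in> vecs n \<Longrightarrow> (\<lambda>N. P N x) \<longlonglongrightarrow> Q x"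
    "\<And>N x. x \<in> vecs n \<Longrightarrow> P N x \<le> Q x"
    using qform_limit_incseq[of n P b, OF P mono bd] by metis
  have step: "P (Suc N) x = sq x + P N (A *v x)" if x: "x \<in> vecs n" for N x
  proof -
    have "A ^\<^sub>m Suc k *v x = A ^\<^sub>m k *v (A *v x)" for k
      using pow A x by (simp add: assoc_mult_mat_vec[of _ n n _ n])
    hence "(\<Sum>k<N. sq (A ^\<^sub>m Suc k *v x)) = P N (A *v x)" unfolding P_def by simp
    moreover have "A ^\<^sub>m 0 *v x = x" using A x by simp
    ultimately show ?thesis unfolding P_def sum.lessThan_Suc_shift by simp
  qed
  show ?thesis
  proof (rule that[OF Q(1)])
    fix x :: "real vec" assume x: "x \<in> vecs n"
    have Ax: "A *v x \<in> vecs n" using A x by simp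
    show "sq x \<le> Q x" using Q(3)[OF x, of "Suc 0"] A x by (simp add: P_def)
    have "(\<lambda>N. sq x + P N (A *v x)) \<longlonglongrightarrow> Q x"
      using LIMSEQ_Suc[OF Q(2)[OF x]] by (simp add: step[OF x])
    moreover have "(\<lambda>N. sq x + P N (A *v x)) \<longlonglongrightarrow> sq x + Q (A *v x)"
      by (intro tendsto_add tendsto_const Q(2)[OF Ax])
    ultimately have "Q x = sq x + Q (A *v x)" by (rule LIMSEQ_unique)
    thus "Q (A *v x) = Q x - sq x" by simp
  qed
qed

text \<open>Young's inequality in the seminorm of \<open>q\<close>, from nonnegativity of
  \<open>q\<close> at \<open>x - y / \<eta>\<close>.\<close>

lemma qform_young:
  assumes q: "qform n q" and nn: "\<And>x. x \<in> vecs n \<Longrightarrow> q x \<ge> 0"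
    and x: "x \<in> vecs n" and y: "y \<in> vecs n" and \<eta>: "\<eta> > 0"
  shows "q (x + y) \<le> (1 + \<eta>) * q x + (1 + 1 / \<eta>) * q y"
proof -
  obtain g where g: "lin n n g" "\<And>x y. x \<in> vecs n \<Longrightarrow> y \<in> vecs n \<Longrightarrow>
      q (x + y) = q x + q y + 2 * (x \<bullet> g y)"
    using qformE[OF q] by metis
  have c: "g y \<in> vecs n" "(-(1/\<eta>)) *s y \<in> vecs n" using linD(1)[OF g(1) y] y by auto
  have "0 \<le> q (x + (-(1/\<eta>)) *s y)" using nn x y by simp
  also have "\<dots> = q x + (1/\<eta>)\<^sup>2 * q y - 2 * ((1/\<eta>) * (x \<bullet> g y))"
    using g(2)[OF x c(2)] c(1) x linD(3)[OF g(1) y] qform_smult[OF q y] by simp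
  finally have "0 \<le> \<eta> * (q x + (1/\<eta>)\<^sup>2 * q y - 2 * ((1/\<eta>) * (x \<bullet> g y)))" using \<eta> by simp
  also have "\<dots> = \<eta> * q x + (1/\<eta>) * q y - 2 * (x \<bullet> g y)"
    using \<eta> by (simp add: field_simps power2_eq_square)
  finally have "2 * (x \<bullet> g y) \<le> \<eta> * q x + (1/\<eta>) * q y" by simp
  thus ?thesis using g(2)[OF x y] by (simp add: algebra_simps)
qed

lemma telescope_le:
  fixes V a b :: "nat \<Rightarrow> real"
  assumes "\<And>k. V (Suc k) + a k \<le> V k + b k"
  shows "V N + (\<Sum>k<N. a k) \<le> V 0 + (\<Sum>k<N. b k)"
proof (induction N)
  case (Suc N)
  thus ?case using assms[of N] by simp
qed simp

text \<open>Stated on finite horizons, so that it applies to signals whose summability is not yet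
  known.\<close>

definition l2_gain :: "nat \<Rightarrow> real mat \<Rightarrow> real \<Rightarrow> bool" where
  "l2_gain n A c \<longleftrightarrow> (\<forall>x d. \<forall>N :: nat. (\<forall>k. x k \<in> vecs n) \<and> (\<forall>k. d k \<in> vecs n) \<and>
     (\<forall>k. x (Suc k) = A *v x k + d k) \<longrightarrow>
     (\<Sum>k<N. sq (x k)) \<le> c * (sq (x 0) + (\<Sum>k<N. sq (d k))))"

lemma l2_gainD:
  assumes "l2_gain n A c" "\<And>k. x k \<in> vecs n" "\<And>k. d k \<in> vecs n"
    "\<And>k. x (Suc k) = A *v x k + d k"
  shows "(\<Sum>k<N. sq (x k)) \<le> c * (sq (x 0) + (\<Sum>k<N. sq (d k)))"
  using assms unfolding l2_gain_def by blast

lemma schur_l2_gain: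
  assumes A: "A \<in> mats n n" and s: "schur A"
  obtains c where "c > 0" "l2_gain n A c"
proof -
  obtain P where P: "qform n P" "\<And>x. x \<in> vecs n \<Longrightarrow> sq x \<le> P x"
    "\<And>x. x \<in> vecs n \<Longrightarrow> P (A *v x) = P x - sq x" using schur_lyapunov[OF A s] by metis
  obtain b where b: "b > 0" "\<And>x. x \<in> vecs n \<Longrightarrow> \<bar>P x\<bar> \<le> b * sq x" using qform_bounded[OF P(1)] by metis
  \<comment> \<open>With this weight the cross term between state and disturbance uses up half of
    the Lyapunov decrease \<open>sq (x k)\<close>.\<close>
  define \<eta> where "\<eta> = 1 / (2 * b)"
  have \<eta>: "\<eta> > 0" using b by (simp add: \<eta>_def)
  define c where "c = 2 * (b + (1 + 1 / \<eta>) * b)"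
  have nn: "P x \<ge> 0" if "x \<in> vecs n" for x using P(2)[OF that] sq_nonneg[of x] by linarith
  show ?thesis
  proof (rule that[of c])
    show "c > 0" using b \<eta> by (simp add: c_def add_pos_pos)
    show "l2_gain n A c" unfolding l2_gain_def
    proof (intro allI impI, elim conjE)
    fix x d :: "nat \<Rightarrow> real vec" and N :: nat
    assume "\<forall>k. x k \<in> vecs n" and "\<forall>k. d k \<in> vecs n"
      and "\<forall>k. x (Suc k) = A *v x k + d k"
    hence x: "x k \<in> vecs n" and d: "d k \<in> vecs n"
      and step: "x (Suc k) = A *v x k + d k" for k by auto
    have "P (x (Suc k)) + sq (x k) / 2 \<le> P (x k) + (1 + 1 / \<eta>) * b * sq (d k)" for k
    proof -
      have Ax: "A *v x k \<in> vecs n" using A x by simp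
      have "P (x (Suc k)) \<le> (1 + \<eta>) * P (A *v x k) + (1 + 1 / \<eta>) * P (d k)"
        unfolding step by (rule qform_young[OF P(1) nn Ax d \<eta>])
      also have "P (A *v x k) = P (x k) - sq (x k)" by (rule P(3)[OF x])
      finally have "P (x (Suc k)) \<le> P (x k) - sq (x k) + \<eta> * (P (x k) - sq (x k)) + (1 + 1 / \<eta>) * P (d k)"
        by (simp add: algebra_simps)
      moreover have "\<eta> * (P (x k) - sq (x k)) \<le> \<eta> * (b * sq (x k))"
        using b(2)[OF x[of k]] \<eta> sq_nonneg[of "x k"] by (intro mult_left_mono) auto
      moreover have "\<eta> * (b * sq (x k)) = sq (x k) / 2" using b by (simp add: \<eta>_def)
      moreover have "(1 + 1 / \<eta>) * P (d k) \<le> (1 + 1 / \<eta>) * (b * sq (d k))"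
        using b(2)[OF d[of k]] \<eta> by (intro mult_left_mono) auto
      ultimately have "P (x (Suc k)) + sq (x k) / 2 \<le> P (x k) + (1 + 1 / \<eta>) * (b * sq (d k))"
        by linarith
      thus ?thesis by (simp add: mult.assoc)
    qed
    from telescope_le[of "\<lambda>k. P (x k)" "\<lambda>k. sq (x k) / 2", OF this, of N]
    have "(\<Sum>k<N. sq (x k)) / 2 \<le> P (x 0) + (1 + 1 / \<eta>) * b * (\<Sum>k<N. sq (d k))"
      using nn[OF x[of N]] by (simp add: sum_divide_distrib sum_distrib_left)
    also have "P (x 0) \<le> b * sq (x 0)" using b(2)[OF x[of 0]] by simp
    finally have "(\<Sum>k<N. sq (x k)) \<le> 2 * (b * sq (x 0)) + 2 * ((1 + 1 / \<eta>) * b * (\<Sum>k<N. sq (d k)))" by linarith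
    also have "\<dots> \<le> c * (sq (x 0) + (\<Sum>k<N. sq (d k)))"
    proof -
      have "0 \<le> 2 * ((1 + 1 / \<eta>) * b) * sq (x 0)" "0 \<le> 2 * b * (\<Sum>k<N. sq (d k))"
        using b \<eta> sq_nonneg by (auto intro!: mult_nonneg_nonneg sum_nonneg add_nonneg_nonneg)
      thus ?thesis by (simp add: c_def algebra_simps)
    qed
    finally show "(\<Sum>k<N. sq (x k)) \<le> c * (sq (x 0) + (\<Sum>k<N. sq (d k)))" .
    qed
  qed
qed

text \<open>For an eigenvalue \<open>\<mu>\<close>, the real and imaginary parts of
  \<open>\<mu>^k v\<close> are real orbits with joint energy \<open>|\<mu>|^(2 k) S\<close>. If
  \<open>|\<mu>|\<close> were at least 1, these energies could not have bounded sums. Stability of a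
  closed loop can thus be shown by following its orbits.\<close>

lemma schur_by_orbits:
  assumes A: "A \<in> mats n n"
    and bd: "\<And>x. (\<And>k. x k \<in> vecs n) \<Longrightarrow> (\<And>k. x (Suc k) = A *v x k) \<Longrightarrow>
      \<exists>c. \<forall>N. (\<Sum>k<N. sq (x k)) \<le> c"
  shows "schur A"
  unfolding schur_def
proof (intro conjI allI impI)
  show "square_mat A" using A by auto
  fix \<mu> assume "eigenvalue (map_mat complex_of_real A) \<mu>"
  then obtain v where v: "v \<in> vecs n" "v \<noteq> 0v n" "map_mat complex_of_real A *v v = \<mu> *s v"
    using A unfolding eigenvalue_def eigenvector_def by auto
  define a where "a k = vec n (\<lambda>i. Re (\<mu> ^ k * v $ i))" for k
  define b where "b k = vec n (\<lambda>i. Im (\<mu> ^ k * v $ i))" for k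
  have ev: "(\<Sum>j<n. complex_of_real (A $$ (i, j)) * v $ j) = \<mu> * v $ i" if i: "i < n" for i
  proof -
    have "(map_mat complex_of_real A *v v) $ i = (\<mu> *s v) $ i" by (simp add: v(3))
    thus ?thesis using i A v(1) by (auto simp: scalar_prod_def atLeast0LessThan)
  qed
  have ev': "(\<Sum>j<n. complex_of_real (A $$ (i, j)) * (\<mu> ^ k * v $ j)) = \<mu> ^ Suc k * v $ i"
    if i: "i < n" for i k
    using arg_cong[OF ev[OF i], of "\<lambda>z. \<mu> ^ k * z"] by (simp add: sum_distrib_left mult_ac)
  have a: "a k \<in> vecs n" "a (Suc k) = A *v a k" for k
  proof -
    show "a (Suc k) = A *v a k"
    proof (rule eq_vecI)
      fix i assume "i < dim_vec (A *v a k)"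
      hence i: "i < n" using A by simp
      have "Re (\<mu> ^ Suc k * v $ i) = (\<Sum>j<n. A $$ (i, j) * Re (\<mu> ^ k * v $ j))"
        unfolding ev'[OF i, symmetric] by simp
      thus "a (Suc k) $ i = (A *v a k) $ i"
        using i A by (auto simp: a_def scalar_prod_def atLeast0LessThan)
    qed (use A in \<open>auto simp: a_def\<close>)
  qed (simp add: a_def)
  have b: "b k \<in> vecs n" "b (Suc k) = A *v b k" for k
  proof -
    show "b (Suc k) = A *v b k"
    proof (rule eq_vecI)
      fix i assume "i < dim_vec (A *v b k)"
      hence i: "i < n" using A by simp
      have "Im (\<mu> ^ Suc k * v $ i) = (\<Sum>j<n. A $$ (i, j) * Im (\<mu> ^ k * v $ j))"
        unfolding ev'[OF i, symmetric] by simp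
      thus "b (Suc k) $ i = (A *v b k) $ i"
        using i A by (auto simp: b_def scalar_prod_def atLeast0LessThan)
    qed (use A in \<open>auto simp: b_def\<close>)
  qed (simp add: b_def)
  obtain c1 c2 where c: "\<And>N. (\<Sum>k<N. sq (a k)) \<le> c1" "\<And>N. (\<Sum>k<N. sq (b k)) \<le> c2"
    using bd[of a, OF a] bd[of b, OF b] by blast
  define S where "S = (\<Sum>i<n. (cmod (v $ i))\<^sup>2)"
  have "S > 0"
  proof -
    obtain i where "i < n" "v $ i \<noteq> 0" using v(1,2) by (auto simp: vec_eq_iff)
    thus ?thesis unfolding S_def by (intro sum_pos2[of _ i]) auto
  qed
  have ab: "sq (a k) + sq (b k) = (cmod \<mu>) ^ (2 * k) * S" for k
  proof -
    have "sq (a k) + sq (b k) = (\<Sum>i<n. (cmod (\<mu> ^ k * v $ i))\<^sup>2)"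
      unfolding cmod_power2 by (simp add: a_def b_def scalar_prod_def power2_eq_square sum.distrib atLeast0LessThan)
    thus ?thesis
      by (simp add: S_def sum_distrib_left norm_mult norm_power power_mult_distrib power_even_eq)
  qed
  show "cmod \<mu> < 1"
  proof (rule ccontr)
    assume "\<not> cmod \<mu> < 1"
    hence g: "(cmod \<mu>) ^ (2 * k) * S \<ge> S" for k
      using \<open>S > 0\<close> one_le_power[of "cmod \<mu>" "2 * k"] by (simp add: mult_le_cancel_right1)
    obtain N :: nat where N: "real N * S > c1 + c2" using reals_Archimedean3[OF \<open>S > 0\<close>] by blast
    have "real N * S \<le> (\<Sum>k<N. (cmod \<mu>) ^ (2 * k) * S)" using sum_mono[of "{..<N}" "\<lambda>_. S", OF g] by simp
    also have "\<dots> = (\<Sum>k<N. sq (a k)) + (\<Sum>k<N. sq (b k))" unfolding ab[symmetric] by (rule sum.distrib)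
    also have "\<dots> \<le> c1 + c2" using c[of N] by simp
    finally show False using N by simp
  qed
qed

section \<open>The Kalman--Yakubovich--Popov lemma\<close>

lemma zero_append_zero: "(0v n @v 0v m :: real vec) = 0v (n + m)"
  by (intro eq_vecI) auto

text \<open>Unlike \<open>ss_state\<close> it admits an arbitrary initial state, as dynamic
  programming requires.\<close>

primrec run :: "real mat \<Rightarrow> real mat \<Rightarrow> real vec \<Rightarrow> signal \<Rightarrow> signal" where
  "run A B x w 0 = x"
| "run A B x w (Suc k) = A *v run A B x w k + B *v w k"

lemma run_carrier:
  assumes "A \<in> mats n n" "B \<in> mats n d" "x \<in> vecs n" "w \<in> signals d"
  shows "run A B x w k \<in> vecs n"
  using assms by (induction k) (auto simp: signals_def)

lemma ss_state_eq_run: "ss_state S w k = run (ssA S) (ssB S) (0v (dim_row (ssA S))) w k"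
  by (induction k) auto

text \<open>Splits off the first input; on this rests the Bellman recursion for the total
  supply.\<close>

lemma run_shift:
  "run A B x w (Suc k) = run A B (A *v x + B *v w 0) (\<lambda>k. w (Suc k)) k"
  by (induction k) auto

lemma run_cong: "(\<And>j. j < k \<Longrightarrow> w j = w' j) \<Longrightarrow> run A B x w k = run A B x w' k"
  by (induction k) auto

lemma run_superposition:
  assumes A: "A \<in> mats n n" and B: "B \<in> mats n d" and x: "x \<in> vecs n"
    and w: "w \<in> signals d"
  shows "run A B x w k = run A B x (\<lambda>_. 0v d) k + run A B (0v n) w k"
proof (induction k)
  case 0
  show ?case using x by simp
next
  case (Suc k)
  have z: "(\<lambda>_. 0v d) \<in> signals d" by (simp add: signals_def)
  have c: "run A B x (\<lambda>_. 0v d) k \<in> vecs n" "run A B (0v n) w k \<in> vecs n"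
    by (rule run_carrier[OF A B x z], rule run_carrier[OF A B _ w]) simp
  have wk: "w k \<in> vecs d" using w by (simp add: signals_def)
  have B0: "B *v 0v d = 0v n" using lin_zero_arg[OF lin_mult_mat[OF B]] .
  have "A *v run A B x (\<lambda>_. 0v d) k \<in> vecs n" "A *v run A B (0v n) w k \<in> vecs n"
    "B *v w k \<in> vecs n" using A B c wk by auto
  thus ?case using c by (simp add: Suc mult_add_distrib_mat_vec[OF A] B0 assoc_add_vec[of _ n])
qed

lemma vnorm_power2: "(vnorm v)\<^sup>2 = sq v"
  using sq_nonneg[of v] by (simp add: vnorm_def)

text \<open>The term with \<open>\<delta>\<close> builds the strictness into the supply: ordinary
  dissipativity for this rate is strict dissipativity, in state and input, for the supply
  \<open>2 * (w \<bullet> z)\<close>.\<close>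

definition supply_rate :: "real mat \<Rightarrow> real mat \<Rightarrow> real \<Rightarrow> real vec \<Rightarrow> real vec \<Rightarrow> real" where
  "supply_rate C D \<delta> x w = 2 * (w \<bullet> (C *v x + D *v w)) + \<delta> * (sq x + sq w)"

lemma supply_qform:
  assumes C: "C \<in> mats d n" and D: "D \<in> mats d d"
  shows "qform (n + d) (\<lambda>v. supply_rate C D \<delta> (vec_first v n) (vec_last v d))"
  unfolding supply_rate_def
  by (intro qform_add qform_scale qform_sq[OF lin_first_id] qform_sq[OF lin_last_id]
      qform_lin[OF lin_last_id lin_add[OF lin_mat[OF C lin_first_id] lin_mat[OF D lin_last_id]]])

text \<open>Only inputs of finite support are tested, so all sums are finite. By causality this
  still controls every truncated trajectory from the zero state.\<close>

definition margin_SNR :: "nat \<Rightarrow> (signal \<Rightarrow> signal) \<Rightarrow> real \<Rightarrow> bool" where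
  "margin_SNR d G \<epsilon> \<longleftrightarrow> (\<forall>w \<in> signals d. \<forall>N :: nat. (\<forall>k \<ge> N. w k = 0v d) \<longrightarrow>
     (\<Sum>k<N. G w k \<bullet> w k) \<le> - \<epsilon> * (\<Sum>k<N. sq (w k)))"

definition strict_storage ::
  "nat \<Rightarrow> nat \<Rightarrow> real mat \<Rightarrow> real mat \<Rightarrow> real mat \<Rightarrow> real mat \<Rightarrow> real \<Rightarrow> (real vec \<Rightarrow> real) \<Rightarrow> bool" where
  "strict_storage n d A B C D \<delta> V \<longleftrightarrow> qform n V \<and> \<delta> > 0 \<and> (\<forall>x \<in> vecs n. \<delta> * sq x \<le> V x) \<and>
     (\<forall>x \<in> vecs n. \<forall>w \<in> vecs d.
        V (A *v x + B *v w) + supply_rate C D \<delta> x w \<le> V x)"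

text \<open>By linearity the response to an initial state only adds a cross term, which half of the negativity
  margin absorbs.\<close>

lemma total_supply_bound:
  assumes A: "A \<in> mats n n" and B: "B \<in> mats n d"
    and C: "C \<in> mats d n" and D: "D \<in> mats d d" and s: "schur A" and \<epsilon>: "\<epsilon> > 0"
    and snr: "margin_SNR d (\<lambda>w k. C *v run A B (0v n) w k + D *v w k) \<epsilon>"
  obtains \<delta> c where "\<delta> > 0" "\<forall>x \<in> vecs n. \<forall>w \<in> signals d. \<forall>N.
    (\<Sum>k<N. supply_rate C D \<delta> (run A B x w k) (w k)) \<le> c * sq x - \<delta> * (\<Sum>k<N. sq (w k))"
proof -
  obtain g where g: "g > 0" "l2_gain n A g"
      by (rule schur_l2_gain[OF A s])
  obtain b where b: "b > 0" "\<And>w. w \<in> vecs d \<Longrightarrow> sq (B *v w) \<le> b * sq w"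
    using lin_bounded[OF lin_mult_mat[OF B]] by metis
  obtain cc where cc: "cc > 0" "\<And>x. x \<in> vecs n \<Longrightarrow> sq (C *v x) \<le> cc * sq x"
    using lin_bounded[OF lin_mult_mat[OF C]] by metis
  \<comment> \<open>One half of the available \<open>2 * \<epsilon>\<close> pays for the cross term.
    The other half is divided into \<open>\<delta> * (g * b)\<close> for the states,
    \<open>\<delta>\<close> for the inputs in the supply, and a last \<open>\<delta>\<close> that
    remains as margin.\<close>
  define \<delta> where "\<delta> = \<epsilon> / (g * b + 2)"
  have \<delta>: "\<delta> > 0" using \<epsilon> g b by (simp add: \<delta>_def add_pos_pos)
  have \<delta>e: "\<delta> * (g * b) + 2 * \<delta> = \<epsilon>"
  proof -
    have "g * b + 2 \<noteq> 0" using mult_pos_pos[OF g(1) b(1)] by linarith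
    hence "\<delta> * (g * b + 2) = \<epsilon>" by (simp add: \<delta>_def)
    thus ?thesis by (simp add: algebra_simps)
  qed
  show ?thesis
  proof (rule that[OF \<delta>], intro ballI allI)
    fix x :: "real vec" and w and N :: nat
    assume x: "x \<in> vecs n" and w: "w \<in> signals d"
    have wk: "w k \<in> vecs d" for k using w by (simp add: signals_def)
    have Bw: "B *v w k \<in> vecs n" for k using B wk by simp
    define X where "X k = run A B x w k" for k
    define f where "f k = run A B x (\<lambda>_. 0v d) k" for k
    have z: "(\<lambda>_. 0v d) \<in> signals d" by (simp add: signals_def)
    have Xc: "X k \<in> vecs n" for k unfolding X_def by (rule run_carrier[OF A B x w])
    have fc: "f k \<in> vecs n" for k unfolding f_def by (rule run_carrier[OF A B x z])
    have rc: "run A B (0v n) w k \<in> vecs n" for k by (rule run_carrier[OF A B _ w]) simp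
    have SX: "(\<Sum>k<N. sq (X k)) \<le> g * (sq x + b * (\<Sum>k<N. sq (w k)))"
    proof -
      have "(\<Sum>k<N. sq (X k)) \<le> g * (sq (X 0) + (\<Sum>k<N. sq (B *v w k)))"
        by (rule l2_gainD[OF g(2)]) (use Xc Bw in \<open>auto simp: X_def\<close>)
      also have "\<dots> \<le> g * (sq x + b * (\<Sum>k<N. sq (w k)))"
        using g(1) b(2)[OF wk] unfolding sum_distrib_left
        by (intro mult_left_mono add_mono sum_mono) (auto simp: X_def)
      finally show ?thesis .
    qed
    have Sf: "(\<Sum>k<N. sq (f k)) \<le> g * sq x"
    proof -
      have "B *v 0v d = 0v n" using lin_zero_arg[OF lin_mult_mat[OF B]] .
      hence "(\<Sum>k<N. sq (f k)) \<le> g * (sq (f 0) + (\<Sum>k<N. sq (0v n)))"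
        by (intro l2_gainD[OF g(2)]) (use fc in \<open>auto simp: f_def\<close>)
      thus ?thesis by (simp add: f_def)
    qed
    have SG: "(\<Sum>k<N. (C *v run A B (0v n) w k + D *v w k) \<bullet> w k) \<le> - \<epsilon> * (\<Sum>k<N. sq (w k))"
    proof -
      \<comment> \<open>Causality: cutting the input off at \<open>N\<close> does not change the
        first \<open>N\<close> outputs and produces finite support.\<close>
      define v where "v k = (if k < N then w k else 0v d)" for k
      have vN: "v k = w k" if "k < N" for k using that by (simp add: v_def)
      have "run A B (0v n) v k = run A B (0v n) w k" if "k < N" for k
        using that by (intro run_cong) (simp add: vN)
      moreover have "(\<Sum>k<N. (C *v run A B (0v n) v k + D *v v k) \<bullet> v k) \<le> - \<epsilon> * (\<Sum>k<N. sq (v k))"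
        by (rule snr[unfolded margin_SNR_def, rule_format]) (use wk in \<open>auto simp: v_def signals_def\<close>)
      ultimately show ?thesis by (simp add: vN)
    qed
    have key: "supply_rate C D \<delta> (X k) (w k) \<le> 2 * ((C *v run A B (0v n) w k + D *v w k) \<bullet> w k)
        + \<epsilon> * sq (w k) + cc / \<epsilon> * sq (f k) + \<delta> * sq (X k) + \<delta> * sq (w k)" for k
    proof -
      have c: "C *v f k \<in> vecs d" "C *v run A B (0v n) w k \<in> vecs d" "D *v w k \<in> vecs d"
        using C D fc rc wk by auto
      have "C *v X k + D *v w k = C *v f k + (C *v run A B (0v n) w k + D *v w k)"
        unfolding X_def run_superposition[OF A B x w, of k] f_def[symmetric]
        using mult_add_distrib_mat_vec[OF C fc rc, of k k] c by (simp add: assoc_add_vec[of _ d])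
      hence "w k \<bullet> (C *v X k + D *v w k) =
          w k \<bullet> (C *v f k) + (C *v run A B (0v n) w k + D *v w k) \<bullet> w k"
        using c wk[of k] comm_scalar_prod[of "C *v run A B (0v n) w k + D *v w k" d "w k"]
        by (simp add: scalar_prod_add_distrib[of "w k" d "C *v f k" "C *v run A B (0v n) w k + D *v w k"])
      moreover have "2 * (w k \<bullet> (C *v f k)) \<le> \<epsilon> * sq (w k) + sq (C *v f k) / \<epsilon>"
        by (rule young[OF wk c(1) \<epsilon>])
      moreover have "sq (C *v f k) / \<epsilon> \<le> cc / \<epsilon> * sq (f k)"
        using cc(2)[OF fc] \<epsilon> by (simp add: divide_right_mono)
      ultimately show ?thesis unfolding supply_rate_def by (simp add: distrib_left)
    qed
    have "(\<Sum>k<N. supply_rate C D \<delta> (X k) (w k)) \<le> (\<Sum>k<N. 2 * ((C *v run A B (0v n) w k + D *v w k) \<bullet> w k)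
        + \<epsilon> * sq (w k) + cc / \<epsilon> * sq (f k) + \<delta> * sq (X k) + \<delta> * sq (w k))"
      by (rule sum_mono) (rule key)
    also have "\<dots> = 2 * (\<Sum>k<N. (C *v run A B (0v n) w k + D *v w k) \<bullet> w k)
        + \<epsilon> * (\<Sum>k<N. sq (w k)) + cc / \<epsilon> * (\<Sum>k<N. sq (f k)) + \<delta> * (\<Sum>k<N. sq (X k))
        + \<delta> * (\<Sum>k<N. sq (w k))"
      by (simp only: sum.distrib sum_distrib_left)
    also have "\<dots> \<le> 2 * (- \<epsilon> * (\<Sum>k<N. sq (w k))) + \<epsilon> * (\<Sum>k<N. sq (w k)) + cc / \<epsilon> * (g * sq x)
        + \<delta> * (g * (sq x + b * (\<Sum>k<N. sq (w k)))) + \<delta> * (\<Sum>k<N. sq (w k))"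
      using \<delta> cc(1) \<epsilon> by (intro add_mono mult_left_mono SG Sf SX) auto
    also have "\<dots> = (cc / \<epsilon> * g + \<delta> * g) * sq x - (\<epsilon> - \<delta> * (g * b) - \<delta>) * (\<Sum>k<N. sq (w k))"
      by (simp add: algebra_simps)
    also have "\<epsilon> - \<delta> * (g * b) - \<delta> = \<delta>" using \<delta>e by simp
    finally show "(\<Sum>k<N. supply_rate C D \<delta> (run A B x w k) (w k)) \<le> (cc / \<epsilon> * g + \<delta> * g) * sq x - \<delta> * (\<Sum>k<N. sq (w k))"
      by (simp add: X_def)
  qed
qed

text \<open>Kalman--Yakubovich--Popov: the storage function is the limit of the finite horizon values of the
  optimal control problem of maximising the total supply.\<close>

lemma kyp:
  assumes A: "A \<in> mats n n" and B: "B \<in> mats n d"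
    and C: "C \<in> mats d n" and D: "D \<in> mats d d" and s: "schur A" and \<epsilon>: "\<epsilon> > 0"
    and snr: "margin_SNR d (\<lambda>w k. C *v run A B (0v n) w k + D *v w k) \<epsilon>"
  obtains V \<delta> where "strict_storage n d A B C D \<delta> V"
proof -
  obtain \<delta> c where \<delta>: "\<delta> > 0" and bd': "\<forall>x \<in> vecs n. \<forall>w \<in> signals d. \<forall>N.
    (\<Sum>k<N. supply_rate C D \<delta> (run A B x w k) (w k)) \<le> c * sq x - \<delta> * (\<Sum>k<N. sq (w k))"
    by (rule total_supply_bound[OF A B C D s \<epsilon> snr])
  have bd: "(\<Sum>k<N. supply_rate C D \<delta> (run A B x w k) (w k)) \<le> c * sq x - \<delta> * (\<Sum>k<N. sq (w k))"
    if "x \<in> vecs n" "w \<in> signals d" for x w N using bd' that by blast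
  define \<sigma> where "\<sigma> x w = supply_rate C D \<delta> x w" for x w
  define F where "F x w = A *v x + B *v w" for x w
  define J where "J N x w = (\<Sum>k<N. \<sigma> (run A B x w k) (w k))" for N x w
  have Fc: "F x w \<in> vecs n" if "x \<in> vecs n" "w \<in> vecs d" for x w
    using A B that by (simp add: F_def)
  have J_Suc: "J (Suc N) x w = \<sigma> x (w 0) + J N (F x (w 0)) (\<lambda>k. w (Suc k))" for N x w
    unfolding J_def sum.lessThan_Suc_shift run_shift F_def by simp
  \<comment> \<open>The values of \<open>P\<close> have to be attained by signals, because then the
    bound on actual totals carries over to \<open>P\<close>. This is used both for concavity in the
    next input and for the bound on the limit.\<close>
  define good where "good N P \<longleftrightarrow> qform n P \<and> (\<forall>x \<in> vecs n. \<exists>w \<in> signals d. P x = J N x w)" for N P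
  define next_val where "next_val P P' \<longleftrightarrow>
    (\<forall>x \<in> vecs n. \<forall>w \<in> vecs d. \<sigma> x w + P (F x w) \<le> P' x) \<and>
    (\<forall>x \<in> vecs n. \<exists>w \<in> vecs d. P' x = \<sigma> x w + P (F x w))" for P P'
  have step: "\<exists>P'. good (Suc N) P' \<and> next_val P P'" if P: "good N P" for N P
  proof -
    define \<phi> where "\<phi> v = - (\<sigma> (vec_first v n) (vec_last v d) + P (F (vec_first v n) (vec_last v d)))" for v
    have \<phi>: "qform (n + d) \<phi>" unfolding \<phi>_def \<sigma>_def F_def
      by (intro qform_uminus qform_add supply_qform[OF C D]
          qform_comp[OF lin_add[OF lin_mat[OF A lin_first_id] lin_mat[OF B lin_last_id]]])
        (use P in \<open>simp add: good_def\<close>)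
    have \<phi>e: "\<phi> (x @v w) = - (\<sigma> x w + P (F x w))" if "x \<in> vecs n" "w \<in> vecs d" for x w
      using that by (simp add: \<phi>_def)
    \<comment> \<open>From the zero state, a nonzero first input costs at least
      \<open>\<delta> * sq w\<close> in total. This makes the Bellman maximisation strictly concave,
      so a linear maximiser exists.\<close>
    have \<phi>0: "\<phi> (0v n @v w) > 0" if w: "w \<in> vecs d" "w \<noteq> 0v d" for w
    proof -
      obtain u where u: "u \<in> signals d" "P (F (0v n) w) = J N (F (0v n) w) u"
        using P Fc[of "0v n" w] w(1) unfolding good_def by auto
      have "\<sigma> (0v n) w + P (F (0v n) w) = J (Suc N) (0v n) (case_nat w u)"
        unfolding J_Suc u(2) by simp
      also have "\<dots> \<le> c * sq (0v n) - \<delta> * (\<Sum>k<Suc N. sq (case_nat w u k))"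
        unfolding J_def \<sigma>_def by (rule bd) (use w u in \<open>auto simp: signals_def split: nat.split\<close>)
      also have "\<dots> \<le> - \<delta> * sq w"
        using \<delta> sum_nonneg[of "{..<N}" "\<lambda>k. sq (u k)"] sq_nonneg
        unfolding sum.lessThan_Suc_shift by (simp add: algebra_simps)
      also have "\<dots> < 0" using \<delta> sq_pos[OF w] by simp
      finally show ?thesis using w(1) by (simp add: \<phi>e)
    qed
    obtain R where R: "lin n d R" "\<And>x w. x \<in> vecs n \<Longrightarrow> w \<in> vecs d \<Longrightarrow>
      \<phi> (x @v w) = \<phi> (x @v R x) + \<phi> (0v n @v (w - R x))" using partial_min[OF \<phi> \<phi>0] by metis
    define P' where "P' x = - \<phi> (x @v R x)" for x
    have P'e: "P' x = \<sigma> x (R x) + P (F x (R x))" if "x \<in> vecs n" for x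
      using that linD(1)[OF R(1) that] by (simp add: P'_def \<phi>e)
    have "qform n P'" unfolding P'_def by (intro qform_uminus qform_comp[OF lin_append[OF lin_id R(1)] \<phi>])
    moreover have "\<exists>w \<in> signals d. P' x = J (Suc N) x w" if x: "x \<in> vecs n" for x
    proof -
      have Rx: "R x \<in> vecs d" by (rule linD(1)[OF R(1) x])
      obtain u where u: "u \<in> signals d" "P (F x (R x)) = J N (F x (R x)) u"
        using P Fc[OF x Rx] unfolding good_def by auto
      have "P' x = J (Suc N) x (case_nat (R x) u)" unfolding J_Suc P'e[OF x] u(2) by simp
      moreover have "case_nat (R x) u \<in> signals d" using Rx u by (auto simp: signals_def split: nat.split)
      ultimately show ?thesis by blast
    qed
    moreover have "\<sigma> x w + P (F x w) \<le> P' x" if x: "x \<in> vecs n" and w: "w \<in> vecs d" for x w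
    proof -
      have Rx: "R x \<in> vecs d" by (rule linD(1)[OF R(1) x])
      have "\<phi> (0v n @v (w - R x)) \<ge> 0"
        using \<phi>0[of "w - R x"] qform_zero_arg[OF \<phi>] w Rx
        by (cases "w - R x = 0v d") (auto simp: zero_append_zero)
      thus ?thesis using R(2)[OF x w] x w Rx by (simp add: P'_def \<phi>e)
    qed
    moreover have "\<exists>w \<in> vecs d. P' x = \<sigma> x w + P (F x w)" if x: "x \<in> vecs n" for x
      using P'e[OF x] linD(1)[OF R(1) x] by blast
    ultimately show ?thesis unfolding good_def next_val_def by blast
  qed
  have "good 0 (\<lambda>x. 0)" unfolding good_def J_def
    by (auto simp: qform_zero signals_def intro!: exI[of _ "\<lambda>_. 0v d"])
  then obtain P where P: "P 0 = (\<lambda>x. 0)" "\<And>N. good N (P N)" "\<And>N. next_val (P N) (P (Suc N))"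
    using dependent_nat_choice[of "\<lambda>N P. good N P \<and> (N = 0 \<longrightarrow> P = (\<lambda>x. 0))" "\<lambda>N P P'. next_val P P'"] step
    by (metis old.nat.distinct(2))
  have Pq: "qform n (P N)" for N using P(2) by (simp add: good_def)
  have nv: "\<sigma> x w + P N (F x w) \<le> P (Suc N) x" if "x \<in> vecs n" "w \<in> vecs d" for x w N
    using P(3)[of N] that by (simp add: next_val_def)
  have \<sigma>0: "\<sigma> x (0v d) = \<delta> * sq x" if "x \<in> vecs n" for x
    using that C D by (simp add: \<sigma>_def supply_rate_def)
  have P1: "\<delta> * sq x \<le> P (Suc 0) x" if x: "x \<in> vecs n" for x
    using nv[OF x, of "0v d" 0] by (simp add: \<sigma>0[OF x] P(1))
  \<comment> \<open>The one-step value is nonnegative, and the Bellman step preserves order; hence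
    the values increase with the horizon.\<close>
  have mono: "P N x \<le> P (Suc N) x" if "x \<in> vecs n" for N x
    using that
  proof (induction N arbitrary: x)
    case 0
    have "0 \<le> \<delta> * sq x" using \<delta> sq_nonneg[of x] by simp
    thus ?case using P1[OF 0] P(1) by simp
  next
    case (Suc N)
    obtain w where w: "w \<in> vecs d" "P (Suc N) x = \<sigma> x w + P N (F x w)"
      using P(3)[of N] Suc.prems by (auto simp: next_val_def)
    show ?case using nv[OF Suc.prems w(1), of "Suc N"] Suc.IH[OF Fc[OF Suc.prems w(1)]] w(2) by simp
  qed
  have ub: "P N x \<le> c * sq x" if x: "x \<in> vecs n" for N x
  proof -
    obtain w where w: "w \<in> signals d" "P N x = J N x w" using P(2)[of N] x by (auto simp: good_def)
    have "J N x w \<le> c * sq x - \<delta> * (\<Sum>k<N. sq (w k))" unfolding J_def \<sigma>_def by (rule bd[OF x w(1)])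
    moreover have "0 \<le> \<delta> * (\<Sum>k<N. sq (w k))" using \<delta> sq_nonneg by (intro mult_nonneg_nonneg sum_nonneg) auto
    ultimately show ?thesis using w(2) by linarith
  qed
  obtain V where V: "qform n V" "\<And>x. x \<in> vecs n \<Longrightarrow> (\<lambda>N. P N x) \<longlonglongrightarrow> V x"
    "\<And>N x. x \<in> vecs n \<Longrightarrow> P N x \<le> V x"
    using qform_limit_incseq[of n P "\<lambda>x. c * sq x", OF Pq mono ub] by metis
  show ?thesis
  proof (rule that[of \<delta> V], unfold strict_storage_def, intro conjI ballI)
    show "qform n V" "\<delta> > 0" by (rule V(1), rule \<delta>)
    show "\<delta> * sq x \<le> V x" if "x \<in> vecs n" for x
      using P1[OF that] V(3)[OF that, of "Suc 0"] by simp
    fix x w :: "real vec" assume x: "x \<in> vecs n" and w: "w \<in> vecs d"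
    have "(\<lambda>N. \<sigma> x w + P N (F x w)) \<longlonglongrightarrow> \<sigma> x w + V (F x w)"
      by (intro tendsto_add tendsto_const V(2) Fc x w)
    moreover have "\<sigma> x w + P N (F x w) \<le> V x" for N
      using nv[OF x w, of N] V(3)[OF x, of "Suc N"] by simp
    ultimately have "\<sigma> x w + V (F x w) \<le> V x" using LIMSEQ_le_const2 by blast
    thus "V (A *v x + B *v w) + supply_rate C D \<delta> x w \<le> V x" by (simp add: F_def \<sigma>_def add.commute)
  qed
qed

text \<open>Telescoping the decrease bounds the energy of every orbit by
  \<open>V (x 0) / \<delta>\<close>.\<close>

lemma storage_schur:
  assumes A: "A \<in> mats n n" and nn: "\<And>x. x \<in> vecs n \<Longrightarrow> V x \<ge> 0" and \<delta>: "\<delta> > 0"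
    and dec: "\<And>x. x \<in> vecs n \<Longrightarrow> V (A *v x) + \<delta> * sq x \<le> V x"
  shows "schur A"
proof (rule schur_by_orbits[OF A])
  fix x :: signal assume x: "\<And>k. x k \<in> vecs n" "\<And>k. x (Suc k) = A *v x k"
  have "(\<Sum>k<N. sq (x k)) \<le> V (x 0) / \<delta>" for N
  proof -
    have "V (x N) + (\<Sum>k<N. \<delta> * sq (x k)) \<le> V (x 0) + (\<Sum>k<N. 0)"
      by (rule telescope_le[of "\<lambda>k. V (x k)"]) (use dec x in simp)
    hence "\<delta> * (\<Sum>k<N. sq (x k)) \<le> V (x 0)" using nn[OF x(1), of N] by (simp add: sum_distrib_left)
    thus ?thesis using \<delta> by (simp add: field_simps)
  qed
  thus "\<exists>c. \<forall>N. (\<Sum>k<N. sq (x k)) \<le> c" by blast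
qed

text \<open>Telescoping from the zero state gives the inequality for partial sums. The finite gain
  of a stable system makes both series converge, so it passes to the limit.\<close>

lemma storage_SNR:
  assumes A: "A \<in> mats n n" and B: "B \<in> mats n d"
    and C: "C \<in> mats d n" and D: "D \<in> mats d d" and s: "schur A"
    and nn: "\<And>x. x \<in> vecs n \<Longrightarrow> V x \<ge> 0" and V0: "V (0v n) = 0" and \<delta>: "\<delta> > 0"
    and dec: "\<And>x w. x \<in> vecs n \<Longrightarrow> w \<in> vecs d \<Longrightarrow>
      V (A *v x + B *v w) + 2 * (w \<bullet> (C *v x + D *v w)) + \<delta> * sq w \<le> V x"
    and G: "\<And>w. w \<in> signals d \<Longrightarrow> G w = ss_op (mk_ss A B C D) w"
  shows "SNR d G"
  unfolding SNR_def
proof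
  show "stable_op d d G" unfolding stable_op_def
    by (rule exI[of _ n], rule exI[of _ "mk_ss A B C D"])
      (use A B C D s G in \<open>auto simp: ss_dims_def mk_ss_def\<close>)
  show "\<exists>\<epsilon>>0. \<forall>w \<in> l2_signals d. inner_l2 (G w) w \<le> - \<epsilon> * inner_l2 w w"
  proof (intro exI conjI ballI)
    \<comment> \<open>Half of \<open>\<delta>\<close>, because the supply carries a factor
      2.\<close>
    show "\<delta> / 2 > 0" using \<delta> by simp
    fix w assume w2: "w \<in> l2_signals d"
    hence w: "w \<in> signals d" and sw: "summable (\<lambda>k. sq (w k))"
      by (auto simp: l2_signals_def vnorm_power2)
    have wk: "w k \<in> vecs d" for k using w by (simp add: signals_def)
    define X where "X k = run A B (0v n) w k" for k
    define z where "z k = C *v X k + D *v w k" for k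
    have Xc: "X k \<in> vecs n" for k unfolding X_def by (rule run_carrier[OF A B _ w]) simp
    have zc: "z k \<in> vecs d" for k using C D Xc wk by (simp add: z_def)
    have Gz: "G w k = z k" for k
      unfolding G[OF w] ss_op_def using A by (simp add: ss_state_eq_run mk_ss_def z_def X_def)
    obtain g where g: "g > 0" "l2_gain n A g"
      by (rule schur_l2_gain[OF A s])
    obtain b where b: "b > 0" "\<And>w. w \<in> vecs d \<Longrightarrow> sq (B *v w) \<le> b * sq w"
      using lin_bounded[OF lin_mult_mat[OF B]] by metis
    obtain cc where cc: "cc > 0" "\<And>x. x \<in> vecs n \<Longrightarrow> sq (C *v x) \<le> cc * sq x"
      using lin_bounded[OF lin_mult_mat[OF C]] by metis
    obtain cd where cd: "cd > 0" "\<And>x. x \<in> vecs d \<Longrightarrow> sq (D *v x) \<le> cd * sq x"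
      using lin_bounded[OF lin_mult_mat[OF D]] by metis
    have "summable (\<lambda>k. sq (X k))"
    proof (rule summableI_nonneg_bounded)
      fix N
      have "(\<Sum>k<N. sq (X k)) \<le> g * (sq (X 0) + (\<Sum>k<N. sq (B *v w k)))"
        by (rule l2_gainD[OF g(2)]) (use Xc B wk in \<open>auto simp: X_def\<close>)
      also have "\<dots> = g * (\<Sum>k<N. sq (B *v w k))" by (simp add: X_def)
      also have "\<dots> \<le> g * (\<Sum>k<N. b * sq (w k))" using g(1) b(2)[OF wk] by (intro mult_left_mono sum_mono) auto
      also have "\<dots> \<le> g * (b * (\<Sum>k. sq (w k)))"
        unfolding sum_distrib_left[symmetric]
        using g(1) b(1) sq_nonneg by (intro mult_left_mono sum_le_suminf sw) auto
      finally show "(\<Sum>k<N. sq (X k)) \<le> g * (b * (\<Sum>k. sq (w k)))" .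
    qed (rule sq_nonneg)
    hence sb: "summable (\<lambda>k. cc * sq (X k) + (cd + 1) * sq (w k))"
      by (intro summable_add summable_mult sw)
    have "norm (z k \<bullet> w k) \<le> cc * sq (X k) + (cd + 1) * sq (w k)" for k
    proof -
      have "2 * (z k \<bullet> w k) \<le> sq (z k) + sq (w k)" using young[OF zc wk, of 1 k k] by simp
      moreover have "2 * (z k \<bullet> (- w k)) \<le> sq (z k) + sq (w k)"
        using young[of "z k" d "- w k" 1] zc[of k] wk[of k] by simp
      moreover have "sq (z k) \<le> 2 * sq (C *v X k) + 2 * sq (D *v w k)"
        unfolding z_def by (rule sq_add_le[of _ d]) (use C D Xc wk in auto)
      moreover have "z k \<bullet> (- w k) = - (z k \<bullet> w k)" using zc[of k] wk[of k] by simp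
      ultimately show ?thesis using cc(2)[OF Xc[of k]] cd(2)[OF wk[of k]] sq_nonneg[of "w k"]
        by (auto simp: distrib_right abs_le_iff)
    qed
    hence szw: "summable (\<lambda>k. z k \<bullet> w k)" by (rule summable_comparison_test'[OF sb, of 0])
    have part: "(\<Sum>k<N. z k \<bullet> w k) \<le> - (\<delta> / 2) * (\<Sum>k<N. sq (w k))" for N
    proof -
      have "V (X N) + (\<Sum>k<N. 2 * (z k \<bullet> w k) + \<delta> * sq (w k)) \<le> V (X 0) + (\<Sum>k<N. 0)"
      proof (rule telescope_le[of "\<lambda>k. V (X k)"])
        fix k
        have "w k \<bullet> z k = z k \<bullet> w k" by (rule comm_scalar_prod[OF wk zc])
        thus "V (X (Suc k)) + (2 * (z k \<bullet> w k) + \<delta> * sq (w k)) \<le> V (X k) + 0"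
          using dec[OF Xc[of k] wk[of k]] by (simp add: X_def z_def)
      qed
      moreover have "V (X 0) = 0" by (simp add: X_def V0)
      ultimately have "(\<Sum>k<N. 2 * (z k \<bullet> w k) + \<delta> * sq (w k)) \<le> 0" using nn[OF Xc, of N] by simp
      thus ?thesis by (simp add: sum.distrib sum_distrib_left[symmetric])
    qed
    have "(\<Sum>k. z k \<bullet> w k) \<le> - (\<delta> / 2) * (\<Sum>k. sq (w k))"
      by (rule LIMSEQ_le[OF summable_LIMSEQ[OF szw] tendsto_mult_left[OF summable_LIMSEQ[OF sw]]])
        (use part in blast)
    thus "inner_l2 (G w) w \<le> - (\<delta> / 2) * inner_l2 w w" by (simp add: inner_l2_def Gz)
  qed
qed

lemma SNR_finite_support:
  assumes "SNR d G"
  obtains \<epsilon> where "\<epsilon> > 0" "margin_SNR d G \<epsilon>"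
proof -
  obtain \<epsilon> where \<epsilon>: "\<epsilon> > 0" "\<And>w. w \<in> l2_signals d \<Longrightarrow> inner_l2 (G w) w \<le> - \<epsilon> * inner_l2 w w"
    and st: "stable_op d d G" using assms unfolding SNR_def by auto
  obtain n S where S: "ss_dims n d d S" "\<And>w. w \<in> signals d \<Longrightarrow> G w = ss_op S w"
    using st unfolding stable_op_def by blast
  show ?thesis
  proof (rule that[OF \<epsilon>(1)], unfold margin_SNR_def, intro ballI allI impI)
    fix w and N :: nat assume w: "w \<in> signals d" and "\<forall>k \<ge> N. w k = 0v d"
    hence fin: "\<And>k. k \<ge> N \<Longrightarrow> w k = 0v d" by blast
    have "(\<lambda>k. sq (w k)) sums (\<Sum>k<N. sq (w k))" by (rule sums_finite) (auto simp: fin)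
    moreover have "(\<lambda>k. G w k \<bullet> w k) sums (\<Sum>k<N. G w k \<bullet> w k)"
    proof (rule sums_finite)
      fix k assume "k \<notin> {..<N}"
      moreover have "G w k \<in> vecs d"
      proof -
        have "ss_state S w k \<in> vecs n"
          unfolding ss_state_eq_run by (rule run_carrier[of _ n _ d]) (use S(1) w in \<open>auto simp: ss_dims_def\<close>)
        thus ?thesis using S w by (auto simp: ss_op_def ss_dims_def signals_def)
      qed
      ultimately show "G w k \<bullet> w k = 0" by (simp add: fin)
    qed simp
    moreover have "w \<in> l2_signals d"
      using w sums_summable[OF calculation(1)] by (simp add: l2_signals_def vnorm_power2)
    ultimately show "(\<Sum>k<N. G w k \<bullet> w k) \<le> - \<epsilon> * (\<Sum>k<N. sq (w k))"
      using \<epsilon>(2)[of w] unfolding inner_l2_def by (simp add: sums_iff)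
  qed
qed

section \<open>Synthesis with a Youla parameter\<close>

definition l2 :: "signal \<Rightarrow> bool" where
  "l2 x \<longleftrightarrow> (\<exists>c. \<forall>N :: nat. (\<Sum>k<N. sq (x k)) \<le> c)"

lemma schur_l2:
  assumes A: "A \<in> mats n n" and s: "schur A" and x: "\<And>k. x k \<in> vecs n"
    and d: "\<And>k. d k \<in> vecs n" and step: "\<And>k. x (Suc k) = A *v x k + d k" and l: "l2 d"
  shows "l2 x"
proof -
  obtain g where g: "g > 0" "l2_gain n A g" by (rule schur_l2_gain[OF A s])
  obtain c where c: "\<And>N. (\<Sum>k<N. sq (d k)) \<le> c" using l by (auto simp: l2_def)
  have "(\<Sum>k<N. sq (x k)) \<le> g * (sq (x 0) + c)" for N
  proof -
    have "(\<Sum>k<N. sq (x k)) \<le> g * (sq (x 0) + (\<Sum>k<N. sq (d k)))"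
      by (rule l2_gainD[where x = x and d = d, OF g(2) x d step])
    also have "\<dots> \<le> g * (sq (x 0) + c)" using g(1) c by (intro mult_left_mono add_left_mono) auto
    finally show ?thesis .
  qed
  thus ?thesis unfolding l2_def by blast
qed

lemma l2_lin:
  assumes f: "lin n m f" and x: "\<And>k. x k \<in> vecs n" and l: "l2 x" shows "l2 (\<lambda>k. f (x k))"
proof -
  obtain b where b: "b > 0" "\<And>x. x \<in> vecs n \<Longrightarrow> sq (f x) \<le> b * sq x"
    by (rule lin_bounded[OF f], rule that)
  obtain c where c: "\<And>N. (\<Sum>k<N. sq (x k)) \<le> c" using l by (auto simp: l2_def)
  have "(\<Sum>k<N. sq (f (x k))) \<le> b * c" for N
  proof -
    have "(\<Sum>k<N. sq (f (x k))) \<le> b * (\<Sum>k<N. sq (x k))"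
      unfolding sum_distrib_left by (intro sum_mono b(2) x)
    also have "\<dots> \<le> b * c" using b(1) c by simp
    finally show ?thesis .
  qed
  thus ?thesis unfolding l2_def by blast
qed

lemma l2_mat: "A \<in> mats m n \<Longrightarrow> (\<And>k. x k \<in> vecs n) \<Longrightarrow> l2 x \<Longrightarrow> l2 (\<lambda>k. A *v x k)"
  using l2_lin[OF lin_mult_mat] .

lemma l2_zero: "l2 (\<lambda>_. 0v n)"
  by (auto simp: l2_def)

lemma l2_append:
  assumes x: "\<And>k. x k \<in> vecs n" "l2 x" and y: "\<And>k. y k \<in> vecs m" "l2 y"
  shows "l2 (\<lambda>k. x k @v y k)"
proof -
  obtain c1 where "\<And>N. (\<Sum>k<N. sq (x k)) \<le> c1" using x by (auto simp: l2_def)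
  moreover obtain c2 where "\<And>N. (\<Sum>k<N. sq (y k)) \<le> c2" using y by (auto simp: l2_def)
  ultimately have "(\<Sum>k<N. sq (x k @v y k)) \<le> c1 + c2" for N
    by (simp add: sq_append[OF x(1) y(1)] sum.distrib add_mono)
  thus ?thesis unfolding l2_def by blast
qed

lemma l2_add:
  assumes x: "\<And>k. x k \<in> vecs n" "l2 x" and y: "\<And>k. y k \<in> vecs n" "l2 y"
  shows "l2 (\<lambda>k. x k + y k)"
proof -
  have "l2 (\<lambda>k. vec_first (x k @v y k) n + vec_last (x k @v y k) n)"
    by (rule l2_lin[where x = "\<lambda>k. x k @v y k", OF lin_add[OF lin_first_id lin_last_id] _ l2_append[OF x y]])
      (use x y in auto)
  moreover have "vec_first (x k @v y k) n = x k" "vec_last (x k @v y k) n = y k" for k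
    using x(1)[of k] y(1)[of k] by auto
  ultimately show ?thesis by simp
qed

lemma l2_of_append:
  assumes x: "\<And>k. x k \<in> vecs n" and y: "\<And>k. y k \<in> vecs m" and l: "l2 (\<lambda>k. x k @v y k)"
  shows "l2 x" "l2 y"
proof -
  have e: "vec_first (x k @v y k) n = x k" "vec_last (x k @v y k) m = y k" for k
    using x[of k] y[of k] by auto
  have c: "x k @v y k \<in> vecs (n + m)" for k using x[of k] y[of k] by simp
  show "l2 x" using l2_lin[OF lin_first_id c l] by (simp add: e)
  show "l2 y" using l2_lin[OF lin_last_id c l] by (simp add: e)
qed

lemma schur_iff_l2:
  assumes A: "A \<in> mats n n"
    and orb: "\<And>x. (\<And>k. x k \<in> vecs n) \<Longrightarrow> (\<And>k. x (Suc k) = A *v x k) \<Longrightarrow> l2 x"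
  shows "schur A"
  by (rule schur_by_orbits[OF A]) (use orb in \<open>auto simp: l2_def\<close>)

lemma schur_block_diag:
  assumes A: "A \<in> mats n n" "schur A" and B: "B \<in> mats m m" "schur B"
  shows "schur (four_block_mat A (0\<^sub>m n m) (0\<^sub>m m n) B)"
proof (rule schur_iff_l2[of _ "n + m"])
  fix x :: signal assume x: "\<And>k. x k \<in> vecs (n + m)"
    "\<And>k. x (Suc k) = four_block_mat A (0\<^sub>m n m) (0\<^sub>m m n) B *v x k"
  define a where "a k = vec_first (x k) n" for k
  define b where "b k = vec_last (x k) m" for k
  have xe: "x k = a k @v b k" for k using x(1)[of k] by (simp add: a_def b_def)
  have c: "a k \<in> vecs n" "b k \<in> vecs m" for k by (auto simp: a_def b_def)
  have "x (Suc k) = (A *v a k) @v (B *v b k)" for k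
    unfolding x(2) xe[of k] using A B c
    by (subst four_block_mat_mult_vec[of _ n n _ m _ m]) auto
  hence step: "a (Suc k) = A *v a k" "b (Suc k) = B *v b k" for k
    using A(1) B(1) c by (auto simp: a_def b_def)
  have "l2 a" by (rule schur_l2[OF A c(1) zero_carrier_vec _ l2_zero]) (use A c step in auto)
  moreover have "l2 b" by (rule schur_l2[OF B c(2) zero_carrier_vec _ l2_zero]) (use B c step in auto)
  ultimately have "l2 (\<lambda>k. a k @v b k)" by (intro l2_append[of _ n _ m] c)
  thus "l2 x" by (simp add: xe[abs_def])
qed (use A B in auto)

lemma mult_mat_zero: "A \<in> mats m n \<Longrightarrow> A *v 0v n = (0v m :: real vec)"
  by (rule lin_zero_arg[OF lin_mult_mat])

lemma append_eq_0: "dim_vec a = n \<Longrightarrow> dim_vec b = m \<Longrightarrow>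
   (a @v b = (0v (n + m) :: real vec)) \<longleftrightarrow> a = 0v n \<and> b = 0v m"
  unfolding zero_append_zero[symmetric]
  by (rule append_vec_eq[of _ n]) (auto intro: carrier_vecI)

text \<open>The assumption \<open>uncontrolled\<close> is the zero block of the realization: the
  control cannot be seen in the measurement. So \<open>Z\<close> works in open loop, and the closed
  loop is affine in it.\<close>

locale youla_plant =
  fixes n d nu p :: nat and A B1 B C1 D1 E C F :: "real mat"
  assumes A: "A \<in> mats n n" and B1: "B1 \<in> mats n d" and B: "B \<in> mats n nu"
    and C1: "C1 \<in> mats d n" and D1: "D1 \<in> mats d d" and E: "E \<in> mats d nu"
    and C: "C \<in> mats p n" and F: "F \<in> mats p d"
    and schurA: "schur A"
    and uncontrolled: "\<And>u k. u \<in> signals nu \<Longrightarrow> C *v run A B (0v n) u k = 0v p"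
begin

text \<open>The matrix-free middle term of the equivalence, with \<open>X\<close> for the kernel
  inequality, \<open>N\<close> for the reply condition and \<open>N < X\<close> as coupling. It is
  related separately to the existence of \<open>Z\<close> and to the matrix inequalities.\<close>

definition synthesis :: bool where
  "synthesis \<longleftrightarrow> (\<exists>X N. qform n X \<and> qform n N \<and>
     (\<forall>x \<in> vecs n. x \<noteq> 0v n \<longrightarrow> 0 < N x \<and> N x < X x) \<and>
     (\<forall>x \<in> vecs n. \<forall>w \<in> vecs d. x @v w \<noteq> 0v (n + d) \<longrightarrow> C *v x + F *v w = 0v p \<longrightarrow>
        X (A *v x + B1 *v w) - X x + 2 * (w \<bullet> (C1 *v x + D1 *v w)) < 0) \<and>
     (\<forall>x \<in> vecs n. \<forall>w \<in> vecs d. x @v w \<noteq> 0v (n + d) \<longrightarrow> (\<exists>u \<in> vecs nu.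
        N (A *v x + B1 *v w + B *v u) - N x + 2 * (w \<bullet> (C1 *v x + D1 *v w + E *v u)) < 0)))"

definition loop_u :: "state_space \<Rightarrow> real vec \<Rightarrow> real vec \<Rightarrow> real vec \<Rightarrow> real vec" where
  "loop_u Z x \<zeta> w = ssC Z *v \<zeta> + ssD Z *v (C *v x + F *v w)"

definition loop_next :: "state_space \<Rightarrow> real vec \<Rightarrow> real vec \<Rightarrow> real vec \<Rightarrow> real vec" where
  "loop_next Z x \<zeta> w = (A *v x + B1 *v w + B *v loop_u Z x \<zeta> w) @v
     (ssA Z *v \<zeta> + ssB Z *v (C *v x + F *v w))"

definition loop_out :: "state_space \<Rightarrow> real vec \<Rightarrow> real vec \<Rightarrow> real vec \<Rightarrow> real vec" where
  "loop_out Z x \<zeta> w = C1 *v x + D1 *v w + E *v loop_u Z x \<zeta> w"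

definition loop_ss :: "nat \<Rightarrow> state_space \<Rightarrow> state_space" where
  "loop_ss nZ Z = mk_ss
     (matf (n + nZ) (n + nZ) (\<lambda>v. loop_next Z (vec_first v n) (vec_last v nZ) (0v d)))
     (matf d (n + nZ) (\<lambda>w. loop_next Z (0v n) (0v nZ) w))
     (matf (n + nZ) d (\<lambda>v. loop_out Z (vec_first v n) (vec_last v nZ) (0v d)))
     (matf d d (\<lambda>w. loop_out Z (0v n) (0v nZ) w))"

lemma lin_loop_u:
  assumes Z: "ss_dims nZ p nu Z" and f: "lin m n f" "lin m nZ g" "lin m d h"
  shows "lin m nu (\<lambda>v. loop_u Z (f v) (g v) (h v))"
proof -
  have Zd: "ssC Z \<in> mats nu nZ" "ssD Z \<in> mats nu p" using Z by (auto simp: ss_dims_def)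
  show ?thesis unfolding loop_u_def
    by (intro lin_add lin_mat[OF Zd(1)] lin_mat[OF Zd(2)] lin_mat[OF C] lin_mat[OF F] f)
qed

lemma lin_loop_next:
  assumes Z: "ss_dims nZ p nu Z" and f: "lin m n f" "lin m nZ g" "lin m d h"
  shows "lin m (n + nZ) (\<lambda>v. loop_next Z (f v) (g v) (h v))"
proof -
  have Zd: "ssA Z \<in> mats nZ nZ" "ssB Z \<in> mats nZ p" using Z by (auto simp: ss_dims_def)
  show ?thesis unfolding loop_next_def
    by (intro lin_append lin_add lin_mat[OF A] lin_mat[OF B] lin_mat[OF B1] lin_loop_u[OF Z]
        lin_mat[OF Zd(1)] lin_mat[OF Zd(2)] lin_mat[OF C] lin_mat[OF F] f)
qed

lemma lin_loop_out:
  assumes Z: "ss_dims nZ p nu Z" and f: "lin m n f" "lin m nZ g" "lin m d h"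
  shows "lin m d (\<lambda>v. loop_out Z (f v) (g v) (h v))"
  unfolding loop_out_def
  by (intro lin_add lin_mat[OF C1] lin_mat[OF D1] lin_mat[OF E] lin_loop_u[OF Z] f)

lemma loop_ss_dims: "ss_dims (n + nZ) d d (loop_ss nZ Z)"
  by (simp add: loop_ss_def ss_dims_def mk_ss_def)

lemma loop_ss_mult:
  assumes Z: "ss_dims nZ p nu Z" and x: "x \<in> vecs n" and \<zeta>: "\<zeta> \<in> vecs nZ"
    and w: "w \<in> vecs d"
  shows "ssA (loop_ss nZ Z) *v (x @v \<zeta>) + ssB (loop_ss nZ Z) *v w = loop_next Z x \<zeta> w"
    and "ssC (loop_ss nZ Z) *v (x @v \<zeta>) + ssD (loop_ss nZ Z) *v w = loop_out Z x \<zeta> w"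
    and "ssA (loop_ss nZ Z) *v (x @v \<zeta>) = loop_next Z x \<zeta> (0v d)"
proof -
  define L where "L v = loop_next Z (vec_first v n) (vec_first (vec_last v (nZ + d)) nZ) (vec_last (vec_last v (nZ + d)) d)" for v
  define Lo where "Lo v = loop_out Z (vec_first v n) (vec_first (vec_last v (nZ + d)) nZ) (vec_last (vec_last v (nZ + d)) d)" for v
  have l: "lin (n + (nZ + d)) (n + nZ) L" unfolding L_def
    by (intro lin_loop_next[OF Z] lin_first_id lin_first[OF lin_last_id] lin_last[OF lin_last_id])
  have lo: "lin (n + (nZ + d)) d Lo" unfolding Lo_def
    by (intro lin_loop_out[OF Z] lin_first_id lin_first[OF lin_last_id] lin_last[OF lin_last_id])
  have e: "x @v \<zeta> @v w = (x @v \<zeta> @v 0v d) + (0v n @v 0v nZ @v w)"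
    using x \<zeta> w by (simp add: append_vec_add[of _ n _ _ "nZ + d"] append_vec_add[of _ nZ _ _ d])
  have cc: "(x @v \<zeta> @v 0v d) \<in> vecs (n + (nZ + d))" "(0v n @v 0v nZ @v w) \<in> vecs (n + (nZ + d))"
    using x \<zeta> w by auto
  have a: "ssA (loop_ss nZ Z) *v (x @v \<zeta>) = loop_next Z x \<zeta> (0v d)"
    unfolding loop_ss_def mk_ss_def using x \<zeta>
    by (simp add: matf_mult[OF lin_loop_next[OF Z lin_first_id lin_last_id lin_zero]])
  show "ssA (loop_ss nZ Z) *v (x @v \<zeta>) = loop_next Z x \<zeta> (0v d)" by (rule a)
  have b: "ssB (loop_ss nZ Z) *v w = loop_next Z (0v n) (0v nZ) w"
    unfolding loop_ss_def mk_ss_def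
    by (simp add: matf_mult[OF lin_loop_next[OF Z lin_zero lin_zero lin_id] w])
  have c: "ssC (loop_ss nZ Z) *v (x @v \<zeta>) = loop_out Z x \<zeta> (0v d)"
    unfolding loop_ss_def mk_ss_def using x \<zeta>
    by (simp add: matf_mult[OF lin_loop_out[OF Z lin_first_id lin_last_id lin_zero]])
  have dd: "ssD (loop_ss nZ Z) *v w = loop_out Z (0v n) (0v nZ) w"
    unfolding loop_ss_def mk_ss_def
    by (simp add: matf_mult[OF lin_loop_out[OF Z lin_zero lin_zero lin_id] w])
  show "ssA (loop_ss nZ Z) *v (x @v \<zeta>) + ssB (loop_ss nZ Z) *v w = loop_next Z x \<zeta> w"
    using linD(2)[OF l cc] x \<zeta> w unfolding a b e[symmetric] by (simp add: L_def)
  show "ssC (loop_ss nZ Z) *v (x @v \<zeta>) + ssD (loop_ss nZ Z) *v w = loop_out Z x \<zeta> w"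
    using linD(2)[OF lo cc] x \<zeta> w unfolding c dd e[symmetric] by (simp add: Lo_def)
qed

lemma loop_u_carrier:
  assumes "ss_dims nZ p nu Z" "x \<in> vecs n" "\<zeta> \<in> vecs nZ" "w \<in> vecs d"
  shows "loop_u Z x \<zeta> w \<in> vecs nu"
proof -
  have "ssC Z \<in> mats nu nZ" "ssD Z \<in> mats nu p" using assms by (auto simp: ss_dims_def)
  moreover have "C *v x + F *v w \<in> vecs p" using C F assms by simp
  ultimately show ?thesis using assms C F unfolding loop_u_def
    by (intro add_carrier_vec mult_mat_vec_carrier)
qed

lemma loop_ss_op:
  assumes Z: "ss_dims nZ p nu Z" and w: "w \<in> signals d" and x: "\<And>k. x k \<in> vecs n" "x 0 = 0v n"
    and y: "\<And>k. y k = C *v x k + F *v w k"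
    and step: "\<And>k. x (Suc k) = A *v x k + B1 *v w k + B *v ss_op Z y k"
  shows "ss_op (loop_ss nZ Z) w k = C1 *v x k + D1 *v w k + E *v ss_op Z y k"
proof -
  have wk: "w k \<in> vecs d" for k using w by (simp add: signals_def)
  have yk: "y \<in> signals p" using C F x wk by (auto simp: signals_def y)
  have z: "ss_state Z y k \<in> vecs nZ" for k
    unfolding ss_state_eq_run by (rule run_carrier[of _ nZ _ p]) (use Z yk in \<open>auto simp: ss_dims_def\<close>)
  have u: "ss_op Z y k = loop_u Z (x k) (ss_state Z y k) (w k)" for k
    by (simp add: ss_op_def loop_u_def y)
  have st: "ss_state (loop_ss nZ Z) w k = x k @v ss_state Z y k" for k
  proof (induction k)
    case 0
    have "dim_row (ssA (loop_ss nZ Z)) = n + nZ" "dim_row (ssA Z) = nZ"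
      using loop_ss_dims[of nZ Z] Z by (auto simp: ss_dims_def)
    thus ?case by (simp add: x(2) zero_append_zero)
  next
    case (Suc k)
    show ?case unfolding ss_state.simps(2) Suc loop_ss_mult(1)[OF Z x(1) z wk]
      by (simp add: loop_next_def step u y)
  qed
  show ?thesis unfolding ss_op_def[of "loop_ss nZ Z"] st loop_ss_mult(2)[OF Z x(1) z wk]
    by (simp add: loop_out_def u)
qed

text \<open>By \<open>uncontrolled\<close> the measurement is that of the free plant and hence
  square summable. This passes to the state of \<open>Z\<close>, then to the control, and finally to
  the plant state.\<close>

lemma schur_loop:
  assumes Z: "ss_dims nZ p nu Z" and s: "schur (ssA Z)"
  shows "schur (ssA (loop_ss nZ Z))"
proof (rule schur_iff_l2[of _ "n + nZ"])
  show "ssA (loop_ss nZ Z) \<in> mats (n + nZ) (n + nZ)" using loop_ss_dims[of nZ Z] by (simp add: ss_dims_def)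
  fix v assume v: "\<And>k. v k \<in> vecs (n + nZ)" "\<And>k. v (Suc k) = ssA (loop_ss nZ Z) *v v k"
  define x where "x k = vec_first (v k) n" for k
  define \<zeta> where "\<zeta> k = vec_last (v k) nZ" for k
  have ve: "v k = x k @v \<zeta> k" for k using v(1)[of k] by (simp add: x_def \<zeta>_def)
  have c: "x k \<in> vecs n" "\<zeta> k \<in> vecs nZ" for k by (auto simp: x_def \<zeta>_def)
  define y where "y k = C *v x k" for k
  define u where "u k = ssC Z *v \<zeta> k + ssD Z *v y k" for k
  have yc: "y k \<in> vecs p" for k using C c by (simp add: y_def)
  have Zd: "ssA Z \<in> mats nZ nZ" "ssB Z \<in> mats nZ p" "ssC Z \<in> mats nu nZ" "ssD Z \<in> mats nu p"
    using Z by (auto simp: ss_dims_def)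
  have uc: "u k \<in> vecs nu" for k using Zd c yc by (simp add: u_def)
  hence us: "u \<in> signals nu" by (simp add: signals_def)
  have y0: "C *v x k + F *v 0v d = y k" for k using yc[of k] by (simp add: y_def mult_mat_zero[OF F])
  have "v (Suc k) = (A *v x k + B *v u k) @v (ssA Z *v \<zeta> k + ssB Z *v y k)" for k
  proof -
    have "A *v x k + B1 *v 0v d + B *v u k = A *v x k + B *v u k"
      using A B c uc by (simp add: mult_mat_zero[OF B1])
    thus ?thesis unfolding v(2) ve[of k] loop_ss_mult(3)[OF Z c zero_carrier_vec] loop_next_def loop_u_def y0
      by (simp add: u_def)
  qed
  hence step: "x (Suc k) = A *v x k + B *v u k" "\<zeta> (Suc k) = ssA Z *v \<zeta> k + ssB Z *v y k" for k
    using A B Zd c yc uc by (auto simp: x_def \<zeta>_def)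
  have x_run: "x k = run A B (x 0) u k" for k by (induction k) (auto simp: step)
  define f where "f k = run A B (x 0) (\<lambda>_. 0v nu) k" for k
  have z: "(\<lambda>_. 0v nu) \<in> signals nu" by (simp add: signals_def)
  have fc: "f k \<in> vecs n" for k unfolding f_def by (rule run_carrier[OF A B c(1) z])
  have rc: "run A B (0v n) u k \<in> vecs n" for k by (rule run_carrier[OF A B _ us]) simp
  have ye: "y k = C *v f k" for k
  proof -
    have "x k = f k + run A B (0v n) u k"
      using run_superposition[OF A B c(1) us, of 0 k] x_run[of k] by (simp add: f_def)
    thus ?thesis
      using uncontrolled[OF us, of k] C fc[of k] rc[of k]
      by (simp add: y_def mult_add_distrib_mat_vec[OF C])
  qed
  have "l2 f" by (rule schur_l2[OF A schurA fc zero_carrier_vec _ l2_zero])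
    (use A fc in \<open>auto simp: f_def mult_mat_zero[OF B]\<close>)
  hence ly: "l2 y" unfolding ye[abs_def] by (rule l2_mat[OF C fc])
  have l\<zeta>: "l2 \<zeta>" by (rule schur_l2[OF Zd(1) s c(2) _ step(2) l2_mat[OF Zd(2) yc ly]]) (use Zd yc in auto)
  have "l2 u" unfolding u_def[abs_def]
    by (intro l2_add[of _ nu] l2_mat[OF Zd(3) c(2) l\<zeta>] l2_mat[OF Zd(4) yc ly]) (use Zd c yc in auto)
  hence lBu: "l2 (\<lambda>k. B *v u k)" by (rule l2_mat[OF B uc])
  have Bu: "B *v u k \<in> vecs n" for k using B uc by simp
  have "l2 x" by (rule schur_l2[where d = "\<lambda>k. B *v u k", OF A schurA c(1) Bu step(1) lBu])
  with l\<zeta> have "l2 (\<lambda>k. x k @v \<zeta> k)" by (intro l2_append[of _ n _ nZ] c)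
  thus "l2 v" by (simp add: ve[abs_def])
qed

end

section \<open>Existence of \<open>Z\<close> and the synthesis condition\<close>

context youla_plant begin

lemma synthesis_necessary:
  assumes Z: "ss_dims nZ p nu Z" and s: "schur (ssA Z)" and snr: "SNR d (ss_op (loop_ss nZ Z))"
  shows synthesis
proof -
  obtain \<epsilon> where \<epsilon>: "\<epsilon> > 0" and neg: "margin_SNR d (ss_op (loop_ss nZ Z)) \<epsilon>"
    by (rule SNR_finite_support[OF snr])
  have dims: "ssA (loop_ss nZ Z) \<in> mats (n + nZ) (n + nZ)" "ssB (loop_ss nZ Z) \<in> mats (n + nZ) d"
    "ssC (loop_ss nZ Z) \<in> mats d (n + nZ)" "ssD (loop_ss nZ Z) \<in> mats d d"
    using loop_ss_dims[of nZ Z] by (auto simp: ss_dims_def)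
  have op: "ss_op (loop_ss nZ Z) = (\<lambda>w k. ssC (loop_ss nZ Z) *v
      run (ssA (loop_ss nZ Z)) (ssB (loop_ss nZ Z)) (0v (n + nZ)) w k + ssD (loop_ss nZ Z) *v w k)"
    using dims(1) by (simp add: ss_op_def[abs_def] ss_state_eq_run)
  obtain V \<delta> where st: "strict_storage (n + nZ) d (ssA (loop_ss nZ Z)) (ssB (loop_ss nZ Z))
      (ssC (loop_ss nZ Z)) (ssD (loop_ss nZ Z)) \<delta> V"
    by (rule kyp[OF dims schur_loop[OF Z s] \<epsilon> neg[unfolded op]])
  hence V: "qform (n + nZ) V" "\<delta> > 0" "\<And>x. x \<in> vecs (n + nZ) \<Longrightarrow> \<delta> * sq x \<le> V x"
    "\<And>x w. x \<in> vecs (n + nZ) \<Longrightarrow> w \<in> vecs d \<Longrightarrow>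
      V (ssA (loop_ss nZ Z) *v x + ssB (loop_ss nZ Z) *v w) +
        supply_rate (ssC (loop_ss nZ Z)) (ssD (loop_ss nZ Z)) \<delta> x w \<le> V x"
    by (auto simp: strict_storage_def)
  have diss: "V (loop_next Z x \<zeta> w) + 2 * (w \<bullet> loop_out Z x \<zeta> w) + \<delta> * (sq x + sq w) \<le> V (x @v \<zeta>)"
    if "x \<in> vecs n" "\<zeta> \<in> vecs nZ" "w \<in> vecs d" for x \<zeta> w
  proof -
    have "\<delta> * sq \<zeta> \<ge> 0" using V(2) sq_nonneg[of \<zeta>] by simp
    thus ?thesis
      using V(4)[of "x @v \<zeta>" w] that loop_ss_mult[OF Z that]
      by (simp add: supply_rate_def sq_append[OF that(1,2)] algebra_simps)
  qed
  have Vpos: "V (0v n @v \<zeta>) > 0" if "\<zeta> \<in> vecs nZ" "\<zeta> \<noteq> 0v nZ" for \<zeta>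
    using V(3)[of "0v n @v \<zeta>"] that mult_pos_pos[OF V(2) sq_pos[OF that]] by (simp add: sq_append[of _ n _ nZ])
  have Vnn: "V v \<ge> 0" if "v \<in> vecs (n + nZ)" for v
    using V(3)[OF that] mult_nonneg_nonneg[OF less_imp_le[OF V(2)] sq_nonneg[of v]] by linarith
  obtain R where R: "lin n nZ R" "\<And>x \<zeta>. x \<in> vecs n \<Longrightarrow> \<zeta> \<in> vecs nZ \<Longrightarrow>
     V (x @v \<zeta>) = V (x @v R x) + V (0v n @v (\<zeta> - R x))" using partial_min[OF V(1) Vpos] by metis
  have VR: "V (x @v R x) \<le> V (x @v \<zeta>)" if "x \<in> vecs n" "\<zeta> \<in> vecs nZ" for x \<zeta>
    using R(2)[OF that] Vnn[of "0v n @v (\<zeta> - R x)"] that linD(1)[OF R(1) that(1)] by simp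
  define N where "N x = V (x @v R x)" for x
  have N: "qform n N" unfolding N_def by (rule qform_comp[OF lin_append[OF lin_id R(1)] V(1)])
  obtain b where b: "b > 0" "\<And>v. v \<in> vecs (n + d) \<Longrightarrow>
      sq (A *v vec_first v n + B1 *v vec_last v d) \<le> b * sq v"
    using lin_bounded[OF lin_add[OF lin_mat[OF A lin_first_id] lin_mat[OF B1 lin_last_id]]] by metis
  \<comment> \<open>The partial minimum may be attained at 0, where the restriction of
    \<open>V\<close> equals \<open>N\<close>. Adding \<open>\<eta> * sq x\<close> makes the coupling
    strict, and \<open>\<eta> * b < \<delta>\<close> keeps the addition within the dissipation
    margin.\<close>
  define \<eta> where "\<eta> = \<delta> / (2 * b)"
  have \<eta>: "\<eta> > 0" "\<eta> * b < \<delta>" using V(2) b by (auto simp: \<eta>_def)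
  define X where "X x = V (x @v 0v nZ) + \<eta> * sq x" for x
  have X: "qform n X" unfolding X_def
    by (intro qform_add qform_scale qform_comp[OF lin_append[OF lin_id lin_zero] V(1)] qform_sq[OF lin_id])
  show ?thesis unfolding synthesis_def
  proof (intro exI conjI ballI impI)
    show "qform n X" "qform n N" by (rule X, rule N)
    fix x :: "real vec" assume x: "x \<in> vecs n"
    {
      assume x0: "x \<noteq> 0v n"
      have "0 < \<delta> * sq x" using V(2) sq_pos[OF x x0] by simp
      also have "\<dots> \<le> \<delta> * sq (x @v R x)"
        using V(2) sq_nonneg[of "R x"] by (simp add: sq_append[OF x linD(1)[OF R(1) x]])
      also have "\<dots> \<le> N x" unfolding N_def by (rule V(3)) (use x linD(1)[OF R(1) x] in simp)
      finally show "0 < N x" .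
      show "N x < X x" using VR[OF x zero_carrier_vec]
        mult_pos_pos[OF \<eta>(1) sq_pos[OF x x0]] unfolding N_def X_def by linarith
    }
    fix w :: "real vec" assume w: "w \<in> vecs d" and nz: "x @v w \<noteq> 0v (n + d)"
    have xw: "x @v w \<in> vecs (n + d)" using x w by simp
    have p: "sq x + sq w > 0" using sq_pos[OF xw nz] by (simp add: sq_append[OF x w])
    have Zd: "ssA Z \<in> mats nZ nZ" "ssB Z \<in> mats nZ p" "ssC Z \<in> mats nu nZ" "ssD Z \<in> mats nu p"
      using Z by (auto simp: ss_dims_def)
    {
      assume ker: "C *v x + F *v w = 0v p"
      \<comment> \<open>With zero measurement, \<open>Z\<close> at rest stays at rest and plays
        nothing, so the restriction of \<open>V\<close> satisfies the uncontrolled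
        inequality.\<close>
      have u0: "loop_u Z x (0v nZ) w = 0v nu"
        by (simp add: loop_u_def ker mult_mat_zero[OF Zd(3)] mult_mat_zero[OF Zd(4)])
      have nx: "loop_next Z x (0v nZ) w = (A *v x + B1 *v w) @v 0v nZ"
        using A B1 x w unfolding loop_next_def u0 ker
        by (simp add: mult_mat_zero[OF Zd(1)] mult_mat_zero[OF Zd(2)] mult_mat_zero[OF B])
      have out: "loop_out Z x (0v nZ) w = C1 *v x + D1 *v w"
        using C1 D1 x w unfolding loop_out_def u0 by (simp add: mult_mat_zero[OF E])
      have "\<eta> * sq (A *v x + B1 *v w) \<le> \<eta> * (b * (sq x + sq w))"
        using b(2)[OF xw] x w \<eta>(1) by (simp add: sq_append[OF x w])
      moreover have "\<eta> * (b * (sq x + sq w)) < \<delta> * (sq x + sq w)"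
        using mult_strict_right_mono[OF \<eta>(2) p] by (simp add: mult.assoc)
      moreover have "0 \<le> \<eta> * sq x" using \<eta>(1) sq_nonneg[of x] by simp
      ultimately show "X (A *v x + B1 *v w) - X x + 2 * (w \<bullet> (C1 *v x + D1 *v w)) < 0"
        using diss[OF x _ w, of "0v nZ"] unfolding nx out X_def by simp
    }
    have Rx: "R x \<in> vecs nZ" by (rule linD(1)[OF R(1) x])
    \<comment> \<open>The reply is what \<open>Z\<close> would play from the internal state that
      minimises \<open>V\<close> over its second argument.\<close>
    let ?u = "loop_u Z x (R x) w"
    have uc: "?u \<in> vecs nu" by (rule loop_u_carrier[OF Z x Rx w])
    have "N (A *v x + B1 *v w + B *v ?u) \<le> V (loop_next Z x (R x) w)"
      unfolding N_def loop_next_def by (rule VR) (use A B1 B C F Zd x w Rx uc in auto)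
    hence "N (A *v x + B1 *v w + B *v ?u) - N x + 2 * (w \<bullet> (C1 *v x + D1 *v w + E *v ?u)) < 0"
      using diss[OF x Rx w] mult_pos_pos[OF V(2) p] by (simp add: N_def loop_out_def)
    thus "\<exists>u \<in> vecs nu.
        N (A *v x + B1 *v w + B *v u) - N x + 2 * (w \<bullet> (C1 *v x + D1 *v w + E *v u)) < 0"
      using uc by blast
  qed
qed

text \<open>The game has data \<open>(x, \<zeta>, w)\<close>, reply \<open>(\<zeta>', u)\<close> and
  observation \<open>(\<zeta>, C x + F w)\<close>. A linear strategy from the observation to the
  reply is precisely a state-space system \<open>Z\<close> with state
  \<open>\<zeta>\<close>.\<close>

lemma synthesis_sufficient:
  assumes synthesis
  shows "\<exists>Z. ss_dims n p nu Z \<and> schur (ssA Z) \<and> SNR d (ss_op (loop_ss n Z))"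
proof -
  from assms[unfolded synthesis_def] obtain X N where X: "qform n X" and N: "qform n N"
    and XN': "\<forall>x \<in> vecs n. x \<noteq> 0v n \<longrightarrow> 0 < N x \<and> N x < X x"
    and primal': "\<forall>x \<in> vecs n. \<forall>w \<in> vecs d. x @v w \<noteq> 0v (n + d) \<longrightarrow>
      C *v x + F *v w = 0v p \<longrightarrow> X (A *v x + B1 *v w) - X x + 2 * (w \<bullet> (C1 *v x + D1 *v w)) < 0"
    and reply': "\<forall>x \<in> vecs n. \<forall>w \<in> vecs d. x @v w \<noteq> 0v (n + d) \<longrightarrow> (\<exists>u \<in> vecs nu.
        N (A *v x + B1 *v w + B *v u) - N x + 2 * (w \<bullet> (C1 *v x + D1 *v w + E *v u)) < 0)"
    by (elim exE conjE) (rule that)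
  note XN = XN'[rule_format] and primal = primal'[rule_format] and reply = reply'[rule_format]
  define M where "M x = X x - N x" for x
  have M: "qform n M" unfolding M_def by (rule qform_minus[OF X N])
  have Mpos: "M x > 0" if "x \<in> vecs n" "x \<noteq> 0v n" for x using XN[OF that] by (simp add: M_def)
  have Mnn: "M x \<ge> 0" if "x \<in> vecs n" for x
    using Mpos[OF that] qform_zero_arg[OF M] by (cases "x = 0v n") auto
  have Nnn: "N x \<ge> 0" if "x \<in> vecs n" for x
    using XN[OF that] qform_zero_arg[OF N] by (cases "x = 0v n") auto
  define V where "V v = N (vec_first v n) + M (vec_first v n - vec_last v n)" for v
  have V: "qform (n + n) V" unfolding V_def
    by (intro qform_add qform_comp[OF lin_first_id N] qform_comp[OF lin_minus[OF lin_first_id lin_last_id] M])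
  have Ve: "V (x @v \<zeta>) = N x + M (x - \<zeta>)" if "x \<in> vecs n" "\<zeta> \<in> vecs n" for x \<zeta>
    using that by (simp add: V_def)
  have Vnn: "V v \<ge> 0" if "v \<in> vecs (n + n)" for v
    unfolding V_def using Nnn[of "vec_first v n"] Mnn[of "vec_first v n - vec_last v n"] by simp
  \<comment> \<open>This gives the reply condition for all \<open>\<zeta>\<close>: copying the next
    plant state into \<open>\<zeta>'\<close> brings \<open>V\<close> down to \<open>N\<close>, while
    \<open>V\<close> before the step is at least \<open>N\<close>.\<close>
  have V_diag: "V (x @v x) = N x" if "x \<in> vecs n" for x
    using that qform_zero_arg[OF M] by (simp add: Ve)
  define hd where "hd v = vec_first v (n + n + d)" for v :: "real vec"
  define tl where "tl v = vec_last v (n + nu)" for v :: "real vec"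
  define px where "px v = vec_first (vec_first (hd v) (n + n)) n" for v
  define pz where "pz v = vec_last (vec_first (hd v) (n + n)) n" for v
  define pw where "pw v = vec_last (hd v) d" for v
  define pn where "pn v = vec_first (tl v) n" for v
  define pu where "pu v = vec_last (tl v) nu" for v
  define \<Phi> where "\<Phi> v = V ((A *v px v + B1 *v pw v + B *v pu v) @v pn v) - V (px v @v pz v)
      + 2 * (pw v \<bullet> (C1 *v px v + D1 *v pw v + E *v pu v))" for v
  let ?m = "(n + n + d) + (n + nu)"
  have hl: "lin ?m (n + n + d) hd" unfolding hd_def[abs_def] by (rule lin_first_id)
  have tl: "lin ?m (n + nu) tl" unfolding tl_def[abs_def] by (rule lin_last_id)
  have pl: "lin ?m n px" "lin ?m n pz" "lin ?m d pw" "lin ?m n pn" "lin ?m nu pu"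
    unfolding px_def[abs_def] pz_def[abs_def] pw_def[abs_def] pn_def[abs_def] pu_def[abs_def]
    by (intro lin_first[OF lin_first[OF hl]] lin_last[OF lin_first[OF hl]] lin_last[OF hl]
        lin_first[OF tl] lin_last[OF tl])+
  have \<Phi>: "qform ?m \<Phi>" unfolding \<Phi>_def
    by (intro qform_add qform_minus qform_scale qform_comp[OF lin_append V] V pl lin_add
        lin_mat[OF A] lin_mat[OF B1] lin_mat[OF B] lin_mat[OF C1] lin_mat[OF D1] lin_mat[OF E]
        qform_lin[OF pl(3) lin_add[OF lin_add[OF lin_mat[OF C1 pl(1)] lin_mat[OF D1 pl(3)]] lin_mat[OF E pl(5)]]])
  have \<Phi>e: "\<Phi> (((x @v \<zeta>) @v w) @v (\<zeta>' @v u)) = V ((A *v x + B1 *v w + B *v u) @v \<zeta>') - V (x @v \<zeta>)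
      + 2 * (w \<bullet> (C1 *v x + D1 *v w + E *v u))"
    if "x \<in> vecs n" "\<zeta> \<in> vecs n" "w \<in> vecs d" "\<zeta>' \<in> vecs n" "u \<in> vecs nu"
    for x \<zeta> w \<zeta>' u
    using that by (simp add: \<Phi>_def px_def pz_def pw_def pn_def pu_def hd_def tl_def)
  define obs where "obs h = vec_last (vec_first h (n + n)) n @v
     (C *v vec_first (vec_first h (n + n)) n + F *v vec_last h d)" for h
  have obs: "lin (n + n + d) (n + p) obs" unfolding obs_def
    by (intro lin_append lin_add lin_mat[OF C] lin_mat[OF F] lin_last[OF lin_first_id]
        lin_first[OF lin_first_id] lin_last_id)
  have obse: "obs ((x @v \<zeta>) @v w) = \<zeta> @v (C *v x + F *v w)"
    if "x \<in> vecs n" "\<zeta> \<in> vecs n" "w \<in> vecs d" for x \<zeta> w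
    using that by (simp add: obs_def)
  have split: "\<exists>x \<zeta> w. x \<in> vecs n \<and> \<zeta> \<in> vecs n \<and> w \<in> vecs d \<and> h = (x @v \<zeta>) @v w"
    if "h \<in> vecs (n + n + d)" for h :: "real vec"
    using that vec_first_last_append[of h "n + n" d] vec_first_last_append[of "vec_first h (n + n)" n n]
    by (metis vec_first_carrier vec_last_carrier)
  have next_c: "A *v x + B1 *v w + B *v u \<in> vecs n"
    if "x \<in> vecs n" "w \<in> vecs d" "u \<in> vecs nu" for x w u
    using A B1 B that by simp
  have z2: "0v (n + n + d) = (0v n @v 0v n) @v (0v d :: real vec)"
    "0v (n + nu) = 0v n @v (0v nu :: real vec)" "0v (n + p) = 0v n @v (0v p :: real vec)"
    by (auto simp: zero_append_zero)
  obtain \<Theta> where \<Theta>: "lin (n + p) (n + nu) \<Theta>"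
    "\<And>h. h \<in> vecs (n + n + d) \<Longrightarrow> h \<noteq> 0v (n + n + d) \<Longrightarrow> \<Phi> (h @v \<Theta> (obs h)) < 0"
  proof (rule quadratic_game[OF \<Phi> obs])
    fix r :: "real vec" assume "r \<in> vecs (n + nu)"
    then obtain \<zeta>' u where r: "r = \<zeta>' @v u" "\<zeta>' \<in> vecs n" "u \<in> vecs nu"
      using vec_first_last_append[of r n nu, symmetric] vec_first_carrier vec_last_carrier by blast
    have "C1 *v 0v n + D1 *v 0v d + E *v u \<in> vecs d" using C1 D1 E r by simp
    thus "0 \<le> \<Phi> (0v (n + n + d) @v r)"
      using \<Phi>e[of "0v n" "0v n" "0v d" \<zeta>' u] r qform_zero_arg[OF V]
        Vnn[of "(A *v 0v n + B1 *v 0v d + B *v u) @v \<zeta>'"] next_c[of "0v n" "0v d" u]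
      by (simp add: zero_append_zero)
  next
    fix h :: "real vec" assume h: "h \<in> vecs (n + n + d)" "h \<noteq> 0v (n + n + d)" "obs h = 0v (n + p)"
    obtain x \<zeta> w where hx: "h = (x @v \<zeta>) @v w" and c: "x \<in> vecs n" "\<zeta> \<in> vecs n" "w \<in> vecs d"
      using split[OF h(1)] by (elim exE conjE) (rule that)
    have y: "C *v x + F *v w \<in> vecs p" using C F c by simp
    \<comment> \<open>Zero observation forces \<open>\<zeta> = 0\<close>, where \<open>V\<close> is
      \<open>X\<close>; the zero reply leaves \<open>\<zeta>' = 0\<close>, so the claim is the
      kernel inequality.\<close>
    have "\<zeta> = 0v n" and ker: "C *v x + F *v w = 0v p"
      using h(3) c y append_vec_eq[OF c(2) zero_carrier_vec] unfolding hx obse[OF c] z2 by auto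
    hence nz: "x @v w \<noteq> 0v (n + d)"
      using h(2) c unfolding hx z2 by (auto simp: append_eq_0)
    have "A *v x + B1 *v w + B *v 0v nu = A *v x + B1 *v w"
      "C1 *v x + D1 *v w + E *v 0v nu = C1 *v x + D1 *v w"
      using A B1 C1 D1 c by (auto simp: mult_mat_zero[OF B] mult_mat_zero[OF E])
    moreover have "A *v x + B1 *v w \<in> vecs n" using A B1 c by simp
    ultimately show "\<Phi> (h @v 0v (n + nu)) < 0"
      using primal[OF c(1,3) nz ker] c unfolding hx \<open>\<zeta> = 0v n\<close> z2 by (simp add: \<Phi>e Ve M_def)
  next
    fix h :: "real vec" assume h: "h \<in> vecs (n + n + d)" "h \<noteq> 0v (n + n + d)"
    obtain x \<zeta> w where hx: "h = (x @v \<zeta>) @v w" and c: "x \<in> vecs n" "\<zeta> \<in> vecs n" "w \<in> vecs d"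
      using split[OF h(1)] by (elim exE conjE) (rule that)
    show "\<exists>r \<in> vecs (n + nu). \<Phi> (h @v r) < 0"
    proof (cases "x @v w = 0v (n + d)")
      case True
      hence xw: "x = 0v n" "w = 0v d" using c by (auto simp: append_eq_0)
      hence "\<zeta> \<noteq> 0v n" using h(2) unfolding hx z2 by auto
      hence "M (0v n - \<zeta>) > 0" using Mpos[OF c(2)] qform_minus_arg[OF M c(2)] c(2) by simp
      moreover have "A *v 0v n + B1 *v 0v d + B *v 0v nu = 0v n"
        "C1 *v 0v n + D1 *v 0v d + E *v 0v nu = 0v d"
        by (auto simp: mult_mat_zero[OF A] mult_mat_zero[OF B1] mult_mat_zero[OF B]
            mult_mat_zero[OF C1] mult_mat_zero[OF D1] mult_mat_zero[OF E])
      ultimately have "\<Phi> (h @v 0v (n + nu)) < 0"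
        using c(2) qform_zero_arg[OF N] qform_zero_arg[OF V]
          \<Phi>e[OF zero_carrier_vec c(2) zero_carrier_vec zero_carrier_vec zero_carrier_vec] unfolding hx xw
        by (simp add: Ve[of "0v n" \<zeta>] zero_append_zero)
      thus ?thesis by (meson zero_carrier_vec)
    next
      case False
      obtain u where u: "u \<in> vecs nu"
        "N (A *v x + B1 *v w + B *v u) - N x + 2 * (w \<bullet> (C1 *v x + D1 *v w + E *v u)) < 0"
        using reply[OF c(1,3) False] by blast
      have "N x \<le> V (x @v \<zeta>)" using c Mnn[of "x - \<zeta>"] by (simp add: Ve)
      hence "\<Phi> (h @v ((A *v x + B1 *v w + B *v u) @v u)) < 0"
        using u c next_c[OF c(1,3) u(1)] unfolding hx by (simp add: \<Phi>e V_diag)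
      thus ?thesis using u(1) next_c[OF c(1,3) u(1)] by (meson append_carrier_vec)
    qed
  qed (rule that)
  \<comment> \<open>The four matrices are the blocks of the strategy \<open>\<Theta>\<close>: by
    argument, state or measurement, and by result, next state or control.\<close>
  define Z where "Z = mk_ss (matf n n (\<lambda>\<zeta>. vec_first (\<Theta> (\<zeta> @v 0v p)) n)) (matf p n (\<lambda>y. vec_first (\<Theta> (0v n @v y)) n))
     (matf n nu (\<lambda>\<zeta>. vec_last (\<Theta> (\<zeta> @v 0v p)) nu)) (matf p nu (\<lambda>y. vec_last (\<Theta> (0v n @v y)) nu))"
  have Z: "ss_dims n p nu Z" by (simp add: Z_def ss_dims_def mk_ss_def)
  have l1: "lin n (n + nu) (\<lambda>\<zeta>. \<Theta> (\<zeta> @v 0v p))" by (rule lin_comp[OF lin_append[OF lin_id lin_zero] \<Theta>(1)])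
  have l2: "lin p (n + nu) (\<lambda>y. \<Theta> (0v n @v y))" by (rule lin_comp[OF lin_append[OF lin_zero lin_id] \<Theta>(1)])
  have Z\<Theta>: "\<Theta> (\<zeta> @v y) = (ssA Z *v \<zeta> + ssB Z *v y) @v (ssC Z *v \<zeta> + ssD Z *v y)"
    if c: "\<zeta> \<in> vecs n" "y \<in> vecs p" for \<zeta> y
  proof -
    have "\<zeta> @v y = (\<zeta> @v 0v p) + (0v n @v y)" using c by (simp add: append_vec_add[of _ n _ _ p])
    hence "\<Theta> (\<zeta> @v y) = \<Theta> (\<zeta> @v 0v p) + \<Theta> (0v n @v y)" using linD(2)[OF \<Theta>(1)] c by simp
    also have "\<dots> = (ssA Z *v \<zeta> + ssB Z *v y) @v (ssC Z *v \<zeta> + ssD Z *v y)"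
      unfolding Z_def mk_ss_def
      using vec_first_last_append[OF linD(1)[OF l1 c(1)]] vec_first_last_append[OF linD(1)[OF l2 c(2)]]
        append_vec_add[of "vec_first (\<Theta> (\<zeta> @v 0v p)) n" n "vec_first (\<Theta> (0v n @v y)) n"
          "vec_last (\<Theta> (\<zeta> @v 0v p)) nu" nu "vec_last (\<Theta> (0v n @v y)) nu"]
      by (simp add: matf_mult[OF lin_first[OF l1]] matf_mult[OF lin_first[OF l2]]
          matf_mult[OF lin_last[OF l1]] matf_mult[OF lin_last[OF l2]] c)
    finally show ?thesis .
  qed
  define \<Psi> where "\<Psi> h = - \<Phi> (h @v \<Theta> (obs h))" for h
  have \<Psi>: "qform (n + n + d) \<Psi>" unfolding \<Psi>_def
    by (rule qform_uminus[OF qform_comp[OF lin_append[OF lin_id lin_comp[OF obs \<Theta>(1)]] \<Phi>]])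
  obtain \<delta> where \<delta>: "\<delta> > 0" "\<And>h. h \<in> vecs (n + n + d) \<Longrightarrow> \<Psi> h \<ge> \<delta> * sq h"
    by (rule pos_margin[OF \<Psi>]) (use \<Theta>(2) in \<open>auto simp: \<Psi>_def\<close>)
  have diss: "V (loop_next Z x \<zeta> w) + 2 * (w \<bullet> loop_out Z x \<zeta> w) + \<delta> * (sq x + sq \<zeta> + sq w) \<le> V (x @v \<zeta>)"
    if c: "x \<in> vecs n" "\<zeta> \<in> vecs n" "w \<in> vecs d" for x \<zeta> w
  proof -
    have y: "C *v x + F *v w \<in> vecs p" using C F c by simp
    have u: "loop_u Z x \<zeta> w \<in> vecs nu" by (rule loop_u_carrier[OF Z c])
    have Zd: "ssA Z \<in> mats n n" "ssB Z \<in> mats n p" using Z by (auto simp: ss_dims_def)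
    have \<zeta>': "ssA Z *v \<zeta> + ssB Z *v (C *v x + F *v w) \<in> vecs n"
      by (intro add_carrier_vec mult_mat_vec_carrier[OF Zd(1) c(2)] mult_mat_vec_carrier[OF Zd(2) y])
    have "\<Theta> (obs ((x @v \<zeta>) @v w)) = (ssA Z *v \<zeta> + ssB Z *v (C *v x + F *v w)) @v loop_u Z x \<zeta> w"
      unfolding obse[OF c] Z\<Theta>[OF c(2) y] loop_u_def ..
    hence "\<Psi> ((x @v \<zeta>) @v w) = - (V (loop_next Z x \<zeta> w) - V (x @v \<zeta>) + 2 * (w \<bullet> loop_out Z x \<zeta> w))"
      unfolding \<Psi>_def using \<Phi>e[OF c \<zeta>' u] by (simp add: loop_next_def loop_out_def)
    moreover have "sq ((x @v \<zeta>) @v w) = sq x + sq \<zeta> + sq w"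
      using c by (simp add: sq_append[of _ "n + n" _ d] sq_append[of _ n _ n])
    moreover have "(x @v \<zeta>) @v w \<in> vecs (n + n + d)" using c by simp
    ultimately show ?thesis using \<delta>(2)[of "(x @v \<zeta>) @v w"] by simp
  qed
  have dims: "ssA (loop_ss n Z) \<in> mats (n + n) (n + n)" "ssB (loop_ss n Z) \<in> mats (n + n) d"
    "ssC (loop_ss n Z) \<in> mats d (n + n)" "ssD (loop_ss n Z) \<in> mats d d"
    using loop_ss_dims[of n Z] by (auto simp: ss_dims_def)
  have splitv: "\<exists>x \<zeta>. x \<in> vecs n \<and> \<zeta> \<in> vecs n \<and> v = x @v \<zeta>"
    if "v \<in> vecs (n + n)" for v :: "real vec"
    using that vec_first_last_append[of v n n] by (metis vec_first_carrier vec_last_carrier)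
  have s: "schur (ssA (loop_ss n Z))"
  proof (rule storage_schur[where V = V, OF dims(1) Vnn \<delta>(1)])
    fix v :: "real vec" assume "v \<in> vecs (n + n)"
    then obtain x \<zeta> where v: "v = x @v \<zeta>" and c: "x \<in> vecs n" "\<zeta> \<in> vecs n"
      using splitv by (metis (no_types))
    have "loop_out Z x \<zeta> (0v d) \<in> vecs d"
      using C1 D1 E c loop_u_carrier[OF Z c, of "0v d"] by (simp add: loop_out_def)
    thus "V (ssA (loop_ss n Z) *v v) + \<delta> * sq v \<le> V v"
      using diss[OF c, of "0v d"] unfolding v loop_ss_mult(3)[OF Z c zero_carrier_vec]
      by (simp add: sq_append[OF c])
  qed
  have mk: "mk_ss (ssA (loop_ss n Z)) (ssB (loop_ss n Z)) (ssC (loop_ss n Z)) (ssD (loop_ss n Z)) = loop_ss n Z"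
    by (simp add: mk_ss_def)
  have "SNR d (ss_op (loop_ss n Z))"
  proof (rule storage_SNR[where V = V, OF dims s Vnn qform_zero_arg[OF V] \<delta>(1)])
    fix v w :: "real vec" assume "v \<in> vecs (n + n)" and w: "w \<in> vecs d"
    then obtain x \<zeta> where v: "v = x @v \<zeta>" and c: "x \<in> vecs n" "\<zeta> \<in> vecs n"
      using splitv by (metis (no_types))
    have "0 \<le> \<delta> * sq x" "0 \<le> \<delta> * sq \<zeta>" using \<delta>(1) sq_nonneg by (auto intro: mult_nonneg_nonneg)
    thus "V (ssA (loop_ss n Z) *v v + ssB (loop_ss n Z) *v w) +
        2 * (w \<bullet> (ssC (loop_ss n Z) *v v + ssD (loop_ss n Z) *v w)) + \<delta> * sq w \<le> V v"
      using diss[OF c w] unfolding v loop_ss_mult(1,2)[OF Z c w] by (simp add: distrib_left)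
  qed (simp_all add: mk)
  \<comment> \<open>A free orbit of \<open>Z\<close>, driving the plant from rest, produces no
    measurement. It is therefore part of a free orbit of the closed loop, whose stability
    \<open>Z\<close> inherits.\<close>
  moreover have "schur (ssA Z)"
  proof (rule schur_iff_l2[of _ n])
    show AZ: "ssA Z \<in> mats n n" using Z by (simp add: ss_dims_def)
    fix \<zeta> assume \<zeta>: "\<And>k. \<zeta> k \<in> vecs n" "\<And>k. \<zeta> (Suc k) = ssA Z *v \<zeta> k"
    define u where "u k = ssC Z *v \<zeta> k" for k
    have us: "u \<in> signals nu" using Z \<zeta>(1) by (auto simp: u_def ss_dims_def signals_def)
    hence uk: "u k \<in> vecs nu" for k by (simp add: signals_def)
    define x where "x k = run A B (0v n) u k" for k
    have xc: "x k \<in> vecs n" for k unfolding x_def by (rule run_carrier[OF A B _ us]) simp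
    have "C *v x k = 0v p" for k unfolding x_def by (rule uncontrolled[OF us])
    hence y: "C *v x k + F *v 0v d = 0v p" for k by (simp add: mult_mat_zero[OF F])
    have Zd: "ssB Z \<in> mats n p" "ssD Z \<in> mats nu p" using Z by (auto simp: ss_dims_def)
    have step: "x (Suc k) @v \<zeta> (Suc k) = ssA (loop_ss n Z) *v (x k @v \<zeta> k)" for k
    proof -
      have "loop_u Z (x k) (\<zeta> k) (0v d) = u k"
        using uk[of k] by (simp add: loop_u_def y mult_mat_zero[OF Zd(2)] u_def)
      moreover have "A *v x k + B1 *v 0v d + B *v u k = x (Suc k)"
        using A xc[of k] by (simp add: mult_mat_zero[OF B1] x_def)
      moreover have "ssA Z *v \<zeta> k + ssB Z *v 0v p = \<zeta> (Suc k)"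
        using AZ \<zeta>(1)[of k] by (simp add: mult_mat_zero[OF Zd(1)] \<zeta>(2))
      ultimately show ?thesis
        unfolding loop_ss_mult(3)[OF Z xc \<zeta>(1) zero_carrier_vec] loop_next_def y by simp
    qed
    have vc: "x k @v \<zeta> k \<in> vecs (n + n)" for k using xc \<zeta>(1) by simp
    have "l2 (\<lambda>k. x k @v \<zeta> k)"
      by (rule schur_l2[OF dims(1) s vc zero_carrier_vec _ l2_zero]) (use vc dims(1) step in auto)
    thus "l2 \<zeta>" by (rule l2_of_append(2)[OF xc \<zeta>(1)])
  qed
  ultimately show ?thesis using Z by blast
qed

section \<open>Dualisation of the reply condition\<close>

lemma adjoint_identity:
  assumes c: "P \<in> vecs n" "q \<in> vecs d" "x \<in> vecs n" "w \<in> vecs d" "u \<in> vecs nu"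
  shows "P \<bullet> (A *v x + B1 *v w + B *v u) + q \<bullet> (C1 *v x + D1 *v w + E *v u) =
    (A\<^sup>T *v P + C1\<^sup>T *v q) \<bullet> x + (B1\<^sup>T *v P + D1\<^sup>T *v q) \<bullet> w
    + (B\<^sup>T *v P + E\<^sup>T *v q) \<bullet> u"
proof -
  have c1: "A *v x \<in> vecs n" "B1 *v w \<in> vecs n" "B *v u \<in> vecs n"
    "C1 *v x \<in> vecs d" "D1 *v w \<in> vecs d" "E *v u \<in> vecs d"
    using A B1 B C1 D1 E c by auto
  have c2: "A\<^sup>T *v P \<in> vecs n" "C1\<^sup>T *v q \<in> vecs n"
    "B1\<^sup>T *v P \<in> vecs d" "D1\<^sup>T *v q \<in> vecs d"
    "B\<^sup>T *v P \<in> vecs nu" "E\<^sup>T *v q \<in> vecs nu"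
    using A B1 B C1 D1 E c by auto
  have "P \<bullet> (A *v x + B1 *v w + B *v u) = P \<bullet> (A *v x) + P \<bullet> (B1 *v w) + P \<bullet> (B *v u)"
    "q \<bullet> (C1 *v x + D1 *v w + E *v u) = q \<bullet> (C1 *v x) + q \<bullet> (D1 *v w) + q \<bullet> (E *v u)"
    using c c1 by (simp_all add: scalar_prod_add_distrib[of _ n] scalar_prod_add_distrib[of _ d])
  moreover have "(A\<^sup>T *v P + C1\<^sup>T *v q) \<bullet> x = P \<bullet> (A *v x) + q \<bullet> (C1 *v x)"
    using c2 c transpose_vec_mult_scalar[OF A c(3,1)] transpose_vec_mult_scalar[OF C1 c(3,2)]
    by (simp add: add_scalar_prod_distrib[of _ n])
  moreover have "(B1\<^sup>T *v P + D1\<^sup>T *v q) \<bullet> w = P \<bullet> (B1 *v w) + q \<bullet> (D1 *v w)"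
    using c2 c transpose_vec_mult_scalar[OF B1 c(4,1)] transpose_vec_mult_scalar[OF D1 c(4,2)]
    by (simp add: add_scalar_prod_distrib[of _ d])
  moreover have "(B\<^sup>T *v P + E\<^sup>T *v q) \<bullet> u = P \<bullet> (B *v u) + q \<bullet> (E *v u)"
    using c2 c transpose_vec_mult_scalar[OF B c(5,1)] transpose_vec_mult_scalar[OF E c(5,2)]
    by (simp add: add_scalar_prod_distrib[of _ nu])
  ultimately show ?thesis by simp
qed

definition reply_cond :: "(real vec \<Rightarrow> real) \<Rightarrow> bool" where
  "reply_cond N \<longleftrightarrow> (\<forall>x \<in> vecs n. \<forall>w \<in> vecs d. x @v w \<noteq> 0v (n + d) \<longrightarrow> (\<exists>u \<in> vecs nu.
     N (A *v x + B1 *v w + B *v u) - N x + 2 * (w \<bullet> (C1 *v x + D1 *v w + E *v u)) < 0))"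

text \<open>\<open>h\<close> is meant to be the inverse of the matrix of \<open>N\<close>. The
  expression is the dissipation form of the transposed system for this inverse storage, with the
  sign reversed.\<close>

definition dual_form :: "(real vec \<Rightarrow> real vec) \<Rightarrow> real vec \<Rightarrow> real vec \<Rightarrow> real" where
  "dual_form h P q = P \<bullet> h P - (A\<^sup>T *v P + C1\<^sup>T *v q) \<bullet>
     h (A\<^sup>T *v P + C1\<^sup>T *v q)
     - 2 * (q \<bullet> (B1\<^sup>T *v P + D1\<^sup>T *v q))"

definition dual_cond :: "(real vec \<Rightarrow> real vec) \<Rightarrow> bool" where
  "dual_cond h \<longleftrightarrow> (\<forall>P \<in> vecs n. \<forall>q \<in> vecs d. P @v q \<noteq> 0v (n + d) \<longrightarrow>
     B\<^sup>T *v P + E\<^sup>T *v q = 0v nu \<longrightarrow> dual_form h P q > 0)"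

text \<open>Dualisation. For the converse, Finsler's lemma relaxes the kernel constraint to a penalty, which
  corresponds to penalising \<open>u\<close> in the primal problem and thus guarantees that an optimal reply exists.\<close>

lemma reply_iff_dual:
  assumes g: "lin n n g" and h: "lin n n h"
    and gh: "\<And>x. x \<in> vecs n \<Longrightarrow> g (h x) = x" and hg: "\<And>x. x \<in> vecs n \<Longrightarrow> h (g x) = x"
    and N: "qform n N" and Ng: "\<And>x. x \<in> vecs n \<Longrightarrow> N x = x \<bullet> g x"
    and sym: "\<And>x y. x \<in> vecs n \<Longrightarrow> y \<in> vecs n \<Longrightarrow> x \<bullet> g y = y \<bullet> g x"
    and pos: "\<And>x. x \<in> vecs n \<Longrightarrow> x \<noteq> 0v n \<Longrightarrow> N x > 0"
  shows "reply_cond N \<longleftrightarrow> dual_cond h"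
proof -
  have Nnn: "N x \<ge> 0" if "x \<in> vecs n" for x
    using pos[OF that] qform_zero_arg[OF N] by (cases "x = 0v n") auto
  \<comment> \<open>Fenchel's inequality for \<open>N\<close> and its conjugate, from
    \<open>N (x - h a) \<ge> 0\<close>.\<close>
  have fenchel: "2 * (a \<bullet> x) \<le> N x + a \<bullet> h a" if x: "x \<in> vecs n" and a: "a \<in> vecs n" for x a
  proof -
    have ha: "h a \<in> vecs n" by (rule linD(1)[OF h a])
    have gx: "g x \<in> vecs n" by (rule linD(1)[OF g x])
    have "0 \<le> N (x - h a)" using Nnn x ha by simp
    also have "N (x - h a) = N x - x \<bullet> a - h a \<bullet> g x + h a \<bullet> a"
      using x ha a gx by (simp add: Ng lin_diff_arg[OF g x ha] gh scalar_prod_minus_distrib[of _ n]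
          minus_scalar_prod_distrib[of _ n])
    also have "h a \<bullet> g x = x \<bullet> a" using sym[OF ha x] by (simp add: gh a)
    finally show ?thesis using comm_scalar_prod[OF x a] comm_scalar_prod[OF ha a] by simp
  qed
  have ct: "A\<^sup>T *v P + C1\<^sup>T *v q \<in> vecs n"
    "B1\<^sup>T *v P + D1\<^sup>T *v q \<in> vecs d"
    "B\<^sup>T *v P + E\<^sup>T *v q \<in> vecs nu"
    if "P \<in> vecs n" "q \<in> vecs d" for P q using A B1 B C1 D1 E that by auto
  have cp: "A *v x + B1 *v w + B *v u \<in> vecs n" "C1 *v x + D1 *v w + E *v u \<in> vecs d"
    if "x \<in> vecs n" "w \<in> vecs d" "u \<in> vecs nu" for x w u using A B1 B C1 D1 E that by auto
  show ?thesis
  proof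
    assume R: "reply_cond N"
    show "dual_cond h" unfolding dual_cond_def
    proof (intro ballI impI)
      fix P q :: "real vec" assume P: "P \<in> vecs n" and q: "q \<in> vecs d" and nz: "P @v q \<noteq> 0v (n + d)"
        and ker: "B\<^sup>T *v P + E\<^sup>T *v q = 0v nu"
      define a where "a = A\<^sup>T *v P + C1\<^sup>T *v q"
      define b where "b = B1\<^sup>T *v P + D1\<^sup>T *v q"
      have a: "a \<in> vecs n" and b: "b \<in> vecs d" using ct[OF P q] by (auto simp: a_def b_def)
      \<comment> \<open>The state with equality in Fenchel's inequality: it is the most demanding
        one for the given dual variables.\<close>
      define x where "x = h a"
      have x: "x \<in> vecs n" unfolding x_def by (rule linD(1)[OF h a])
      have Nx: "N x = a \<bullet> x" using x a by (simp add: Ng x_def gh comm_scalar_prod[of _ n])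
      have df: "dual_form h P q = P \<bullet> h P - a \<bullet> x - 2 * (q \<bullet> b)" by (simp add: dual_form_def a_def b_def x_def)
      show "dual_form h P q > 0"
      proof (cases "x @v q = 0v (n + d)")
        case True
        hence z: "x = 0v n" "q = 0v d" using x q by (auto simp: append_eq_0)
        hence P0: "P \<noteq> 0v n" using nz P q by (auto simp: append_eq_0)
        have hP: "h P \<in> vecs n" by (rule linD(1)[OF h P])
        have "h P \<noteq> 0v n" using gh[OF P] lin_zero_arg[OF g] P0 by auto
        hence "N (h P) > 0" using pos hP by blast
        hence "P \<bullet> h P > 0" using hP P by (simp add: Ng gh comm_scalar_prod[of _ n])
        thus ?thesis unfolding df using a b by (simp add: z)
      next
        case False
        obtain u where u: "u \<in> vecs nu"
          "N (A *v x + B1 *v q + B *v u) - N x + 2 * (q \<bullet> (C1 *v x + D1 *v q + E *v u)) < 0"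
          using R x q False unfolding reply_cond_def by blast
        have "P \<bullet> (A *v x + B1 *v q + B *v u) + q \<bullet> (C1 *v x + D1 *v q + E *v u) = a \<bullet> x + b \<bullet> q"
          using adjoint_identity[OF P q x q u(1)] u(1) by (simp add: ker a_def b_def)
        moreover have "2 * (P \<bullet> (A *v x + B1 *v q + B *v u)) \<le> N (A *v x + B1 *v q + B *v u) + P \<bullet> h P"
          by (rule fenchel[OF cp(1)[OF x q u(1)] P])
        ultimately show ?thesis using u(2) comm_scalar_prod[OF b q] unfolding df Nx by linarith
      qed
    qed
  next
    assume D: "dual_cond h"
    define Q where "Q v = - dual_form h (vec_first v n) (vec_last v d)" for v
    have la: "lin (n + d) n (\<lambda>v. A\<^sup>T *v vec_first v n + C1\<^sup>T *v vec_last v d)"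
      and lb: "lin (n + d) d (\<lambda>v. B1\<^sup>T *v vec_first v n + D1\<^sup>T *v vec_last v d)"
      and le: "lin (n + d) nu (\<lambda>v. B\<^sup>T *v vec_first v n + E\<^sup>T *v vec_last v d)"
      using A C1 B1 D1 B E
      by (auto intro!: lin_add lin_mat[OF _ lin_first_id] lin_mat[OF _ lin_last_id])
    have Q: "qform (n + d) Q" unfolding Q_def dual_form_def
      by (intro qform_uminus qform_minus qform_scale qform_lin[OF lin_first_id lin_comp[OF lin_first_id h]]
          qform_lin[OF la lin_comp[OF la h]] qform_lin[OF lin_last_id lb])
    obtain \<kappa> where \<kappa>: "\<kappa> > 0" "\<And>v. v \<in> vecs (n + d) \<Longrightarrow> v \<noteq> 0v (n + d) \<Longrightarrow>
        Q v < \<kappa> * sq (B\<^sup>T *v vec_first v n + E\<^sup>T *v vec_last v d)"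
    proof (rule finsler[OF Q le])
      fix v :: "real vec" assume v: "v \<in> vecs (n + d)" "v \<noteq> 0v (n + d)"
        "B\<^sup>T *v vec_first v n + E\<^sup>T *v vec_last v d = 0v nu"
      have "dual_form h (vec_first v n) (vec_last v d) > 0"
        by (rule D[unfolded dual_cond_def, rule_format]) (use v in auto)
      thus "Q v < 0" by (simp add: Q_def)
    qed (rule that)
    show "reply_cond N" unfolding reply_cond_def
    proof (intro ballI impI)
      fix x w :: "real vec" assume x: "x \<in> vecs n" and w: "w \<in> vecs d" and nz: "x @v w \<noteq> 0v (n + d)"
      \<comment> \<open>Half of the Hessian in \<open>u\<close> of the primal objective with the
        extra penalty \<open>sq u / \<kappa>\<close>. The penalty makes it invertible even if
        \<open>B\<close> is not injective.\<close>
      define G where "G u = B\<^sup>T *v g (B *v u) + (1 / \<kappa>) *s u" for u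
      have tB: "B\<^sup>T \<in> mats nu n" using B by simp
      have G: "lin nu nu G" unfolding G_def
        by (intro lin_add lin_mat[OF tB] lin_comp[OF lin_mult_mat[OF B] g] lin_smult lin_id)
      have Ginj: "G u \<noteq> 0v nu" if u: "u \<in> vecs nu" "u \<noteq> 0v nu" for u
      proof
        assume G0: "G u = 0v nu"
        have Bu: "B *v u \<in> vecs n" "g (B *v u) \<in> vecs n" using B u linD(1)[OF g] by auto
        have "B\<^sup>T *v g (B *v u) \<in> vecs nu" using tB Bu by simp
        hence "G u \<bullet> u = (B\<^sup>T *v g (B *v u)) \<bullet> u + (1 / \<kappa>) * sq u"
          using u by (simp add: G_def add_scalar_prod_distrib[of _ nu])
        also have "(B\<^sup>T *v g (B *v u)) \<bullet> u = N (B *v u)"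
          using transpose_vec_mult_scalar[OF B u(1) Bu(2)] Bu by (simp add: Ng comm_scalar_prod[of _ n])
        finally have "N (B *v u) + (1 / \<kappa>) * sq u = 0" using u by (simp add: G0)
        moreover have "(1 / \<kappa>) * sq u > 0" using \<kappa>(1) sq_pos[OF u] by simp
        ultimately show False using Nnn[OF Bu(1)] by linarith
      qed
      obtain H where H: "lin nu nu H" "\<And>u. u \<in> vecs nu \<Longrightarrow> G (H u) = u"
        using pos_def_inverse[OF G Ginj] by metis
      define x0 where "x0 = A *v x + B1 *v w"
      have x0: "x0 \<in> vecs n" using A B1 x w by (simp add: x0_def)
      have tE: "E\<^sup>T \<in> mats nu d" using E by simp
      define c where "c = B\<^sup>T *v g x0 + E\<^sup>T *v w"
      have c: "c \<in> vecs nu" using tB tE linD(1)[OF g x0] w by (simp add: c_def)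
      define u where "u = H (- c)"
      have u: "u \<in> vecs nu" unfolding u_def by (rule linD(1)[OF H(1)]) (use c in simp)
      have Gu: "G u = - c" unfolding u_def by (rule H(2)) (use c in simp)
      define y where "y = A *v x + B1 *v w + B *v u"
      have y: "y \<in> vecs n" unfolding y_def by (rule cp(1)[OF x w u])
      define P where "P = g y"
      have P: "P \<in> vecs n" unfolding P_def by (rule linD(1)[OF g y])
      have Bu: "B *v u \<in> vecs n" using B u by simp
      define e where "e = B\<^sup>T *v P + E\<^sup>T *v w"
      have e: "e \<in> vecs nu" unfolding e_def by (rule ct(3)[OF P w])
      \<comment> \<open>The optimality condition \<open>G u = - c\<close> ties the reply to the dual
        residual \<open>e\<close>, so \<open>e \<bullet> u\<close> becomes exactly the penalty
        \<open>- \<kappa> * sq e\<close> that Finsler's lemma compensates.\<close>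
      have eu: "u = - (\<kappa> *s e)"
      proof -
        have gx0: "g x0 \<in> vecs n" "g (B *v u) \<in> vecs n" using linD(1)[OF g] x0 Bu by auto
        have P2: "P = g x0 + g (B *v u)"
          unfolding P_def y_def x0_def[symmetric] by (rule linD(2)[OF g x0 Bu])
        have e2: "e = c + B\<^sup>T *v g (B *v u)"
          unfolding e_def P2 c_def mult_add_distrib_mat_vec[OF tB gx0]
          using tB tE gx0 w by (intro eq_vecI) auto
        have tb: "B\<^sup>T *v g (B *v u) \<in> vecs nu" using tB gx0 by simp
        show ?thesis
        proof (rule eq_vecI)
          fix i assume "i < dim_vec (- (\<kappa> *s e))"
          hence i: "i < nu" using e by simp
          have "G u $ i = (- c) $ i" by (simp add: Gu)
          hence "(B\<^sup>T *v g (B *v u)) $ i + u $ i / \<kappa> = - (c $ i)"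
            using i tb u c by (simp add: G_def)
          moreover have "e $ i = c $ i + (B\<^sup>T *v g (B *v u)) $ i" using i tb c B by (simp add: e2)
          ultimately show "u $ i = (- (\<kappa> *s e)) $ i" using i e \<kappa>(1) by (simp add: field_simps)
        qed (use u e in simp)
      qed
      define a where "a = A\<^sup>T *v P + C1\<^sup>T *v w"
      define b where "b = B1\<^sup>T *v P + D1\<^sup>T *v w"
      have a: "a \<in> vecs n" and b: "b \<in> vecs d" using ct[OF P w] by (auto simp: a_def b_def)
      define z where "z = C1 *v x + D1 *v w + E *v u"
      have "e \<bullet> u = - (\<kappa> * sq e)" unfolding eu using e by simp
      hence adj: "P \<bullet> y + w \<bullet> z = a \<bullet> x + b \<bullet> w - \<kappa> * sq e"
        using adjoint_identity[OF P w x w u] unfolding y_def z_def a_def b_def e_def by simp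
      have Py: "P \<bullet> y = N y" "P \<bullet> h P = N y" using P y by (simp_all add: Ng P_def hg comm_scalar_prod[of _ n])
      have fx: "2 * (a \<bullet> x) \<le> N x + a \<bullet> h a" by (rule fenchel[OF x a])
      have \<kappa>e: "\<kappa> * sq e \<ge> 0" using \<kappa>(1) sq_nonneg[of e] by simp
      have "N y - N x + 2 * (w \<bullet> z) < 0"
      proof (cases "P @v w = 0v (n + d)")
        case True
        hence z0: "P = 0v n" "w = 0v d" using P w by (auto simp: append_eq_0)
        hence "x \<noteq> 0v n" using nz x w by (auto simp: append_eq_0)
        moreover have "N y = 0" using Py(1) y by (simp add: z0)
        moreover have "z \<in> vecs d" unfolding z_def by (rule cp(2)[OF x w u])
        ultimately show ?thesis using pos[OF x] by (simp add: z0)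
      next
        case False
        have "P @v w \<in> vecs (n + d)" using P w by simp
        from \<kappa>(2)[OF this False] have "- dual_form h P w < \<kappa> * sq e"
          using P w by (simp add: Q_def e_def)
        hence "- N y + a \<bullet> h a + 2 * (w \<bullet> b) < \<kappa> * sq e"
          using Py(2) by (simp add: dual_form_def a_def b_def)
        thus ?thesis using adj Py(1) fx \<kappa>e comm_scalar_prod[OF b w] by linarith
      qed
      thus "\<exists>u \<in> vecs nu. N (A *v x + B1 *v w + B *v u) - N x + 2 * (w \<bullet> (C1 *v x + D1 *v w + E *v u)) < 0"
        using u unfolding y_def z_def by blast
    qed
  qed
qed

end

section \<open>The linear matrix inequalities\<close>

lemma zero_mat_mult_vec: "x \<in> vecs n \<Longrightarrow> 0\<^sub>m r n *v x = (0v r :: real vec)"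
  by (intro eq_vecI) auto

lemma kernel_basis_mat_props:
  assumes M: "M \<in> mats r c" and K: "kernel_basis_mat M U"
  shows "U \<in> mats c (dim_col U)"
    and "\<And>v. v \<in> vecs (dim_col U) \<Longrightarrow> M *v (U *v v) = 0v r"
    and "\<And>v. v \<in> vecs (dim_col U) \<Longrightarrow> v \<noteq> 0v (dim_col U) \<Longrightarrow> U *v v \<noteq> 0v c"
    and "\<And>x. x \<in> vecs c \<Longrightarrow> M *v x = 0v r \<Longrightarrow> \<exists>v \<in> vecs (dim_col U). x = U *v v"
proof -
  interpret kernel r c M by unfold_locales (rule M)
  define m where "m = dim_col U"
  have U: "U \<in> mats c m" and dist: "distinct (cols U)" and b: "Ker.basis (set (cols U))"
    using K M by (auto simp: kernel_basis_mat_def m_def)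
  have sub: "set (cols U) \<subseteq> mat_kernel M" and gen: "Ker.span (set (cols U)) = mat_kernel M"
    and ind: "\<not> Ker.lin_dep (set (cols U))"
    using b unfolding Ker.basis_def by auto
  show "U \<in> mats c (dim_col U)" using U unfolding m_def .
  have 1: "M *v (U *v v) = 0v r" if v: "v \<in> vecs m" for v
  proof -
    have "M * U = 0\<^sub>m r m"
    proof (rule eq_matI)
      fix i j assume "i < dim_row (0\<^sub>m r m :: real mat)" "j < dim_col (0\<^sub>m r m :: real mat)"
      hence ij: "i < r" "j < m" by auto
      hence "j < dim_col U" using U by simp
      hence "col U j \<in> mat_kernel M" using sub by (auto simp: cols_def)
      hence "M *v col U j = 0v r" using mat_kernelD[OF M] by blast
      hence "(M *v col U j) $ i = 0" using ij by simp
      thus "(M * U) $$ (i, j) = 0\<^sub>m r m $$ (i, j)" using M U ij by simp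
    qed (use M U in auto)
    thus ?thesis using v by (simp add: assoc_mult_mat_vec[OF M U v, symmetric] zero_mat_mult_vec)
  qed
  have 2: "U *v v \<noteq> 0v c" if v: "v \<in> vecs m" "v \<noteq> 0v m" for v
    using NC.lin_depI[OF U v _ dist] ind lindep_same[OF sub] by blast
  have 3: "\<exists>v \<in> vecs m. x = U *v v" if x: "x \<in> vecs c" "M *v x = 0v r" for x
  proof -
    have "x \<in> NC.span (set (cols U))" using mat_kernelI[OF M x] gen span_same[OF sub] by auto
    moreover have "set (cols U) \<subseteq> vecs c" using cols_dim[of U] U by auto
    ultimately obtain a where "x = NC.lincomb a (set (cols U))"
      using NC.finite_span[of "set (cols U)"] by auto
    hence "x = U *v vec m (\<lambda>i. a (col U i))" using NC.mat_mult_eq_lincomb[OF U dist] by simp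
    thus ?thesis by (rule bexI) simp
  qed
  show "\<And>v. v \<in> vecs (dim_col U) \<Longrightarrow> M *v (U *v v) = 0v r"
    "\<And>v. v \<in> vecs (dim_col U) \<Longrightarrow> v \<noteq> 0v (dim_col U) \<Longrightarrow> U *v v \<noteq> 0v c"
    "\<And>x. x \<in> vecs c \<Longrightarrow> M *v x = 0v r \<Longrightarrow> \<exists>v \<in> vecs (dim_col U). x = U *v v"
    by (rule 1[unfolded m_def] 2[unfolded m_def] 3[unfolded m_def]; assumption)+
qed

lemma append_columns_carrier [simp]:
  "A \<in> mats r n \<Longrightarrow> B \<in> mats r m \<Longrightarrow> A @\<^sub>c B \<in> mats r (n + m)"
  unfolding append_columns_def by (metis add_0_right carrier_matD(2) four_block_carrier_mat zero_carrier_mat)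

lemma append_columns_mult:
  assumes "A \<in> mats r n" "B \<in> mats r m" "x \<in> vecs n" "y \<in> vecs m"
  shows "(A @\<^sub>c B) *v (x @v y) = A *v x + B *v (y :: real vec)"
proof -
  have d: "dim_col A = n" "dim_col B = m" using assms by auto
  have "(A @\<^sub>c B) *v (x @v y) = (A *v x + B *v y) @v (0\<^sub>m 0 n *v x + 0\<^sub>m 0 m *v y)"
    unfolding append_columns_def d using assms
    by (intro four_block_mat_mult_vec[of _ r n _ m _ 0]) auto
  also have "\<dots> = A *v x + B *v y" using assms by (intro eq_vecI) auto
  finally show ?thesis .
qed

lemma scalar_prod_transpose_mult:
  assumes "P \<in> mats k N" "Q \<in> mats k M" "x \<in> vecs N" "y \<in> vecs M"
  shows "x \<bullet> ((P\<^sup>T * Q) *v y) = (P *v x) \<bullet> (Q *v (y :: real vec))"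
proof -
  have c: "Q *v y \<in> vecs k" "P *v x \<in> vecs k" using assms by auto
  have "x \<bullet> ((P\<^sup>T * Q) *v y) = (P\<^sup>T *v (Q *v y)) \<bullet> x"
    using assms c by (simp add: assoc_mult_mat_vec[of _ N k _ M] comm_scalar_prod[of _ N])
  also have "\<dots> = (Q *v y) \<bullet> (P *v x)" by (rule transpose_vec_mult_scalar[OF assms(1,3) c(1)])
  finally show ?thesis using comm_scalar_prod[OF c] by simp
qed

lemma scalar_prod_transpose_mult3:
  assumes "P \<in> mats k N" "X \<in> mats k l" "Q \<in> mats l M" "x \<in> vecs N" "y \<in> vecs M"
  shows "x \<bullet> ((P\<^sup>T * X * Q) *v y) = (P *v x) \<bullet> (X *v (Q *v (y :: real vec)))"
proof -
  have "P\<^sup>T * X * Q = P\<^sup>T * (X * Q)"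
    using assms by (intro assoc_mult_mat[of _ N k _ l _ M]) auto
  thus ?thesis using scalar_prod_transpose_mult[of P k N "X * Q" M x y] assms
    by (simp add: assoc_mult_mat_vec[of _ k l _ M])
qed

lemma sym_mat_by_form:
  assumes M: "(M :: real mat) \<in> mats n n"
    and s: "\<And>x y. x \<in> vecs n \<Longrightarrow> y \<in> vecs n \<Longrightarrow> x \<bullet> (M *v y) = y \<bullet> (M *v x)"
  shows "sym_mat M"
proof -
  have "M\<^sup>T = M"
  proof (rule eq_matI)
    fix i j assume "i < dim_row M" "j < dim_col M"
    hence ij: "i < n" "j < n" using M by auto
    have "unit_vec n a \<bullet> (M *v unit_vec n b) = M $$ (a, b)" if "a < n" "b < n" for a b
      using M that by (simp add: mult_mat_unit_vec[of _ n n])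
    thus "M\<^sup>T $$ (i, j) = M $$ (i, j)" using s[of "unit_vec n i" "unit_vec n j"] ij M by simp
  qed (use M in auto)
  thus ?thesis using M by (auto simp: sym_mat_def)
qed

lemma sym_matD:
  assumes "sym_mat M" "M \<in> mats n n" "x \<in> vecs n" "y \<in> vecs n"
  shows "x \<bullet> (M *v y) = y \<bullet> (M *v x)"
  using scalar_prod_sym_mat[of M n y x] assms by (simp add: sym_mat_def)

text \<open>Basis matrices matter only as bijective parametrisations of a kernel. This form also
  covers \<open>V\<close>, of which only the lower block is given as a basis matrix.\<close>

definition spans_kernel :: "nat \<Rightarrow> nat \<Rightarrow> real mat \<Rightarrow> real mat \<Rightarrow> bool" where
  "spans_kernel k N K U \<longleftrightarrow> K \<in> mats k N \<and> (\<exists>m. U \<in> mats N m \<and>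
     (\<forall>v \<in> vecs m. K *v (U *v v) = 0v k) \<and>
     (\<forall>v \<in> vecs m. v \<noteq> 0v m \<longrightarrow> U *v v \<noteq> 0v N) \<and>
     (\<forall>x \<in> vecs N. K *v x = 0v k \<longrightarrow> (\<exists>v \<in> vecs m. x = U *v v)))"

text \<open>Congruence with a bijective parametrisation of the kernel tests a form on exactly this
  kernel.\<close>

lemma pos_def_on_kernel:
  assumes K: "spans_kernel k N K U" and M: "M \<in> mats N N" and s: "sym_mat M"
  shows "pos_def (U\<^sup>T * M * U) \<longleftrightarrow>
    (\<forall>x \<in> vecs N. x \<noteq> 0v N \<longrightarrow> K *v x = 0v k \<longrightarrow> 0 < x \<bullet> (M *v x))"
    and "neg_def (U\<^sup>T * M * U) \<longleftrightarrow>
    (\<forall>x \<in> vecs N. x \<noteq> 0v N \<longrightarrow> K *v x = 0v k \<longrightarrow> x \<bullet> (M *v x) < 0)"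
proof -
  obtain m where U: "U \<in> mats N m" and ker: "\<And>v. v \<in> vecs m \<Longrightarrow> K *v (U *v v) = 0v k"
    and inj: "\<And>v. v \<in> vecs m \<Longrightarrow> v \<noteq> 0v m \<Longrightarrow> U *v v \<noteq> 0v N"
    and surj: "\<And>x. x \<in> vecs N \<Longrightarrow> K *v x = 0v k \<Longrightarrow> \<exists>v \<in> vecs m. x = U *v v"
    using K unfolding spans_kernel_def by metis
  have UM: "U\<^sup>T * M * U \<in> mats m m" using U M by simp
  have f: "x \<bullet> ((U\<^sup>T * M * U) *v y) = (U *v x) \<bullet> (M *v (U *v y))"
    if "x \<in> vecs m" "y \<in> vecs m" for x y
    by (rule scalar_prod_transpose_mult3[OF U M U that])
  have Uc: "U *v x \<in> vecs N" if "x \<in> vecs m" for x using U that by simp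
  have sym: "sym_mat (U\<^sup>T * M * U)"
    by (rule sym_mat_by_form[OF UM]) (use f Uc sym_matD[OF s M] in simp)
  have d: "dim_row (U\<^sup>T * M * U) = m" using U by simp
  have U0: "U *v 0v m = 0v N" by (rule mult_mat_zero[OF U])
  show "pos_def (U\<^sup>T * M * U) \<longleftrightarrow>
    (\<forall>x \<in> vecs N. x \<noteq> 0v N \<longrightarrow> K *v x = 0v k \<longrightarrow> 0 < x \<bullet> (M *v x))"
    unfolding pos_def_def d
  proof (intro iffI conjI ballI impI sym)
    fix x :: "real vec"
    assume p: "sym_mat (U\<^sup>T * M * U) \<and>
       (\<forall>x \<in> vecs m. x \<noteq> 0v m \<longrightarrow> 0 < x \<bullet> ((U\<^sup>T * M * U) *v x))"
      and x: "x \<in> vecs N" "x \<noteq> 0v N" "K *v x = 0v k"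
    obtain v where v: "v \<in> vecs m" "x = U *v v" using surj[OF x(1,3)] by blast
    hence "v \<noteq> 0v m" using x(2) U0 by auto
    thus "0 < x \<bullet> (M *v x)" using p v f by metis
  next
    fix v :: "real vec"
    assume p: "\<forall>x \<in> vecs N. x \<noteq> 0v N \<longrightarrow> K *v x = 0v k \<longrightarrow> 0 < x \<bullet> (M *v x)"
      and v: "v \<in> vecs m" "v \<noteq> 0v m"
    show "0 < v \<bullet> ((U\<^sup>T * M * U) *v v)"
      unfolding f[OF v(1) v(1)] using p Uc[OF v(1)] inj[OF v] ker[OF v(1)] by blast
  qed
  show "neg_def (U\<^sup>T * M * U) \<longleftrightarrow>
    (\<forall>x \<in> vecs N. x \<noteq> 0v N \<longrightarrow> K *v x = 0v k \<longrightarrow> x \<bullet> (M *v x) < 0)"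
    unfolding neg_def_def d
  proof (intro iffI conjI ballI impI sym)
    fix x :: "real vec"
    assume p: "sym_mat (U\<^sup>T * M * U) \<and>
       (\<forall>x \<in> vecs m. x \<noteq> 0v m \<longrightarrow> x \<bullet> ((U\<^sup>T * M * U) *v x) < 0)"
      and x: "x \<in> vecs N" "x \<noteq> 0v N" "K *v x = 0v k"
    obtain v where v: "v \<in> vecs m" "x = U *v v" using surj[OF x(1,3)] by blast
    hence "v \<noteq> 0v m" using x(2) U0 by auto
    thus "x \<bullet> (M *v x) < 0" using p v f by metis
  next
    fix v :: "real vec"
    assume p: "\<forall>x \<in> vecs N. x \<noteq> 0v N \<longrightarrow> K *v x = 0v k \<longrightarrow> x \<bullet> (M *v x) < 0"
      and v: "v \<in> vecs m" "v \<noteq> 0v m"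
    show "v \<bullet> ((U\<^sup>T * M * U) *v v) < 0"
      unfolding f[OF v(1) v(1)] using p Uc[OF v(1)] inj[OF v] ker[OF v(1)] by blast
  qed
qed

lemma minv_props:
  assumes Y: "Y \<in> mats n n" and inj: "\<And>x. x \<in> vecs n \<Longrightarrow> x \<noteq> 0v n \<Longrightarrow> Y *v x \<noteq> 0v n"
  shows "minv Y \<in> mats n n" "Y * minv Y = 1\<^sub>m n" "minv Y * Y = 1\<^sub>m n"
proof -
  have "det Y \<noteq> 0" using det_0_iff_vec_prod_zero[OF Y] inj by auto
  hence "Y \<in> Units (ring_mat TYPE(real) n ())" by (rule det_non_zero_imp_unit[OF Y])
  hence "mat_inverse Y \<noteq> None" using mat_inverse(1)[OF Y, where b = "()"] by blast
  then obtain B where B: "mat_inverse Y = Some B" by blast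
  from mat_inverse(2)[OF Y B] show "minv Y \<in> mats n n" "Y * minv Y = 1\<^sub>m n" "minv Y * Y = 1\<^sub>m n"
    by (simp_all add: minv_def B)
qed

lemma bW1_mult:
  assumes "W11 \<in> mats n1 n1" "W12 \<in> mats n1 n2" "a \<in> vecs n1" "b \<in> vecs n2"
  shows "bW1 W11 W12 *v (a @v b) = (W11 *v a + W12 *v b) @v b"
proof -
  have "bW1 W11 W12 *v (a @v b) = (W11 *v a + W12 *v b) @v (0\<^sub>m n2 n1 *v a + 1\<^sub>m n2 *v b)"
    unfolding bW1_def using assms by (subst four_block_mat_mult_vec[of _ n1 n1 _ n2 _ n2]) auto
  thus ?thesis using assms by (simp add: zero_mat_mult_vec)
qed

lemma bW2_mult:
  assumes "W12 \<in> mats n1 n2" "W22 \<in> mats n2 n2" "a \<in> vecs n1" "b \<in> vecs n2"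
  shows "bW2 W12 W22 *v (a @v b) = a @v (W22 *v b - W12\<^sup>T *v a)"
proof -
  have "bW2 W12 W22 *v (a @v b) = (1\<^sub>m n1 *v a + 0\<^sub>m n1 n2 *v b) @v (- W12\<^sup>T *v a + W22 *v b)"
    unfolding bW2_def using assms by (subst four_block_mat_mult_vec[of _ n1 n1 _ n2 _ n2]) auto
  moreover have "- W12\<^sup>T *v a + W22 *v b = W22 *v b - W12\<^sup>T *v a"
    using assms by (intro eq_vecI) (auto simp: scalar_prod_def sum_negf)
  ultimately show ?thesis using assms by (simp add: zero_mat_mult_vec)
qed

lemma bW_carrier:
  assumes "W11 \<in> mats n1 n1" "W12 \<in> mats n1 n2" "W22 \<in> mats n2 n2"
  shows "bW1 W11 W12 \<in> mats (n1 + n2) (n1 + n2)" "bW2 W12 W22 \<in> mats (n1 + n2) (n1 + n2)"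
  using assms unfolding bW1_def bW2_def by auto

lemma form_of_sum:
  assumes c: "M1 \<in> mats N N" "M2 \<in> mats N N" "M3 \<in> mats N N" "M4 \<in> mats N N"
    and u: "u \<in> vecs N" "v \<in> vecs N"
  shows "M1 - M2 + M3 + M4 \<in> mats N N" "M1 - M2 - M3 - M4 \<in> mats N N"
    "u \<bullet> ((M1 - M2 + M3 + M4) *v v) =
       u \<bullet> (M1 *v v) - u \<bullet> (M2 *v v) + u \<bullet> (M3 *v v) + u \<bullet> (M4 *v (v :: real vec))"
    "u \<bullet> ((M1 - M2 - M3 - M4) *v v) =
       u \<bullet> (M1 *v v) - u \<bullet> (M2 *v v) - u \<bullet> (M3 *v v) - u \<bullet> (M4 *v v)"
proof -
  show "M1 - M2 + M3 + M4 \<in> mats N N" "M1 - M2 - M3 - M4 \<in> mats N N" using c by auto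
  have d: "M1 - M2 \<in> mats N N" "M1 - M2 + M3 \<in> mats N N" "M1 - M2 - M3 \<in> mats N N" using c by auto
  have v: "M1 *v v \<in> vecs N" "M2 *v v \<in> vecs N" "M3 *v v \<in> vecs N" "M4 *v v \<in> vecs N"
    using c u by auto
  show "u \<bullet> ((M1 - M2 + M3 + M4) *v v) =
       u \<bullet> (M1 *v v) - u \<bullet> (M2 *v v) + u \<bullet> (M3 *v v) + u \<bullet> (M4 *v v)"
    unfolding add_mult_distrib_mat_vec[OF d(2) c(4) u(2)] add_mult_distrib_mat_vec[OF d(1) c(3) u(2)]
      minus_mult_distrib_mat_vec[OF c(1,2) u(2)]
    using u v by (simp add: scalar_prod_add_distrib[of _ N] scalar_prod_minus_distrib[of _ N])
  show "u \<bullet> ((M1 - M2 - M3 - M4) *v v) =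
       u \<bullet> (M1 *v v) - u \<bullet> (M2 *v v) - u \<bullet> (M3 *v v) - u \<bullet> (M4 *v v)"
    unfolding minus_mult_distrib_mat_vec[OF d(3) c(4) u(2)] minus_mult_distrib_mat_vec[OF d(1) c(3) u(2)]
      minus_mult_distrib_mat_vec[OF c(1,2) u(2)]
    using u v by (simp add: scalar_prod_minus_distrib[of _ N])
qed

text \<open>\<open>B_split\<close> records that the control enters only the second block of the
  state. This makes the change of variables by \<open>bW1\<close> compatible with a matrix
  \<open>V\<close> that does not depend on \<open>W\<close>.\<close>

locale youla_lmi = youla_plant +
  fixes n1 n2 :: nat and B22 U V :: "real mat"
  assumes n: "n = n1 + n2" and B22: "B22 \<in> mats n2 nu" and B_split: "B = 0\<^sub>m n1 nu @\<^sub>r B22"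
    and U: "spans_kernel p (n + d) (C @\<^sub>c F) U"
    and V: "spans_kernel nu (n + d) (B\<^sup>T @\<^sub>c E\<^sup>T) V"
begin

definition primal_mat :: "real mat \<Rightarrow> real mat" where
  "primal_mat X = (A @\<^sub>c B1)\<^sup>T * X * (A @\<^sub>c B1) - (1\<^sub>m n @\<^sub>c 0\<^sub>m n d)\<^sup>T * X * (1\<^sub>m n @\<^sub>c 0\<^sub>m n d)
     + (C1 @\<^sub>c D1)\<^sup>T * (0\<^sub>m d n @\<^sub>c 1\<^sub>m d) + (0\<^sub>m d n @\<^sub>c 1\<^sub>m d)\<^sup>T * (C1 @\<^sub>c D1)"

definition dual_mat :: "real mat \<Rightarrow> real mat \<Rightarrow> real mat" where
  "dual_mat W1 W2 =
    (let Y = W1\<^sup>T * W2;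
         ACt = (W1\<^sup>T * A * W2)\<^sup>T @\<^sub>c (C1 * W2)\<^sup>T;
         BDt = (W1\<^sup>T * B1)\<^sup>T @\<^sub>c D1\<^sup>T
     in (1\<^sub>m n @\<^sub>c 0\<^sub>m n d)\<^sup>T * Y * (1\<^sub>m n @\<^sub>c 0\<^sub>m n d) - ACt\<^sup>T * minv Y * ACt
        - (0\<^sub>m d n @\<^sub>c 1\<^sub>m d)\<^sup>T * BDt - BDt\<^sup>T * (0\<^sub>m d n @\<^sub>c 1\<^sub>m d))"

definition lmi :: "real mat \<Rightarrow> real mat \<Rightarrow> real mat \<Rightarrow> real mat \<Rightarrow> bool" where
  "lmi X W11 W12 W22 \<longleftrightarrow> X \<in> mats n n \<and> sym_mat X \<and>
     W11 \<in> mats n1 n1 \<and> W12 \<in> mats n1 n2 \<and> W22 \<in> mats n2 n2 \<and>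
     sym_mat (four_block_mat W11 W12 (W12\<^sup>T) W22) \<and>
     pos_def (four_block_mat X (bW1 W11 W12) ((bW1 W11 W12)\<^sup>T) ((bW1 W11 W12)\<^sup>T * bW2 W12 W22)) \<and>
     neg_def (U\<^sup>T * primal_mat X * U) \<and>
     pos_def (V\<^sup>T * dual_mat (bW1 W11 W12) (bW2 W12 W22) * V)"

lemma selectors:
  assumes "x \<in> vecs n" "w \<in> vecs d"
  shows "(1\<^sub>m n @\<^sub>c 0\<^sub>m n d) *v (x @v w) = x" "(0\<^sub>m d n @\<^sub>c 1\<^sub>m d) *v (x @v w) = (w :: real vec)"
  using assms by (auto simp: append_columns_mult[of _ n n _ d] append_columns_mult[of _ d n _ d] zero_mat_mult_vec)

lemma splitv:
  assumes "v \<in> vecs (n + d)"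
  obtains x w where "x \<in> vecs n" "w \<in> vecs d" "v = x @v (w :: real vec)"
  using vec_first_last_append[OF assms] vec_first_carrier vec_last_carrier by metis

lemma primal_mat:
  assumes X: "X \<in> mats n n" and sX: "sym_mat X"
  shows "primal_mat X \<in> mats (n + d) (n + d)" "sym_mat (primal_mat X)"
    and "\<And>x w. x \<in> vecs n \<Longrightarrow> w \<in> vecs d \<Longrightarrow> (x @v w) \<bullet> (primal_mat X *v (x @v w)) =
      (A *v x + B1 *v w) \<bullet> (X *v (A *v x + B1 *v w)) - x \<bullet> (X *v x) + 2 * (w \<bullet> (C1 *v x + D1 *v w))"
proof -
  let ?P = "A @\<^sub>c B1" and ?I = "1\<^sub>m n @\<^sub>c 0\<^sub>m n d :: real mat" and ?K = "C1 @\<^sub>c D1" and ?O = "0\<^sub>m d n @\<^sub>c 1\<^sub>m d :: real mat"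
  have P: "?P \<in> mats n (n + d)" and I: "?I \<in> mats n (n + d)"
    and K: "?K \<in> mats d (n + d)" and O': "?O \<in> mats d (n + d)"
    using A B1 C1 D1 by auto
  have c1: "?P\<^sup>T * X * ?P \<in> mats (n + d) (n + d)" using P X by (meson mult_carrier_mat transpose_carrier_mat)
  have c2: "?I\<^sup>T * X * ?I \<in> mats (n + d) (n + d)" using I X by (meson mult_carrier_mat transpose_carrier_mat)
  have c3: "?K\<^sup>T * ?O \<in> mats (n + d) (n + d)" using K O' by (meson mult_carrier_mat transpose_carrier_mat)
  have c4: "?O\<^sup>T * ?K \<in> mats (n + d) (n + d)" using K O' by (meson mult_carrier_mat transpose_carrier_mat)
  show M: "primal_mat X \<in> mats (n + d) (n + d)" unfolding primal_mat_def by (rule form_of_sum(1)[OF c1 c2 c3 c4 zero_carrier_vec zero_carrier_vec])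
  have f: "u \<bullet> (primal_mat X *v v) = (?P *v u) \<bullet> (X *v (?P *v v)) - (?I *v u) \<bullet> (X *v (?I *v v))
      + (?K *v u) \<bullet> (?O *v v) + (?O *v u) \<bullet> (?K *v v)"
    if u: "u \<in> vecs (n + d)" and v: "v \<in> vecs (n + d)" for u v
  proof -
    show ?thesis
      using form_of_sum(3)[OF c1 c2 c3 c4 u v, folded primal_mat_def] scalar_prod_transpose_mult3[OF P X P u v]
        scalar_prod_transpose_mult3[OF I X I u v] scalar_prod_transpose_mult[OF K O' u v]
        scalar_prod_transpose_mult[OF O' K u v] by linarith
  qed
  have mc: "?P *v u \<in> vecs n" "?I *v u \<in> vecs n" "?K *v u \<in> vecs d" "?O *v u \<in> vecs d"
    if "u \<in> vecs (n + d)" for u using mult_mat_vec_carrier[OF P that] mult_mat_vec_carrier[OF I that]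
      mult_mat_vec_carrier[OF K that] mult_mat_vec_carrier[OF O' that] by auto
  show "sym_mat (primal_mat X)"
  proof (rule sym_mat_by_form[OF M])
    fix u v :: "real vec" assume uv: "u \<in> vecs (n + d)" "v \<in> vecs (n + d)"
    show "u \<bullet> (primal_mat X *v v) = v \<bullet> (primal_mat X *v u)"
      unfolding f[OF uv] f[OF uv(2,1)]
      using sym_matD[OF sX X mc(1)[OF uv(1)] mc(1)[OF uv(2)]] sym_matD[OF sX X mc(2)[OF uv(1)] mc(2)[OF uv(2)]]
        comm_scalar_prod[OF mc(3)[OF uv(1)] mc(4)[OF uv(2)]] comm_scalar_prod[OF mc(4)[OF uv(1)] mc(3)[OF uv(2)]]
      by simp
  qed
  fix x w :: "real vec" assume x: "x \<in> vecs n" and w: "w \<in> vecs d"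
  have c: "C1 *v x + D1 *v w \<in> vecs d" using C1 D1 x w by simp
  have xw: "x @v w \<in> vecs (n + d)" using x w by simp
  show "(x @v w) \<bullet> (primal_mat X *v (x @v w)) =
      (A *v x + B1 *v w) \<bullet> (X *v (A *v x + B1 *v w)) - x \<bullet> (X *v x) + 2 * (w \<bullet> (C1 *v x + D1 *v w))"
    unfolding f[OF xw xw] selectors[OF x w] append_columns_mult[OF A B1 x w] append_columns_mult[OF C1 D1 x w]
    using comm_scalar_prod[OF w c] by simp
qed

lemma dual_mat:
  assumes W: "W1 \<in> mats n n" "W2 \<in> mats n n" and sY: "sym_mat (W1\<^sup>T * W2)"
    and inj: "\<And>x. x \<in> vecs n \<Longrightarrow> x \<noteq> 0v n \<Longrightarrow> (W1\<^sup>T * W2) *v x \<noteq> 0v n"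
  shows "dual_mat W1 W2 \<in> mats (n + d) (n + d)" "sym_mat (dual_mat W1 W2)"
    and "\<And>s q. s \<in> vecs n \<Longrightarrow> q \<in> vecs d \<Longrightarrow> (s @v q) \<bullet> (dual_mat W1 W2 *v (s @v q)) =
      s \<bullet> ((W1\<^sup>T * W2) *v s)
      - (W2\<^sup>T *v (A\<^sup>T *v (W1 *v s) + C1\<^sup>T *v q)) \<bullet>
        (minv (W1\<^sup>T * W2) *v (W2\<^sup>T *v (A\<^sup>T *v (W1 *v s) + C1\<^sup>T *v q)))
      - 2 * (q \<bullet> (B1\<^sup>T *v (W1 *v s) + D1\<^sup>T *v q))"
proof -
  define Y where "Y = W1\<^sup>T * W2"
  have Y: "Y \<in> mats n n" using W by (simp add: Y_def)
  note sY' = sY[folded Y_def] and inj' = inj[folded Y_def]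
  note mY = minv_props[OF Y inj']
  have smY: "u \<bullet> (minv Y *v v) = v \<bullet> (minv Y *v u)" if u: "u \<in> vecs n" and v: "v \<in> vecs n" for u v
  proof -
    have m: "minv Y *v u \<in> vecs n" "minv Y *v v \<in> vecs n" using mY(1) u v by auto
    have e: "Y *v (minv Y *v u) = u" "Y *v (minv Y *v v) = v"
      using assoc_mult_mat_vec[OF Y mY(1), symmetric] u v mY(2) by auto
    show ?thesis using sym_matD[OF sY' Y m] unfolding e
      using comm_scalar_prod[OF u m(2)] comm_scalar_prod[OF v m(1)] by simp
  qed
  let ?P = "(W1\<^sup>T * A * W2)\<^sup>T @\<^sub>c (C1 * W2)\<^sup>T"
    and ?I = "1\<^sub>m n @\<^sub>c 0\<^sub>m n d :: real mat"
    and ?K = "(W1\<^sup>T * B1)\<^sup>T @\<^sub>c D1\<^sup>T" and ?O = "0\<^sub>m d n @\<^sub>c 1\<^sub>m d :: real mat"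
  have cc: "W1\<^sup>T * A * W2 \<in> mats n n" "C1 * W2 \<in> mats d n" "W1\<^sup>T * B1 \<in> mats n d"
    using W A C1 B1 by (meson mult_carrier_mat transpose_carrier_mat)+
  hence tc: "(W1\<^sup>T * A * W2)\<^sup>T \<in> mats n n" "(C1 * W2)\<^sup>T \<in> mats n d"
    "(W1\<^sup>T * B1)\<^sup>T \<in> mats d n" "D1\<^sup>T \<in> mats d d" using D1 by auto
  have P: "?P \<in> mats n (n + d)" and I: "?I \<in> mats n (n + d)"
    and K: "?K \<in> mats d (n + d)" and O': "?O \<in> mats d (n + d)"
    using tc by auto
  have c1: "?I\<^sup>T * Y * ?I \<in> mats (n + d) (n + d)" using I Y by (meson mult_carrier_mat transpose_carrier_mat)
  have c2: "?P\<^sup>T * minv Y * ?P \<in> mats (n + d) (n + d)" using P mY(1) by (meson mult_carrier_mat transpose_carrier_mat)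
  have c3: "?O\<^sup>T * ?K \<in> mats (n + d) (n + d)" using K O' by (meson mult_carrier_mat transpose_carrier_mat)
  have c4: "?K\<^sup>T * ?O \<in> mats (n + d) (n + d)" using K O' by (meson mult_carrier_mat transpose_carrier_mat)
  have dm: "dual_mat W1 W2 = ?I\<^sup>T * Y * ?I - ?P\<^sup>T * minv Y * ?P
        - ?O\<^sup>T * ?K - ?K\<^sup>T * ?O"
    unfolding dual_mat_def Let_def Y_def ..
  show M: "dual_mat W1 W2 \<in> mats (n + d) (n + d)" unfolding dm by (rule form_of_sum(2)[OF c1 c2 c3 c4 zero_carrier_vec zero_carrier_vec])
  have f: "u \<bullet> (dual_mat W1 W2 *v v) = (?I *v u) \<bullet> (Y *v (?I *v v)) - (?P *v u) \<bullet> (minv Y *v (?P *v v))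
      - (?O *v u) \<bullet> (?K *v v) - (?K *v u) \<bullet> (?O *v v)"
    if u: "u \<in> vecs (n + d)" and v: "v \<in> vecs (n + d)" for u v
  proof -
    show ?thesis
      using form_of_sum(4)[OF c1 c2 c3 c4 u v, folded dm] scalar_prod_transpose_mult3[OF I Y I u v]
        scalar_prod_transpose_mult3[OF P mY(1) P u v] scalar_prod_transpose_mult[OF O' K u v]
        scalar_prod_transpose_mult[OF K O' u v] by linarith
  qed
  have mc: "?P *v u \<in> vecs n" "?I *v u \<in> vecs n" "?K *v u \<in> vecs d" "?O *v u \<in> vecs d"
    if "u \<in> vecs (n + d)" for u using mult_mat_vec_carrier[OF P that] mult_mat_vec_carrier[OF I that]
      mult_mat_vec_carrier[OF K that] mult_mat_vec_carrier[OF O' that] by auto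
  show "sym_mat (dual_mat W1 W2)"
  proof (rule sym_mat_by_form[OF M])
    fix u v :: "real vec" assume uv: "u \<in> vecs (n + d)" "v \<in> vecs (n + d)"
    show "u \<bullet> (dual_mat W1 W2 *v v) = v \<bullet> (dual_mat W1 W2 *v u)"
      unfolding f[OF uv] f[OF uv(2,1)]
      using smY[OF mc(1)[OF uv(1)] mc(1)[OF uv(2)]] sym_matD[OF sY' Y mc(2)[OF uv(1)] mc(2)[OF uv(2)]]
        comm_scalar_prod[OF mc(3)[OF uv(1)] mc(4)[OF uv(2)]] comm_scalar_prod[OF mc(4)[OF uv(1)] mc(3)[OF uv(2)]]
      by simp
  qed
  fix s q :: "real vec" assume s: "s \<in> vecs n" and q: "q \<in> vecs d"
  have sq: "s @v q \<in> vecs (n + d)" using s q by simp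
  have W1s: "W1 *v s \<in> vecs n" using W s by simp
  have tm: "A\<^sup>T \<in> mats n n" "C1\<^sup>T \<in> mats n d" "B1\<^sup>T \<in> mats d n"
    "W2\<^sup>T \<in> mats n n" "W1\<^sup>T \<in> mats n n" using A C1 B1 W by auto
  have e1: "(W1\<^sup>T * A * W2)\<^sup>T *v s = W2\<^sup>T *v (A\<^sup>T *v (W1 *v s))"
  proof -
    have "(W1\<^sup>T * A * W2)\<^sup>T = W2\<^sup>T * (A\<^sup>T * W1)"
      using tm W A by (simp add: transpose_mult[of _ n n _ n])
    thus ?thesis using tm W s by (simp add: assoc_mult_mat_vec[of _ n n _ n])
  qed
  have e2: "(C1 * W2)\<^sup>T *v q = W2\<^sup>T *v (C1\<^sup>T *v q)"
    using C1 W q tm by (simp add: transpose_mult[of _ d n _ n] assoc_mult_mat_vec[of _ n n _ d])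
  have e3: "(W1\<^sup>T * B1)\<^sup>T *v s = B1\<^sup>T *v (W1 *v s)"
    using B1 W s tm by (simp add: transpose_mult[of _ n n _ d] assoc_mult_mat_vec[of _ d n _ n])
  have Ps: "?P *v (s @v q) = W2\<^sup>T *v (A\<^sup>T *v (W1 *v s) + C1\<^sup>T *v q)"
  proof -
    have "A\<^sup>T *v (W1 *v s) \<in> vecs n" "C1\<^sup>T *v q \<in> vecs n"
      using mult_mat_vec_carrier[OF tm(1) W1s] mult_mat_vec_carrier[OF tm(2) q] by auto
    thus ?thesis unfolding append_columns_mult[OF tc(1,2) s q] e1 e2
      by (simp add: mult_add_distrib_mat_vec[OF tm(4)])
  qed
  have Ks: "?K *v (s @v q) = B1\<^sup>T *v (W1 *v s) + D1\<^sup>T *v q"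
    unfolding append_columns_mult[OF tc(3,4) s q] e3 ..
  have kc: "B1\<^sup>T *v (W1 *v s) + D1\<^sup>T *v q \<in> vecs d"
    using mult_mat_vec_carrier[OF tm(3) W1s] mult_mat_vec_carrier[OF tc(4) q] by simp
  show "(s @v q) \<bullet> (dual_mat W1 W2 *v (s @v q)) = s \<bullet> ((W1\<^sup>T * W2) *v s)
      - (W2\<^sup>T *v (A\<^sup>T *v (W1 *v s) + C1\<^sup>T *v q)) \<bullet>
        (minv (W1\<^sup>T * W2) *v (W2\<^sup>T *v (A\<^sup>T *v (W1 *v s) + C1\<^sup>T *v q)))
      - 2 * (q \<bullet> (B1\<^sup>T *v (W1 *v s) + D1\<^sup>T *v q))"
    unfolding f[OF sq sq] selectors[OF s q] Ps Ks Y_def[symmetric]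
    using comm_scalar_prod[OF q kc] by simp
qed

end

lemma vec_eq_by_scalar_prod:
  assumes "a \<in> vecs m" "b \<in> vecs m" "\<And>u. u \<in> vecs m \<Longrightarrow> a \<bullet> u = b \<bullet> (u :: real vec)"
  shows "a = b"
proof -
  have "sq (a - b) = a \<bullet> (a - b) - b \<bullet> (a - b)"
    using assms(1,2) by (simp add: minus_scalar_prod_distrib[of _ m])
  also have "\<dots> = 0" using assms(3)[of "a - b"] assms(1,2) by simp
  finally have "a - b = 0v m" using sq_eq_0[of "a - b" m] assms(1,2) by simp
  hence "b + (a - b) = b + 0v m" by simp
  thus ?thesis using vec_add_diff_cancel[OF assms(2,1)] assms(2) by simp
qed

section \<open>The synthesis condition as matrix inequalities\<close>

context youla_lmi begin

text \<open>\<open>bW1\<close> alters only the first block of a vector, to which the transpose of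
  \<open>B\<close> is blind.\<close>

lemma transpose_B_bW1:
  assumes W: "W11 \<in> mats n1 n1" "W12 \<in> mats n1 n2" and s: "s \<in> vecs n"
  shows "B\<^sup>T *v (bW1 W11 W12 *v s) = B\<^sup>T *v s"
proof (rule vec_eq_by_scalar_prod)
  obtain s1 s2 where s12: "s = s1 @v s2" "s1 \<in> vecs n1" "s2 \<in> vecs n2"
    using s vec_first_last_append[of s n1 n2] vec_first_carrier vec_last_carrier unfolding n by metis
  have W1s: "bW1 W11 W12 *v s = (W11 *v s1 + W12 *v s2) @v s2"
    unfolding s12(1) by (rule bW1_mult[OF W s12(2,3)])
  have c1: "W11 *v s1 + W12 *v s2 \<in> vecs n1" using W s12 by simp
  have W1c: "bW1 W11 W12 *v s \<in> vecs n" unfolding W1s n using c1 s12 by simp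
  show "B\<^sup>T *v (bW1 W11 W12 *v s) \<in> vecs nu" "B\<^sup>T *v s \<in> vecs nu"
    using B W1c s by (meson mult_mat_vec_carrier transpose_carrier_mat)+
  fix u :: "real vec" assume u: "u \<in> vecs nu"
  have Bu: "B *v u = 0v n1 @v (B22 *v u)"
    unfolding B_split using B22 u by (subst mat_mult_append[of _ n1 nu _ n2]) (auto simp: zero_mat_mult_vec)
  have c: "B22 *v u \<in> vecs n2" using B22 u by simp
  have "(a @v s2) \<bullet> (B *v u) = s2 \<bullet> (B22 *v u)" if "a \<in> vecs n1" for a
    unfolding Bu using scalar_prod_append[OF that s12(3) zero_carrier_vec c] that by simp
  thus "(B\<^sup>T *v (bW1 W11 W12 *v s)) \<bullet> u = (B\<^sup>T *v s) \<bullet> u"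
    unfolding transpose_vec_mult_scalar[OF B u W1c] transpose_vec_mult_scalar[OF B u s]
    unfolding W1s unfolding s12(1) using c1 s12(2) by simp
qed

lemma big_form:
  fixes X W1 Y :: "real mat"
  assumes X: "X \<in> mats n n" and W: "W1 \<in> mats n n" and Y: "Y \<in> mats n n"
    and c: "x \<in> vecs n" "t \<in> vecs n" "x' \<in> vecs n" "t' \<in> vecs n"
  shows "(x @v t) \<bullet> (four_block_mat X W1 (W1\<^sup>T) Y *v (x' @v t')) =
    x \<bullet> (X *v x') + x \<bullet> (W1 *v t') + (W1 *v t) \<bullet> x' + t \<bullet> (Y *v t')"
proof -
  have tW: "W1\<^sup>T \<in> mats n n" using W by simp
  have cc: "X *v x' \<in> vecs n" "W1 *v t' \<in> vecs n" "W1\<^sup>T *v x' \<in> vecs n"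
    "Y *v t' \<in> vecs n" using mult_mat_vec_carrier X W Y tW c by blast+
  have tWx: "W1\<^sup>T *v x' \<in> vecs n" by (rule mult_mat_vec_carrier[OF tW c(3)])
  have "t \<bullet> (W1\<^sup>T *v x') = (W1\<^sup>T *v x') \<bullet> t" by (rule comm_scalar_prod[OF c(2) tWx])
  also have "\<dots> = x' \<bullet> (W1 *v t)" by (rule transpose_vec_mult_scalar[OF W c(2,3)])
  also have "\<dots> = (W1 *v t) \<bullet> x'" by (rule comm_scalar_prod[of _ n]) (use W c in auto)
  finally have e: "t \<bullet> (W1\<^sup>T *v x') = (W1 *v t) \<bullet> x'" .
  show ?thesis
    unfolding four_block_mat_mult_vec[OF X W tW Y c(3,4)]
    using scalar_prod_append[OF c(1,2), of "X *v x' + W1 *v t'" "W1\<^sup>T *v x' + Y *v t'"] cc c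
    by (simp add: scalar_prod_add_distrib[of _ n] e)
qed

lemma split2:
  assumes "v \<in> vecs (n + n)"
  obtains x t where "x \<in> vecs n" "t \<in> vecs n" "v = x @v (t :: real vec)"
  by (rule that[OF vec_first_carrier vec_last_carrier vec_first_last_append[OF assms, symmetric]])

lemma big_Y:
  assumes X: "X \<in> mats n n" and W: "W1 \<in> mats n n" and Y: "Y \<in> mats n n"
    and p: "pos_def (four_block_mat X W1 (W1\<^sup>T) Y)"
  shows "sym_mat Y" "\<And>t. t \<in> vecs n \<Longrightarrow> t \<noteq> 0v n \<Longrightarrow> 0 < t \<bullet> (Y *v t)"
proof -
  let ?G = "four_block_mat X W1 (W1\<^sup>T) Y"
  have G: "?G \<in> mats (n + n) (n + n)" using X Y by simp
  have z: "0v n \<in> (vecs n :: real vec set)" by simp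
  have f: "(0v n @v s) \<bullet> (?G *v (0v n @v t)) = s \<bullet> (Y *v t)"
    if "s \<in> vecs n" "t \<in> vecs n" for s t
  proof -
    have "W1 *v s \<in> vecs n" "W1 *v t \<in> vecs n" "X *v 0v n \<in> vecs n"
      using W X that z by (meson mult_mat_vec_carrier)+
    thus ?thesis using big_form[OF X W Y z that(1) z that(2)] by simp
  qed
  show "sym_mat Y"
  proof (rule sym_mat_by_form[OF Y])
    fix s t :: "real vec" assume st: "s \<in> vecs n" "t \<in> vecs n"
    have "sym_mat ?G" using p by (simp add: pos_def_def)
    from sym_matD[OF this G, of "0v n @v s" "0v n @v t"] show "s \<bullet> (Y *v t) = t \<bullet> (Y *v s)"
      using st by (simp add: f)
  qed
  fix t :: "real vec" assume t: "t \<in> vecs n" "t \<noteq> 0v n"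
  have "0v n @v t \<noteq> 0v (n + n)" using t by (simp add: append_eq_0)
  thus "0 < t \<bullet> (Y *v t)" using p t f[OF t(1) t(1)] X Y unfolding pos_def_def
    by (metis G append_carrier_vec carrier_matD(1) z)
qed

text \<open>With \<open>N x = x \<bullet> g x\<close> for \<open>g = W1 W2^-1\<close> one has
  \<open>N (W2 t) = t \<bullet> (Y t)\<close>. The block inequality with \<open>X\<close> then
  becomes \<open>N < X\<close> by a Schur complement. The inequality with \<open>V\<close> becomes
  the dual condition under the substitution \<open>P = W1 s\<close>.\<close>

lemma dual_param:
  assumes W: "W11 \<in> mats n1 n1" "W12 \<in> mats n1 n2" "W22 \<in> mats n2 n2"
    and W1_def: "W1 = bW1 W11 W12" and W2_def: "W2 = bW2 W12 W22" and Y_def: "Y = W1\<^sup>T * W2"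
    and sY: "sym_mat Y" and pY': "\<forall>t. t \<in> vecs n \<longrightarrow> t \<noteq> 0v n \<longrightarrow> 0 < t \<bullet> (Y *v t)"
    and X: "X \<in> mats n n" and sX: "sym_mat X"
  shows "\<exists>N. qform n N \<and> (\<forall>x \<in> vecs n. x \<noteq> 0v n \<longrightarrow> 0 < N x) \<and>
    (\<forall>x \<in> vecs n. \<exists>t \<in> vecs n. x = W2 *v t \<and> N x = t \<bullet> (Y *v t)) \<and>
    (pos_def (four_block_mat X W1 (W1\<^sup>T) Y) \<longleftrightarrow>
       (\<forall>x \<in> vecs n. x \<noteq> 0v n \<longrightarrow> N x < x \<bullet> (X *v x))) \<and>
    (pos_def (V\<^sup>T * dual_mat W1 W2 * V) \<longleftrightarrow> reply_cond N)"
proof -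
  note pY = pY'[rule_format]
  have W12: "W1 \<in> mats n n" "W2 \<in> mats n n" using bW_carrier[OF W] by (auto simp: W1_def W2_def n)
  have Y: "Y \<in> mats n n" using W12 by (simp add: Y_def)
  have Yf: "s \<bullet> (Y *v t) = (W1 *v s) \<bullet> (W2 *v t)" if "s \<in> vecs n" "t \<in> vecs n" for s t
    unfolding Y_def by (rule scalar_prod_transpose_mult[OF W12 that])
  have W1c: "W1 *v s \<in> vecs n" "W2 *v s \<in> vecs n" if "s \<in> vecs n" for s
    using mult_mat_vec_carrier[OF W12(1) that] mult_mat_vec_carrier[OF W12(2) that] by auto
  \<comment> \<open>Positivity of \<open>Y = W1^T W2\<close> forces both factors to be injective,
    hence invertible.\<close>
  have i1: "W1 *v t \<noteq> 0v n" if t: "t \<in> vecs n" "t \<noteq> 0v n" for t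
    using pY[OF t] Yf[OF t(1) t(1)] W1c[OF t(1)] by auto
  have i2: "W2 *v t \<noteq> 0v n" if t: "t \<in> vecs n" "t \<noteq> 0v n" for t
    using pY[OF t] Yf[OF t(1) t(1)] W1c[OF t(1)] by auto
  have iY: "Y *v t \<noteq> 0v n" if t: "t \<in> vecs n" "t \<noteq> 0v n" for t using pY[OF t] t(1) by auto
  obtain V1 where V1: "lin n n V1" "\<And>x. x \<in> vecs n \<Longrightarrow> W1 *v V1 x = x" "\<And>x. x \<in> vecs n \<Longrightarrow> V1 (W1 *v x) = x"
    using pos_def_inverse[OF lin_mult_mat[OF W12(1)] i1] by metis
  obtain V2 where V2: "lin n n V2" "\<And>x. x \<in> vecs n \<Longrightarrow> W2 *v V2 x = x" "\<And>x. x \<in> vecs n \<Longrightarrow> V2 (W2 *v x) = x"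
    using pos_def_inverse[OF lin_mult_mat[OF W12(2)] i2] by metis
  define g where "g x = W1 *v V2 x" for x
  define h where "h x = W2 *v V1 x" for x
  define N where "N x = x \<bullet> g x" for x
  have g: "lin n n g" unfolding g_def by (rule lin_mat[OF W12(1) V2(1)])
  have h: "lin n n h" unfolding h_def by (rule lin_mat[OF W12(2) V1(1)])
  have V1c: "V1 x \<in> vecs n" "V2 x \<in> vecs n" if "x \<in> vecs n" for x
    using linD(1)[OF V1(1) that] linD(1)[OF V2(1) that] by auto
  have gh: "g (h x) = x" "h (g x) = x" if "x \<in> vecs n" for x
    using that V1 V2 V1c by (simp_all add: g_def h_def)
  have N: "qform n N" unfolding N_def by (rule qform_lin[OF lin_id g])
  have gW: "g (W2 *v t) = W1 *v t" "h (W1 *v t) = W2 *v t" if "t \<in> vecs n" for t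
    using that by (simp_all add: g_def h_def V1 V2)
  have sym: "x \<bullet> g y = y \<bullet> g x" if x: "x \<in> vecs n" and y: "y \<in> vecs n" for x y
  proof -
    have e: "x \<bullet> g y = V2 y \<bullet> (Y *v V2 x)" if "x \<in> vecs n" "y \<in> vecs n" for x y
      using Yf[of "V2 y" "V2 x"] V1c that V2(2) W1c comm_scalar_prod[of x n "W1 *v V2 y"] by (simp add: g_def)
    show ?thesis unfolding e[OF x y] e[OF y x] by (rule sym_matD[OF sY Y]) (use V1c x y in auto)
  qed
  have NW: "N (W2 *v t) = t \<bullet> (Y *v t)" if "t \<in> vecs n" for t
    using Yf[OF that that] W1c[OF that] by (simp add: N_def gW[OF that] comm_scalar_prod[of _ n])
  have pos: "N x > 0" if x: "x \<in> vecs n" "x \<noteq> 0v n" for x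
  proof -
    have "V2 x \<noteq> 0v n" using V2(2)[OF x(1)] x(2) mult_mat_zero[OF W12(2)] by auto
    thus ?thesis using NW[of "V2 x"] V2(2)[OF x(1)] pY[of "V2 x"] V1c[OF x(1)] by simp
  qed
  have Nnn: "N x \<ge> 0" if "x \<in> vecs n" for x
    using pos[OF that] qform_zero_arg[OF N] by (cases "x = 0v n") auto
  let ?G = "four_block_mat X W1 (W1\<^sup>T) Y"
  have G: "?G \<in> mats (n + n) (n + n)" using X Y by simp
  \<comment> \<open>Completing the square in \<open>t\<close>; since \<open>W2\<close> is onto, the
    last term can be made 0 for every \<open>x\<close>.\<close>
  have Gf: "(x @v t) \<bullet> (?G *v (x @v t)) = x \<bullet> (X *v x) - N x + N (x + W2 *v t)"
    if x: "x \<in> vecs n" and t: "t \<in> vecs n" for x t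
  proof -
    have "N (x + W2 *v t) = N x + x \<bullet> (W1 *v t) + (W2 *v t) \<bullet> g x + N (W2 *v t)"
      using x W1c[OF t] linD(1)[OF g x] unfolding N_def linD(2)[OF g x W1c(2)[OF t]] gW[OF t]
      by (simp add: scalar_prod_add_distrib[of _ n] add_scalar_prod_distrib[of _ n])
    also have "(W2 *v t) \<bullet> g x = x \<bullet> (W1 *v t)" using sym[OF W1c(2)[OF t] x] by (simp add: gW[OF t])
    finally show ?thesis unfolding big_form[OF X W12(1) Y x t x t] NW[OF t]
      using comm_scalar_prod[OF x W1c(1)[OF t]] by simp
  qed
  have Gsym: "sym_mat ?G"
  proof (rule sym_mat_by_form[OF G])
    fix v v' :: "real vec" assume "v \<in> vecs (n + n)" "v' \<in> vecs (n + n)"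
    then obtain x t x' t' where c: "x \<in> vecs n" "t \<in> vecs n" "x' \<in> vecs n" "t' \<in> vecs n"
      and v: "v = x @v t" "v' = x' @v t'" by (metis split2)
    show "v \<bullet> (?G *v v') = v' \<bullet> (?G *v v)"
      unfolding v big_form[OF X W12(1) Y c] big_form[OF X W12(1) Y c(3,4,1,2)]
      using sym_matD[OF sX X c(1,3)] sym_matD[OF sY Y c(2,4)]
        comm_scalar_prod[OF c(1) W1c(1)[OF c(4)]] comm_scalar_prod[OF c(3) W1c(1)[OF c(2)]] by simp
  qed
  have E1: "pos_def ?G \<longleftrightarrow> (\<forall>x \<in> vecs n. x \<noteq> 0v n \<longrightarrow> N x < x \<bullet> (X *v x))"
  proof
    assume p: "pos_def ?G"
    show "\<forall>x \<in> vecs n. x \<noteq> 0v n \<longrightarrow> N x < x \<bullet> (X *v x)"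
    proof (intro ballI impI)
      fix x :: "real vec" assume x: "x \<in> vecs n" "x \<noteq> 0v n"
      have t: "V2 (- x) \<in> vecs n" using V1c x by simp
      have "x @v V2 (- x) \<noteq> 0v (n + n)" using x t by (simp add: append_eq_0)
      hence "0 < (x @v V2 (- x)) \<bullet> (?G *v (x @v V2 (- x)))"
        using p x(1) t G unfolding pos_def_def by (metis append_carrier_vec carrier_matD(1))
      moreover have "x + W2 *v V2 (- x) = 0v n" using V2(2)[of "- x"] x by simp
      ultimately show "N x < x \<bullet> (X *v x)" unfolding Gf[OF x(1) t] using qform_zero_arg[OF N] by simp
    qed
  next
    assume p: "\<forall>x \<in> vecs n. x \<noteq> 0v n \<longrightarrow> N x < x \<bullet> (X *v x)"
    have d: "dim_row ?G = n + n" using G by blast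
    show "pos_def ?G" unfolding pos_def_def d
    proof (intro conjI ballI impI Gsym)
      fix v :: "real vec" assume v: "v \<in> vecs (n + n)" "v \<noteq> 0v (n + n)"
      obtain x t where c: "x \<in> vecs n" "t \<in> vecs n" and vx: "v = x @v t" using split2[OF v(1)] by metis
      have xt: "x + W2 *v t \<in> vecs n" using c W1c by simp
      show "0 < v \<bullet> (?G *v v)" unfolding vx Gf[OF c]
      proof (cases "x = 0v n")
        case True
        hence "t \<noteq> 0v n" using v(2) c unfolding vx by (simp add: append_eq_0)
        hence "N (W2 *v t) > 0" using pos i2 c W1c by blast
        thus "0 < x \<bullet> (X *v x) - N x + N (x + W2 *v t)"
          using True c W1c[OF c(2)] qform_zero_arg[OF N] mult_mat_zero[OF X] by simp
      next
        case False
        thus "0 < x \<bullet> (X *v x) - N x + N (x + W2 *v t)" using p c(1) Nnn[OF xt] by fastforce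
      qed
    qed
  qed
  have tA: "A\<^sup>T \<in> mats n n" "C1\<^sup>T \<in> mats n d" using A C1 by auto
  \<comment> \<open>Symmetry of \<open>Y\<close> gives \<open>W2^T a = Y (V1 a)\<close>, so the
    inverse of \<open>Y\<close> cancels and only \<open>a \<bullet> h a\<close> is left.\<close>
  have DM: "(s @v q) \<bullet> (dual_mat W1 W2 *v (s @v q)) = dual_form h (W1 *v s) q"
    if s: "s \<in> vecs n" and q: "q \<in> vecs d" for s q
  proof -
    define a where "a = A\<^sup>T *v (W1 *v s) + C1\<^sup>T *v q"
    have a: "a \<in> vecs n"
      using mult_mat_vec_carrier[OF tA(1) W1c(1)[OF s]] mult_mat_vec_carrier[OF tA(2) q] by (simp add: a_def)
    have t: "V1 a \<in> vecs n" using V1c a by simp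
    have "W2\<^sup>T *v a = Y *v V1 a"
    proof -
      have "Y\<^sup>T = W2\<^sup>T * W1" unfolding Y_def using W12 by (simp add: transpose_mult[of _ n n _ n])
      hence "Y = W2\<^sup>T * W1" using sY by (simp add: sym_mat_def)
      hence "Y *v V1 a = W2\<^sup>T *v (W1 *v V1 a)" using W12 t by (simp add: assoc_mult_mat_vec[of _ n n _ n])
      thus ?thesis by (simp add: V1(2)[OF a])
    qed
    moreover have "minv Y *v (Y *v V1 a) = V1 a"
      using minv_props[OF Y iY] assoc_mult_mat_vec[OF _ Y t, of "minv Y" n] t by simp
    ultimately have "(W2\<^sup>T *v a) \<bullet> (minv Y *v (W2\<^sup>T *v a)) = (W2\<^sup>T *v a) \<bullet> V1 a"
      by simp
    also have "\<dots> = a \<bullet> h a" unfolding h_def by (rule transpose_vec_mult_scalar[OF W12(2) t a])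
    finally have e: "(W2\<^sup>T *v a) \<bullet> (minv Y *v (W2\<^sup>T *v a)) = a \<bullet> h a" .
    show ?thesis
      using dual_mat(3)[OF W12 sY[unfolded Y_def] iY[unfolded Y_def] s q] e Yf[OF s s]
      unfolding dual_form_def gW(2)[OF s] a_def[symmetric] Y_def[symmetric] by simp
  qed
  have tB: "B\<^sup>T \<in> mats nu n" "E\<^sup>T \<in> mats nu d" using B E by auto
  have ker: "(B\<^sup>T @\<^sub>c E\<^sup>T) *v (s @v q) = B\<^sup>T *v (W1 *v s) + E\<^sup>T *v q"
    if "s \<in> vecs n" "q \<in> vecs d" for s q
    unfolding append_columns_mult[OF tB that] W1_def transpose_B_bW1[OF W(1,2) that(1)] ..
  have "pos_def (V\<^sup>T * dual_mat W1 W2 * V) \<longleftrightarrow> (\<forall>x \<in> vecs (n + d). x \<noteq> 0v (n + d) \<longrightarrow>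
      (B\<^sup>T @\<^sub>c E\<^sup>T) *v x = 0v nu \<longrightarrow> 0 < x \<bullet> (dual_mat W1 W2 *v x))"
    by (rule pos_def_on_kernel(1)[OF V dual_mat(1,2)[OF W12 sY[unfolded Y_def] iY[unfolded Y_def]]])
  also have "\<dots> \<longleftrightarrow> dual_cond h"
  proof
    assume p: "\<forall>x \<in> vecs (n + d). x \<noteq> 0v (n + d) \<longrightarrow>
      (B\<^sup>T @\<^sub>c E\<^sup>T) *v x = 0v nu \<longrightarrow> 0 < x \<bullet> (dual_mat W1 W2 *v x)"
    show "dual_cond h" unfolding dual_cond_def
    proof (intro ballI impI)
      fix P q :: "real vec" assume P: "P \<in> vecs n" and q: "q \<in> vecs d" and nz: "P @v q \<noteq> 0v (n + d)"
        and k: "B\<^sup>T *v P + E\<^sup>T *v q = 0v nu"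
      have s: "V1 P \<in> vecs n" and Pe: "W1 *v V1 P = P" using V1c V1(2) P by auto
      have "V1 P @v q \<noteq> 0v (n + d)" using nz s q P Pe mult_mat_zero[OF W12(1)] by (auto simp: append_eq_0)
      moreover have "V1 P @v q \<in> vecs (n + d)" using s q by simp
      ultimately show "0 < dual_form h P q" using p ker[OF s q] DM[OF s q] k Pe by metis
    qed
  next
    assume D: "dual_cond h"
    show "\<forall>x \<in> vecs (n + d). x \<noteq> 0v (n + d) \<longrightarrow>
      (B\<^sup>T @\<^sub>c E\<^sup>T) *v x = 0v nu \<longrightarrow> 0 < x \<bullet> (dual_mat W1 W2 *v x)"
    proof (intro ballI impI)
      fix v :: "real vec" assume v: "v \<in> vecs (n + d)" "v \<noteq> 0v (n + d)"
        "(B\<^sup>T @\<^sub>c E\<^sup>T) *v v = 0v nu"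
      obtain s q where c: "s \<in> vecs n" "q \<in> vecs d" and vs: "v = s @v q" using splitv[OF v(1)] by metis
      have "W1 *v s @v q \<noteq> 0v (n + d)"
      proof
        assume "W1 *v s @v q = 0v (n + d)"
        hence "W1 *v s = 0v n" "q = 0v d" using W12(1) c by (auto simp: append_eq_0)
        thus False using v(2) c i1[OF c(1)] unfolding vs by (auto simp: append_eq_0)
      qed
      thus "0 < v \<bullet> (dual_mat W1 W2 *v v)"
        unfolding vs DM[OF c] using D W1c(1)[OF c(1)] c(2) v(3) ker[OF c] unfolding vs dual_cond_def by metis
    qed
  qed
  also have "\<dots> \<longleftrightarrow> reply_cond N"
    using reply_iff_dual[of g h N, OF g h gh N _ sym pos] by (simp add: N_def)
  finally have E2: "pos_def (V\<^sup>T * dual_mat W1 W2 * V) \<longleftrightarrow> reply_cond N" .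
  show ?thesis
  proof (intro exI[of _ N] conjI N E1 E2)
    show "\<forall>x \<in> vecs n. x \<noteq> 0v n \<longrightarrow> 0 < N x" using pos by blast
    show "\<forall>x \<in> vecs n. \<exists>t \<in> vecs n. x = W2 *v t \<and> N x = t \<bullet> (Y *v t)"
      using V1c(2) V2(2) NW by metis
  qed
qed

lemma primal_cond_iff:
  assumes X: "X \<in> mats n n" and sX: "sym_mat X"
  shows "neg_def (U\<^sup>T * primal_mat X * U) \<longleftrightarrow>
    (\<forall>x \<in> vecs n. \<forall>w \<in> vecs d. x @v w \<noteq> 0v (n + d) \<longrightarrow> C *v x + F *v w = 0v p \<longrightarrow>
      (A *v x + B1 *v w) \<bullet> (X *v (A *v x + B1 *v w)) - x \<bullet> (X *v x) + 2 * (w \<bullet> (C1 *v x + D1 *v w)) < 0)"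
proof -
  have e: "(C @\<^sub>c F) *v (x @v w) = C *v x + F *v w"
    if "x \<in> vecs n" "w \<in> vecs d" for x w by (rule append_columns_mult[OF C F that])
  show ?thesis
    unfolding pos_def_on_kernel(2)[OF U primal_mat(1,2)[OF X sX]] all_vec_append
    by (intro ball_cong refl) (simp only: primal_mat(3)[OF X sX] e)
qed

lemma lmi_imp_synthesis:
  assumes "lmi X W11 W12 W22"
  shows synthesis
proof -
  have X: "X \<in> mats n n" "sym_mat X"
    and W: "W11 \<in> mats n1 n1" "W12 \<in> mats n1 n2" "W22 \<in> mats n2 n2"
    using assms by (auto simp: lmi_def)
  let ?W1 = "bW1 W11 W12" and ?W2 = "bW2 W12 W22"
  have W12: "?W1 \<in> mats n n" "?W2 \<in> mats n n" using bW_carrier[OF W] by (auto simp: n)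
  have Y: "?W1\<^sup>T * ?W2 \<in> mats n n" using W12 by simp
  have big: "pos_def (four_block_mat X ?W1 (?W1\<^sup>T) (?W1\<^sup>T * ?W2))"
    and pr: "neg_def (U\<^sup>T * primal_mat X * U)"
    and du: "pos_def (V\<^sup>T * dual_mat ?W1 ?W2 * V)" using assms unfolding lmi_def by auto
  have sY: "sym_mat (?W1\<^sup>T * ?W2)" by (rule big_Y(1)[OF X(1) W12(1) Y big])
  have pY: "\<forall>t. t \<in> vecs n \<longrightarrow> t \<noteq> 0v n \<longrightarrow> 0 < t \<bullet> ((?W1\<^sup>T * ?W2) *v t)"
    using big_Y(2)[OF X(1) W12(1) Y big] by blast
  obtain N where N: "qform n N" "\<forall>x \<in> vecs n. x \<noteq> 0v n \<longrightarrow> 0 < N x"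
    "pos_def (four_block_mat X ?W1 (?W1\<^sup>T) (?W1\<^sup>T * ?W2)) \<longleftrightarrow>
       (\<forall>x \<in> vecs n. x \<noteq> 0v n \<longrightarrow> N x < x \<bullet> (X *v x))"
    "pos_def (V\<^sup>T * dual_mat ?W1 ?W2 * V) \<longleftrightarrow> reply_cond N"
    using dual_param[OF W refl refl refl sY pY X] by (elim exE conjE) (rule that)
  have "qform n (\<lambda>x. x \<bullet> (X *v x))" by (rule qform_lin[OF lin_id lin_mult_mat[OF X(1)]])
  thus ?thesis unfolding synthesis_def
    using N(1,2) N(3)[THEN iffD1, OF big] N(4)[THEN iffD1, OF du, unfolded reply_cond_def]
      primal_cond_iff[OF X, THEN iffD1, OF pr]
    by (intro exI[of _ "\<lambda>x. x \<bullet> (X *v x)"] exI[of _ N]) simp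
qed

text \<open>Every positive \<open>N\<close> has the required factorisation, obtained by completing
  its square in the second block: \<open>W11\<close> is the partial minimum, \<open>- W12^T\<close>
  its minimiser \<open>R\<close>, and \<open>W22\<close> the inverse of the second diagonal
  block.\<close>

lemma synthesis_imp_lmi:
  assumes synthesis
  shows "\<exists>X W11 W12 W22. lmi X W11 W12 W22"
proof -
  from assms[unfolded synthesis_def] obtain X N where X: "qform n X" and N: "qform n N"
    and XN: "\<forall>x \<in> vecs n. x \<noteq> 0v n \<longrightarrow> 0 < N x \<and> N x < X x"
    and primal: "\<forall>x \<in> vecs n. \<forall>w \<in> vecs d. x @v w \<noteq> 0v (n + d) \<longrightarrow>
      C *v x + F *v w = 0v p \<longrightarrow> X (A *v x + B1 *v w) - X x + 2 * (w \<bullet> (C1 *v x + D1 *v w)) < 0"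
    and reply: "\<forall>x \<in> vecs n. \<forall>w \<in> vecs d. x @v w \<noteq> 0v (n + d) \<longrightarrow> (\<exists>u \<in> vecs nu.
        N (A *v x + B1 *v w + B *v u) - N x + 2 * (w \<bullet> (C1 *v x + D1 *v w + E *v u)) < 0)"
    by (elim exE conjE) (rule that)
  from X obtain XM where XM: "XM \<in> mats n n" "XM\<^sup>T = XM"
    and Xe: "\<And>x. x \<in> vecs n \<Longrightarrow> X x = x \<bullet> (XM *v x)" unfolding qform_def by blast
  have sX: "sym_mat XM" using XM by (auto simp: sym_mat_def)
  have N': "qform (n1 + n2) N" using N by (simp add: n)
  have posN: "N x > 0" if "x \<in> vecs n" "x \<noteq> 0v n" for x using XN that by blast
  have pos2: "N (0v n1 @v y) > 0" if y: "y \<in> vecs n2" "y \<noteq> 0v n2" for y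
  proof (rule posN)
    show "0v n1 @v y \<in> vecs n" unfolding n using y by simp
    show "0v n1 @v y \<noteq> 0v n" unfolding n using y by (simp add: append_eq_0)
  qed
  obtain R where R: "lin n1 n2 R" "\<And>x y. x \<in> vecs n1 \<Longrightarrow> y \<in> vecs n2 \<Longrightarrow>
     N (x @v y) = N (x @v R x) + N (0v n1 @v (y - R x))"
    using partial_min[OF N' pos2] by metis
  have "qform n1 (\<lambda>x. N (x @v R x))" by (rule qform_comp[OF lin_append[OF lin_id R(1)] N'])
  then obtain W11 where W11: "W11 \<in> mats n1 n1" "W11\<^sup>T = W11"
    and W11e: "\<And>x. x \<in> vecs n1 \<Longrightarrow> N (x @v R x) = x \<bullet> (W11 *v x)" unfolding qform_def by blast
  have "qform n2 (\<lambda>y. N (0v n1 @v y))" by (rule qform_comp[OF lin_append[OF lin_zero lin_id] N'])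
  then obtain g2 where g2: "lin n2 n2 g2" "\<And>y. y \<in> vecs n2 \<Longrightarrow> N (0v n1 @v y) = y \<bullet> g2 y"
    "\<And>x y. x \<in> vecs n2 \<Longrightarrow> y \<in> vecs n2 \<Longrightarrow> x \<bullet> g2 y = y \<bullet> g2 x"
    using qformE by metis
  have "g2 y \<noteq> 0v n2" if y: "y \<in> vecs n2" "y \<noteq> 0v n2" for y
    using pos2[OF y] g2(2)[OF y(1)] y(1) by auto
  then obtain h2 where h2: "lin n2 n2 h2" "\<And>y. y \<in> vecs n2 \<Longrightarrow> g2 (h2 y) = y" "\<And>y. y \<in> vecs n2 \<Longrightarrow> h2 (g2 y) = y"
    using pos_def_inverse[OF g2(1)] by metis
  have h2c: "h2 y \<in> vecs n2" if "y \<in> vecs n2" for y by (rule linD(1)[OF h2(1) that])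
  have h2s: "x \<bullet> h2 y = y \<bullet> h2 x" if xy: "x \<in> vecs n2" "y \<in> vecs n2" for x y
    using g2(3)[OF h2c[OF xy(1)] h2c[OF xy(2)]] xy h2c comm_scalar_prod[of _ n2] by (metis h2(2))
  define W12 where "W12 = - (matf n1 n2 R)\<^sup>T"
  define W22 where "W22 = matf n2 n2 h2"
  have W12: "W12 \<in> mats n1 n2" and W22: "W22 \<in> mats n2 n2" by (auto simp: W12_def W22_def)
  have W22e: "W22 *v y = h2 y" if "y \<in> vecs n2" for y unfolding W22_def by (rule matf_mult[OF h2(1) that])
  have tW12: "W12\<^sup>T *v x = - R x" if x: "x \<in> vecs n1" for x
  proof -
    have "W12\<^sup>T = - matf n1 n2 R" unfolding W12_def by (intro eq_matI) auto
    hence "W12\<^sup>T *v x = - (matf n1 n2 R *v x)"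
      using x matf_carrier[of n1 n2 R] by (intro eq_vecI) (auto simp: scalar_prod_def sum_negf matf_def)
    thus ?thesis by (simp add: matf_mult[OF R(1) x])
  qed
  let ?W1 = "bW1 W11 W12" and ?W2 = "bW2 W12 W22"
  have W: "?W1 \<in> mats n n" "?W2 \<in> mats n n" using bW_carrier[OF W11(1) W12 W22] by (auto simp: n)
  define Y where "Y = ?W1\<^sup>T * ?W2"
  have Y: "Y \<in> mats n n" using W by (simp add: Y_def)
  have W2e: "?W2 *v (a @v b) = a @v (h2 b + R a)" if c: "a \<in> vecs n1" "b \<in> vecs n2" for a b
  proof -
    have "h2 b - (- R a) = h2 b + R a" using h2c[OF c(2)] linD(1)[OF R(1) c(1)] by (intro eq_vecI) auto
    thus ?thesis unfolding bW2_mult[OF W12 W22 c] tW12[OF c(1)] W22e[OF c(2)] by simp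
  qed
  have Ye: "(a' @v b') \<bullet> (Y *v (a @v b)) = a \<bullet> (W11 *v a') + b' \<bullet> h2 b"
    if c: "a \<in> vecs n1" "b \<in> vecs n2" "a' \<in> vecs n1" "b' \<in> vecs n2" for a b a' b'
  proof -
    have Ra: "R a \<in> vecs n2" and hb: "h2 b \<in> vecs n2" using linD(1)[OF R(1) c(1)] h2c[OF c(2)] by auto
    have ca: "W11 *v a' \<in> vecs n1" "W12 *v b' \<in> vecs n1"
      using mult_mat_vec_carrier[OF W11(1) c(3)] mult_mat_vec_carrier[OF W12 c(4)] by auto
    have "(W12 *v b') \<bullet> a = a \<bullet> (W12 *v b')" by (rule comm_scalar_prod[OF ca(2) c(1)])
    also have "\<dots> = (W12\<^sup>T *v a) \<bullet> b'" by (rule transpose_vec_mult_scalar[OF W12 c(4,1), symmetric])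
    also have "\<dots> = - (b' \<bullet> R a)" unfolding tW12[OF c(1)] using Ra c by (simp add: comm_scalar_prod[of _ n2])
    finally have e: "(W12 *v b') \<bullet> a = - (b' \<bullet> R a)" .
    have ab: "a @v b \<in> vecs n" "a' @v b' \<in> vecs n" unfolding n using c by auto
    have "(a' @v b') \<bullet> (Y *v (a @v b)) = (?W1 *v (a' @v b')) \<bullet> (?W2 *v (a @v b))"
      unfolding Y_def by (rule scalar_prod_transpose_mult[OF W ab(2,1)])
    also have "\<dots> = (W11 *v a' + W12 *v b') \<bullet> a + b' \<bullet> (h2 b + R a)"
      unfolding W2e[OF c(1,2)] bW1_mult[OF W11(1) W12 c(3,4)]
      by (rule scalar_prod_append[of _ n1 _ n2]) (use ca c Ra hb in auto)
    also have "\<dots> = (W11 *v a') \<bullet> a + b' \<bullet> h2 b"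
      using ca c Ra hb e by (simp add: add_scalar_prod_distrib[of _ n1] scalar_prod_add_distrib[of _ n2])
    finally show ?thesis using comm_scalar_prod[OF ca(1) c(1)] by simp
  qed
  have spl: "\<exists>a b. a \<in> vecs n1 \<and> b \<in> vecs n2 \<and> v = a @v b" if "v \<in> vecs n" for v :: "real vec"
    using that vec_first_last_append[of v n1 n2] vec_first_carrier vec_last_carrier unfolding n by metis
  have s11: "sym_mat W11" using W11 by (auto simp: sym_mat_def)
  have sY: "sym_mat Y"
  proof (rule sym_mat_by_form[OF Y])
    fix s t :: "real vec" assume "s \<in> vecs n" "t \<in> vecs n"
    then obtain a b a' b' where c: "a \<in> vecs n1" "b \<in> vecs n2" "a' \<in> vecs n1" "b' \<in> vecs n2"
      and st: "s = a @v b" "t = a' @v b'" using spl by metis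
    show "s \<bullet> (Y *v t) = t \<bullet> (Y *v s)"
      unfolding st Ye[OF c] Ye[OF c(3,4,1,2)] using sym_matD[OF s11 W11(1) c(1,3)] h2s[OF c(2,4)] by simp
  qed
  have NY: "N (?W2 *v t) = t \<bullet> (Y *v t)" if t0: "t \<in> vecs n" for t
  proof -
    obtain a b where c: "a \<in> vecs n1" "b \<in> vecs n2" and t: "t = a @v b" using spl[OF t0] by metis
    have Ra: "R a \<in> vecs n2" and hb: "h2 b \<in> vecs n2" using linD(1)[OF R(1) c(1)] h2c[OF c(2)] by auto
    have "h2 b + R a - R a = h2 b" using Ra hb by (intro eq_vecI) auto
    hence "N (a @v (h2 b + R a)) = a \<bullet> (W11 *v a) + h2 b \<bullet> b"
      using R(2)[OF c(1), of "h2 b + R a"] Ra hb by (simp add: W11e[OF c(1)] g2(2)[OF hb] h2(2)[OF c(2)])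
    thus ?thesis unfolding t W2e[OF c] Ye[OF c c] using comm_scalar_prod[OF hb c(2)] by simp
  qed
  have pY: "0 < t \<bullet> (Y *v t)" if t: "t \<in> vecs n" "t \<noteq> 0v n" for t
  proof -
    obtain a b where c: "a \<in> vecs n1" "b \<in> vecs n2" and tt: "t = a @v b" using spl[OF t(1)] by metis
    have Ra: "R a \<in> vecs n2" and hb: "h2 b \<in> vecs n2" using linD(1)[OF R(1) c(1)] h2c[OF c(2)] by auto
    have "?W2 *v t \<noteq> 0v n"
    proof
      assume "?W2 *v t = 0v n"
      hence "a @v (h2 b + R a) = 0v (n1 + n2)" unfolding tt W2e[OF c] n .
      hence a0: "a = 0v n1" and "h2 b + R a = 0v n2" using c Ra hb by (auto simp: append_eq_0)
      hence "h2 b = 0v n2" using lin_zero_arg[OF R(1)] hb by simp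
      hence "b = 0v n2" using h2(2)[OF c(2)] lin_zero_arg[OF g2(1)] by simp
      thus False using t(2) a0 unfolding tt n by (simp add: zero_append_zero)
    qed
    moreover have "?W2 *v t \<in> vecs n" by (rule mult_mat_vec_carrier[OF W(2) t(1)])
    ultimately show ?thesis using posN NY[OF t(1)] by metis
  qed
  have pY': "\<forall>t. t \<in> vecs n \<longrightarrow> t \<noteq> 0v n \<longrightarrow> 0 < t \<bullet> (Y *v t)" using pY by blast
  obtain N1 where N1: "qform n N1"
    "\<forall>x \<in> vecs n. \<exists>t \<in> vecs n. x = ?W2 *v t \<and> N1 x = t \<bullet> (Y *v t)"
    "pos_def (four_block_mat XM ?W1 (?W1\<^sup>T) Y) \<longleftrightarrow>
       (\<forall>x \<in> vecs n. x \<noteq> 0v n \<longrightarrow> N1 x < x \<bullet> (XM *v x))"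
    "pos_def (V\<^sup>T * dual_mat ?W1 ?W2 * V) \<longleftrightarrow> reply_cond N1"
    using dual_param[OF W11(1) W12 W22 refl refl Y_def sY pY' XM(1) sX] by (elim exE conjE) (rule that)
  have NN: "N1 x = N x" if "x \<in> vecs n" for x using N1(2) NY that by metis
  have "reply_cond N1"
    unfolding reply_cond_def
  proof (intro ballI impI)
    fix x w :: "real vec" assume x: "x \<in> vecs n" and w: "w \<in> vecs d" and nz: "x @v w \<noteq> 0v (n + d)"
    obtain u where u: "u \<in> vecs nu"
      "N (A *v x + B1 *v w + B *v u) - N x + 2 * (w \<bullet> (C1 *v x + D1 *v w + E *v u)) < 0"
      using reply x w nz by blast
    have "A *v x + B1 *v w + B *v u \<in> vecs n" using A B1 B x w u by simp
    thus "\<exists>u \<in> vecs nu. N1 (A *v x + B1 *v w + B *v u) - N1 x + 2 * (w \<bullet> (C1 *v x + D1 *v w + E *v u)) < 0"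
      using u x by (intro bexI[of _ u]) (simp_all add: NN)
  qed
  moreover have "\<forall>x \<in> vecs n. x \<noteq> 0v n \<longrightarrow> N1 x < x \<bullet> (XM *v x)" using XN NN Xe by metis
  moreover have "neg_def (U\<^sup>T * primal_mat XM * U)"
    unfolding primal_cond_iff[OF XM(1) sX]
  proof (intro ballI impI)
    fix x w :: "real vec" assume x: "x \<in> vecs n" and w: "w \<in> vecs d" and nz: "x @v w \<noteq> 0v (n + d)"
      and k: "C *v x + F *v w = 0v p"
    have "A *v x + B1 *v w \<in> vecs n" using A B1 x w by simp
    thus "(A *v x + B1 *v w) \<bullet> (XM *v (A *v x + B1 *v w)) - x \<bullet> (XM *v x) + 2 * (w \<bullet> (C1 *v x + D1 *v w)) < 0"
      using primal[rule_format, OF x w nz k] x by (simp add: Xe)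
  qed
  moreover have "sym_mat (four_block_mat W11 W12 (W12\<^sup>T) W22)"
  proof -
    have "W22\<^sup>T = W22"
      using sym_mat_by_form[OF W22] W22e h2s by (simp add: sym_mat_def)
    hence "(four_block_mat W11 W12 (W12\<^sup>T) W22)\<^sup>T = four_block_mat W11 W12 (W12\<^sup>T) W22"
      using W11 W12 W22 by (subst transpose_four_block_mat[of _ n1 n1 _ n2 _ n2]) auto
    thus ?thesis using W11 W22 by (auto simp: sym_mat_def)
  qed
  ultimately have "lmi XM W11 W12 W22"
    unfolding lmi_def using XM(1) sX W11(1) W12 W22 N1(3,4) unfolding Y_def by blast
  thus ?thesis by blast
qed

end

section \<open>Gradients of strongly convex functions\<close>

lemma gradient_atD:
  assumes "is_gradient_at d f x g" "e > 0"
  shows "\<exists>\<delta>>0. \<forall>y \<in> vecs d. vnorm (y - x) < \<delta> \<longrightarrow> \<bar>f y - f x - g \<bullet> (y - x)\<bar> \<le> e * vnorm (y - x)"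
  by (rule assms(1)[unfolded is_gradient_at_def, THEN conjunct2, THEN spec, THEN mp, OF assms(2)])

lemma gradient_unique:
  assumes g: "is_gradient_at d f x g" and h: "is_gradient_at d f x h" and x: "x \<in> vecs d"
  shows "g = h"
proof (rule ccontr)
  assume ne: "g \<noteq> h"
  have c: "g \<in> vecs d" "h \<in> vecs d" using g h by (auto simp: is_gradient_at_def)
  define v where "v = g - h"
  have v: "v \<in> vecs d" using c by (simp add: v_def)
  have "v \<noteq> 0v d"
  proof
    assume "v = 0v d"
    hence "h + v = h" using c by simp
    thus False using vec_add_diff_cancel[OF c(2,1)] ne by (simp add: v_def)
  qed
  hence "sq v > 0" using sq_pos v by blast
  define r where "r = vnorm v"
  have r: "r > 0" "r\<^sup>2 = sq v" using \<open>sq v > 0\<close> vnorm_power2[of v] by (simp_all add: r_def vnorm_def)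
  \<comment> \<open>Two tolerances of \<open>r / 4\<close> account for at most half of the gap
    \<open>t * r^2\<close> between the two linear approximations.\<close>
  obtain \<delta>1 where d1: "\<delta>1 > 0" "\<And>y. y \<in> vecs d \<Longrightarrow> vnorm (y - x) < \<delta>1 \<Longrightarrow>
    \<bar>f y - f x - g \<bullet> (y - x)\<bar> \<le> r / 4 * vnorm (y - x)"
    using gradient_atD[OF g, of "r / 4"] r(1) by auto
  obtain \<delta>2 where d2: "\<delta>2 > 0" "\<And>y. y \<in> vecs d \<Longrightarrow> vnorm (y - x) < \<delta>2 \<Longrightarrow>
    \<bar>f y - f x - h \<bullet> (y - x)\<bar> \<le> r / 4 * vnorm (y - x)"
    using gradient_atD[OF h, of "r / 4"] r(1) by auto
  define t where "t = min \<delta>1 \<delta>2 / (2 * r)"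
  have t: "t > 0" "t * r < \<delta>1" "t * r < \<delta>2" using d1 d2 r by (auto simp: t_def field_simps min_def)
  have y: "x + t *s v \<in> vecs d" and e: "x + t *s v - x = t *s v" using x v by (auto intro!: eq_vecI)
  have n: "vnorm (t *s v) = t * r"
    using t(1) by (simp add: vnorm_def r_def sq_smult real_sqrt_mult)
  have "\<bar>f (x + t *s v) - f x - t * (g \<bullet> v)\<bar> \<le> r / 4 * (t * r)"
    using d1(2)[OF y] t(2) v c by (simp add: e n)
  moreover have "\<bar>f (x + t *s v) - f x - t * (h \<bullet> v)\<bar> \<le> r / 4 * (t * r)"
    using d2(2)[OF y] t(3) v c by (simp add: e n)
  ultimately have "t * (g \<bullet> v) - t * (h \<bullet> v) \<le> r / 4 * (t * r) + r / 4 * (t * r)"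
    unfolding abs_le_iff by linarith
  hence "t * (g \<bullet> v) - t * (h \<bullet> v) \<le> t * r\<^sup>2 / 2" by (simp add: power2_eq_square mult_ac)
  moreover have "t * (g \<bullet> v) - t * (h \<bullet> v) = t * r\<^sup>2"
    unfolding r(2) using c v by (simp add: v_def minus_scalar_prod_distrib[of _ d] right_diff_distrib)
  ultimately show False using t(1) r(1) by simp
qed

text \<open>Uniqueness of gradients gives the definite description in \<open>grad\<close> its
  meaning.\<close>

lemma S_class_gradient:
  assumes "f \<in> S_class d m L" "x \<in> vecs d"
  shows "is_gradient_at d f x (grad d f x)"
proof -
  obtain g where "is_gradient_at d f x g" using assms by (auto simp: S_class_def C1_function_def)
  thus ?thesis unfolding grad_def using gradient_unique[OF _ _ assms(2)] by (metis theI)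
qed

lemma DERIV_along_line:
  assumes f: "f \<in> S_class d m L" and x: "x \<in> vecs d" and v: "v \<in> vecs d"
  shows "((\<lambda>t. f (x + t *s v)) has_real_derivative (grad d f (x + t *s v) \<bullet> v)) (at t)"
proof -
  define y where "y = x + t *s v"
  define g where "g = grad d f y"
  have y: "y \<in> vecs d" using x v by (simp add: y_def)
  have gr: "is_gradient_at d f y g" unfolding g_def by (rule S_class_gradient[OF f y])
  have g: "g \<in> vecs d" using gr by (simp add: is_gradient_at_def)
  define r where "r = vnorm v"
  have r: "r \<ge> 0" by (simp add: r_def vnorm_def sq_nonneg)
  have "(\<lambda>h. (f (x + (t + h) *s v) - f (x + t *s v)) / h) \<midarrow>0\<rightarrow> g \<bullet> v"
  proof (rule LIM_I)
    fix e :: real assume e: "0 < e"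
    \<comment> \<open>\<open>r + 1\<close> instead of \<open>r\<close> also covers
      \<open>v = 0\<close>.\<close>
    define e' where "e' = e / (2 * (r + 1))"
    have e': "e' > 0" "e' * r < e" using e r by (auto simp: e'_def field_simps intro: add_nonneg_pos)
    obtain \<delta> where \<delta>: "\<delta> > 0" "\<And>z. z \<in> vecs d \<Longrightarrow> vnorm (z - y) < \<delta> \<Longrightarrow>
      \<bar>f z - f y - g \<bullet> (z - y)\<bar> \<le> e' * vnorm (z - y)"
      using gradient_atD[OF gr e'(1)] by auto
    show "\<exists>s>0. \<forall>h. h \<noteq> 0 \<and> norm (h - 0) < s \<longrightarrow>
      norm ((f (x + (t + h) *s v) - f (x + t *s v)) / h - g \<bullet> v) < e"
    proof (intro exI[of _ "\<delta> / (r + 1)"] conjI allI impI)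
      show "0 < \<delta> / (r + 1)" using \<delta> r by simp
      fix h :: real assume h: "h \<noteq> 0 \<and> norm (h - 0) < \<delta> / (r + 1)"
      define z where "z = x + (t + h) *s v"
      have z: "z \<in> vecs d" using x v by (simp add: z_def)
      have zy: "z - y = h *s v" unfolding z_def y_def using x v by (intro eq_vecI) (auto simp: algebra_simps)
      have n: "vnorm (h *s v) = \<bar>h\<bar> * r" by (simp add: vnorm_def r_def sq_smult real_sqrt_mult)
      have "\<bar>h\<bar> * (r + 1) < \<delta>" using h r by (simp add: field_simps)
      moreover have "\<bar>h\<bar> * r \<le> \<bar>h\<bar> * (r + 1)" by (simp add: mult_left_mono)
      ultimately have "\<bar>f z - f y - h * (g \<bullet> v)\<bar> \<le> e' * (\<bar>h\<bar> * r)"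
        using \<delta>(2)[OF z] g v by (simp add: zy n)
      also have "\<dots> = \<bar>h\<bar> * (e' * r)" by simp
      also have "\<dots> < \<bar>h\<bar> * e" using h e' by (intro mult_strict_left_mono) auto
      finally have "\<bar>f z - f y - h * (g \<bullet> v)\<bar> / \<bar>h\<bar> < e" using h by (simp add: field_simps)
      moreover have "(f z - f y) / h - g \<bullet> v = (f z - f y - h * (g \<bullet> v)) / h" using h by (simp add: field_simps)
      ultimately show "norm ((f (x + (t + h) *s v) - f (x + t *s v)) / h - g \<bullet> v) < e"
        by (simp add: z_def y_def)
    qed
  qed
  thus ?thesis unfolding DERIV_def g_def y_def .
qed

lemma grad_carrier: "f \<in> S_class d m L \<Longrightarrow> x \<in> vecs d \<Longrightarrow> grad d f x \<in> vecs d"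
  by (rule S_class_gradient[unfolded is_gradient_at_def, THEN conjunct1])

text \<open>Along the segment, \<open>f\<close> minus its quadratic model with curvature
  \<open>m\<close> has nonnegative derivative by strong monotonicity; with curvature
  \<open>L\<close> the derivative is nonpositive by the Lipschitz bound.\<close>

lemma quadratic_bounds:
  assumes f: "f \<in> S_class d m L" and x: "x \<in> vecs d" and v: "v \<in> vecs d" and L: "L > 0"
  shows "f x + grad d f x \<bullet> v + m / 2 * sq v \<le> f (x + v)"
    and "f (x + v) \<le> f x + grad d f x \<bullet> v + L / 2 * sq v"
proof -
  let ?g = "grad d f"
  have c: "x + t *s v \<in> vecs d" for t using x v by simp
  have gc: "?g x \<in> vecs d" "?g (x + t *s v) \<in> vecs d" for t using grad_carrier[OF f] x c by auto
  have e: "x + t *s v - x = t *s v" for t using x v by (intro eq_vecI) auto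
  have D: "(?g (x + t *s v) - ?g x) \<bullet> v = ?g (x + t *s v) \<bullet> v - ?g x \<bullet> v" for t
    using gc v by (simp add: minus_scalar_prod_distrib[of _ d])
  have S: "m * (vnorm (y - z))\<^sup>2 \<le> (?g y - ?g z) \<bullet> (y - z)" "vnorm (?g y - ?g z) \<le> L * vnorm (y - z)"
    if "y \<in> vecs d" "z \<in> vecs d" for y z using f that unfolding S_class_def by auto
  have low: "m * t * sq v \<le> ?g (x + t *s v) \<bullet> v - ?g x \<bullet> v"
    and up: "?g (x + t *s v) \<bullet> v - ?g x \<bullet> v \<le> L * t * sq v" if t: "t > 0" for t
  proof -
    have d: "?g (x + t *s v) - ?g x \<in> vecs d" using gc by simp
    have f1: "m * (vnorm (t *s v))\<^sup>2 \<le> (?g (x + t *s v) - ?g x) \<bullet> (t *s v)"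
      and f2: "vnorm (?g (x + t *s v) - ?g x) \<le> L * vnorm (t *s v)"
      using S[OF c x, of t] unfolding e by simp_all
    have "t * (m * t * sq v) \<le> t * (?g (x + t *s v) \<bullet> v - ?g x \<bullet> v)"
      using f1 d v unfolding vnorm_power2 sq_smult by (simp add: D power2_eq_square mult_ac)
    thus "m * t * sq v \<le> ?g (x + t *s v) \<bullet> v - ?g x \<bullet> v" using t by simp
    have "(vnorm (?g (x + t *s v) - ?g x))\<^sup>2 \<le> (L * vnorm (t *s v))\<^sup>2"
      by (rule power_mono[OF f2]) (simp add: vnorm_def sq_nonneg)
    hence s: "sq (?g (x + t *s v) - ?g x) \<le> (L * t)\<^sup>2 * sq v"
      unfolding power_mult_distrib vnorm_power2 sq_smult by simp
    \<comment> \<open>Young's inequality with weight \<open>L * t\<close> replaces Cauchy-Schwarz;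
      at this weight the two terms have the same bound.\<close>
    have "2 * (v \<bullet> (?g (x + t *s v) - ?g x)) \<le> (L * t) * sq v + sq (?g (x + t *s v) - ?g x) / (L * t)"
      by (rule young[OF v d]) (use L t in simp)
    also have "\<dots> \<le> (L * t) * sq v + (L * t)\<^sup>2 * sq v / (L * t)"
      using s L t by (intro add_left_mono divide_right_mono) auto
    also have "\<dots> = 2 * (L * t * sq v)" using L t by (simp add: power2_eq_square)
    finally show "?g (x + t *s v) \<bullet> v - ?g x \<bullet> v \<le> L * t * sq v"
      using comm_scalar_prod[OF v d] D[of t] by simp
  qed
  have x1: "x + 0 *s v = x" "x + 1 *s v = x + v" using x v by auto
  define \<psi> where "\<psi> a t = f (x + t *s v) - t * (?g x \<bullet> v) - a / 2 * t\<^sup>2 * sq v" for a t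
  have \<psi>: "(\<psi> a has_real_derivative (?g (x + t *s v) \<bullet> v - ?g x \<bullet> v - a * t * sq v)) (at t)" for a t
    unfolding \<psi>_def by (rule derivative_eq_intros DERIV_along_line[OF f x v] refl)+ simp
  have "\<psi> m 0 \<le> \<psi> m 1"
  proof (rule DERIV_nonneg_imp_nondecreasing[of 0 1])
    fix t :: real assume "0 \<le> t"
    hence "0 \<le> ?g (x + t *s v) \<bullet> v - ?g x \<bullet> v - m * t * sq v" using low[of t] x1 by (cases "t = 0") auto
    thus "\<exists>y. (\<psi> m has_real_derivative y) (at t) \<and> 0 \<le> y" using \<psi> by blast
  qed simp
  thus "f x + ?g x \<bullet> v + m / 2 * sq v \<le> f (x + v)" by (simp add: \<psi>_def x1)
  have "\<psi> L 1 \<le> \<psi> L 0"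
  proof (rule DERIV_nonpos_imp_nonincreasing[of 0 1])
    fix t :: real assume "0 \<le> t"
    hence "?g (x + t *s v) \<bullet> v - ?g x \<bullet> v - L * t * sq v \<le> 0" using up[of t] x1 by (cases "t = 0") auto
    thus "\<exists>y. (\<psi> L has_real_derivative y) (at t) \<and> y \<le> 0" using \<psi> by blast
  qed simp
  thus "f (x + v) \<le> f x + ?g x \<bullet> v + L / 2 * sq v" by (simp add: \<psi>_def x1)
qed

text \<open>A gradient step of length \<open>1 / L\<close> would lower the value by at least
  \<open>sq g / (2 * L)\<close>, where \<open>g\<close> is the gradient at the minimizer.\<close>

lemma grad_minimizer:
  assumes f: "f \<in> S_class d m L" and L: "L > 0" and z: "is_minimizer d f z"
  shows "grad d f z = 0v d"
proof -
  have zc: "z \<in> vecs d" using z by (simp add: is_minimizer_def)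
  let ?g = "grad d f z"
  have g: "?g \<in> vecs d" by (rule grad_carrier[OF f zc])
  have "f z \<le> f (z + (- (1 / L)) *s ?g)" using z g zc unfolding is_minimizer_def by simp
  also have "\<dots> \<le> f z + ?g \<bullet> ((- (1 / L)) *s ?g) + L / 2 * sq ((- (1 / L)) *s ?g)"
    by (rule quadratic_bounds(2)[OF f zc _ L]) (use g in simp)
  also have "\<dots> = f z - sq ?g / (2 * L)"
    unfolding sq_smult using g L by (simp add: power2_eq_square field_simps)
  finally have "sq ?g \<le> 0" using L by (simp add: field_simps)
  thus ?thesis using sq_eq_0[OF g] sq_nonneg[of ?g] by simp
qed

text \<open>The interpolation inequality for strong convexity with Lipschitz gradient. The lower
  model based at \<open>x\<close> and the upper model based at \<open>x + v\<close> are compared at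
  one auxiliary point.\<close>

lemma S_class_interpolation:
  assumes f: "f \<in> S_class d m L" and mL: "0 < m" "m < L" and x: "x \<in> vecs d" and v: "v \<in> vecs d"
  defines "\<delta> \<equiv> grad d f (x + v) - grad d f x - m *s v"
  shows "sq \<delta> / 2 \<le> (L - m) * (f (x + v) - f x - grad d f x \<bullet> v - m / 2 * sq v)"
proof -
  have L: "L > 0" using mL by simp
  define gx where "gx = grad d f x"
  define gy where "gy = grad d f (x + v)"
  have xv: "x + v \<in> vecs d" using x v by simp
  have c: "gx \<in> vecs d" "gy \<in> vecs d" using grad_carrier[OF f] x xv by (auto simp: gx_def gy_def)
  have \<delta>: "\<delta> = gy - gx - m *s v" by (simp add: \<delta>_def gx_def gy_def)
  have \<delta>c: "\<delta> \<in> vecs d" using c v by (simp add: \<delta>)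
  define s where "s = 1 / (L - m)"
  have s: "s > 0" "(L - m) * s = 1" using mL by (auto simp: s_def)
  \<comment> \<open>The auxiliary point \<open>x + v + e\<close> minimises the upper minus the lower
    model, a quadratic in \<open>e\<close> with curvature \<open>L - m\<close> and linear part
    \<open>\<delta>\<close>.\<close>
  define e where "e = (- s) *s \<delta>"
  have ec: "e \<in> vecs d" using \<delta>c by (simp add: e_def)
  have "f x + gx \<bullet> (v + e) + m / 2 * sq (v + e) \<le> f (x + (v + e))"
    unfolding gx_def by (rule quadratic_bounds(1)[OF f x _ L]) (use v ec in simp)
  also have "x + (v + e) = x + v + e" using x v ec by (simp add: assoc_add_vec[of _ d])
  also have "f (x + v + e) \<le> f (x + v) + gy \<bullet> e + L / 2 * sq e"
    unfolding gy_def by (rule quadratic_bounds(2)[OF f xv ec L])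
  finally have b: "f x + gx \<bullet> (v + e) + m / 2 * sq (v + e) \<le> f (x + v) + gy \<bullet> e + L / 2 * sq e" .
  have e1: "gx \<bullet> (v + e) = gx \<bullet> v + gx \<bullet> e" using c v ec by (simp add: scalar_prod_add_distrib[of _ d])
  have e2: "sq (v + e) = sq v + 2 * (v \<bullet> e) + sq e"
    using v ec comm_scalar_prod[OF v ec]
    by (simp add: scalar_prod_add_distrib[of _ d] add_scalar_prod_distrib[of _ d])
  have e3: "\<delta> \<bullet> e = gy \<bullet> e - gx \<bullet> e - m * (v \<bullet> e)"
    unfolding \<delta> using c v ec by (simp add: minus_scalar_prod_distrib[of _ d])
  have e4: "\<delta> \<bullet> e = - s * sq \<delta>" unfolding e_def using \<delta>c by simp
  have e5: "sq e = s\<^sup>2 * sq \<delta>" by (simp add: e_def sq_smult)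
  have b2: "0 \<le> f (x + v) - f x - gx \<bullet> v - m / 2 * sq v + \<delta> \<bullet> e + (L - m) / 2 * sq e"
    using b unfolding e1 e2 e3 by (simp add: field_simps)
  have "\<delta> \<bullet> e + (L - m) / 2 * sq e = - s / 2 * sq \<delta>"
  proof -
    have "(L - m) / 2 * (s\<^sup>2 * sq \<delta>) = ((L - m) * s) * (s / 2 * sq \<delta>)" by (simp add: power2_eq_square)
    hence "(L - m) / 2 * (s\<^sup>2 * sq \<delta>) = s / 2 * sq \<delta>" by (simp only: s(2) mult_1_left)
    thus ?thesis unfolding e4 e5 by linarith
  qed
  hence "s / 2 * sq \<delta> \<le> f (x + v) - f x - gx \<bullet> v - m / 2 * sq v"
    using b2 by linarith
  hence "(L - m) * (s / 2 * sq \<delta>) \<le> (L - m) * (f (x + v) - f x - gx \<bullet> v - m / 2 * sq v)"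
    using mL by (intro mult_left_mono) auto
  moreover have "(L - m) * (s / 2 * sq \<delta>) = sq \<delta> / 2" using s(2) by (metis (no_types, lifting) mult.assoc mult_1 times_divide_eq_left times_divide_eq_right)
  ultimately show ?thesis unfolding gx_def by linarith
qed

text \<open>The loop transformation to \<open>p = \<nabla>f(z) - m (z - z\<^sub>*)\<close>, \<open>s = (L - m) (z - z\<^sub>*) - p\<close> turns the
  interpolation inequality into the subgradient inequality of the potential \<open>q\<close>.\<close>

lemma S_class_potential:
  assumes f: "f \<in> S_class d m L" and mL: "0 < m" "m < L" and zs: "is_minimizer d f zs"
  defines "P a \<equiv> grad d f (zs + a) - m *s a"
  defines "s a \<equiv> (L - m) *s a - P a"
  obtains q where "\<forall>a \<in> vecs d. 0 \<le> q a \<and> q a \<le> P a \<bullet> s a"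
    "\<forall>a \<in> vecs d. \<forall>b \<in> vecs d. P a \<bullet> s b \<le> P a \<bullet> s a - q a + q b"
proof -
  have zc: "zs \<in> vecs d" using zs by (simp add: is_minimizer_def)
  define q where "q a = (L - m) * (f (zs + a) - f zs - m / 2 * sq a) - sq (P a) / 2" for a
  have Pc: "P a \<in> vecs d" if "a \<in> vecs d" for a
    using grad_carrier[OF f, of "zs + a"] that zc by (simp add: P_def)
  have key: "P a \<bullet> s b \<le> P a \<bullet> s a - q a + q b" if a: "a \<in> vecs d" and b: "b \<in> vecs d" for a b
  proof -
    define pa where "pa = P a"
    define pb where "pb = P b"
    define ga where "ga = grad d f (zs + a)"
    define gb where "gb = grad d f (zs + b)"
    have c: "pa \<in> vecs d" "pb \<in> vecs d" using Pc a b by (auto simp: pa_def pb_def)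
    have gc: "ga \<in> vecs d" "gb \<in> vecs d" using grad_carrier[OF f] a b zc by (auto simp: ga_def gb_def)
    have za: "zs + a \<in> vecs d" and ba: "b - a \<in> vecs d" using zc a b by auto
    have e: "zs + a + (b - a) = zs + b" using zc a b by (intro eq_vecI) auto
    have \<delta>: "grad d f (zs + b) - grad d f (zs + a) - m *s (b - a) = pb - pa"
      unfolding pa_def pb_def P_def ga_def[symmetric] gb_def[symmetric] using gc a b by (intro eq_vecI) (auto simp: algebra_simps)
    have "ga = pa + m *s a" unfolding pa_def P_def ga_def[symmetric] using gc a by (intro eq_vecI) auto
    hence g: "ga \<bullet> (b - a) = pa \<bullet> b - pa \<bullet> a + m * (a \<bullet> b) - m * sq a"
      using c a b by (simp add: add_scalar_prod_distrib[of _ d] scalar_prod_minus_distrib[of _ d] algebra_simps)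
    have s1: "sq (b - a) = sq b - 2 * (a \<bullet> b) + sq a"
      using a b comm_scalar_prod[OF a b] by (simp add: minus_scalar_prod_distrib[of _ d] scalar_prod_minus_distrib[of _ d])
    have s2: "sq (pb - pa) = sq pb - 2 * (pa \<bullet> pb) + sq pa"
      using c comm_scalar_prod[OF c] by (simp add: minus_scalar_prod_distrib[of _ d] scalar_prod_minus_distrib[of _ d])
    have "(sq pb - 2 * (pa \<bullet> pb) + sq pa) / 2 \<le> (L - m) * (f (zs + b) - f (zs + a)
        - (pa \<bullet> b - pa \<bullet> a + m * (a \<bullet> b) - m * sq a) - m / 2 * (sq b - 2 * (a \<bullet> b) + sq a))"
      using S_class_interpolation[OF f mL za ba, unfolded e \<delta> s1 s2, folded ga_def, unfolded g] .
    also have "\<dots> = (L - m) * (f (zs + b) - f zs - m / 2 * sq b) - (L - m) * (f (zs + a) - f zs - m / 2 * sq a)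
        - (L - m) * (pa \<bullet> b) + (L - m) * (pa \<bullet> a)"
      by (simp add: algebra_simps)
    finally have ineq: "(sq pb - 2 * (pa \<bullet> pb) + sq pa) / 2 \<le> \<dots>" .
    have "pa \<bullet> s a = (L - m) * (pa \<bullet> a) - sq pa" "pa \<bullet> s b = (L - m) * (pa \<bullet> b) - pa \<bullet> pb"
      unfolding s_def pa_def[symmetric] pb_def[symmetric]
      using c a b by (simp_all add: scalar_prod_minus_distrib[of _ d])
    thus ?thesis using ineq unfolding q_def pa_def[symmetric] pb_def[symmetric] by simp
  qed
  have z: "0v d \<in> vecs d" by simp
  have "P (0v d) = 0v d"
    using grad_minimizer[OF f _ zs] mL zc unfolding P_def by (intro eq_vecI) auto
  hence "s (0v d) = 0v d" "q (0v d) = 0" using zc by (auto simp: s_def q_def)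
  \<comment> \<open>Both bounds are \<open>key\<close> for the pair of \<open>a\<close> and the
    minimizer, where \<open>P\<close>, \<open>s\<close> and \<open>q\<close> vanish.\<close>
  hence "0 \<le> q a" "q a \<le> P a \<bullet> s a" if "a \<in> vecs d" for a
    using key[OF z that] key[OF that z] \<open>P (0v d) = 0v d\<close> Pc[OF that] that mL by (simp_all add: s_def)
  thus ?thesis using key by (intro that[of q]) auto
qed

text \<open>Delayed terms have nonpositive coefficients, so \<open>c\<close> may be replaced there
  by its upper bound. The part \<open>c k k - q k\<close> is then multiplied by the sum of
  \<open>lam i * \<rho>^i\<close>. In the part with \<open>q\<close>, a delay by \<open>i\<close>
  changes the weight by \<open>\<rho>^(- 2 i)\<close>, which produces the sum of
  \<open>lam i * (1 / \<rho>)^i\<close>.\<close>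

lemma zames_falb:
  fixes c :: "nat \<Rightarrow> nat \<Rightarrow> real" and q lam :: "nat \<Rightarrow> real" and \<rho> :: real
  assumes \<rho>: "\<rho> > 0" and lam: "\<forall>i \<in> {1..l}. lam i \<le> 0"
    and sums: "(\<Sum>i\<le>l. lam i * \<rho> ^ i) \<ge> 0" "(\<Sum>i\<le>l. lam i * (1 / \<rho>) ^ i) \<ge> 0"
    and q: "\<And>k. 0 \<le> q k" "\<And>k. q k \<le> c k k" and c: "\<And>k j. c k j \<le> c k k - q k + q j"
  shows "0 \<le> (\<Sum>k<N. (1 / \<rho>) ^ (2 * k) * (\<Sum>i\<le>l. lam i * \<rho> ^ i * (if i \<le> k then c k (k - i) else 0)))"
proof -
  define r where "r = 1 / \<rho>"
  have r: "r > 0" "\<rho> ^ i * r ^ i = 1" for i using \<rho> by (auto simp: r_def power_one_over)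
  let ?q = "\<lambda>k i. if i \<le> k then q (k - i) else 0"
  have tm: "lam i * \<rho> ^ i * (c k k - q k + ?q k i) \<le> lam i * \<rho> ^ i * (if i \<le> k then c k (k - i) else 0)"
    if "i \<le> l" for i k
  proof (cases "i = 0")
    case False
    hence "lam i * \<rho> ^ i \<le> 0" using lam that \<rho> by (simp add: mult_nonpos_nonneg)
    \<comment> \<open>For \<open>i > k\<close> the delayed signal is 0, and the bound reduces to
      \<open>q k \<le> c k k\<close>.\<close>
    moreover have "(if i \<le> k then c k (k - i) else 0) \<le> c k k - q k + ?q k i" using c q(2)[of k] by simp
    ultimately show ?thesis by (rule mult_left_mono_neg[rotated])
  qed simp
  define Q where "Q = (\<Sum>k<N. r ^ (2 * k) * q k)"
  \<comment> \<open>Reindexing by \<open>j = k - i\<close>; the end of the horizon cuts off only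
    nonnegative terms.\<close>
  have shift: "(\<Sum>k<N. r ^ (2 * k) * ?q k i) \<le> r ^ (2 * i) * Q" for i
  proof -
    have "(\<Sum>k<N. r ^ (2 * k) * ?q k i) = (\<Sum>k\<in>{k. k < N \<and> i \<le> k}. r ^ (2 * k) * q (k - i))"
      by (intro sum.mono_neutral_cong_right) auto
    also have "\<dots> = (\<Sum>j<N - i. r ^ (2 * (j + i)) * q j)"
      by (rule sum.reindex_bij_witness[of _ "\<lambda>j. j + i" "\<lambda>k. k - i"]) auto
    also have "\<dots> = r ^ (2 * i) * (\<Sum>j<N - i. r ^ (2 * j) * q j)"
      by (simp add: sum_distrib_left power_add distrib_left mult_ac)
    also have "\<dots> \<le> r ^ (2 * i) * Q" unfolding Q_def
      by (intro mult_left_mono sum_mono2) (use r(1) q in auto)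
    finally show ?thesis .
  qed
  have Q0: "0 \<le> Q" unfolding Q_def using r(1) q by (intro sum_nonneg) auto
  have "0 \<le> (\<Sum>k<N. r ^ (2 * k) * (c k k - q k)) * (\<Sum>i\<le>l. lam i * \<rho> ^ i)"
    by (rule mult_nonneg_nonneg[OF sum_nonneg sums(1)]) (use r(1) q(2) in simp)
  moreover have "0 \<le> (\<Sum>i\<le>l. lam i * \<rho> ^ i * (\<Sum>k<N. r ^ (2 * k) * ?q k i))"
  proof -
    have "0 \<le> (\<Sum>i\<le>l. lam i * r ^ i) * Q" using sums(2) Q0 by (simp add: r_def)
    also have "\<dots> = (\<Sum>i\<le>l. lam i * \<rho> ^ i * (r ^ (2 * i) * Q))"
      unfolding sum_distrib_right
    proof (intro sum.cong refl)
      fix i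
      have "\<rho> ^ i * r ^ (2 * i) = (\<rho> ^ i * r ^ i) * r ^ i" by (simp add: mult_2 power_add)
      hence "\<rho> ^ i * r ^ (2 * i) = r ^ i" by (simp only: r(2) mult_1_left)
      thus "lam i * r ^ i * Q = lam i * \<rho> ^ i * (r ^ (2 * i) * Q)" by (metis mult.assoc)
    qed
    also have "\<dots> \<le> (\<Sum>i\<le>l. lam i * \<rho> ^ i * (\<Sum>k<N. r ^ (2 * k) * ?q k i))"
    proof (intro sum_mono)
      fix i assume i: "i \<in> {..l}"
      show "lam i * \<rho> ^ i * (r ^ (2 * i) * Q) \<le> lam i * \<rho> ^ i * (\<Sum>k<N. r ^ (2 * k) * ?q k i)"
      proof (cases "i = 0")
        case True thus ?thesis by (simp add: Q_def)
      next
        case False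
        hence "lam i * \<rho> ^ i \<le> 0" using lam i \<rho> by (simp add: mult_nonpos_nonneg)
        thus ?thesis using shift by (rule mult_left_mono_neg[rotated])
      qed
    qed
    finally show ?thesis .
  qed
  ultimately have "0 \<le> (\<Sum>k<N. r ^ (2 * k) * (c k k - q k)) * (\<Sum>i\<le>l. lam i * \<rho> ^ i)
      + (\<Sum>i\<le>l. lam i * \<rho> ^ i * (\<Sum>k<N. r ^ (2 * k) * ?q k i))" by simp
  also have "\<dots> = (\<Sum>k<N. r ^ (2 * k) * (\<Sum>i\<le>l. lam i * \<rho> ^ i * (c k k - q k + ?q k i)))"
  proof -
    have "(\<Sum>i\<le>l. lam i * \<rho> ^ i * (\<Sum>k<N. r ^ (2 * k) * ?q k i)) =
        (\<Sum>k<N. \<Sum>i\<le>l. lam i * \<rho> ^ i * (r ^ (2 * k) * ?q k i))"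
      unfolding sum_distrib_left by (rule sum.swap)
    thus ?thesis
      by (simp add: sum_distrib_left sum_distrib_right distrib_left sum.distrib mult_ac)
  qed
  also have "\<dots> \<le> (\<Sum>k<N. r ^ (2 * k) * (\<Sum>i\<le>l. lam i * \<rho> ^ i * (if i \<le> k then c k (k - i) else 0)))"
    by (intro sum_mono mult_left_mono tm) (use r(1) in auto)
  finally show ?thesis by (simp add: r_def)
qed

section \<open>Finite impulse response multipliers\<close>

text \<open>Signals are continued by 0 to negative times, which matches the zero initial state of
  the multiplier.\<close>

definition fir :: "nat \<Rightarrow> (nat \<Rightarrow> real) \<Rightarrow> nat \<Rightarrow> signal \<Rightarrow> signal" where
  "fir n lam l w k = vec n (\<lambda>j. \<Sum>i\<le>l. lam i * (if i \<le> k then w (k - i) $ j else 0))"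

lemma fir_carrier [simp]: "fir n lam l w k \<in> vecs n" "dim_vec (fir n lam l w k) = n"
  by (simp_all add: fir_def)

lemma multiplier_dims:
  assumes "\<Lambda> = map (\<lambda>i. lam i \<cdot>\<^sub>m 1\<^sub>m n) [0..<l + 1]"
  shows "ss_dims (l * n) n n (multiplier n l \<Lambda>)"
proof -
  have "\<Lambda> ! 0 = lam 0 \<cdot>\<^sub>m 1\<^sub>m n" unfolding assms by (subst nth_map) (auto simp del: upt_Suc)
  thus ?thesis by (simp add: multiplier_def ss_dims_def mk_ss_def)
qed

text \<open>The state is a shift register: block \<open>a div n\<close> stores the input delayed by
  \<open>l - a div n\<close> steps.\<close>

lemma multiplier_state:
  assumes \<Lambda>: "\<Lambda> = map (\<lambda>i. lam i \<cdot>\<^sub>m 1\<^sub>m n) [0..<l + 1]" and w: "w \<in> signals n" and a: "a < l * n"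
  shows "ss_state (multiplier n l \<Lambda>) w k $ a =
    (if l - a div n \<le> k then w (k - (l - a div n)) $ (a mod n) else 0)"
  using a
proof (induction k arbitrary: a)
  case 0
  have "l - a div n > 0" using 0 by (simp add: less_mult_imp_div_less)
  thus ?case using 0 by (simp add: multiplier_def mk_ss_def)
next
  case (Suc k)
  let ?M = "multiplier n l \<Lambda>" and ?x = "ss_state (multiplier n l \<Lambda>) w k"
  have n: "n > 0" using Suc.prems by (cases n) auto
  have wk: "w k \<in> vecs n" using w by (simp add: signals_def)
  have D: "ssA ?M \<in> mats (l * n) (l * n)" "ssB ?M \<in> mats (l * n) n"
    using multiplier_dims[OF \<Lambda>] by (auto simp: ss_dims_def)
  have x: "?x \<in> vecs (l * n)" unfolding ss_state_eq_run
    by (rule run_carrier[of _ "l * n" _ n]) (use D w in \<open>auto simp: signals_def\<close>)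
  have dl: "a div n < l" using Suc.prems by (simp add: less_mult_imp_div_less)
  have dm: "a = (a div n) * n + a mod n" by simp
  have Ax: "(ssA ?M *v ?x) $ a = (if a + n < l * n then ?x $ (a + n) else 0)"
  proof -
    have "(ssA ?M *v ?x) $ a = (\<Sum>j<l * n. (if j = a + n then 1 else 0) * ?x $ j)"
      using Suc.prems x by (auto simp: multiplier_def mk_ss_def scalar_prod_def atLeast0LessThan intro!: sum.cong)
    also have "\<dots> = (\<Sum>j<l * n. if j = a + n then ?x $ j else 0)" by (intro sum.cong) auto
    also have "\<dots> = (if a + n < l * n then ?x $ (a + n) else 0)" by (simp add: sum.delta)
    finally show ?thesis .
  qed
  have Bw: "(ssB ?M *v w k) $ a = (if a + n < l * n then 0 else w k $ (a + n - l * n))"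
  proof -
    have "(ssB ?M *v w k) $ a = (\<Sum>j<n. (if a + n = l * n + j then 1 else 0) * w k $ j)"
      using Suc.prems wk by (auto simp: multiplier_def mk_ss_def scalar_prod_def atLeast0LessThan intro!: sum.cong)
    also have "\<dots> = (\<Sum>j<n. if j = a + n - l * n then (if a + n < l * n then 0 else w k $ j) else 0)"
      by (intro sum.cong) auto
    also have "\<dots> = (if a + n < l * n then 0 else w k $ (a + n - l * n))"
      using Suc.prems by (subst sum.delta) auto
    finally show ?thesis .
  qed
  have s: "ss_state ?M w (Suc k) $ a = (ssA ?M *v ?x) $ a + (ssB ?M *v w k) $ a"
    using D Suc.prems by (simp del: index_mult_mat_vec)
  show ?case
  proof (cases "a + n < l * n")
    case True
    have "(a + n) div n = Suc (a div n)" "(a + n) mod n = a mod n" using n by auto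
    moreover have "Suc (a div n) < l" using True less_mult_imp_div_less[of "a + n" l n] n by simp
    ultimately show ?thesis unfolding s Ax Bw using True Suc.IH[OF True] dl
      by (auto simp: Suc_diff_le)
  next
    case False
    have "l \<le> Suc (a div n)"
    proof (rule ccontr)
      assume "\<not> ?thesis"
      hence "(Suc (a div n) + 1) * n \<le> l * n" by (intro mult_right_mono) auto
      moreover have "a mod n < n" using n by simp
      moreover have "(Suc (a div n) + 1) * n = a div n * n + n + n" by simp
      ultimately show False using False dm by linarith
    qed
    hence l: "l = Suc (a div n)" using dl by simp
    have "a + n - l * n = a - a div n * n" unfolding l by simp
    also have "\<dots> = a mod n" by (rule minus_div_mult_eq_mod)
    finally have "a + n - l * n = a mod n" .
    thus ?thesis unfolding s Ax Bw using False l by simp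
  qed
qed

lemma multiplier_op:
  assumes \<Lambda>: "\<Lambda> = map (\<lambda>i. lam i \<cdot>\<^sub>m 1\<^sub>m n) [0..<l + 1]" and w: "w \<in> signals n"
  shows "ss_op (multiplier n l \<Lambda>) w k = fir n lam l w k"
proof (rule eq_vecI)
  let ?M = "multiplier n l \<Lambda>"
  have wk: "w k \<in> vecs n" using w by (simp add: signals_def)
  have D: "ssA ?M \<in> mats (l * n) (l * n)" "ssB ?M \<in> mats (l * n) n"
    "ssC ?M \<in> mats n (l * n)" "ssD ?M \<in> mats n n"
    using multiplier_dims[OF \<Lambda>] by (auto simp: ss_dims_def)
  have x: "ss_state ?M w k \<in> vecs (l * n)" unfolding ss_state_eq_run
    by (rule run_carrier[of _ "l * n" _ n]) (use D w in \<open>auto simp: signals_def\<close>)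
  show "dim_vec (ss_op ?M w k) = dim_vec (fir n lam l w k)" using D by (simp add: ss_op_def)
  fix j assume "j < dim_vec (fir n lam l w k)"
  hence j: "j < n" by simp
  have nth: "\<Lambda> ! i = lam i \<cdot>\<^sub>m 1\<^sub>m n" if "i \<le> l" for i unfolding \<Lambda> using that by (subst nth_map) (auto simp del: upt_Suc)
  define h where "h i = lam i * (if i \<le> k then w (k - i) $ j else 0)" for i
  have "(ssC ?M *v ss_state ?M w k) $ j = (\<Sum>a<l * n. if a mod n = j then h (l - a div n) else 0)"
  proof -
    have "(ssC ?M *v ss_state ?M w k) $ j = (\<Sum>a<l * n. (\<Lambda> ! (l - a div n)) $$ (j, a mod n) * ss_state ?M w k $ a)"
      using j x by (auto simp: multiplier_def mk_ss_def scalar_prod_def atLeast0LessThan intro!: sum.cong)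
    also have "\<dots> = (\<Sum>a<l * n. if a mod n = j then h (l - a div n) else 0)"
      using j by (intro sum.cong) (auto simp: nth multiplier_state[OF \<Lambda> w] h_def)
    finally show ?thesis .
  qed
  also have "\<dots> = (\<Sum>a\<in>{a. a < l * n \<and> a mod n = j}. h (l - a div n))"
    by (intro sum.mono_neutral_cong_right) auto
  \<comment> \<open>For fixed \<open>j\<close>, the register entries \<open>a\<close> with
    \<open>a mod n = j\<close> correspond one to one to the delays
    \<open>i = l - a div n\<close>.\<close>
  also have "\<dots> = (\<Sum>i\<in>{1..l}. h i)"
  proof (rule sum.reindex_bij_witness[of _ "\<lambda>i. (l - i) * n + j" "\<lambda>a. l - a div n"])
    fix a assume a: "a \<in> {a. a < l * n \<and> a mod n = j}"
    hence dl: "a div n < l" by (simp add: less_mult_imp_div_less)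
    show "(l - (l - a div n)) * n + j = a" using a dl by auto
    show "l - a div n \<in> {1..l}" using dl by auto
  next
    fix i assume i: "i \<in> {1..l}"
    have e: "((l - i) * n + j) div n = l - i" "((l - i) * n + j) mod n = j" using j by auto
    show "l - ((l - i) * n + j) div n = i" unfolding e using i by auto
    have "(l - i) * n + j < (l - i + 1) * n" using j by simp
    also have "\<dots> \<le> l * n" using i by (intro mult_right_mono) auto
    finally show "(l - i) * n + j \<in> {a. a < l * n \<and> a mod n = j}" using e by auto
  qed auto
  finally have C: "(ssC ?M *v ss_state ?M w k) $ j = (\<Sum>i\<in>{1..l}. h i)" .
  have "ssD ?M = lam 0 \<cdot>\<^sub>m 1\<^sub>m n" using nth[of 0] by (simp add: multiplier_def mk_ss_def)
  hence "(ssD ?M *v w k) $ j = h 0" using wk j by (simp add: smult_mat_mult_vec[of _ n n] h_def)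
  hence "ss_op ?M w k $ j = (\<Sum>i\<in>{1..l}. h i) + h 0"
    using C D j by (simp add: ss_op_def del: index_mult_mat_vec)
  also have "\<dots> = (\<Sum>i\<le>l. h i)"
  proof -
    have "{..l} = insert 0 {1..l}" by auto
    thus ?thesis by simp
  qed
  finally show "ss_op ?M w k $ j = fir n lam l w k $ j" using j by (simp add: fir_def h_def)
qed

lemma fir_mat:
  assumes A: "A \<in> mats m n" and w: "w \<in> signals n"
  shows "fir m lam l (\<lambda>k. A *v w k) k = A *v fir n lam l w k"
proof (rule eq_vecI)
  show "dim_vec (fir m lam l (\<lambda>k. A *v w k) k) = dim_vec (A *v fir n lam l w k)" using A by simp
  have wk: "dim_vec (w k) = n" for k using w by (auto simp: signals_def)
  fix j assume "j < dim_vec (A *v fir n lam l w k)"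
  hence j: "j < m" using A by simp
  have "fir m lam l (\<lambda>k. A *v w k) k $ j = (\<Sum>i\<le>l. \<Sum>a<n. A $$ (j, a) * (lam i * (if i \<le> k then w (k - i) $ a else 0)))"
    using j A wk by (auto simp: fir_def scalar_prod_def sum_distrib_left mult_ac atLeast0LessThan intro!: sum.cong)
  also have "\<dots> = (\<Sum>a<n. \<Sum>i\<le>l. A $$ (j, a) * (lam i * (if i \<le> k then w (k - i) $ a else 0)))"
    by (rule sum.swap)
  also have "\<dots> = (A *v fir n lam l w k) $ j"
    using j A by (auto simp: fir_def scalar_prod_def sum_distrib_left atLeast0LessThan intro!: sum.cong)
  finally show "fir m lam l (\<lambda>k. A *v w k) k $ j = (A *v fir n lam l w k) $ j" .
qed

lemma fir_add:
  assumes "v \<in> signals n" "w \<in> signals n"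
  shows "fir n lam l (\<lambda>k. v k + w k) k = fir n lam l v k + fir n lam l w k"
proof (rule eq_vecI)
  have c: "dim_vec (v k) = n" "dim_vec (w k) = n" for k using assms by (auto simp: signals_def)
  fix j assume "j < dim_vec (fir n lam l v k + fir n lam l w k)"
  hence j: "j < n" by simp
  have e: "lam i * (if i \<le> k then (v (k - i) + w (k - i)) $ j else 0) =
      lam i * (if i \<le> k then v (k - i) $ j else 0) + lam i * (if i \<le> k then w (k - i) $ j else 0)" for i
    using j c by (simp add: distrib_left)
  have "fir n lam l (\<lambda>k. v k + w k) k $ j = (\<Sum>i\<le>l. lam i * (if i \<le> k then (v (k - i) + w (k - i)) $ j else 0))"
    unfolding fir_def by (rule index_vec[OF j])
  also have "\<dots> = fir n lam l v k $ j + fir n lam l w k $ j"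
    unfolding e sum.distrib using j by (simp add: fir_def)
  finally show "fir n lam l (\<lambda>k. v k + w k) k $ j = (fir n lam l v k + fir n lam l w k) $ j"
    using j by simp
qed simp

lemma fir_shift:
  assumes "x 0 = 0v n"
  shows "fir n lam l (\<lambda>k. x (Suc k)) k = fir n lam l x (Suc k)"
  unfolding fir_def
proof (intro eq_vecI, goal_cases)
  case (1 j)
  thus ?case using assms by (auto simp: Suc_diff_le le_Suc_eq intro!: sum.cong)
qed simp

lemma fir_zero: "x 0 = 0v n \<Longrightarrow> fir n lam l x 0 = 0v n"
  unfolding fir_def by (intro eq_vecI) (auto intro!: sum.neutral)

text \<open>Scalar coefficients commute with constant matrices, and also with the shift when the
  state starts at 0. Hence filtering the state gives the state for the filtered input.\<close>

lemma fir_commute: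
  assumes G: "ss_dims n p q G" and w: "w \<in> signals p"
  shows "fir q lam l (ss_op G w) k = ss_op G (fir p lam l w) k"
proof -
  have D: "ssA G \<in> mats n n" "ssB G \<in> mats n p" "ssC G \<in> mats q n" "ssD G \<in> mats q p"
    using G by (auto simp: ss_dims_def)
  let ?x = "ss_state G w"
  have x: "?x k \<in> vecs n" for k unfolding ss_state_eq_run
    by (rule run_carrier[of _ n _ p]) (use D w in \<open>auto simp: signals_def\<close>)
  hence xs: "?x \<in> signals n" by (simp add: signals_def)
  have wk: "w k \<in> vecs p" for k using w by (simp add: signals_def)
  have c: "(\<lambda>k. ssA G *v ?x k) \<in> signals n" "(\<lambda>k. ssB G *v w k) \<in> signals n"
    "(\<lambda>k. ssC G *v ?x k) \<in> signals q" "(\<lambda>k. ssD G *v w k) \<in> signals q"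
    unfolding signals_def using mult_mat_vec_carrier[OF D(1) x] mult_mat_vec_carrier[OF D(2) wk]
      mult_mat_vec_carrier[OF D(3) x] mult_mat_vec_carrier[OF D(4) wk] by auto
  have x0: "?x 0 = 0v n" using D by simp
  have st: "ss_state G (fir p lam l w) k = fir n lam l ?x k" for k
  proof (induction k)
    case 0 show ?case unfolding fir_zero[where x = ?x, OF x0] using D by simp
  next
    case (Suc k)
    have "fir n lam l ?x (Suc k) = fir n lam l (\<lambda>k. ssA G *v ?x k + ssB G *v w k) k"
      unfolding fir_shift[where x = ?x, OF x0, symmetric] by simp
    also have "\<dots> = ssA G *v fir n lam l ?x k + ssB G *v fir p lam l w k"
      unfolding fir_add[OF c(1,2)] fir_mat[OF D(1) xs] fir_mat[OF D(2) w] ..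
    finally show ?case by (simp add: Suc)
  qed
  show ?thesis unfolding ss_op_def st fir_add[OF c(3,4)] fir_mat[OF D(3) xs] fir_mat[OF D(4) w] ..
qed

text \<open>The shift register is nilpotent: a free state is 0 after \<open>l\<close> steps.\<close>

lemma schur_multiplier:
  assumes \<Lambda>: "\<Lambda> = map (\<lambda>i. lam i \<cdot>\<^sub>m 1\<^sub>m n) [0..<l + 1]"
  shows "schur (ssA (multiplier n l \<Lambda>))"
proof (rule schur_iff_l2[of _ "l * n"])
  let ?A = "ssA (multiplier n l \<Lambda>)"
  show A: "?A \<in> mats (l * n) (l * n)" using multiplier_dims[OF \<Lambda>] by (simp add: ss_dims_def)
  fix x :: signal assume x: "\<And>k. x k \<in> vecs (l * n)" "\<And>k. x (Suc k) = ?A *v x k"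
  have step: "(?A *v y) $ a = (if a + n < l * n then y $ (a + n) else 0)"
    if "a < l * n" "y \<in> vecs (l * n)" for a y
  proof -
    have "(?A *v y) $ a = (\<Sum>j<l * n. (if j = a + n then 1 else 0) * y $ j)"
      using that by (auto simp: multiplier_def mk_ss_def scalar_prod_def atLeast0LessThan intro!: sum.cong)
    also have "\<dots> = (\<Sum>j<l * n. if j = a + n then y $ j else 0)" by (intro sum.cong) auto
    also have "\<dots> = (if a + n < l * n then y $ (a + n) else 0)" by (simp add: sum.delta)
    finally show ?thesis .
  qed
  have z: "x k $ a = 0" if "l * n \<le> a + k * n" "a < l * n" for k a
    using that
  proof (induction k arbitrary: a)
    case (Suc k)
    thus ?case unfolding x(2) step[OF Suc.prems(2) x(1)] using Suc.IH[of "a + n"] by auto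
  qed simp
  have "x k = 0v (l * n)" if "k \<ge> l" for k
  proof (rule eq_vecI)
    fix a assume "a < dim_vec (0v (l * n) :: real vec)"
    moreover have "l * n \<le> a + k * n" using that by (meson mult_le_mono1 trans_le_add2)
    ultimately show "x k $ a = 0v (l * n) $ a" using z[of a k] by simp
  qed (use x(1)[of k] in simp)
  hence fin: "sq (x k) = 0" if "k \<ge> l" for k using that by simp
  have "(\<Sum>k<N. sq (x k)) \<le> (\<Sum>k<l. sq (x k))" for N
  proof -
    have "(\<Sum>k<N. sq (x k)) = (\<Sum>k\<in>{..<N} \<inter> {..<l}. sq (x k))"
      by (intro sum.mono_neutral_right ballI) (auto simp: fin not_less)
    also have "\<dots> \<le> (\<Sum>k<l. sq (x k))" by (intro sum_mono2) (auto simp: sq_nonneg)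
    finally show ?thesis .
  qed
  thus "l2 x" by (auto simp: l2_def)
qed

lemma scalar_prod_fir:
  assumes v: "v \<in> vecs n" and w: "\<And>k. w k \<in> vecs n"
  shows "v \<bullet> fir n lam l w k = (\<Sum>i\<le>l. lam i * (if i \<le> k then v \<bullet> w (k - i) else 0))"
proof -
  have "v \<bullet> fir n lam l w k = (\<Sum>j<n. \<Sum>i\<le>l. lam i * (if i \<le> k then v $ j * w (k - i) $ j else 0))"
    by (auto simp: scalar_prod_def fir_def sum_distrib_left atLeast0LessThan intro!: sum.cong)
  also have "\<dots> = (\<Sum>i\<le>l. \<Sum>j<n. lam i * (if i \<le> k then v $ j * w (k - i) $ j else 0))" by (rule sum.swap)
  also have "\<dots> = (\<Sum>i\<le>l. lam i * (if i \<le> k then v \<bullet> w (k - i) else 0))"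
    using w by (auto simp: scalar_prod_def sum_distrib_left atLeast0LessThan carrier_vecD[OF w] intro!: sum.cong)
  finally show ?thesis .
qed

text \<open>Stable invertibility by diagonal dominance. As delayed coefficients are nonpositive,
  pairing \<open>u\<close> with its filtered version gives at least the coefficient sum
  \<open>\<sigma>\<close> times the energy of \<open>u\<close>, on every horizon.\<close>

lemma fir_l2:
  assumes lam: "\<forall>i \<in> {1..l}. lam i \<le> 0" and pos: "(\<Sum>i\<le>l. lam i) > 0"
    and u: "u \<in> signals n" and l2: "l2 (fir n lam l u)"
  shows "l2 u"
proof -
  define \<sigma> where "\<sigma> = (\<Sum>i\<le>l. lam i)"
  obtain c where c: "\<And>N. (\<Sum>k<N. sq (fir n lam l u k)) \<le> c" using l2 by (auto simp: l2_def)
  have uk: "u k \<in> vecs n" for k using u by (simp add: signals_def)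
  let ?u = "\<lambda>i k. if i \<le> k then sq (u (k - i)) else 0"
  note ip = scalar_prod_fir[OF uk uk]
  have key: "(\<Sum>i\<le>l. lam i * (sq (u k) + ?u i k)) \<le> 2 * (u k \<bullet> fir n lam l u k)" for k
    unfolding ip[of k] sum_distrib_left
  proof (intro sum_mono)
    fix i assume i: "i \<in> {..l}"
    show "lam i * (sq (u k) + ?u i k) \<le> 2 * (lam i * (if i \<le> k then u k \<bullet> u (k - i) else 0))"
    proof (cases "i = 0")
      case False
      hence "lam i \<le> 0" using lam i by auto
      moreover have "2 * (if i \<le> k then u k \<bullet> u (k - i) else 0) \<le> sq (u k) + ?u i k"
        using young[OF uk[of k] uk[of "k - i"], of 1] sq_nonneg[of "u k"] by simp
      ultimately have "lam i * (sq (u k) + ?u i k) \<le> lam i * (2 * (if i \<le> k then u k \<bullet> u (k - i) else 0))"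
        by (rule mult_left_mono_neg[rotated])
      thus ?thesis by (simp only: mult.left_commute)
    qed simp
  qed
  have "\<sigma> * (\<Sum>k<N. sq (u k)) \<le> c / \<sigma>" for N
  proof -
    define S where "S = (\<Sum>k<N. sq (u k))"
    have S: "S \<ge> 0" by (simp add: S_def sum_nonneg sq_nonneg)
    have sh: "(\<Sum>k<N. ?u i k) \<le> S" for i
    proof -
      have "(\<Sum>k<N. ?u i k) = (\<Sum>k\<in>{k. k < N \<and> i \<le> k}. sq (u (k - i)))"
        by (intro sum.mono_neutral_cong_right) auto
      also have "\<dots> = (\<Sum>j<N - i. sq (u j))"
        by (rule sum.reindex_bij_witness[of _ "\<lambda>j. j + i" "\<lambda>k. k - i"]) auto
      also have "\<dots> \<le> S" unfolding S_def by (intro sum_mono2) (auto simp: sq_nonneg)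
      finally show ?thesis .
    qed
    have "2 * \<sigma> * S = (\<Sum>i\<le>l. lam i * (S + S))" by (simp add: \<sigma>_def sum_distrib_right sum_distrib_left algebra_simps)
    also have "\<dots> \<le> (\<Sum>i\<le>l. lam i * (S + (\<Sum>k<N. ?u i k)))"
    proof (intro sum_mono)
      fix i assume i: "i \<in> {..l}"
      show "lam i * (S + S) \<le> lam i * (S + (\<Sum>k<N. ?u i k))"
      proof (cases "i = 0")
        case False
        hence "lam i \<le> 0" using lam i by auto
        thus ?thesis using sh by (intro mult_left_mono_neg) auto
      qed (simp add: S_def)
    qed
    also have "\<dots> = (\<Sum>k<N. \<Sum>i\<le>l. lam i * (sq (u k) + ?u i k))"
      unfolding S_def sum.distrib[symmetric] sum_distrib_left by (rule sum.swap)
    also have "\<dots> \<le> (\<Sum>k<N. 2 * (u k \<bullet> fir n lam l u k))" by (rule sum_mono[OF key])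
    \<comment> \<open>Young's inequality with weight \<open>\<sigma>\<close> takes only half of
      \<open>2 * \<sigma> * S\<close>.\<close>
    also have "\<dots> \<le> (\<Sum>k<N. \<sigma> * sq (u k) + sq (fir n lam l u k) / \<sigma>)"
      by (intro sum_mono young[OF uk]) (use pos in \<open>auto simp: \<sigma>_def\<close>)
    also have "\<dots> = \<sigma> * S + (\<Sum>k<N. sq (fir n lam l u k)) / \<sigma>"
      by (simp add: S_def sum.distrib sum_distrib_left sum_divide_distrib)
    also have "\<dots> \<le> \<sigma> * S + c / \<sigma>"
      using c[of N] pos by (intro add_left_mono divide_right_mono) (auto simp: \<sigma>_def)
    finally show ?thesis by (simp add: S_def)
  qed
  hence "(\<Sum>k<N. sq (u k)) \<le> c / \<sigma> / \<sigma>" for N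
    using pos by (simp add: \<sigma>_def pos_le_divide_eq mult_ac)
  thus ?thesis by (auto simp: l2_def)
qed

section \<open>The structured realization\<close>

lemma ss_state_carrier:
  assumes "ss_dims n p q S" "w \<in> signals p" shows "ss_state S w k \<in> vecs n"
  unfolding ss_state_eq_run
  by (rule run_carrier[of _ n _ p]) (use assms in \<open>auto simp: ss_dims_def signals_def\<close>)

lemma ss_op_signal:
  assumes S: "ss_dims n p q S" and w: "w \<in> signals p" shows "ss_op S w \<in> signals q"
proof -
  have "ssC S \<in> mats q n" "ssD S \<in> mats q p" using S by (auto simp: ss_dims_def)
  moreover have "w k \<in> vecs p" for k using w by (simp add: signals_def)
  ultimately show ?thesis using ss_state_carrier[OF S w]
    unfolding signals_def ss_op_def by (auto intro!: add_carrier_vec mult_mat_vec_carrier)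
qed

lemma gen_plant_dims:
  assumes G: "plant_dims nG nu nv d G" and P: "P = gen_plant_of nG nv d m L \<rho> G"
  shows "gA P \<in> mats (d + nG) (d + nG)" "gB1 P \<in> mats (d + nG) d" "gB P \<in> mats (d + nG) nu"
    "gC1 P \<in> mats d (d + nG)" "gD1 P \<in> mats d d" "gE P \<in> mats d nu"
    "gC P \<in> mats (d + nv) (d + nG)" "gF P \<in> mats (d + nv) d"
  using G unfolding P gen_plant_of_def plant_dims_def by auto

lemma T_dims:
  assumes G: "plant_dims nG nu nv d G" and P: "P = gen_plant_of nG nv d m L \<rho> G"
    and M: "Mt \<in> mats nu (d + nG)" and Lt: "Lt \<in> mats (d + nG) (d + nv)"
  shows "ss_dims ((d + nG) + (d + nG)) d d (T1_ss P Mt Lt)" "ss_dims (d + nG) nu d (T2_ss P Mt)"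
    "ss_dims (d + nG) d (d + nv) (T3_ss P Lt)"
proof -
  note g = gen_plant_dims[OF G P]
  have c: "gA P + gB P * Mt \<in> mats (d + nG) (d + nG)" "gA P + Lt * gC P \<in> mats (d + nG) (d + nG)"
    "gB P * Mt \<in> mats (d + nG) (d + nG)" "gE P * Mt \<in> mats d (d + nG)"
    "gB1 P + Lt * gF P \<in> mats (d + nG) d" "gC1 P + gE P * Mt \<in> mats d (d + nG)"
    using g M Lt by auto
  show "ss_dims ((d + nG) + (d + nG)) d d (T1_ss P Mt Lt)" "ss_dims (d + nG) nu d (T2_ss P Mt)"
    "ss_dims (d + nG) d (d + nv) (T3_ss P Lt)"
    using c g by (auto simp: ss_dims_def T1_ss_def T2_ss_def T3_ss_def mk_ss_def)
qed

lemma Lambda_r_tuples: "\<Lambda> \<in> Lambda_r d l \<rho> \<Longrightarrow> \<Lambda> \<in> tuples d l"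
  by (auto simp: Lambda_r_def tuples_def)

lemma SNR_cong:
  assumes "\<And>w. w \<in> signals d \<Longrightarrow> G w = H w" shows "SNR d G \<longleftrightarrow> SNR d H"
proof -
  have "w \<in> signals d" if "w \<in> l2_signals d" for w using that by (simp add: l2_signals_def)
  thus ?thesis using assms unfolding SNR_def stable_op_def by simp
qed

locale structured_realization =
  fixes d l nu nv n1 n2 :: nat and R :: realization
  assumes dims: "realization_dims d l nu nv n1 n2 R" and schur12: "schur (rA1 R)" "schur (rA2 R)"
begin

lemma rdims:
  "rA1 R \<in> mats n1 n1" "rA2 R \<in> mats n2 n2" "rB11 R \<in> mats n1 d" "rB22 R \<in> mats n2 nu"
  "rC12 R \<in> mats d n2" "rE R \<in> mats d nu" "rC21 R \<in> mats (d + nv) n1" "rF R \<in> mats (d + nv) d"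
  "\<Lambda> \<in> tuples d l \<Longrightarrow> rC11 R \<Lambda> \<in> mats d n1" "\<Lambda> \<in> tuples d l \<Longrightarrow> rD1 R \<Lambda> \<in> mats d d"
  using dims unfolding realization_dims_def by auto

lemma full_dims:
  "rA R \<in> mats (n1 + n2) (n1 + n2)" "rB1 R \<in> mats (n1 + n2) d" "rB R \<in> mats (n1 + n2) nu"
  "rC R \<in> mats (d + nv) (n1 + n2)" "\<Lambda> \<in> tuples d l \<Longrightarrow> rC1 R \<Lambda> \<in> mats d (n1 + n2)"
  using rdims by (auto simp: rA_def rB1_def rB_def rC_def rC1_def)

lemma rB_mult: "u \<in> vecs nu \<Longrightarrow> rB R *v u = 0v n1 @v (rB22 R *v u)"
  using rdims unfolding rB_def by (subst mat_mult_append[of _ n1 nu _ n2]) (auto simp: zero_mat_mult_vec)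

lemma rB_transpose_mult:
  assumes a: "a \<in> vecs n1" and b: "b \<in> vecs n2"
  shows "(rB R)\<^sup>T *v (a @v b) = (rB22 R)\<^sup>T *v b"
proof (rule vec_eq_by_scalar_prod)
  have ab: "a @v b \<in> vecs (n1 + n2)" using a b by simp
  show "(rB R)\<^sup>T *v (a @v b) \<in> vecs nu" "(rB22 R)\<^sup>T *v b \<in> vecs nu"
    using full_dims(3) rdims(4) ab b by (meson mult_mat_vec_carrier transpose_carrier_mat)+
  fix u :: "real vec" assume u: "u \<in> vecs nu"
  have c: "rB22 R *v u \<in> vecs n2" by (rule mult_mat_vec_carrier[OF rdims(4) u])
  show "((rB R)\<^sup>T *v (a @v b)) \<bullet> u = ((rB22 R)\<^sup>T *v b) \<bullet> u"
    unfolding transpose_vec_mult_scalar[OF full_dims(3) u ab] transpose_vec_mult_scalar[OF rdims(4) u b] rB_mult[OF u]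
    using scalar_prod_append[OF a b zero_carrier_vec c] a by simp
qed

text \<open>The control excites only the second block of the state, and the measurement sees only
  the first.\<close>

lemma uncontrolled_output:
  assumes u: "u \<in> signals nu"
  shows "rC R *v run (rA R) (rB R) (0v (n1 + n2)) u k = 0v (d + nv)"
proof -
  have uk: "u k \<in> vecs nu" for k using u by (simp add: signals_def)
  have "\<exists>b \<in> vecs n2. run (rA R) (rB R) (0v (n1 + n2)) u k = 0v n1 @v b"
  proof (induction k)
    case 0
    show ?case by (intro bexI[of _ "0v n2"]) (simp_all add: zero_append_zero)
  next
    case (Suc k)
    then obtain b where b: "b \<in> vecs n2" "run (rA R) (rB R) (0v (n1 + n2)) u k = 0v n1 @v b" by blast
    have c: "rA2 R *v b \<in> vecs n2" "rB22 R *v u k \<in> vecs n2"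
      using mult_mat_vec_carrier[OF rdims(2) b(1)] mult_mat_vec_carrier[OF rdims(4) uk] by auto
    have "rA R *v (0v n1 @v b) = 0v n1 @v (rA2 R *v b)"
      unfolding rA_def using rdims b(1) c(1)
      by (subst four_block_mat_mult_vec[of _ n1 n1 _ n2 _ n2])
        (auto simp: zero_mat_mult_vec mult_mat_zero[OF rdims(1)])
    hence "run (rA R) (rB R) (0v (n1 + n2)) u (Suc k) = 0v n1 @v (rA2 R *v b + rB22 R *v u k)"
      using c by (simp add: b(2) rB_mult[OF uk] append_vec_add[of _ n1 _ _ n2])
    thus ?case using c by (intro bexI[of _ "rA2 R *v b + rB22 R *v u k"]) auto
  qed
  then obtain b where b: "b \<in> vecs n2" "run (rA R) (rB R) (0v (n1 + n2)) u k = 0v n1 @v b" by blast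
  have z: "0\<^sub>m (dim_row (rC21 R)) (dim_row (rA2 R)) = (0\<^sub>m (d + nv) n2 :: real mat)" using rdims by simp
  show ?thesis unfolding b(2) rC_def z
    using append_columns_mult[OF rdims(7) zero_carrier_mat zero_carrier_vec b(1)]
    by (simp add: mult_mat_zero[OF rdims(7)] zero_mat_mult_vec[OF b(1)])
qed

lemma U_spans:
  assumes "kernel_basis_mat (rC R @\<^sub>c rF R) U"
  shows "spans_kernel (d + nv) (n1 + n2 + d) (rC R @\<^sub>c rF R) U"
proof -
  have M: "rC R @\<^sub>c rF R \<in> mats (d + nv) (n1 + n2 + d)"
    by (rule append_columns_carrier[OF full_dims(4) rdims(8)])
  note k = kernel_basis_mat_props[OF M assms]
  show ?thesis unfolding spans_kernel_def
    using M k by (intro conjI exI[of _ "dim_col U"]) blast+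
qed

text \<open>The first block of a vector does not enter the kernel condition, so the kernel is the
  full first block times the kernel of the reduced matrix.\<close>

lemma V_spans:
  assumes V1: "dim_row V1 = n2" and V2: "dim_row V2 = d" and cc: "dim_col V1 = dim_col V2"
    and kb: "kernel_basis_mat ((rB22 R)\<^sup>T @\<^sub>c (rE R)\<^sup>T) (V1 @\<^sub>r V2)"
    and V: "V = four_block_mat (1\<^sub>m n1) (0\<^sub>m n1 (dim_col V1)) (0\<^sub>m (n2 + d) n1) (V1 @\<^sub>r V2)"
  shows "spans_kernel nu (n1 + n2 + d) ((rB R)\<^sup>T @\<^sub>c (rE R)\<^sup>T) V"
proof -
  let ?K = "(rB R)\<^sup>T @\<^sub>c (rE R)\<^sup>T" and ?K2 = "(rB22 R)\<^sup>T @\<^sub>c (rE R)\<^sup>T"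
  let ?c = "dim_col V1" and ?W = "V1 @\<^sub>r V2"
  have t: "(rB R)\<^sup>T \<in> mats nu (n1 + n2)" "(rB22 R)\<^sup>T \<in> mats nu n2"
    "(rE R)\<^sup>T \<in> mats nu d" using full_dims(3) rdims by auto
  have M2: "?K2 \<in> mats nu (n2 + d)" and M: "?K \<in> mats nu (n1 + n2 + d)"
    using append_columns_carrier[OF t(2,3)] append_columns_carrier[OF t(1,3)] by auto
  have W: "?W \<in> mats (n2 + d) ?c"
    using V1 V2 cc by (intro carrier_append_rows carrier_matI) auto
  hence dc: "dim_col ?W = ?c" by simp
  note k = kernel_basis_mat_props[OF M2 kb, unfolded dc]
  have Vc: "V \<in> mats (n1 + n2 + d) (n1 + ?c)"
    using four_block_carrier_mat[OF one_carrier_mat[of n1] W] unfolding V by (simp add: add.assoc)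
  have Vm: "V *v (a @v e) = a @v (?W *v e)" if a: "a \<in> vecs n1" and e: "e \<in> vecs ?c" for a e
  proof -
    have "?W *v e \<in> vecs (n2 + d)" by (rule mult_mat_vec_carrier[OF W e])
    thus ?thesis unfolding V
      by (subst four_block_mat_mult_vec[OF one_carrier_mat zero_carrier_mat zero_carrier_mat W a e])
        (use a e in \<open>simp add: zero_mat_mult_vec\<close>)
  qed
  have Km: "?K *v (a @v s) = ?K2 *v s" if a: "a \<in> vecs n1" and s: "s \<in> vecs (n2 + d)" for a s
  proof -
    define b where "b = vec_first s n2"
    define q where "q = vec_last s d"
    have bq: "s = b @v q" "b \<in> vecs n2" "q \<in> vecs d" using s by (auto simp: b_def q_def)
    have e: "a @v s = (a @v b) @v q" unfolding bq(1) by (intro eq_vecI) auto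
    have ab: "a @v b \<in> vecs (n1 + n2)" using a bq by simp
    show ?thesis unfolding e append_columns_mult[OF t(1,3) ab bq(3)] rB_transpose_mult[OF a bq(2)]
      unfolding bq(1) append_columns_mult[OF t(2,3) bq(2,3)] ..
  qed
  have sp: "\<exists>a e. a \<in> vecs n1 \<and> e \<in> vecs j \<and> v = a @v e" if "v \<in> vecs (n1 + j)" for v :: "real vec" and j
    using that by (intro exI[of _ "vec_first v n1"] exI[of _ "vec_last v j"]) auto
  show ?thesis unfolding spans_kernel_def
  proof (intro conjI exI[of _ "n1 + ?c"] M Vc ballI impI)
    fix v :: "real vec" assume "v \<in> vecs (n1 + ?c)"
    then obtain a e where ae: "a \<in> vecs n1" "e \<in> vecs ?c" and v: "v = a @v e" using sp by blast
    have We: "?W *v e \<in> vecs (n2 + d)" by (rule mult_mat_vec_carrier[OF W ae(2)])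
    show "?K *v (V *v v) = 0v nu" unfolding v Vm[OF ae] Km[OF ae(1) We] by (rule k(2)[OF ae(2)])
    assume "v \<noteq> 0v (n1 + ?c)"
    hence "\<not> (a = 0v n1 \<and> e = 0v ?c)" unfolding v by (auto simp: zero_append_zero)
    hence "a @v (?W *v e) \<noteq> 0v (n1 + (n2 + d))"
      using append_eq_0[OF carrier_vecD[OF ae(1)] carrier_vecD[OF We]] k(3)[OF ae(2)] by auto
    thus "V *v v \<noteq> 0v (n1 + n2 + d)" unfolding v Vm[OF ae] by (simp add: add.assoc)
  next
    fix x :: "real vec" assume "x \<in> vecs (n1 + n2 + d)" and K0: "?K *v x = 0v nu"
    then obtain a s where as: "a \<in> vecs n1" "s \<in> vecs (n2 + d)" and x: "x = a @v s"
      using sp[of x "n2 + d"] by (auto simp: add.assoc)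
    have "?K2 *v s = 0v nu" using K0 unfolding x Km[OF as] .
    then obtain e where e: "e \<in> vecs ?c" "s = ?W *v e" using k(4)[OF as(2)] by blast
    have "x = V *v (a @v e)" unfolding x Vm[OF as(1) e(1)] e(2) ..
    thus "\<exists>v \<in> vecs (n1 + ?c). x = V *v v" using as(1) e(1) by (intro bexI[of _ "a @v e"]) auto
  qed
qed

lemma youla_lmi:
  assumes U: "kernel_basis_mat (rC R @\<^sub>c rF R) U"
    and V: "dim_row V1 = n2" "dim_row V2 = d" "dim_col V1 = dim_col V2"
      "kernel_basis_mat ((rB22 R)\<^sup>T @\<^sub>c (rE R)\<^sup>T) (V1 @\<^sub>r V2)"
      "V = four_block_mat (1\<^sub>m n1) (0\<^sub>m n1 (dim_col V1)) (0\<^sub>m (n2 + d) n1) (V1 @\<^sub>r V2)"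
    and \<Lambda>: "\<Lambda> \<in> tuples d l"
  shows "youla_lmi (n1 + n2) d nu (d + nv) (rA R) (rB1 R) (rB R) (rC1 R \<Lambda>) (rD1 R \<Lambda>) (rE R) (rC R) (rF R)
    n1 n2 (rB22 R) U V"
proof (unfold_locales)
  show "schur (rA R)" using schur_block_diag[OF rdims(1) schur12(1) rdims(2) schur12(2)] rdims
    by (simp add: rA_def)
  show "rB R = 0\<^sub>m n1 nu @\<^sub>r rB22 R" using rdims by (simp add: rB_def)
  show "spans_kernel (d + nv) (n1 + n2 + d) (rC R @\<^sub>c rF R) U" by (rule U_spans[OF U])
  show "spans_kernel nu (n1 + n2 + d) ((rB R)\<^sup>T @\<^sub>c (rE R)\<^sup>T) V" by (rule V_spans[OF V])
qed (simp_all add: rdims full_dims \<Lambda> uncontrolled_output)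

text \<open>Only the input-output behaviour of the realization is given. Since \<open>T3\<close> is
  fed by \<open>w\<close> alone, \<open>y\<close> and \<open>u = Z y\<close> can be computed first;
  driving the realization with this pair then reproduces the feedback loop.\<close>

lemma closed_loop_operator:
  assumes G: "plant_dims nG nu nv d G" and P: "P = gen_plant_of nG nv d m L \<rho> G"
    and M: "Mt \<in> mats nu (d + nG)" and Lt: "Lt \<in> mats (d + nG) (d + nv)"
    and R: "is_realization d l nu P Mt Lt R" and \<Lambda>: "\<Lambda> \<in> tuples d l"
    and Z: "ss_dims nZ (d + nv) nu Z"
    and Y: "youla_plant (n1 + n2) d nu (d + nv) (rA R) (rB1 R) (rB R) (rC1 R \<Lambda>) (rD1 R \<Lambda>) (rE R) (rC R) (rF R)"
    and w: "w \<in> signals d"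
  shows "ss_op (youla_plant.loop_ss (n1 + n2) d (rA R) (rB1 R) (rB R) (rC1 R \<Lambda>) (rD1 R \<Lambda>) (rE R) (rC R) (rF R) nZ Z) w =
    add_op (ss_op (multiplier d l \<Lambda>) \<circ> ss_op (T1_ss P Mt Lt)) (ss_op (T2_ss P Mt) \<circ> ss_op Z \<circ> ss_op (T3_ss P Lt)) w"
proof
  interpret Y: youla_plant "n1 + n2" d nu "d + nv" "rA R" "rB1 R" "rB R" "rC1 R \<Lambda>" "rD1 R \<Lambda>" "rE R" "rC R" "rF R" by (rule Y)
  fix k
  note T = T_dims[OF G P M Lt]
  define y where "y = ss_op (T3_ss P Lt) w"
  define u where "u = ss_op Z y"
  have y: "y \<in> signals (d + nv)" unfolding y_def by (rule ss_op_signal[OF T(3) w])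
  have u: "u \<in> signals nu" unfolding u_def by (rule ss_op_signal[OF Z y])
  define z where "z k = ss_op (multiplier d l \<Lambda>) (ss_op (T1_ss P Mt Lt) w) k + ss_op (T2_ss P Mt) u k" for k
  have t2: "ss_op (T2_ss P Mt) u k \<in> vecs d" for k using ss_op_signal[OF T(2) u] by (simp add: signals_def)
  have zc: "dim_vec (z k) = d" for k using carrier_vecD[OF t2] by (simp add: z_def)
  have wk: "w k \<in> vecs d" and uk: "u k \<in> vecs nu" for k using w u by (auto simp: signals_def)
  let ?S = "full_ss R \<Lambda>"
  define x where "x = ss_state ?S (\<lambda>k. w k @v u k)"
  have step: "x (Suc k) = rA R *v x k + rB1 R *v w k + rB R *v u k" if c: "x k \<in> vecs (n1 + n2)" for k
  proof -
    have "rA R *v x k \<in> vecs (n1 + n2)" "rB1 R *v w k \<in> vecs (n1 + n2)" "rB R *v u k \<in> vecs (n1 + n2)"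
      using full_dims c wk uk by (meson mult_mat_vec_carrier)+
    thus ?thesis unfolding x_def ss_state.simps full_ss_def mk_ss_def state_space.simps
      by (simp add: append_columns_mult[OF full_dims(2,3) wk uk] assoc_add_vec[of _ "n1 + n2"])
  qed
  have x0: "x 0 = 0v (n1 + n2)" using full_dims(1) by (simp add: x_def full_ss_def mk_ss_def)
  have x: "x k \<in> vecs (n1 + n2)" for k
  proof (induction k)
    case (Suc k)
    show ?case unfolding step[OF Suc]
      using full_dims Suc wk uk by (intro add_carrier_vec) (meson mult_mat_vec_carrier)+
  qed (simp add: x0)
  have out: "rC1 R \<Lambda> *v x k + rD1 R \<Lambda> *v w k + rE R *v u k = z k \<and> rC R *v x k + rF R *v w k = y k" for k
  proof -
    have c: "rC1 R \<Lambda> *v x k \<in> vecs d" "rC R *v x k \<in> vecs (d + nv)" "rD1 R \<Lambda> *v w k \<in> vecs d"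
      "rE R *v u k \<in> vecs d" "rF R *v w k \<in> vecs (d + nv)"
      using full_dims(5)[OF \<Lambda>] full_dims(4) rdims x wk uk \<Lambda> by (meson mult_mat_vec_carrier)+
    have z0: "0\<^sub>m (dim_row (rF R)) (dim_col (rE R)) = (0\<^sub>m (d + nv) nu :: real mat)" using rdims by simp
    have Sf: "ssC ?S = rC1 R \<Lambda> @\<^sub>r rC R" "ssD ?S = four_block_mat (rD1 R \<Lambda>) (rE R) (rF R) (0\<^sub>m (d + nv) nu)"
      by (simp_all add: full_ss_def mk_ss_def z0)
    have e1: "(rC1 R \<Lambda> @\<^sub>r rC R) *v x k = (rC1 R \<Lambda> *v x k) @v (rC R *v x k)"
      by (rule mat_mult_append[OF full_dims(5)[OF \<Lambda>] full_dims(4) x])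
    have e2: "four_block_mat (rD1 R \<Lambda>) (rE R) (rF R) (0\<^sub>m (d + nv) nu) *v (w k @v u k) =
      (rD1 R \<Lambda> *v w k + rE R *v u k) @v (rF R *v w k)"
      by (subst four_block_mat_mult_vec[OF rdims(10)[OF \<Lambda>] rdims(6,8) zero_carrier_mat wk uk])
        (use c in \<open>simp add: zero_mat_mult_vec[OF uk]\<close>)
    have "ss_op ?S (\<lambda>k. w k @v u k) k = (rC1 R \<Lambda> *v x k + (rD1 R \<Lambda> *v w k + rE R *v u k)) @v (rC R *v x k + rF R *v w k)"
      unfolding ss_op_def x_def[symmetric] Sf e1 e2
      by (rule append_vec_add[of _ d _ _ "d + nv"]) (use c in auto)
    moreover have "ss_op ?S (\<lambda>k. w k @v u k) k = z k @v y k"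
      using R \<Lambda> w u unfolding is_realization_def by (simp add: z_def y_def add_op_def)
    moreover have "rC1 R \<Lambda> *v x k + (rD1 R \<Lambda> *v w k + rE R *v u k) \<in> vecs d" "z k \<in> vecs d"
      using c zc[of k] by (auto intro: carrier_vecI)
    ultimately show ?thesis using append_vec_eq c by (simp add: assoc_add_vec[of _ d])
  qed
  have "ss_op (Y.loop_ss nZ Z) w k = rC1 R \<Lambda> *v x k + rD1 R \<Lambda> *v w k + rE R *v ss_op Z y k"
    by (rule Y.loop_ss_op[where x = x, OF Z w x x0]) (use out step[OF x] in \<open>auto simp: u_def\<close>)
  also have "\<dots> = z k" using out[of k] by (simp add: u_def)
  finally show "ss_op (Y.loop_ss nZ Z) w k = add_op (ss_op (multiplier d l \<Lambda>) \<circ> ss_op (T1_ss P Mt Lt))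
      (ss_op (T2_ss P Mt) \<circ> ss_op Z \<circ> ss_op (T3_ss P Lt)) w k"
    by (simp add: add_op_def z_def u_def y_def)
qed

text \<open>The multiplier is the same on both sides; for each fixed one, both statements are
  equivalent to \<open>synthesis\<close>.\<close>

theorem SNR_iff_LMI:
  assumes G: "plant_dims nG nu nv d G" and P: "P = gen_plant_of nG nv d m L \<rho> G"
    and M: "Mt \<in> mats nu (d + nG)" and Lt: "Lt \<in> mats (d + nG) (d + nv)"
    and R: "is_realization d l nu P Mt Lt R"
    and U: "kernel_basis_mat (rC R @\<^sub>c rF R) U"
    and V: "dim_row V1 = n2" "dim_row V2 = d" "dim_col V1 = dim_col V2"
      "kernel_basis_mat ((rB22 R)\<^sup>T @\<^sub>c (rE R)\<^sup>T) (V1 @\<^sub>r V2)"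
      "V = four_block_mat (1\<^sub>m n1) (0\<^sub>m n1 (dim_col V1)) (0\<^sub>m (n2 + d) n1) (V1 @\<^sub>r V2)"
  shows "SNR_condition d l nu nv \<rho> P Mt Lt \<longleftrightarrow> LMI_condition d l n1 n2 \<rho> R U V"
proof -
  let ?op = "\<lambda>\<Lambda> Z. add_op (ss_op (multiplier d l \<Lambda>) \<circ> ss_op (T1_ss P Mt Lt))
    (ss_op (T2_ss P Mt) \<circ> ss_op Z \<circ> ss_op (T3_ss P Lt))"
  let ?lmi = "\<lambda>\<Lambda>. youla_lmi.lmi (n1 + n2) d (rA R) (rB1 R) (rC1 R \<Lambda>) (rD1 R \<Lambda>) n1 n2 U V"
  have eq: "(\<exists>nZ Z. ss_dims nZ (d + nv) nu Z \<and> schur (ssA Z) \<and> SNR d (?op \<Lambda> Z)) \<longleftrightarrow>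
      (\<exists>X W11 W12 W22. ?lmi \<Lambda> X W11 W12 W22)" if "\<Lambda> \<in> Lambda_r d l \<rho>" for \<Lambda>
  proof -
    have \<Lambda>: "\<Lambda> \<in> tuples d l" by (rule Lambda_r_tuples[OF that])
    interpret Y: youla_lmi "n1 + n2" d nu "d + nv" "rA R" "rB1 R" "rB R" "rC1 R \<Lambda>" "rD1 R \<Lambda>" "rE R" "rC R" "rF R"
      n1 n2 "rB22 R" U V by (rule youla_lmi[OF U V \<Lambda>])
    have S: "SNR d (ss_op (Y.loop_ss nZ Z)) \<longleftrightarrow> SNR d (?op \<Lambda> Z)" if "ss_dims nZ (d + nv) nu Z" for nZ Z
      by (rule SNR_cong) (rule closed_loop_operator[OF G P M Lt R \<Lambda> that Y.youla_plant_axioms])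
    have "(\<exists>nZ Z. ss_dims nZ (d + nv) nu Z \<and> schur (ssA Z) \<and> SNR d (?op \<Lambda> Z)) \<longleftrightarrow> Y.synthesis"
      using Y.synthesis_necessary Y.synthesis_sufficient S by metis
    also have "\<dots> \<longleftrightarrow> (\<exists>X W11 W12 W22. ?lmi \<Lambda> X W11 W12 W22)"
      using Y.lmi_imp_synthesis Y.synthesis_imp_lmi by blast
    finally show ?thesis .
  qed
  have "LMI_condition d l n1 n2 \<rho> R U V \<longleftrightarrow> (\<exists>\<Lambda> \<in> Lambda_r d l \<rho>. \<exists>X W11 W12 W22. ?lmi \<Lambda> X W11 W12 W22)"
  proof -
    have e: "?lmi \<Lambda> X W11 W12 W22 \<longleftrightarrow> X \<in> mats (n1 + n2) (n1 + n2) \<and> sym_mat X \<and>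
        W11 \<in> mats n1 n1 \<and> W12 \<in> mats n1 n2 \<and> W22 \<in> mats n2 n2 \<and>
        sym_mat (four_block_mat W11 W12 (W12\<^sup>T) W22) \<and>
        pos_def (four_block_mat X (bW1 W11 W12) ((bW1 W11 W12)\<^sup>T) ((bW1 W11 W12)\<^sup>T * bW2 W12 W22)) \<and>
        neg_def (U\<^sup>T * youla_lmi.primal_mat (n1 + n2) d (rA R) (rB1 R) (rC1 R \<Lambda>) (rD1 R \<Lambda>) X * U) \<and>
        pos_def (V\<^sup>T * youla_lmi.dual_mat (n1 + n2) d (rA R) (rB1 R) (rC1 R \<Lambda>) (rD1 R \<Lambda>)
          (bW1 W11 W12) (bW2 W12 W22) * V)"
      if "\<Lambda> \<in> Lambda_r d l \<rho>" for \<Lambda> X W11 W12 W22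
      by (rule youla_lmi.lmi_def[OF youla_lmi[OF U V Lambda_r_tuples[OF that]]])
    have p: "youla_lmi.primal_mat (n1 + n2) d (rA R) (rB1 R) (rC1 R \<Lambda>) (rD1 R \<Lambda>) X =
        (rA R @\<^sub>c rB1 R)\<^sup>T * X * (rA R @\<^sub>c rB1 R)
        - (1\<^sub>m (n1 + n2) @\<^sub>c 0\<^sub>m (n1 + n2) d)\<^sup>T * X * (1\<^sub>m (n1 + n2) @\<^sub>c 0\<^sub>m (n1 + n2) d)
        + (rC1 R \<Lambda> @\<^sub>c rD1 R \<Lambda>)\<^sup>T * (0\<^sub>m d (n1 + n2) @\<^sub>c 1\<^sub>m d)
        + (0\<^sub>m d (n1 + n2) @\<^sub>c 1\<^sub>m d)\<^sup>T * (rC1 R \<Lambda> @\<^sub>c rD1 R \<Lambda>)"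
      if "\<Lambda> \<in> Lambda_r d l \<rho>" for \<Lambda> X
      by (rule youla_lmi.primal_mat_def[OF youla_lmi[OF U V Lambda_r_tuples[OF that]]])
    note dm = youla_lmi.dual_mat_def[OF youla_lmi[OF U V Lambda_r_tuples], unfolded Let_def]
    have b: "?lmi \<Lambda> X W11 W12 W22 \<longleftrightarrow> X \<in> mats (n1 + n2) (n1 + n2) \<and> sym_mat X \<and>
        W11 \<in> mats n1 n1 \<and> W12 \<in> mats n1 n2 \<and> W22 \<in> mats n2 n2 \<and>
        sym_mat (four_block_mat W11 W12 (W12\<^sup>T) W22) \<and>
        (let n = n1 + n2;
             W1 = bW1 W11 W12;
             W2 = bW2 W12 W22;
             Y = W1\<^sup>T * W2;
             bA = W1\<^sup>T * rA R * W2;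
             bB1 = W1\<^sup>T * rB1 R;
             bC1 = rC1 R \<Lambda> * W2;
             bD1 = rD1 R \<Lambda>;
             AB = rA R @\<^sub>c rB1 R;
             CD = rC1 R \<Lambda> @\<^sub>c rD1 R \<Lambda>;
             I0 = 1\<^sub>m n @\<^sub>c 0\<^sub>m n d;
             OI = 0\<^sub>m d n @\<^sub>c 1\<^sub>m d;
             ACt = bA\<^sup>T @\<^sub>c bC1\<^sup>T;
             BDt = bB1\<^sup>T @\<^sub>c bD1\<^sup>T
         in
           pos_def (four_block_mat X W1 (W1\<^sup>T) Y) \<and>
           neg_def (U\<^sup>T *
             (AB\<^sup>T * X * AB - I0\<^sup>T * X * I0
              + CD\<^sup>T * OI + OI\<^sup>T * CD) * U) \<and>
           pos_def (V\<^sup>T *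
             (I0\<^sup>T * Y * I0 - ACt\<^sup>T * minv Y * ACt
              - OI\<^sup>T * BDt - BDt\<^sup>T * OI) * V))"
      if \<Lambda>: "\<Lambda> \<in> Lambda_r d l \<rho>" for \<Lambda> X W11 W12 W22
      unfolding e[OF \<Lambda>] Let_def p[OF \<Lambda>] dm[OF \<Lambda>] by (rule refl)
    show ?thesis unfolding LMI_condition_def using b by (metis (no_types, lifting))
  qed
  thus ?thesis unfolding SNR_condition_def using eq by (simp cong: bex_cong)
qed

end

section \<open>Closed loops\<close>

lemma minv_eq:
  assumes T: "T \<in> mats n n" and Ti: "Ti \<in> mats n n" and inv: "T * Ti = 1\<^sub>m n" "Ti * T = 1\<^sub>m n"
  shows "minv T = Ti" "invertible_mat T"
proof -
  have inj: "T *v x \<noteq> 0v n" if x: "x \<in> vecs n" "x \<noteq> 0v n" for x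
  proof
    assume "T *v x = 0v n"
    hence "Ti *v (T *v x) = 0v n" using mult_mat_zero[OF Ti] by simp
    moreover have "Ti *v (T *v x) = x" using assoc_mult_mat_vec[OF Ti T x(1)] inv(2) x(1) by simp
    ultimately show False using x(2) by simp
  qed
  note p = minv_props[OF T inj]
  have "minv T = minv T * (T * Ti)" using inv(1) p(1) by simp
  also have "\<dots> = minv T * T * Ti" by (rule assoc_mult_mat[OF p(1) T Ti, symmetric])
  also have "\<dots> = Ti" using p(3) Ti by simp
  finally show "minv T = Ti" .
  show "invertible_mat T" using inv T Ti unfolding invertible_mat_def inverts_mat_def by auto
qed

lemma detectable_part_self:
  assumes A: "A \<in> mats n n" and B: "B \<in> mats n d" and C: "C \<in> mats d n" and dt: "detectable A C"
  shows "detectable_part d A B C n A B C"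
  unfolding detectable_part_def
proof (intro conjI A B C dt, rule exI[of _ 0], rule exI[of _ "1\<^sub>m n"], rule exI[of _ "0\<^sub>m 0 n"],
    rule exI[of _ "0\<^sub>m 0 0"], rule exI[of _ "0\<^sub>m 0 d"], intro conjI)
  have m: "minv (1\<^sub>m n) = 1\<^sub>m n" and i: "invertible_mat (1\<^sub>m n :: real mat)" using minv_eq[of "1\<^sub>m n" n "1\<^sub>m n"] by auto
  show "invertible_mat (1\<^sub>m n :: real mat)" by (rule i)
  show "minv (1\<^sub>m n) * A * 1\<^sub>m n = four_block_mat A (0\<^sub>m n 0) (0\<^sub>m 0 n) (0\<^sub>m 0 0)"
    using A by (simp add: m) (auto intro!: eq_matI)
  show "minv (1\<^sub>m n) * B = B @\<^sub>r 0\<^sub>m 0 d"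
    using B by (simp add: m append_rows_def) (auto intro!: eq_matI)
  show "C * 1\<^sub>m n = C @\<^sub>c 0\<^sub>m d 0"
    using C by (simp add: append_columns_def) (auto intro!: eq_matI)
qed (use A in auto)

text \<open>A permutation brings the integrator block \<open>\<xi>\<close> to the front. By
  \<open>Am\<close> it is preserved by the dynamics, which gives the identity and the zero block; by
  \<open>Bm\<close> it is the only part that the input drives.\<close>

lemma integrator_form_by_swap:
  assumes A: "A \<in> mats (k + (d + r)) (k + (d + r))" and B: "B \<in> mats (k + (d + r)) d"
    and C: "C \<in> mats d (k + (d + r))"
    and Am: "\<And>x \<xi> y. x \<in> vecs k \<Longrightarrow> \<xi> \<in> vecs d \<Longrightarrow> y \<in> vecs r \<Longrightarrow>
      \<exists>x' y'. x' \<in> vecs k \<and> y' \<in> vecs r \<and> A *v (x @v (\<xi> @v y)) = x' @v (\<xi> @v y')"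
    and Bm: "\<And>w. w \<in> vecs d \<Longrightarrow> B *v w = 0v k @v (w @v 0v r)"
  shows "integrator_form d (k + (d + r)) A B C"
proof -
  define n where "n = k + (d + r)"
  define na where "na = k + r"
  have n: "n = d + na" by (simp add: n_def na_def)
  \<comment> \<open>\<open>t\<close> and \<open>s\<close> exchange the first two blocks in opposite
    directions and are inverse to each other.\<close>
  define t where "t v = vec_first (vec_last v na) k @v (vec_first v d @v vec_last (vec_last v na) r)" for v :: "real vec"
  define s where "s v = vec_first (vec_last v (d + r)) d @v (vec_first v k @v vec_last (vec_last v (d + r)) r)" for v :: "real vec"
  have "lin (d + (k + r)) (k + (d + r)) t" unfolding t_def na_def
    by (intro lin_append lin_first[OF lin_last_id] lin_last[OF lin_last_id] lin_first_id)
  hence lt: "lin n n t" by (simp add: n_def add.left_commute)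
  have "lin (k + (d + r)) (d + (k + r)) s" unfolding s_def
    by (intro lin_append lin_first[OF lin_last_id] lin_last[OF lin_last_id] lin_first_id)
  hence ls: "lin n n s" by (simp add: n_def add.left_commute)
  define T where "T = matf n n t"
  define Ti where "Ti = matf n n s"
  have c: "T \<in> mats n n" "Ti \<in> mats n n" by (simp_all add: T_def Ti_def)
  have Tm: "T *v (\<xi> @v (x @v y)) = x @v (\<xi> @v y)" and Tim: "Ti *v (x @v (\<xi> @v y)) = \<xi> @v (x @v y)"
    if "x \<in> vecs k" "\<xi> \<in> vecs d" "y \<in> vecs r" for x \<xi> y
  proof -
    have "\<xi> @v (x @v y) \<in> vecs n" "x @v (\<xi> @v y) \<in> vecs n"
      unfolding n_def using that by (auto intro: carrier_vecI)
    thus "T *v (\<xi> @v (x @v y)) = x @v (\<xi> @v y)" "Ti *v (x @v (\<xi> @v y)) = \<xi> @v (x @v y)"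
      unfolding T_def Ti_def using that by (simp_all add: matf_mult[OF lt] matf_mult[OF ls] t_def s_def na_def)
  qed
  have split3: "\<exists>a b c. a \<in> vecs i \<and> b \<in> vecs j \<and> c \<in> vecs l \<and> v = a @v (b @v c)"
    if "v \<in> vecs (i + (j + l))" for v :: "real vec" and i j l
  proof -
    have "v = vec_first v i @v (vec_first (vec_last v (j + l)) j @v vec_last (vec_last v (j + l)) l)"
      using that by simp
    thus ?thesis by (metis vec_first_carrier vec_last_carrier)
  qed
  have n': "d + (k + r) = n" by (simp add: n_def)
  have inv: "T * Ti = 1\<^sub>m n" "Ti * T = 1\<^sub>m n"
  proof -
    show "T * Ti = 1\<^sub>m n"
    proof (rule mat_eq_by_mult[of _ n n])
      fix v :: "real vec" assume v: "v \<in> vecs n"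
      then obtain x \<xi> y where p: "x \<in> vecs k" "\<xi> \<in> vecs d" "y \<in> vecs r" "v = x @v (\<xi> @v y)"
        using split3 unfolding n_def by blast
      show "(T * Ti) *v v = 1\<^sub>m n *v v" unfolding assoc_mult_mat_vec[OF c(1,2) v] using v
        by (simp add: p(4) Tim[OF p(1-3)] Tm[OF p(1-3)])
    qed (use c in auto)
    show "Ti * T = 1\<^sub>m n"
    proof (rule mat_eq_by_mult[of _ n n])
      fix v :: "real vec" assume v: "v \<in> vecs n"
      then obtain \<xi> x y where p: "x \<in> vecs k" "\<xi> \<in> vecs d" "y \<in> vecs r" "v = \<xi> @v (x @v y)"
        using split3[of v d k r] unfolding n' by blast
      show "(Ti * T) *v v = 1\<^sub>m n *v v" unfolding assoc_mult_mat_vec[OF c(2,1) v] using v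
        by (simp add: p(4) Tim[OF p(1-3)] Tm[OF p(1-3)])
    qed (use c in auto)
  qed
  note mi = minv_eq[OF c inv]
  have A': "A \<in> mats n n" and B': "B \<in> mats n d" and C': "C \<in> mats d n" using A B C by (simp_all add: n_def)
  define M where "M = Ti * A * T"
  have M: "M \<in> mats n n" using A' c by (simp add: M_def)
  have Mm: "\<exists>e. e \<in> vecs na \<and> M *v (\<xi> @v q) = \<xi> @v e" if \<xi>: "\<xi> \<in> vecs d" and q: "q \<in> vecs na" for \<xi> q
  proof -
    define x where "x = vec_first q k"
    define y where "y = vec_last q r"
    have xy: "x \<in> vecs k" "y \<in> vecs r" "q = x @v y" using q by (auto simp: x_def y_def na_def)
    have v: "\<xi> @v q \<in> vecs n" unfolding n using \<xi> q by simp
    obtain x' y' where x'y': "x' \<in> vecs k" "y' \<in> vecs r" "A *v (x @v (\<xi> @v y)) = x' @v (\<xi> @v y')"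
      using Am[OF xy(1) \<xi> xy(2)] by blast
    have "M *v (\<xi> @v q) = Ti *v (A *v (T *v (\<xi> @v q)))"
      unfolding M_def using A' c v by (simp add: assoc_mult_mat_vec[of _ n n _ n])
    also have "\<dots> = \<xi> @v (x' @v y')"
      unfolding xy(3) Tm[OF xy(1) \<xi> xy(2)] x'y'(3) by (rule Tim[OF x'y'(1) \<xi> x'y'(2)])
    finally show ?thesis using x'y'(1,2) by (intro exI[of _ "x' @v y'"]) (simp add: na_def)
  qed
  define Ba where "Ba = matf d na (\<lambda>\<xi>. vec_last (M *v (\<xi> @v 0v na)) na)"
  define Aa where "Aa = matf na na (\<lambda>q. vec_last (M *v (0v d @v q)) na)"
  define Da where "Da = matf d d (\<lambda>\<xi>. C * T *v (\<xi> @v 0v na))"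
  define Ca where "Ca = matf na d (\<lambda>q. C * T *v (0v d @v q))"
  have car: "Ba \<in> mats na d" "Aa \<in> mats na na" "Da \<in> mats d d" "Ca \<in> mats d na"
    by (simp_all add: Ba_def Aa_def Da_def Ca_def)
  have CT: "C * T \<in> mats d n" using C' c by simp
  have l1: "lin d (d + na) (\<lambda>\<xi>. \<xi> @v 0v na)" by (rule lin_append[OF lin_id lin_zero])
  have l2: "lin na (d + na) (\<lambda>q. 0v d @v q)" by (rule lin_append[OF lin_zero lin_id])
  have Mn: "M \<in> mats (d + na) (d + na)" and CTn: "C * T \<in> mats d (d + na)" using M CT by (simp_all add: n)
  have spl: "\<exists>\<xi> q. \<xi> \<in> vecs d \<and> q \<in> vecs na \<and> v = \<xi> @v q" if "v \<in> vecs n" for v :: "real vec"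
    using that unfolding n by (intro exI[of _ "vec_first v d"] exI[of _ "vec_last v na"]) auto
  have add: "\<xi> @v q = (\<xi> @v 0v na) + (0v d @v q)" if "\<xi> \<in> vecs d" "q \<in> vecs na" for \<xi> q :: "real vec"
    using that by (simp add: append_vec_add[of _ d _ _ na])
  show ?thesis unfolding integrator_form_def n_def[symmetric]
  proof (intro exI conjI)
    show "n = d + na" by (rule n)
    show "T \<in> mats n n" "invertible_mat T" by (rule c mi)+
    show "Ba \<in> mats na d" "Aa \<in> mats na na" "Da \<in> mats d d" "Ca \<in> mats d na" by (rule car)+
    show "minv T * A * T = four_block_mat (1\<^sub>m d) (0\<^sub>m d na) Ba Aa"
      unfolding mi(1) M_def[symmetric]
    proof (rule mat_eq_by_mult[OF M])
      show "four_block_mat (1\<^sub>m d) (0\<^sub>m d na) Ba Aa \<in> mats n n" unfolding n using car by auto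
      fix v :: "real vec" assume "v \<in> vecs n"
      then obtain \<xi> q where p: "\<xi> \<in> vecs d" "q \<in> vecs na" and v: "v = \<xi> @v q" using spl by blast
      obtain e1 where e1: "e1 \<in> vecs na" "M *v (\<xi> @v 0v na) = \<xi> @v e1" using Mm[OF p(1) zero_carrier_vec] by blast
      obtain e2 where e2: "e2 \<in> vecs na" "M *v (0v d @v q) = 0v d @v e2" using Mm[OF zero_carrier_vec p(2)] by blast
      have b: "Ba *v \<xi> = e1" "Aa *v q = e2"
        unfolding Ba_def Aa_def
        using e1 e2 by (simp_all add: matf_mult[OF lin_last[OF lin_mat[OF Mn l1]] p(1)] matf_mult[OF lin_last[OF lin_mat[OF Mn l2]] p(2)])
      have "M *v v = (\<xi> @v e1) + (0v d @v e2)"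
        unfolding v add[OF p] e1(2)[symmetric] e2(2)[symmetric]
        by (rule mult_add_distrib_mat_vec[OF Mn]) (use p in auto)
      also have "\<dots> = \<xi> @v (e1 + e2)" using p e1 e2 by (simp add: append_vec_add[of _ d _ _ na])
      also have "\<dots> = four_block_mat (1\<^sub>m d) (0\<^sub>m d na) Ba Aa *v v" unfolding v
        by (subst four_block_mat_mult_vec[OF one_carrier_mat zero_carrier_mat car(1,2) p])
          (use p in \<open>simp add: b zero_mat_mult_vec\<close>)
      finally show "M *v v = four_block_mat (1\<^sub>m d) (0\<^sub>m d na) Ba Aa *v v" .
    qed
    show "minv T * B = 1\<^sub>m d @\<^sub>r 0\<^sub>m na d" unfolding mi(1)
    proof (rule mat_eq_by_mult[of _ n d])
      show "Ti * B \<in> mats n d" using c B' by simp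
      show "1\<^sub>m d @\<^sub>r 0\<^sub>m na d \<in> mats n d" unfolding n by (intro carrier_append_rows) auto
      fix w :: "real vec" assume w: "w \<in> vecs d"
      have "(Ti * B) *v w = Ti *v (B *v w)" by (rule assoc_mult_mat_vec[OF c(2) B' w])
      also have "\<dots> = w @v (0v k @v 0v r)" unfolding Bm[OF w] by (rule Tim) (use w in auto)
      also have "\<dots> = (1\<^sub>m d @\<^sub>r 0\<^sub>m na d) *v w"
        by (subst mat_mult_append[of _ d d _ na]) (use w in \<open>auto simp: zero_mat_mult_vec zero_append_zero na_def\<close>)
      finally show "(Ti * B) *v w = (1\<^sub>m d @\<^sub>r 0\<^sub>m na d) *v w" .
    qed
    show "C * T = Da @\<^sub>c Ca"
    proof (rule mat_eq_by_mult[OF CT])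
      show "Da @\<^sub>c Ca \<in> mats d n" unfolding n by (rule append_columns_carrier[OF car(3,4)])
      fix v :: "real vec" assume "v \<in> vecs n"
      then obtain \<xi> q where p: "\<xi> \<in> vecs d" "q \<in> vecs na" and v: "v = \<xi> @v q" using spl by blast
      have "C * T *v v = C * T *v (\<xi> @v 0v na) + C * T *v (0v d @v q)"
        unfolding v add[OF p] by (rule mult_add_distrib_mat_vec[OF CTn]) (use p in auto)
      also have "\<dots> = Da *v \<xi> + Ca *v q" unfolding Da_def Ca_def
        by (simp add: matf_mult[OF lin_mat[OF CTn l1] p(1)] matf_mult[OF lin_mat[OF CTn l2] p(2)])
      finally show "C * T *v v = (Da @\<^sub>c Ca) *v v" unfolding v append_columns_mult[OF car(3,4) p] .
    qed
  qed
qed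

lemma closed_loop_mult:
  assumes G: "plant_dims nG nu nv d G" and K: "controller_dims nK nu nv d K"
    and x: "x \<in> vecs nG" and \<kappa>: "\<kappa> \<in> vecs nK"
    and v: "v = CG2 G *v x" and u: "u = DK2 K *v v + CK K *v \<kappa>"
  shows "clA G K *v (x @v \<kappa>) = (AG G *v x + BG G *v u) @v (BK2 K *v v + AK K *v \<kappa>)"
    and "clC G K *v (x @v \<kappa>) = CG1 G *v x + DG1 G *v u"
proof -
  have g: "AG G \<in> mats nG nG" "BG G \<in> mats nG nu" "CG1 G \<in> mats d nG" "DG1 G \<in> mats d nu"
    "CG2 G \<in> mats nv nG" using G by (auto simp: plant_dims_def)
  have k: "AK K \<in> mats nK nK" "BK2 K \<in> mats nK nv" "CK K \<in> mats nu nK" "DK2 K \<in> mats nu nv"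
    using K by (auto simp: controller_dims_def)
  have vc: "v \<in> vecs nv" unfolding v by (rule mult_mat_vec_carrier[OF g(5) x])
  have uc: "DK2 K *v v \<in> vecs nu" "CK K *v \<kappa> \<in> vecs nu"
    using mult_mat_vec_carrier[OF k(4) vc] mult_mat_vec_carrier[OF k(3) \<kappa>] by auto
  have sum: "(S + M * DK2 K * CG2 G) *v x + (M * CK K) *v \<kappa> = S *v x + M *v u"
    if S: "S \<in> mats j nG" and M: "M \<in> mats j nu" for S M :: "real mat" and j
  proof -
    have MD: "M * DK2 K \<in> mats j nv" using M k by simp
    have c: "S *v x \<in> vecs j" "M *v (DK2 K *v v) \<in> vecs j" "M *v (CK K *v \<kappa>) \<in> vecs j"
      using S M x uc by (meson mult_mat_vec_carrier)+
    have "(S + M * DK2 K * CG2 G) *v x = S *v x + (M * DK2 K * CG2 G) *v x"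
      by (rule add_mult_distrib_mat_vec[OF S _ x]) (use MD g in simp)
    also have "(M * DK2 K * CG2 G) *v x = M *v (DK2 K *v v)"
      unfolding v assoc_mult_mat_vec[OF MD g(5) x] using assoc_mult_mat_vec[OF M k(4) vc] by (simp add: v)
    finally show ?thesis unfolding u mult_add_distrib_mat_vec[OF M uc] assoc_mult_mat_vec[OF M k(3) \<kappa>]
      using c by (simp add: assoc_add_vec[of _ j])
  qed
  have b: "(BK2 K * CG2 G) *v x = BK2 K *v v" unfolding v by (rule assoc_mult_mat_vec[OF k(2) g(5) x])
  have m1: "AG G + BG G * DK2 K * CG2 G \<in> mats nG nG" "BG G * CK K \<in> mats nG nK"
    "BK2 K * CG2 G \<in> mats nK nG" "CG1 G + DG1 G * DK2 K * CG2 G \<in> mats d nG" "DG1 G * CK K \<in> mats d nK"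
    using g k by auto
  show "clA G K *v (x @v \<kappa>) = (AG G *v x + BG G *v u) @v (BK2 K *v v + AK K *v \<kappa>)"
    unfolding clA_def four_block_mat_mult_vec[OF m1(1-3) k(1) x \<kappa>] sum[OF g(1,2)] b ..
  show "clC G K *v (x @v \<kappa>) = CG1 G *v x + DG1 G *v u"
    unfolding clC_def append_columns_mult[OF m1(4,5) x \<kappa>] sum[OF g(3,4)] ..
qed

lemma closed_loop_dims:
  assumes G: "plant_dims nG nu nv d G" and K: "controller_dims nK nu nv d K"
  shows "clA G K \<in> mats (nG + nK) (nG + nK)" "clB G K \<in> mats (nG + nK) d"
    "clC G K \<in> mats d (nG + nK)" "w \<in> vecs d \<Longrightarrow> clB G K *v w = 0v nG @v (BK1 K *v w)"
proof -
  have g: "AG G \<in> mats nG nG" "BG G \<in> mats nG nu" "CG1 G \<in> mats d nG" "DG1 G \<in> mats d nu"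
    "CG2 G \<in> mats nv nG" using G by (auto simp: plant_dims_def)
  have k: "AK K \<in> mats nK nK" "BK1 K \<in> mats nK d" "BK2 K \<in> mats nK nv" "CK K \<in> mats nu nK" "DK2 K \<in> mats nu nv"
    using K by (auto simp: controller_dims_def)
  have z: "0\<^sub>m (dim_row (AG G)) (dim_col (BK1 K)) = (0\<^sub>m nG d :: real mat)" using g k by simp
  show "clA G K \<in> mats (nG + nK) (nG + nK)" "clC G K \<in> mats d (nG + nK)"
    unfolding clA_def clC_def using g k by auto
  show "clB G K \<in> mats (nG + nK) d" unfolding clB_def z by (rule carrier_append_rows[OF _ k(2)]) simp
  show "clB G K *v w = 0v nG @v (BK1 K *v w)" if "w \<in> vecs d"
    unfolding clB_def z mat_mult_append[OF zero_carrier_mat k(2) that] by (simp add: zero_mat_mult_vec[OF that])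
qed

lemma gen_plant_mult:
  assumes G: "plant_dims nG nu nv d G" and P: "P = gen_plant_of nG nv d m L \<rho> G"
    and \<xi>: "\<xi> \<in> vecs d" and x: "x \<in> vecs nG" and p: "p \<in> vecs d" and u: "u \<in> vecs nu"
  shows "gA P *v (\<xi> @v x) = (1 / \<rho>) *s ((\<xi> + m *s (CG1 G *v x)) @v (AG G *v x))"
    and "gB1 P *v p = (1 / \<rho>) *s (p @v 0v nG)"
    and "gB P *v u = (1 / \<rho>) *s ((m *s (DG1 G *v u)) @v (BG G *v u))"
    and "gC1 P *v (\<xi> @v x) = (L - m) *s (CG1 G *v x)"
    and "gD1 P *v p = - p" and "gE P *v u = (L - m) *s (DG1 G *v u)"
    and "gC P *v (\<xi> @v x) = \<xi> @v (CG2 G *v x)" and "gF P *v p = 0v (d + nv)"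
proof -
  have g: "AG G \<in> mats nG nG" "BG G \<in> mats nG nu" "CG1 G \<in> mats d nG" "DG1 G \<in> mats d nu"
    "CG2 G \<in> mats nv nG" using G by (auto simp: plant_dims_def)
  have c: "CG1 G *v x \<in> vecs d" "AG G *v x \<in> vecs nG" "CG2 G *v x \<in> vecs nv"
    using g x by (meson mult_mat_vec_carrier)+
  have xx: "\<xi> @v x \<in> vecs (d + nG)" using \<xi> x by simp
  have mC: "m \<cdot>\<^sub>m CG1 G \<in> mats d nG" and mD: "m \<cdot>\<^sub>m DG1 G \<in> mats d nu" using g by auto
  have f: "four_block_mat (1\<^sub>m d) (m \<cdot>\<^sub>m CG1 G) (0\<^sub>m nG d) (AG G) \<in> mats (d + nG) (d + nG)"
    "1\<^sub>m d @\<^sub>r 0\<^sub>m nG d \<in> mats (d + nG) d" "(m \<cdot>\<^sub>m DG1 G) @\<^sub>r BG G \<in> mats (d + nG) nu"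
    "0\<^sub>m d d @\<^sub>c CG1 G \<in> mats d (d + nG)"
    using four_block_carrier_mat[OF one_carrier_mat g(1)] carrier_append_rows[OF one_carrier_mat zero_carrier_mat]
      carrier_append_rows[OF mD g(2)] append_columns_carrier[OF zero_carrier_mat g(3)] by auto
  show "gA P *v (\<xi> @v x) = (1 / \<rho>) *s ((\<xi> + m *s (CG1 G *v x)) @v (AG G *v x))"
    unfolding P gen_plant_of_def gen_plant.simps smult_mat_mult_vec[OF f(1) xx]
      four_block_mat_mult_vec[OF one_carrier_mat mC zero_carrier_mat g(1) \<xi> x]
      smult_mat_mult_vec[OF g(3) x] zero_mat_mult_vec[OF \<xi>] using \<xi> c by simp
  show "gB1 P *v p = (1 / \<rho>) *s (p @v 0v nG)"
    unfolding P gen_plant_of_def gen_plant.simps smult_mat_mult_vec[OF f(2) p]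
      mat_mult_append[OF one_carrier_mat zero_carrier_mat p] zero_mat_mult_vec[OF p] using p by simp
  show "gB P *v u = (1 / \<rho>) *s ((m *s (DG1 G *v u)) @v (BG G *v u))"
    unfolding P gen_plant_of_def gen_plant.simps smult_mat_mult_vec[OF f(3) u]
      mat_mult_append[OF mD g(2) u] smult_mat_mult_vec[OF g(4) u] ..
  show "gC1 P *v (\<xi> @v x) = (L - m) *s (CG1 G *v x)"
    unfolding P gen_plant_of_def gen_plant.simps smult_mat_mult_vec[OF f(4) xx]
      append_columns_mult[OF zero_carrier_mat g(3) \<xi> x] zero_mat_mult_vec[OF \<xi>] using c by simp
  show "gD1 P *v p = - p" unfolding P gen_plant_of_def gen_plant.simps
    using p by (intro eq_vecI) (auto simp: scalar_prod_uminus_left scalar_prod_left_unit)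
  show "gE P *v u = (L - m) *s (DG1 G *v u)"
    unfolding P gen_plant_of_def gen_plant.simps by (rule smult_mat_mult_vec[OF g(4) u])
  show "gC P *v (\<xi> @v x) = \<xi> @v (CG2 G *v x)"
    unfolding P gen_plant_of_def gen_plant.simps
      four_block_mat_mult_vec[OF one_carrier_mat zero_carrier_mat zero_carrier_mat g(5) \<xi> x]
      zero_mat_mult_vec[OF \<xi>] zero_mat_mult_vec[OF x] using \<xi> c by simp
  show "gF P *v p = 0v (d + nv)" unfolding P gen_plant_of_def gen_plant.simps by (rule zero_mat_mult_vec[OF p])
qed

section \<open>The controller\<close>

text \<open>A jointly linear map is cut into one matrix per argument by freezing the other argument
  at 0. In this way controllers and filters given by formulas obtain their matrices.\<close>

lemma matf_lin2:
  assumes l: "lin (n + u) m (\<lambda>v. f (vec_first v n) (vec_last v u))" and x: "x \<in> vecs n" and y: "y \<in> vecs u"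
  shows "matf n m (\<lambda>x. f x (0v u)) *v x + matf u m (\<lambda>y. f (0v n) y) *v y = f x y"
    and "matf n m (\<lambda>x. f x (0v u)) *v x = f x (0v u)" "matf u m (\<lambda>y. f (0v n) y) *v y = f (0v n) y"
proof -
  have l1: "lin n m (\<lambda>x. f x (0v u))"
    using lin_comp[OF lin_append[OF lin_id lin_zero] l] by (subst (asm) lin_cong[where g = "\<lambda>x. f x (0v u)"]) auto
  have l2: "lin u m (\<lambda>y. f (0v n) y)"
    using lin_comp[OF lin_append[OF lin_zero lin_id] l] by (subst (asm) lin_cong[where g = "\<lambda>y. f (0v n) y"]) auto
  show e1: "matf n m (\<lambda>x. f x (0v u)) *v x = f x (0v u)" and e2: "matf u m (\<lambda>y. f (0v n) y) *v y = f (0v n) y"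
    by (rule matf_mult[OF l1 x] matf_mult[OF l2 y])+
  have eq: "x @v y = (x @v 0v u) + (0v n @v y)" using x y by (simp add: append_vec_add[of _ n _ _ u])
  have "f x y = f x (0v u) + f (0v n) y"
    using linD(2)[OF l, of "x @v 0v u" "0v n @v y", folded eq] x y by simp
  thus "matf n m (\<lambda>x. f x (0v u)) *v x + matf u m (\<lambda>y. f (0v n) y) *v y = f x y" unfolding e1 e2 by simp
qed

lemma matf_lin3:
  assumes l: "lin (n + (d + u)) m (\<lambda>v. f (vec_first v n) (vec_first (vec_last v (d + u)) d) (vec_last (vec_last v (d + u)) u))"
    and x: "x \<in> vecs n" and y: "y \<in> vecs d" and z: "z \<in> vecs u"
  shows "matf n m (\<lambda>x. f x (0v d) (0v u)) *v x + matf d m (\<lambda>y. f (0v n) y (0v u)) *v y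
      + matf u m (\<lambda>z. f (0v n) (0v d) z) *v z = f x y z"
    and "matf n m (\<lambda>x. f x (0v d) (0v u)) *v x = f x (0v d) (0v u)"
    and "matf u m (\<lambda>z. f (0v n) (0v d) z) *v z = f (0v n) (0v d) z"
proof -
  define g where "g = (\<lambda>a b. f a (vec_first b d) (vec_last b u))"
  have lg: "lin (n + (d + u)) m (\<lambda>v. g (vec_first v n) (vec_last v (d + u)))" using l by (simp add: g_def)
  have z0: "(0v (d + u) :: real vec) = 0v d @v 0v u" by (simp add: zero_append_zero)
  have yz: "y @v z \<in> vecs (d + u)" using y z by simp
  note g = matf_lin2[OF lg x yz]
  have gx: "matf n m (\<lambda>x. g x (0v (d + u))) *v x = f x (0v d) (0v u)" unfolding g(2) unfolding z0 g_def by simp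
  have l2: "lin (d + u) m (g (0v n))"
    using lin_comp[OF lin_append[OF lin_zero lin_id] lg] by (subst (asm) lin_cong[where g = "g (0v n)"]) auto
  have l2': "lin (d + u) m (\<lambda>v. f (0v n) (vec_first v d) (vec_last v u))" using l2 by (simp add: g_def)
  note h = matf_lin2[OF l2' y z]
  show a: "matf n m (\<lambda>x. f x (0v d) (0v u)) *v x = f x (0v d) (0v u)"
    using gx unfolding g_def z0 by simp
  show "matf u m (\<lambda>z. f (0v n) (0v d) z) *v z = f (0v n) (0v d) z" by (rule h(3))
  have c: "f x (0v d) (0v u) \<in> vecs m" "f (0v n) y (0v u) \<in> vecs m" "f (0v n) (0v d) z \<in> vecs m"
    using matf_carrier mult_mat_vec_carrier x y z a h(2,3) by metis+
  have "f x y z = f x (0v d) (0v u) + f (0v n) y z"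
    using g(1) unfolding gx g(3) using y z by (simp add: g_def)
  also have "f (0v n) y z = f (0v n) y (0v u) + f (0v n) (0v d) z" using h by simp
  finally show "matf n m (\<lambda>x. f x (0v d) (0v u)) *v x + matf d m (\<lambda>y. f (0v n) y (0v u)) *v y
      + matf u m (\<lambda>z. f (0v n) (0v d) z) *v z = f x y z"
    unfolding a h(2,3) using c by (simp add: assoc_add_vec[of _ m])
qed

locale observer_loop =
  fixes nG nu nv d :: nat and m L \<rho> :: real and G :: plant and P :: gen_plant and Mt Lt :: "real mat"
  assumes mL: "0 < m" "m < L" and \<rho>: "0 < \<rho>" "\<rho> < 1" and G: "plant_dims nG nu nv d G"
    and P: "P = gen_plant_of nG nv d m L \<rho> G"
    and Mt: "Mt \<in> mats nu (d + nG)" and sM: "schur (gA P + gB P * Mt)"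
    and Lt: "Lt \<in> mats (d + nG) (d + nv)" and sL: "schur (gA P + Lt * gC P)"
begin

abbreviation "N \<equiv> d + nG"

lemma g: "gA P \<in> mats N N" "gB1 P \<in> mats N d" "gB P \<in> mats N nu"
    "gC1 P \<in> mats d N" "gD1 P \<in> mats d d" "gE P \<in> mats d nu"
    "gC P \<in> mats (d + nv) N" "gF P \<in> mats (d + nv) d"
  using gen_plant_dims[OF G P] by auto

text \<open>\<open>a\<close> is the state of the generalized plant, \<open>e\<close> the observer
  error, \<open>q\<close> the output of the Youla parameter and \<open>p\<close> the transformed
  gradient. The state feedback acts on the estimate \<open>a - e\<close>.\<close>

definition hx where "hx a e q p = gA P *v a + gB P *v (Mt *v (a - e) + q) + gB1 P *v p"
definition he where "he e p = gA P *v e + Lt *v (gC P *v e) + gB1 P *v p"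
definition hz where "hz a e q p = gC1 P *v a + gE P *v (Mt *v (a - e) + q) + gD1 P *v p"

lemma lin_h:
  assumes "lin k N a" "lin k N e" "lin k nu q" "lin k d p"
  shows "lin k N (\<lambda>v. hx (a v) (e v) (q v) (p v))" "lin k N (\<lambda>v. he (e v) (p v))" "lin k d (\<lambda>v. hz (a v) (e v) (q v) (p v))"
  unfolding hx_def he_def hz_def
  by (intro lin_add lin_mat[OF g(1)] lin_mat[OF g(2)] lin_mat[OF g(3)] lin_mat[OF Mt] lin_minus assms)
    (intro lin_add lin_mat[OF g(1)] lin_mat[OF g(2)] lin_mat[OF Lt] lin_mat[OF g(7)] assms,
     intro lin_add lin_mat[OF g(4)] lin_mat[OF g(5)] lin_mat[OF g(6)] lin_mat[OF Mt] lin_minus assms)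

lemma h_carrier:
  assumes "a \<in> vecs N" "e \<in> vecs N" "q \<in> vecs nu" "p \<in> vecs d"
  shows "hx a e q p \<in> vecs N" "he e p \<in> vecs N" "hz a e q p \<in> vecs d"
proof -
  have c: "Mt *v (a - e) + q \<in> vecs nu"
    using assms by (intro add_carrier_vec mult_mat_vec_carrier[OF Mt] minus_carrier_vec) auto
  show "hx a e q p \<in> vecs N" "he e p \<in> vecs N" "hz a e q p \<in> vecs d"
    unfolding hx_def he_def hz_def
    by (intro add_carrier_vec mult_mat_vec_carrier[OF g(1)] mult_mat_vec_carrier[OF g(2)] mult_mat_vec_carrier[OF g(3)]
        mult_mat_vec_carrier[OF g(4)] mult_mat_vec_carrier[OF g(5)] mult_mat_vec_carrier[OF g(6)]
        mult_mat_vec_carrier[OF Lt] mult_mat_vec_carrier[OF g(7)] assms c)+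
qed

text \<open>The controller state consists of an integrator \<open>\<xi>\<close> of the gradients, an observer state for the generalized
  plant and the state of the Youla parameter \<open>Q\<close>. As the generalized plant is scaled by \<open>\<rho>\<^sup>-\<^sup>k\<close>, the observer
  and \<open>Q\<close> are scaled back by \<open>\<rho>\<close>.\<close>

definition innov :: "real vec \<Rightarrow> real vec \<Rightarrow> real vec \<Rightarrow> real vec" where
  "innov \<xi> xh v = (\<xi> @v v) - gC P *v xh"

definition ctl_u :: "state_space \<Rightarrow> real vec \<Rightarrow> real vec \<Rightarrow> real vec \<Rightarrow> real vec \<Rightarrow> real vec" where
  "ctl_u Q \<xi> xh xq v = Mt *v xh + (ssC Q *v xq + ssD Q *v innov \<xi> xh v)"

definition ctl_next :: "state_space \<Rightarrow> real vec \<Rightarrow> real vec \<Rightarrow> real vec \<Rightarrow> real vec \<Rightarrow> real vec \<Rightarrow> real vec" where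
  "ctl_next Q \<xi> xh xq v w = (\<xi> + w) @v
     (\<rho> *s (gA P *v xh + gB P *v ctl_u Q \<xi> xh xq v - Lt *v innov \<xi> xh v) @v
      \<rho> *s (ssA Q *v xq + ssB Q *v innov \<xi> xh v))"

definition ctl :: "nat \<Rightarrow> state_space \<Rightarrow> controller" where
  "ctl nQ Q = (let
     u = (\<lambda>\<kappa> v. ctl_u Q (vec_first \<kappa> d) (vec_first (vec_last \<kappa> (N + nQ)) N) (vec_last (vec_last \<kappa> (N + nQ)) nQ) v);
     s = (\<lambda>\<kappa> v w. ctl_next Q (vec_first \<kappa> d) (vec_first (vec_last \<kappa> (N + nQ)) N) (vec_last (vec_last \<kappa> (N + nQ)) nQ) v w);
     k = d + (N + nQ)
   in \<lparr>AK = matf k k (\<lambda>\<kappa>. s \<kappa> (0v nv) (0v d)), BK1 = matf d k (\<lambda>w. s (0v k) (0v nv) w),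
       BK2 = matf nv k (\<lambda>v. s (0v k) v (0v d)), CK = matf k nu (\<lambda>\<kappa>. u \<kappa> (0v nv)), DK2 = matf nv nu (\<lambda>v. u (0v k) v)\<rparr>)"

lemma ctl_dims: "controller_dims (d + (N + nQ)) nu nv d (ctl nQ Q)"
  by (simp add: ctl_def controller_dims_def Let_def)

lemma lin_ctl:
  assumes Q: "ss_dims nQ (d + nv) nu Q" and f: "lin k d \<xi>" "lin k N xh" "lin k nQ xq" "lin k nv v" "lin k d w"
  shows "lin k nu (\<lambda>t. ctl_u Q (\<xi> t) (xh t) (xq t) (v t))"
    "lin k (d + (N + nQ)) (\<lambda>t. ctl_next Q (\<xi> t) (xh t) (xq t) (v t) (w t))"
proof -
  have q: "ssA Q \<in> mats nQ nQ" "ssB Q \<in> mats nQ (d + nv)" "ssC Q \<in> mats nu nQ" "ssD Q \<in> mats nu (d + nv)"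
    using Q by (auto simp: ss_dims_def)
  have i: "lin k (d + nv) (\<lambda>t. innov (\<xi> t) (xh t) (v t))" unfolding innov_def
    by (intro lin_minus lin_append lin_mat[OF g(7)] f)
  show u: "lin k nu (\<lambda>t. ctl_u Q (\<xi> t) (xh t) (xq t) (v t))" unfolding ctl_u_def
    by (intro lin_add lin_mat[OF Mt] lin_mat[OF q(3)] lin_mat[OF q(4)] i f)
  show "lin k (d + (N + nQ)) (\<lambda>t. ctl_next Q (\<xi> t) (xh t) (xq t) (v t) (w t))" unfolding ctl_next_def
    by (intro lin_append lin_add lin_smult lin_minus lin_mat[OF g(1)] lin_mat[OF g(3)] lin_mat[OF Lt] lin_mat[OF q(1)] lin_mat[OF q(2)] u i f)
qed

lemma ctl_mult:
  assumes Q: "ss_dims nQ (d + nv) nu Q" and c: "\<xi> \<in> vecs d" "xh \<in> vecs N" "xq \<in> vecs nQ"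
    "v \<in> vecs nv" "w \<in> vecs d"
  shows "AK (ctl nQ Q) *v (\<xi> @v (xh @v xq)) + BK2 (ctl nQ Q) *v v + BK1 (ctl nQ Q) *v w = ctl_next Q \<xi> xh xq v w"
    and "CK (ctl nQ Q) *v (\<xi> @v (xh @v xq)) + DK2 (ctl nQ Q) *v v = ctl_u Q \<xi> xh xq v"
    and "BK1 (ctl nQ Q) *v w = w @v (0v N @v 0v nQ)"
proof -
  let ?k = "d + (N + nQ)"
  define s where "s \<kappa> v w = ctl_next Q (vec_first \<kappa> d) (vec_first (vec_last \<kappa> (N + nQ)) N) (vec_last (vec_last \<kappa> (N + nQ)) nQ) v w" for \<kappa> v w
  define u where "u \<kappa> v = ctl_u Q (vec_first \<kappa> d) (vec_first (vec_last \<kappa> (N + nQ)) N) (vec_last (vec_last \<kappa> (N + nQ)) nQ) v" for \<kappa> v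
  have q: "ssA Q \<in> mats nQ nQ" "ssB Q \<in> mats nQ (d + nv)" "ssC Q \<in> mats nu nQ" "ssD Q \<in> mats nu (d + nv)"
    using Q by (auto simp: ss_dims_def)
  have K: "ctl nQ Q = \<lparr>AK = matf ?k ?k (\<lambda>\<kappa>. s \<kappa> (0v nv) (0v d)), BK1 = matf d ?k (\<lambda>w. s (0v ?k) (0v nv) w),
       BK2 = matf nv ?k (\<lambda>v. s (0v ?k) v (0v d)), CK = matf ?k nu (\<lambda>\<kappa>. u \<kappa> (0v nv)), DK2 = matf nv nu (\<lambda>v. u (0v ?k) v)\<rparr>"
    by (simp add: ctl_def Let_def s_def u_def)
  have ls: "lin (?k + (nv + d)) ?k (\<lambda>t. s (vec_first t ?k) (vec_first (vec_last t (nv + d)) nv) (vec_last (vec_last t (nv + d)) d))"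
    unfolding s_def
    by (intro lin_ctl(2)[OF Q] lin_first[OF lin_first_id] lin_first[OF lin_last[OF lin_first_id]] lin_last[OF lin_last[OF lin_first_id]]
        lin_first[OF lin_last_id] lin_last[OF lin_last_id])
  have lu: "lin (?k + nv) nu (\<lambda>t. u (vec_first t ?k) (vec_last t nv))" unfolding u_def
    by (intro lin_ctl(1)[OF Q _ _ _ _ lin_zero] lin_first[OF lin_first_id] lin_first[OF lin_last[OF lin_first_id]] lin_last[OF lin_last[OF lin_first_id]]
        lin_last_id)
  have \<kappa>: "\<xi> @v (xh @v xq) \<in> vecs ?k" using c by simp
  have e: "vec_first (\<xi> @v (xh @v xq)) d = \<xi>" "vec_first (vec_last (\<xi> @v (xh @v xq)) (N + nQ)) N = xh"
    "vec_last (vec_last (\<xi> @v (xh @v xq)) (N + nQ)) nQ = xq" using c by simp_all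
  show "AK (ctl nQ Q) *v (\<xi> @v (xh @v xq)) + BK2 (ctl nQ Q) *v v + BK1 (ctl nQ Q) *v w = ctl_next Q \<xi> xh xq v w"
    unfolding K controller.simps matf_lin3(1)[OF ls \<kappa> c(4,5)] by (simp only: s_def e)
  show "CK (ctl nQ Q) *v (\<xi> @v (xh @v xq)) + DK2 (ctl nQ Q) *v v = ctl_u Q \<xi> xh xq v"
    unfolding K controller.simps matf_lin2(1)[OF lu \<kappa> c(4)] by (simp only: u_def e)
  have z: "vec_first (0v ?k) d = (0v d :: real vec)" "vec_first (vec_last (0v ?k) (N + nQ)) N = (0v N :: real vec)"
    "vec_last (vec_last (0v ?k) (N + nQ)) nQ = (0v nQ :: real vec)"
    by (auto simp: vec_first_def vec_last_def intro!: eq_vecI)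
  have i0: "innov (0v d) (0v N) (0v nv) = 0v (d + nv)"
    using mult_mat_zero[OF g(7)] by (simp add: innov_def zero_append_zero)
  have u0: "ctl_u Q (0v d) (0v N) (0v nQ) (0v nv) = 0v nu"
    unfolding ctl_u_def i0 by (simp add: mult_mat_zero[OF Mt] mult_mat_zero[OF q(3)] mult_mat_zero[OF q(4)])
  have sz: "\<rho> *s 0v k = 0v k" for k by (intro eq_vecI) auto
  show "BK1 (ctl nQ Q) *v w = w @v (0v N @v 0v nQ)"
    unfolding K controller.simps matf_lin3(3)[OF ls \<kappa> c(4,5)] s_def z ctl_next_def u0 i0
    using c(5) by (simp add: sz mult_mat_zero[OF g(1)] mult_mat_zero[OF g(3)] mult_mat_zero[OF Lt] mult_mat_zero[OF q(1)] mult_mat_zero[OF q(2)])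
qed

text \<open>Integrator and plant states together form the state of the generalized plant: its term
  \<open>m z\<close> cancels against \<open>p = w - m z\<close>, leaving the integration of
  \<open>w\<close>. The observer is not fed with \<open>p\<close>, which is why \<open>p\<close>
  drives the error. The control cancels from the error equation.\<close>

lemma loop_step:
  assumes Q: "ss_dims nQ (d + nv) nu Q" and x: "x \<in> vecs nG" and \<xi>: "\<xi> \<in> vecs d"
    and xh: "xh \<in> vecs N" and xq: "xq \<in> vecs nQ" and w: "w \<in> vecs d"
  defines "a \<equiv> \<xi> @v x" defines "e \<equiv> a - xh" defines "y \<equiv> gC P *v e"
  defines "q \<equiv> ssC Q *v xq + ssD Q *v y"
  defines "z \<equiv> clC G (ctl nQ Q) *v (x @v (\<xi> @v (xh @v xq)))"
  defines "p \<equiv> w - m *s z"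
  shows "\<exists>x' xh'. x' \<in> vecs nG \<and> xh' \<in> vecs N \<and>
    clA G (ctl nQ Q) *v (x @v (\<xi> @v (xh @v xq))) + clB G (ctl nQ Q) *v w =
      x' @v ((\<xi> + w) @v (xh' @v \<rho> *s (ssA Q *v xq + ssB Q *v y))) \<and>
    (\<xi> + w) @v x' = \<rho> *s hx a e q p \<and> ((\<xi> + w) @v x') - xh' = \<rho> *s he e p \<and>
    (L - m) *s z - p = hz a e q p"
proof -
  let ?K = "ctl nQ Q"
  define v where "v = CG2 G *v x"
  have pg: "AG G \<in> mats nG nG" "BG G \<in> mats nG nu" "CG1 G \<in> mats d nG" "DG1 G \<in> mats d nu"
    "CG2 G \<in> mats nv nG" using G by (auto simp: plant_dims_def)
  have qd: "ssA Q \<in> mats nQ nQ" "ssB Q \<in> mats nQ (d + nv)" "ssC Q \<in> mats nu nQ" "ssD Q \<in> mats nu (d + nv)"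
    using Q by (auto simp: ss_dims_def)
  have kd: "AK ?K \<in> mats (d + (N + nQ)) (d + (N + nQ))" "BK1 ?K \<in> mats (d + (N + nQ)) d"
    "BK2 ?K \<in> mats (d + (N + nQ)) nv" "CK ?K \<in> mats nu (d + (N + nQ))" "DK2 ?K \<in> mats nu nv"
    using ctl_dims[of nQ Q] by (auto simp: controller_dims_def)
  have v: "v \<in> vecs nv" unfolding v_def by (rule mult_mat_vec_carrier[OF pg(5) x])
  have a: "a \<in> vecs N" using \<xi> x by (simp add: a_def)
  have e: "e \<in> vecs N" using a xh by (simp add: e_def)
  have y: "y \<in> vecs (d + nv)" unfolding y_def by (rule mult_mat_vec_carrier[OF g(7) e])
  have q: "q \<in> vecs nu" unfolding q_def
    by (intro add_carrier_vec mult_mat_vec_carrier[OF qd(3) xq] mult_mat_vec_carrier[OF qd(4) y])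
  have yi: "innov \<xi> xh v = y"
  proof -
    have "y = gC P *v a - gC P *v xh" unfolding y_def e_def by (rule mult_minus_distrib_mat_vec[OF g(7) a xh])
    thus ?thesis unfolding innov_def v_def a_def gen_plant_mult(7)[OF G P \<xi> x w q] by simp
  qed
  define u where "u = Mt *v xh + q"
  have u: "u \<in> vecs nu" unfolding u_def by (intro add_carrier_vec mult_mat_vec_carrier[OF Mt xh] q)
  have uc: "ctl_u Q \<xi> xh xq v = u" by (simp add: ctl_u_def yi q_def u_def)
  have ae: "a - e = xh" unfolding e_def using a xh by (intro eq_vecI) auto
  define \<kappa> where "\<kappa> = \<xi> @v (xh @v xq)"
  have \<kappa>: "\<kappa> \<in> vecs (d + (N + nQ))" using \<xi> xh xq by (simp add: \<kappa>_def)
  have kc: "AK ?K *v \<kappa> \<in> vecs (d + (N + nQ))" "BK2 ?K *v v \<in> vecs (d + (N + nQ))"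
    "BK1 ?K *v w \<in> vecs (d + (N + nQ))" "CK ?K *v \<kappa> \<in> vecs nu" "DK2 ?K *v v \<in> vecs nu"
    using kd \<kappa> v w by (meson mult_mat_vec_carrier)+
  have u': "u = DK2 ?K *v v + CK ?K *v \<kappa>"
    using ctl_mult(2)[OF Q \<xi> xh xq v w] comm_add_vec[OF kc(4,5)] by (simp add: uc \<kappa>_def)
  note cl = closed_loop_mult[OF G ctl_dims x \<kappa> v_def u']
  have zz: "z = CG1 G *v x + DG1 G *v u" unfolding z_def cl(2)[unfolded \<kappa>_def] ..
  define x' where "x' = AG G *v x + BG G *v u"
  define xh' where "xh' = \<rho> *s (gA P *v xh + gB P *v u - Lt *v y)"
  have gc: "AG G *v x \<in> vecs nG" "BG G *v u \<in> vecs nG" "CG1 G *v x \<in> vecs d" "DG1 G *v u \<in> vecs d"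
    using pg x u by (meson mult_mat_vec_carrier)+
  have x': "x' \<in> vecs nG" using gc by (simp add: x'_def)
  have z: "z \<in> vecs d" using gc by (simp add: zz)
  have p: "p \<in> vecs d" using w z by (simp add: p_def)
  have lc: "gA P *v xh \<in> vecs N" "gB P *v u \<in> vecs N" "Lt *v y \<in> vecs N" "gA P *v a \<in> vecs N"
    "gB1 P *v p \<in> vecs N" "gA P *v e \<in> vecs N"
    using g Lt xh u y a p e by (meson mult_mat_vec_carrier)+
  have xh': "xh' \<in> vecs N" using lc by (simp add: xh'_def)
  have "clA G ?K *v (x @v \<kappa>) + clB G ?K *v w = (x' + 0v nG) @v (BK2 ?K *v v + AK ?K *v \<kappa> + BK1 ?K *v w)"
    unfolding cl(1) closed_loop_dims(4)[OF G ctl_dims w] x'_def[symmetric]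
    by (rule append_vec_add[of _ nG _ _ "d + (N + nQ)"]) (use x' kc in auto)
  also have "x' + 0v nG = x'" using x' by simp
  also have "BK2 ?K *v v + AK ?K *v \<kappa> = AK ?K *v \<kappa> + BK2 ?K *v v" by (rule comm_add_vec[OF kc(2,1)])
  also have "AK ?K *v \<kappa> + BK2 ?K *v v + BK1 ?K *v w = ctl_next Q \<xi> xh xq v w"
    unfolding \<kappa>_def by (rule ctl_mult(1)[OF Q \<xi> xh xq v w])
  also have "\<dots> = (\<xi> + w) @v (xh' @v \<rho> *s (ssA Q *v xq + ssB Q *v y))"
    by (simp add: ctl_next_def uc yi xh'_def)
  finally have c1: "clA G ?K *v (x @v (\<xi> @v (xh @v xq))) + clB G ?K *v w =
      x' @v ((\<xi> + w) @v (xh' @v \<rho> *s (ssA Q *v xq + ssB Q *v y)))" by (simp add: \<kappa>_def)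
  have hxe: "hx a e q p = gA P *v a + gB P *v u + gB1 P *v p" by (simp add: hx_def ae u_def)
  have c2: "(\<xi> + w) @v x' = \<rho> *s hx a e q p"
  proof -
    define b1 where "b1 = CG1 G *v x"
    define b2 where "b2 = DG1 G *v u"
    define b3 where "b3 = AG G *v x"
    define b4 where "b4 = BG G *v u"
    have b: "b1 \<in> vecs d" "b2 \<in> vecs d" "b3 \<in> vecs nG" "b4 \<in> vecs nG"
      using gc by (simp_all add: b1_def b2_def b3_def b4_def)
    show ?thesis
      unfolding hxe unfolding a_def gen_plant_mult(1-3)[OF G P \<xi> x p u]
      unfolding x'_def p_def zz
        b1_def[symmetric] b2_def[symmetric] b3_def[symmetric] b4_def[symmetric]
      using \<rho>(1) \<xi> w b by (intro eq_vecI) (auto simp: field_simps)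
  qed
  have c3: "((\<xi> + w) @v x') - xh' = \<rho> *s he e p"
  proof -
    have ge: "gA P *v e = gA P *v a - gA P *v xh" unfolding e_def by (rule mult_minus_distrib_mat_vec[OF g(1) a xh])
    define b1 where "b1 = gA P *v a"
    define b2 where "b2 = gA P *v xh"
    define b3 where "b3 = gB P *v u"
    define b4 where "b4 = Lt *v y"
    define b5 where "b5 = gB1 P *v p"
    have b: "b1 \<in> vecs N" "b2 \<in> vecs N" "b3 \<in> vecs N" "b4 \<in> vecs N" "b5 \<in> vecs N"
      using lc by (simp_all add: b1_def b2_def b3_def b4_def b5_def)
    show ?thesis
      unfolding c2 hxe he_def ge xh'_def y_def[symmetric]
        b1_def[symmetric] b2_def[symmetric] b3_def[symmetric] b4_def[symmetric] b5_def[symmetric]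
      using b by (intro eq_vecI) (auto simp: algebra_simps)
  qed
  have c4: "(L - m) *s z - p = hz a e q p"
  proof -
    define b1 where "b1 = CG1 G *v x"
    define b2 where "b2 = DG1 G *v u"
    have b: "b1 \<in> vecs d" "b2 \<in> vecs d" using gc by (simp_all add: b1_def b2_def)
    show ?thesis
      unfolding hz_def ae u_def[symmetric] unfolding a_def gen_plant_mult(4,5,6)[OF G P \<xi> x p u]
      unfolding zz b1_def[symmetric] b2_def[symmetric]
      using b p by (intro eq_vecI) (auto simp: algebra_simps)
  qed
  show ?thesis by (intro exI[of _ x'] exI[of _ xh'] conjI x' xh' c1 c2 c3 c4)
qed

end

section \<open>Closed loop with multiplier\<close>

context observer_loop
begin

text \<open>The state consists of the plant state, the observer error and the multiplier state.\<close>

definition fil_next where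
  "fil_next M nf s w u =
    (let a = vec_first (vec_first s (N + N)) N; e = vec_last (vec_first s (N + N)) N; xf = vec_last s nf
     in (hx a e u w @v he e w) @v (ssA M *v xf + ssB M *v hz a e u w))"

definition fil_out where
  "fil_out M nf s w u =
    (let a = vec_first (vec_first s (N + N)) N; e = vec_last (vec_first s (N + N)) N; xf = vec_last s nf
     in ssC M *v xf + ssD M *v hz a e u w)"

lemma fil_append:
  assumes "a \<in> vecs N" "e \<in> vecs N" "xf \<in> vecs nf"
  shows "fil_next M nf ((a @v e) @v xf) w u = (hx a e u w @v he e w) @v (ssA M *v xf + ssB M *v hz a e u w)"
    and "fil_out M nf ((a @v e) @v xf) w u = ssC M *v xf + ssD M *v hz a e u w"
  using assms by (simp_all add: fil_next_def fil_out_def)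

lemma lin_fil:
  assumes M: "ss_dims nf d d M" and f: "lin k ((N + N) + nf) s" "lin k d w" "lin k nu u"
  shows "lin k ((N + N) + nf) (\<lambda>t. fil_next M nf (s t) (w t) (u t))" "lin k d (\<lambda>t. fil_out M nf (s t) (w t) (u t))"
proof -
  have c: "ssA M \<in> mats nf nf" "ssB M \<in> mats nf d" "ssC M \<in> mats d nf" "ssD M \<in> mats d d"
    using M by (auto simp: ss_dims_def)
  have a: "lin k N (\<lambda>t. vec_first (vec_first (s t) (N + N)) N)" and e: "lin k N (\<lambda>t. vec_last (vec_first (s t) (N + N)) N)"
    and x: "lin k nf (\<lambda>t. vec_last (s t) nf)"
    by (rule lin_first[OF lin_first[OF f(1)]] lin_last[OF lin_first[OF f(1)]] lin_last[OF f(1)])+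
  note h = lin_h[OF a e f(3,2)]
  show "lin k ((N + N) + nf) (\<lambda>t. fil_next M nf (s t) (w t) (u t))" "lin k d (\<lambda>t. fil_out M nf (s t) (w t) (u t))"
    unfolding fil_next_def fil_out_def Let_def
    by (intro lin_append lin_add h x lin_mat[OF c(1)] lin_mat[OF c(2)])
      (intro lin_add h x lin_mat[OF c(3)] lin_mat[OF c(4)])
qed

definition "fA M nf = matf ((N + N) + nf) ((N + N) + nf) (\<lambda>s. fil_next M nf s (0v d) (0v nu))"
definition "fB1 M nf = matf d ((N + N) + nf) (\<lambda>w. fil_next M nf (0v ((N + N) + nf)) w (0v nu))"
definition "fB M nf = matf nu ((N + N) + nf) (\<lambda>u. fil_next M nf (0v ((N + N) + nf)) (0v d) u)"
definition "fC1 M nf = matf ((N + N) + nf) d (\<lambda>s. fil_out M nf s (0v d) (0v nu))"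
definition "fD1 M nf = matf d d (\<lambda>w. fil_out M nf (0v ((N + N) + nf)) w (0v nu))"
definition "fE M nf = matf nu d (\<lambda>u. fil_out M nf (0v ((N + N) + nf)) (0v d) u)"
definition "fC nf = matf ((N + N) + nf) (d + nv) (\<lambda>s. gC P *v vec_last (vec_first s (N + N)) N)"

lemma fil_mult:
  assumes M: "ss_dims nf d d M" and s: "s \<in> vecs ((N + N) + nf)" and w: "w \<in> vecs d" and u: "u \<in> vecs nu"
  shows "fA M nf *v s + fB1 M nf *v w + fB M nf *v u = fil_next M nf s w u"
    and "fC1 M nf *v s + fD1 M nf *v w + fE M nf *v u = fil_out M nf s w u"
    and "fC nf *v s = gC P *v vec_last (vec_first s (N + N)) N"
    and "fA M nf *v s = fil_next M nf s (0v d) (0v nu)"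
    and "fB M nf *v u = fil_next M nf (0v ((N + N) + nf)) (0v d) u"
proof -
  have n: "lin (((N + N) + nf) + (d + nu)) ((N + N) + nf)
      (\<lambda>v. fil_next M nf (vec_first v ((N + N) + nf)) (vec_first (vec_last v (d + nu)) d) (vec_last (vec_last v (d + nu)) nu))"
    and o: "lin (((N + N) + nf) + (d + nu)) d
      (\<lambda>v. fil_out M nf (vec_first v ((N + N) + nf)) (vec_first (vec_last v (d + nu)) d) (vec_last (vec_last v (d + nu)) nu))"
    by (rule lin_fil[OF M lin_first_id lin_first[OF lin_last_id] lin_last[OF lin_last_id]])+
  show "fA M nf *v s + fB1 M nf *v w + fB M nf *v u = fil_next M nf s w u" "fA M nf *v s = fil_next M nf s (0v d) (0v nu)"
    "fB M nf *v u = fil_next M nf (0v ((N + N) + nf)) (0v d) u"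
    unfolding fA_def fB1_def fB_def by (rule matf_lin3[OF n s w u])+
  show "fC1 M nf *v s + fD1 M nf *v w + fE M nf *v u = fil_out M nf s w u"
    unfolding fC1_def fD1_def fE_def by (rule matf_lin3(1)[OF o s w u])
  show "fC nf *v s = gC P *v vec_last (vec_first s (N + N)) N"
    unfolding fC_def by (rule matf_mult[OF lin_mat[OF g(7) lin_last[OF lin_first_id]] s])
qed

lemma split_state:
  assumes "s \<in> vecs ((N + N) + nf)"
  obtains a e xf where "a \<in> vecs N" "e \<in> vecs N" "xf \<in> vecs nf" "s = (a @v e) @v (xf :: real vec)"
proof
  let ?h = "vec_first s (N + N)"
  show "s = (vec_first ?h N @v vec_last ?h N) @v vec_last s nf"
    using assms vec_first_last_append[of ?h N N] by simp
qed auto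

lemma h_zero: "hx (0v N) (0v N) (0v nu) (0v d) = 0v N" "he (0v N) (0v d) = 0v N"
  unfolding hx_def he_def
  by (simp_all add: mult_mat_zero[OF g(1)] mult_mat_zero[OF g(2)] mult_mat_zero[OF g(3)] mult_mat_zero[OF Mt]
      mult_mat_zero[OF Lt] mult_mat_zero[OF g(7)])

lemma he_alt: "e \<in> vecs N \<Longrightarrow> he e (0v d) = (gA P + Lt * gC P) *v e"
proof -
  assume e: "e \<in> vecs N"
  have "gA P *v e + Lt *v (gC P *v e) \<in> vecs N"
    by (intro add_carrier_vec mult_mat_vec_carrier[OF g(1)] mult_mat_vec_carrier[OF Lt] mult_mat_vec_carrier[OF g(7)] e)
  moreover have "Lt * gC P \<in> mats N N" using Lt g by simp
  ultimately show ?thesis unfolding he_def mult_mat_zero[OF g(2)]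
    using add_mult_distrib_mat_vec[OF g(1) _ e] assoc_mult_mat_vec[OF Lt g(7) e] by simp
qed

lemma hx_alt:
  assumes a: "a \<in> vecs N" and e: "e \<in> vecs N" and q: "q \<in> vecs nu" and p: "p \<in> vecs d"
  shows "hx a e q p = (gA P + gB P * Mt) *v a + (gB P *v q + gB1 P *v p - gB P *v (Mt *v e))"
proof -
  have BM: "gB P * Mt \<in> mats N N" using g Mt by simp
  have c: "Mt *v a \<in> vecs nu" "Mt *v e \<in> vecs nu" using mult_mat_vec_carrier[OF Mt] a e by auto
  have E1: "gB P *v (Mt *v (a - e) + q) = gB P *v (Mt *v a) - gB P *v (Mt *v e) + gB P *v q"
    unfolding mult_minus_distrib_mat_vec[OF Mt a e]
    using mult_add_distrib_mat_vec[OF g(3) minus_carrier_vec[OF c(1,2)] q] mult_minus_distrib_mat_vec[OF g(3) c] by simp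
  have E2: "(gA P + gB P * Mt) *v a = gA P *v a + gB P *v (Mt *v a)"
    using add_mult_distrib_mat_vec[OF g(1) BM a] assoc_mult_mat_vec[OF g(3) Mt a] by simp
  define b1 b2 b3 b4 b5 where "b1 = gA P *v a" and "b2 = gB P *v (Mt *v a)" and "b3 = gB P *v (Mt *v e)"
    and "b4 = gB P *v q" and "b5 = gB1 P *v p"
  have b: "b1 \<in> vecs N" "b2 \<in> vecs N" "b3 \<in> vecs N" "b4 \<in> vecs N" "b5 \<in> vecs N"
    unfolding b1_def b2_def b3_def b4_def b5_def
    using mult_mat_vec_carrier[OF g(1) a] mult_mat_vec_carrier[OF g(3)] mult_mat_vec_carrier[OF g(2) p] c q by auto
  show ?thesis
    unfolding hx_def E1 E2 b1_def[symmetric] b2_def[symmetric] b3_def[symmetric] b4_def[symmetric] b5_def[symmetric]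
    using b by (intro eq_vecI) auto
qed

text \<open>The dynamics are triangular: the free error decays by itself, drives the plant state,
  and both drive the filter. The measurement \<open>gC P e\<close> depends on the error only, which
  the control does not reach.\<close>

lemma youla_plant:
  assumes M: "ss_dims nf d d M" and sM': "schur (ssA M)"
  shows "youla_plant ((N + N) + nf) d nu (d + nv) (fA M nf) (fB1 M nf) (fB M nf) (fC1 M nf) (fD1 M nf) (fE M nf) (fC nf) (0\<^sub>m (d + nv) d)"
proof
  let ?n = "(N + N) + nf"
  have c: "ssA M \<in> mats nf nf" "ssB M \<in> mats nf d" using M by (auto simp: ss_dims_def)
  show cs: "fA M nf \<in> mats ?n ?n" "fB1 M nf \<in> mats ?n d" "fB M nf \<in> mats ?n nu" "fC1 M nf \<in> mats d ?n"
    "fD1 M nf \<in> mats d d" "fE M nf \<in> mats d nu" "fC nf \<in> mats (d + nv) ?n" "0\<^sub>m (d + nv) d \<in> mats (d + nv) d"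
    by (simp_all add: fA_def fB1_def fB_def fC1_def fD1_def fE_def fC_def)
  have zu: "0v nu \<in> vecs nu" "0v d \<in> vecs d" by auto
  show "schur (fA M nf)"
  proof (rule schur_iff_l2[OF cs(1)])
    fix s assume s: "\<And>k. s k \<in> vecs ?n" "\<And>k. s (Suc k) = fA M nf *v s k"
    define a where "a k = vec_first (vec_first (s k) (N + N)) N" for k
    define e where "e k = vec_last (vec_first (s k) (N + N)) N" for k
    define xf where "xf k = vec_last (s k) nf" for k
    have k: "a k \<in> vecs N" "e k \<in> vecs N" "xf k \<in> vecs nf" for k by (auto simp: a_def e_def xf_def)
    have se: "s k = (a k @v e k) @v xf k" for k
      unfolding a_def e_def xf_def using s(1)[of k] vec_first_last_append[of "vec_first (s k) (N + N)" N N] by simp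
    define v where "v k = hz (a k) (e k) (0v nu) (0v d)" for k
    have hc: "hx (a k) (e k) (0v nu) (0v d) \<in> vecs N" "he (e k) (0v d) \<in> vecs N" "v k \<in> vecs d" for k
      unfolding v_def using h_carrier[OF k(1,2) zu] by auto
    have st: "s (Suc k) = (hx (a k) (e k) (0v nu) (0v d) @v he (e k) (0v d)) @v (ssA M *v xf k + ssB M *v v k)" for k
      unfolding s(2) fil_mult(4)[OF M s(1) zu(2,1)] unfolding se v_def by (rule fil_append(1)[OF k])
    have xc: "ssA M *v xf k + ssB M *v v k \<in> vecs nf" for k
      by (intro add_carrier_vec mult_mat_vec_carrier[OF c(1)] mult_mat_vec_carrier[OF c(2)] k hc)
    have step: "a (Suc k) = hx (a k) (e k) (0v nu) (0v d)" "e (Suc k) = he (e k) (0v d)"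
      "xf (Suc k) = ssA M *v xf k + ssB M *v v k" for k
      using hc[of k] xc[of k] c by (simp_all add: a_def e_def xf_def st)
    have LC: "gA P + Lt * gC P \<in> mats N N" "gA P + gB P * Mt \<in> mats N N" using g Lt Mt by auto
    have "e (Suc k) = (gA P + Lt * gC P) *v e k + 0v N" for k
      using LC k mult_mat_vec_carrier[OF LC(1) k(2)] by (simp add: step(2) he_alt[OF k(2)])
    hence le: "l2 e" by (rule schur_l2[OF LC(1) sL k(2) zero_carrier_vec _ l2_zero])
    have BMc: "gB P *v 0v nu + gB1 P *v 0v d - gB P *v (Mt *v e k) \<in> vecs N" for k
      by (intro minus_carrier_vec add_carrier_vec mult_mat_vec_carrier[OF g(3)] mult_mat_vec_carrier[OF g(2)] mult_mat_vec_carrier[OF Mt] k zu)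
    have lf: "lin N N (\<lambda>e. gB P *v 0v nu + gB1 P *v 0v d - gB P *v (Mt *v e))"
      unfolding mult_mat_zero[OF g(3)] mult_mat_zero[OF g(2)]
      by (intro lin_minus lin_add lin_zero lin_mat[OF g(3)] lin_mat[OF Mt] lin_id)
    have la: "l2 a"
      by (rule schur_l2[OF LC(2) sM k(1) BMc _ l2_lin[OF lf k(2) le]])
        (simp add: step(1) hx_alt[OF k(1,2) zu])
    have lh: "lin (N + N) d (\<lambda>t. hz (vec_first t N) (vec_last t N) (0v nu) (0v d))"
      by (rule lin_h(3)[OF lin_first_id lin_last_id lin_zero lin_zero])
    have lae: "l2 (\<lambda>k. a k @v e k)" by (rule l2_append[OF k(1) la k(2) le])
    have "l2 (\<lambda>k. hz (vec_first (a k @v e k) N) (vec_last (a k @v e k) N) (0v nu) (0v d))"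
      by (rule l2_lin[OF lh _ lae]) (use k in simp)
    hence lv: "l2 v" using k by (simp add: v_def[abs_def] carrier_vecD[OF k(1)] carrier_vecD[OF k(2)])
    have "l2 xf" by (rule schur_l2[OF c(1) sM' k(3) _ step(3) l2_mat[OF c(2) hc(3) lv]])
        (rule mult_mat_vec_carrier[OF c(2) hc(3)])
    hence "l2 (\<lambda>k. (a k @v e k) @v xf k)" by (intro l2_append[OF _ lae k(3)]) (use k in auto)
    thus "l2 s" by (simp add: se[abs_def])
  qed
  fix u k assume u: "u \<in> signals nu"
  have uk: "u k \<in> vecs nu" for k using u by (simp add: signals_def)
  let ?r = "run (fA M nf) (fB M nf) (0v ?n) u"
  have rc: "?r k \<in> vecs ?n" for k by (rule run_carrier[OF cs(1,3) _ u]) simp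
  have "vec_last (vec_first (?r k) (N + N)) N = 0v N" for k
  proof (induction k)
    case 0
    show ?case by (auto simp: vec_first_def vec_last_def intro!: eq_vecI)
  next
    case (Suc k)
    obtain a e xf where p: "a \<in> vecs N" "e \<in> vecs N" "xf \<in> vecs nf" "?r k = (a @v e) @v xf"
      by (rule split_state[OF rc[of k]])
    have e0: "e = 0v N" using Suc p by simp
    have z: "fB1 M nf *v 0v d = 0v ?n" by (rule mult_mat_zero[OF cs(2)])
    have "fA M nf *v ?r k \<in> vecs ?n" by (rule mult_mat_vec_carrier[OF cs(1) rc])
    hence "?r (Suc k) = fil_next M nf (?r k) (0v d) (u k)"
      unfolding fil_mult(1)[OF M rc zu(2) uk, symmetric] z by simp
    also have "\<dots> = (hx a e (u k) (0v d) @v he e (0v d)) @v (ssA M *v xf + ssB M *v hz a e (u k) (0v d))"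
      unfolding p(4) by (rule fil_append(1)[OF p(1-3)])
    finally show ?case
      using h_carrier[OF p(1,2) uk[of k] zu(2)] h_zero(2) by (simp add: e0 carrier_vecD del: run.simps)
  qed
  thus "fC nf *v ?r k = 0v (d + nv)"
    unfolding fil_mult(3)[OF M rc zu(2,1)] by (simp add: mult_mat_zero[OF g(7)])
qed

abbreviation "fil_loop M nf nQ Q \<equiv>
  youla_plant.loop_ss ((N + N) + nf) d (fA M nf) (fB1 M nf) (fB M nf) (fC1 M nf) (fD1 M nf) (fE M nf) (fC nf) (0\<^sub>m (d + nv) d) nQ Q"

lemma fil_loop_mult:
  assumes M: "ss_dims nf d d M" and sM': "schur (ssA M)" and Q: "ss_dims nQ (d + nv) nu Q"
    and a: "a \<in> vecs N" and e: "e \<in> vecs N" and xf: "xf \<in> vecs nf" and xq: "xq \<in> vecs nQ"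
    and w: "w \<in> vecs d"
  defines "y \<equiv> gC P *v e" defines "q \<equiv> ssC Q *v xq + ssD Q *v y"
  shows "ssA (fil_loop M nf nQ Q) *v (((a @v e) @v xf) @v xq) + ssB (fil_loop M nf nQ Q) *v w =
      ((hx a e q w @v he e w) @v (ssA M *v xf + ssB M *v hz a e q w)) @v (ssA Q *v xq + ssB Q *v y)"
    and "ssC (fil_loop M nf nQ Q) *v (((a @v e) @v xf) @v xq) + ssD (fil_loop M nf nQ Q) *v w =
      ssC M *v xf + ssD M *v hz a e q w"
proof -
  interpret Y: youla_plant "(N + N) + nf" d nu "d + nv" "fA M nf" "fB1 M nf" "fB M nf" "fC1 M nf" "fD1 M nf" "fE M nf" "fC nf"
    "0\<^sub>m (d + nv) d" by (rule youla_plant[OF M sM'])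
  have q: "ssC Q \<in> mats nu nQ" "ssD Q \<in> mats nu (d + nv)" using Q by (auto simp: ss_dims_def)
  have yc: "y \<in> vecs (d + nv)" unfolding y_def by (rule mult_mat_vec_carrier[OF g(7) e])
  have qc: "q \<in> vecs nu" unfolding q_def
    by (intro add_carrier_vec mult_mat_vec_carrier[OF q(1) xq] mult_mat_vec_carrier[OF q(2) yc])
  have s: "(a @v e) @v xf \<in> vecs ((N + N) + nf)" using a e xf by simp
  have C: "fC nf *v ((a @v e) @v xf) + 0\<^sub>m (d + nv) d *v w = y"
    unfolding fil_mult(3)[OF M s w qc] zero_mat_mult_vec[OF w] using a e xf yc by (simp add: y_def)
  have u: "Y.loop_u Q ((a @v e) @v xf) xq w = q" unfolding Y.loop_u_def C q_def ..
  show "ssA (Y.loop_ss nQ Q) *v (((a @v e) @v xf) @v xq) + ssB (Y.loop_ss nQ Q) *v w =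
      ((hx a e q w @v he e w) @v (ssA M *v xf + ssB M *v hz a e q w)) @v (ssA Q *v xq + ssB Q *v y)"
    unfolding Y.loop_ss_mult(1)[OF Q s xq w] Y.loop_next_def u C fil_mult(1)[OF M s w qc] fil_append(1)[OF a e xf] ..
  show "ssC (Y.loop_ss nQ Q) *v (((a @v e) @v xf) @v xq) + ssD (Y.loop_ss nQ Q) *v w =
      ssC M *v xf + ssD M *v hz a e q w"
    unfolding Y.loop_ss_mult(2)[OF Q s xq w] Y.loop_out_def u fil_mult(2)[OF M s w qc] fil_append(2)[OF a e xf] ..
qed

text \<open>The closed-loop state in the coordinates of the filtered loop, with the estimate
  replaced by its error. The filter has no counterpart in the closed loop and is absent.\<close>

definition obs_state :: "nat \<Rightarrow> real vec \<Rightarrow> real vec" where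
  "obs_state nQ c =
    (let \<kappa> = vec_last c (d + (N + nQ)); a = vec_first \<kappa> d @v vec_first c nG; r = vec_last \<kappa> (N + nQ)
     in (a @v (a - vec_first r N)) @v vec_last r nQ)"

lemma obs_state_append:
  assumes "x \<in> vecs nG" "\<xi> \<in> vecs d" "xh \<in> vecs N" "xq \<in> vecs nQ"
  shows "obs_state nQ (x @v (\<xi> @v (xh @v xq))) = ((\<xi> @v x) @v ((\<xi> @v x) - xh)) @v xq"
  using assms by (simp add: obs_state_def Let_def)

lemma lin_obs_state: "lin (nG + (d + (N + nQ))) ((N + N) + nQ) (obs_state nQ)"
  unfolding obs_state_def[abs_def] Let_def
  by (intro lin_append lin_minus lin_first[OF lin_last_id] lin_first_id lin_first[OF lin_last[OF lin_last_id]]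
      lin_last[OF lin_last[OF lin_last_id]])

lemma split_cl:
  assumes "c \<in> vecs (nG + (d + (N + nQ)))"
  shows "\<exists>x \<xi> xh xq. x \<in> vecs nG \<and> \<xi> \<in> vecs d \<and> xh \<in> vecs N \<and> xq \<in> vecs nQ \<and>
    c = x @v (\<xi> @v (xh @v (xq :: real vec)))"
proof -
  let ?\<kappa> = "vec_last c (d + (N + nQ))"
  let ?r = "vec_last ?\<kappa> (N + nQ)"
  have "c = vec_first c nG @v (vec_first ?\<kappa> d @v (vec_first ?r N @v vec_last ?r nQ))"
    using assms vec_first_last_append[of c nG "d + (N + nQ)"] vec_first_last_append[of ?\<kappa> d "N + nQ"]
      vec_first_last_append[of ?r N nQ] by simp
  thus ?thesis by (metis vec_first_carrier vec_last_carrier)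
qed

text \<open>Here \<open>c k\<close> is \<open>\<rho>\<^sup>-\<^sup>k\<close> times the closed-loop state, hence the factor \<open>\<rho>\<close> in the recursion.\<close>

lemma trajectory:
  assumes Q: "ss_dims nQ (d + nv) nu Q" and M: "ss_dims nf d d M" and sM': "schur (ssA M)"
    and c: "\<And>k. c k \<in> vecs (nG + (d + (N + nQ)))" and w: "\<And>k. w k \<in> vecs d"
    and step: "\<And>k. \<rho> *s c (Suc k) = clA G (ctl nQ Q) *v c k + clB G (ctl nQ Q) *v w k"
  defines "z k \<equiv> clC G (ctl nQ Q) *v c k"
  defines "p k \<equiv> w k - m *s z k"
  defines "s k \<equiv> (L - m) *s z k - p k"
  obtains X where "\<forall>k. X k \<in> vecs (((N + N) + nf) + nQ)"
    "\<forall>k. X (Suc k) = ssA (fil_loop M nf nQ Q) *v X k + ssB (fil_loop M nf nQ Q) *v p k"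
    "\<forall>k. ssC (fil_loop M nf nQ Q) *v X k + ssD (fil_loop M nf nQ Q) *v p k = ss_op M s k"
    "\<forall>k. obs_state nQ (c k) = vec_first (vec_first (X k) ((N + N) + nf)) (N + N) @v vec_last (X k) nQ"
    "sq (X 0) = sq (obs_state nQ (c 0))"
proof -
  have mc: "ssA M \<in> mats nf nf" "ssB M \<in> mats nf d" using M by (auto simp: ss_dims_def)
  have "\<exists>x \<xi> xh xq. x \<in> vecs nG \<and> \<xi> \<in> vecs d \<and> xh \<in> vecs N \<and> xq \<in> vecs nQ \<and>
    c k = x @v (\<xi> @v (xh @v xq))" for k by (rule split_cl[OF c])
  then obtain x \<xi> xh xq where k: "\<And>k. x k \<in> vecs nG" "\<And>k. \<xi> k \<in> vecs d" "\<And>k. xh k \<in> vecs N"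
    "\<And>k. xq k \<in> vecs nQ" and ce: "\<And>k. c k = x k @v (\<xi> k @v (xh k @v xq k))" by metis
  define a where "a k = \<xi> k @v x k" for k
  define e where "e k = a k - xh k" for k
  define y where "y k = gC P *v e k" for k
  define q where "q k = ssC Q *v xq k + ssD Q *v y k" for k
  have ac: "a k \<in> vecs N" "e k \<in> vecs N" for k using k by (auto simp: a_def e_def)
  have cl: "clC G (ctl nQ Q) \<in> mats d (nG + (d + (N + nQ)))" by (rule closed_loop_dims(3)[OF G ctl_dims])
  have zc: "z k \<in> vecs d" for k unfolding z_def by (rule mult_mat_vec_carrier[OF cl c])
  have pc: "p k \<in> vecs d" "s k \<in> vecs d" for k using zc w by (auto simp: p_def s_def)
  have cancel: "u = v" if "\<rho> *s u = \<rho> *s v" for u v :: "real vec"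
  proof -
    have "(1 / \<rho>) *s (\<rho> *s u) = (1 / \<rho>) *s (\<rho> *s v)" using that by simp
    thus ?thesis using \<rho>(1) by (simp add: smult_smult_assoc)
  qed
  have dyn: "a (Suc k) = hx (a k) (e k) (q k) (p k) \<and> e (Suc k) = he (e k) (p k) \<and>
      xq (Suc k) = ssA Q *v xq k + ssB Q *v y k \<and> s k = hz (a k) (e k) (q k) (p k)" for k
  proof -
    have "\<exists>x' xh'. x' \<in> vecs nG \<and> xh' \<in> vecs N \<and>
      clA G (ctl nQ Q) *v c k + clB G (ctl nQ Q) *v w k =
        x' @v ((\<xi> k + w k) @v (xh' @v \<rho> *s (ssA Q *v xq k + ssB Q *v y k))) \<and>
      (\<xi> k + w k) @v x' = \<rho> *s hx (a k) (e k) (q k) (p k) \<and>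
      ((\<xi> k + w k) @v x') - xh' = \<rho> *s he (e k) (p k) \<and> s k = hz (a k) (e k) (q k) (p k)"
      unfolding s_def p_def z_def q_def y_def e_def a_def ce[of k]
      by (rule loop_step[OF Q k(1)[of k] k(2)[of k] k(3)[of k] k(4)[of k] w[of k]])
    then obtain x' xh' where st: "x' \<in> vecs nG" "xh' \<in> vecs N"
      "clA G (ctl nQ Q) *v c k + clB G (ctl nQ Q) *v w k = x' @v ((\<xi> k + w k) @v (xh' @v \<rho> *s (ssA Q *v xq k + ssB Q *v y k)))"
      "(\<xi> k + w k) @v x' = \<rho> *s hx (a k) (e k) (q k) (p k)" "((\<xi> k + w k) @v x') - xh' = \<rho> *s he (e k) (p k)"
      "s k = hz (a k) (e k) (q k) (p k)"
      by (elim exE conjE) (rule that)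
    have "\<rho> *s x (Suc k) @v (\<rho> *s \<xi> (Suc k) @v (\<rho> *s xh (Suc k) @v \<rho> *s xq (Suc k))) =
        x' @v ((\<xi> k + w k) @v (xh' @v \<rho> *s (ssA Q *v xq k + ssB Q *v y k)))"
      using step[of k] unfolding st(3) ce[of "Suc k"] append_vec_smult .
    moreover have "\<rho> *s x (Suc k) \<in> vecs nG" "\<rho> *s \<xi> (Suc k) \<in> vecs d" "\<xi> k + w k \<in> vecs d"
      "\<rho> *s xh (Suc k) \<in> vecs N" using k w by auto
    ultimately have E: "\<rho> *s x (Suc k) = x'" "\<rho> *s \<xi> (Suc k) = \<xi> k + w k" "\<rho> *s xh (Suc k) = xh'"
      "\<rho> *s xq (Suc k) = \<rho> *s (ssA Q *v xq k + ssB Q *v y k)"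
      using append_vec_eq st(1,2) by metis+
    have "\<rho> *s a (Suc k) = (\<xi> k + w k) @v x'" unfolding a_def append_vec_smult E(1,2) ..
    hence ra: "\<rho> *s a (Suc k) = \<rho> *s hx (a k) (e k) (q k) (p k)" using st(4) by simp
    have "\<rho> *s e (Suc k) = \<rho> *s a (Suc k) - \<rho> *s xh (Suc k)"
      unfolding e_def using ac(1)[of "Suc k"] k(3)[of "Suc k"] by (intro eq_vecI) (auto simp: algebra_simps)
    hence "\<rho> *s e (Suc k) = \<rho> *s he (e k) (p k)"
      unfolding ra E(3) st(4)[symmetric] st(5) .
    thus ?thesis using cancel ra E(4) st(6) by blast
  qed
  have ss: "s \<in> signals d" using pc by (simp add: signals_def)
  define xf where "xf = ss_state M s"
  have xfc: "xf k \<in> vecs nf" for k unfolding xf_def by (rule ss_state_carrier[OF M ss])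
  define X where "X k = ((a k @v e k) @v xf k) @v xq k" for k
  have X0: "xf 0 = 0v nf" using mc by (simp add: xf_def)
  have oe: "obs_state nQ (c k) = (a k @v e k) @v xq k" for k
    unfolding ce obs_state_append[OF k] a_def e_def ..
  show ?thesis
  proof (rule that[of X]; (intro allI)?)
    fix k
    show "X k \<in> vecs (((N + N) + nf) + nQ)" using ac xfc k by (simp add: X_def)
    show "X (Suc k) = ssA (fil_loop M nf nQ Q) *v X k + ssB (fil_loop M nf nQ Q) *v p k"
      unfolding X_def fil_loop_mult(1)[OF M sM' Q ac xfc k(4) pc(1), folded y_def, folded q_def]
      using dyn[of k] by (simp add: xf_def q_def)
    show "ssC (fil_loop M nf nQ Q) *v X k + ssD (fil_loop M nf nQ Q) *v p k = ss_op M s k"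
      unfolding X_def fil_loop_mult(2)[OF M sM' Q ac xfc k(4) pc(1), folded y_def, folded q_def]
      using dyn[of k] by (simp add: xf_def ss_op_def q_def)
    show "obs_state nQ (c k) = vec_first (vec_first (X k) ((N + N) + nf)) (N + N) @v vec_last (X k) nQ"
      unfolding oe X_def using ac[of k] xfc[of k] k(4)[of k] by simp
  next
    \<comment> \<open>The filter starts at rest and contributes nothing to the initial
      energy.\<close>
    have "sq (X 0) = sq (a 0 @v e 0) + sq (xf 0) + sq (xq 0)"
      unfolding X_def using ac xfc k by (simp add: sq_append[of _ "(N + N) + nf" _ nQ] sq_append[of _ "N + N" _ nf])
    also have "\<dots> = sq (obs_state nQ (c 0))"
      unfolding oe X0 using ac k by (simp add: sq_append[of _ "N + N" _ nQ])
    finally show "sq (X 0) = sq (obs_state nQ (c 0))" .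
  qed
qed

end

section \<open>Convergence of the closed loop\<close>

context observer_loop
begin

text \<open>In \<open>loop_step\<close> the choice \<open>w = m z\<close> makes
  \<open>p = 0\<close>, and \<open>(L - m) z\<close> becomes \<open>hz\<close> without external
  input. This exhibits the output as a linear function of \<open>obs_state\<close>.\<close>

lemma output_bound:
  assumes Q: "ss_dims nQ (d + nv) nu Q"
  obtains b where "b > 0" "\<forall>c \<in> vecs (nG + (d + (N + nQ))). sq (clC G (ctl nQ Q) *v c) \<le> b * sq (obs_state nQ c)"
proof -
  have q: "ssC Q \<in> mats nu nQ" "ssD Q \<in> mats nu (d + nv)" using Q by (auto simp: ss_dims_def)
  define f where "f t = hz (vec_first (vec_first t (N + N)) N) (vec_last (vec_first t (N + N)) N)
    (ssC Q *v vec_last t nQ + ssD Q *v (gC P *v vec_last (vec_first t (N + N)) N)) (0v d)" for t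
  have lf: "lin ((N + N) + nQ) d f" unfolding f_def
    by (intro lin_h(3) lin_first[OF lin_first_id] lin_last[OF lin_first_id] lin_zero lin_add lin_mat[OF q(1)] lin_mat[OF q(2)]
        lin_mat[OF g(7)] lin_last_id)
  obtain b where b: "b > 0" "\<And>t. t \<in> vecs ((N + N) + nQ) \<Longrightarrow> sq (f t) \<le> b * sq t" by (rule lin_bounded[OF lf], rule that)
  define L' where "L' = L - m"
  have L': "L' > 0" using mL by (simp add: L'_def)
  show ?thesis
  proof (rule that[of "b / L'\<^sup>2"], goal_cases)
    case 1 show ?case using b(1) L' by simp
  next
    case 2
    show ?case
    proof
      fix c :: "real vec" assume c: "c \<in> vecs (nG + (d + (N + nQ)))"
      obtain x \<xi> xh xq where k: "x \<in> vecs nG" "\<xi> \<in> vecs d" "xh \<in> vecs N" "xq \<in> vecs nQ"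
        and ce: "c = x @v (\<xi> @v (xh @v xq))" using split_cl[OF c] by (elim exE conjE) (rule that)
      define z where "z = clC G (ctl nQ Q) *v c"
      have z: "z \<in> vecs d" unfolding z_def by (rule mult_mat_vec_carrier[OF closed_loop_dims(3)[OF G ctl_dims] c])
      have mz: "m *s z \<in> vecs d" using z by simp
      have z0: "m *s z - m *s z = 0v d" using mz by simp
      have "(L - m) *s z - (m *s z - m *s z) =
          hz (\<xi> @v x) ((\<xi> @v x) - xh) (ssC Q *v xq + ssD Q *v (gC P *v ((\<xi> @v x) - xh))) (m *s z - m *s z)"
        using loop_step[OF Q k mz, folded ce, folded z_def] by blast
      hence "L' *s z = f (obs_state nQ c)"
        unfolding z0 ce obs_state_append[OF k] using k z by (simp add: f_def L'_def)
      hence "L'\<^sup>2 * sq z \<le> b * sq (obs_state nQ c)"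
        using b(2)[OF linD(1)[OF lin_obs_state c]] by (simp add: sq_smult[symmetric])
      thus "sq (clC G (ctl nQ Q) *v c) \<le> b / L'\<^sup>2 * sq (obs_state nQ c)"
        using L' by (simp add: z_def field_simps)
    qed
  qed
qed

text \<open>The output injection \<open>m B\<close> amounts to \<open>w = m z\<close>, that is
  \<open>p = 0\<close>, for which the loop of generalized plant, observer and \<open>Q\<close> is
  free and stable. The weight \<open>\<rho>^-k\<close> only enlarges the states, so stability of the
  weighted loop suffices.\<close>

lemma closed_loop_schur:
  assumes Q: "ss_dims nQ (d + nv) nu Q" and sQ: "schur (ssA Q)"
  shows "detectable (clA G (ctl nQ Q)) (clC G (ctl nQ Q))"
proof -
  let ?n = "nG + (d + (N + nQ))"
  let ?A = "clA G (ctl nQ Q)" and ?B = "clB G (ctl nQ Q)" and ?C = "clC G (ctl nQ Q)"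
  note cd = closed_loop_dims(1-3)[OF G ctl_dims, of nQ Q]
  have mB: "m \<cdot>\<^sub>m ?B \<in> mats ?n d" using cd(2) by simp
  have mBC: "m \<cdot>\<^sub>m ?B * ?C \<in> mats ?n ?n" by (rule mult_carrier_mat[OF mB cd(3)])
  have ABC: "?A + m \<cdot>\<^sub>m ?B * ?C \<in> mats ?n ?n" using mBC by simp
  have "schur (?A + m \<cdot>\<^sub>m ?B * ?C)"
  proof (rule schur_iff_l2[OF ABC])
    fix x assume x: "\<And>k. x k \<in> vecs ?n" "\<And>k. x (Suc k) = (?A + m \<cdot>\<^sub>m ?B * ?C) *v x k"
    define r where "r = 1 / \<rho>"
    have r: "\<rho> * r ^ Suc k = r ^ k" for k using \<rho>(1) by (simp add: r_def)
    define c where "c k = r ^ k *s x k" for k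
    have cc: "c k \<in> vecs ?n" for k using x(1) by (simp add: c_def)
    define w where "w k = m *s (?C *v c k)" for k
    have Cc: "?C *v c k \<in> vecs d" "?C *v x k \<in> vecs d" for k
      using mult_mat_vec_carrier[OF cd(3) cc] mult_mat_vec_carrier[OF cd(3) x(1)] by auto
    have wc: "w k \<in> vecs d" for k using Cc by (simp add: w_def)
    have step: "\<rho> *s c (Suc k) = ?A *v c k + ?B *v w k" for k
    proof -
      have "(?A + m \<cdot>\<^sub>m ?B * ?C) *v c k = ?A *v c k + ?B *v w k"
        unfolding add_mult_distrib_mat_vec[OF cd(1) mBC cc] assoc_mult_mat_vec[OF mB cd(3) cc]
          smult_mat_mult_vec[OF cd(2) Cc(1)] w_def mult_mat_vec[OF cd(2) Cc(1)] ..
      moreover have "(?A + m \<cdot>\<^sub>m ?B * ?C) *v c k = r ^ k *s x (Suc k)"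
        unfolding c_def x(2) by (rule mult_mat_vec[OF ABC x(1)])
      ultimately show ?thesis unfolding c_def[of "Suc k"] smult_smult_assoc r by simp
    qed
    \<comment> \<open>A stateless filter, present only so that \<open>trajectory\<close> can be
      applied.\<close>
    define M where "M = multiplier d 0 (map (\<lambda>i. (0::real) \<cdot>\<^sub>m 1\<^sub>m d) [0..<0 + 1])"
    have M: "ss_dims 0 d d M" and sM': "schur (ssA M)"
      using multiplier_dims[of _ "\<lambda>_. 0" d 0, OF refl] schur_multiplier[of _ "\<lambda>_. 0" d 0, OF refl] by (simp_all add: M_def)
    have "\<exists>X. (\<forall>k. X k \<in> vecs (((N + N) + 0) + nQ)) \<and>
      (\<forall>k. X (Suc k) = ssA (fil_loop M 0 nQ Q) *v X k + ssB (fil_loop M 0 nQ Q) *v (w k - m *s (?C *v c k))) \<and>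
      (\<forall>k. obs_state nQ (c k) = vec_first (vec_first (X k) ((N + N) + 0)) (N + N) @v vec_last (X k) nQ)"
      by (rule trajectory[where c = c and w = w, OF Q M sM' cc wc step]) blast
    then obtain X where X: "\<forall>k. X k \<in> vecs (((N + N) + 0) + nQ)"
      "\<forall>k. X (Suc k) = ssA (fil_loop M 0 nQ Q) *v X k + ssB (fil_loop M 0 nQ Q) *v (w k - m *s (?C *v c k))"
      "\<forall>k. obs_state nQ (c k) = vec_first (vec_first (X k) ((N + N) + 0)) (N + N) @v vec_last (X k) nQ"
      by (elim exE conjE) (rule that)
    interpret Y: youla_plant "(N + N) + 0" d nu "d + nv" "fA M 0" "fB1 M 0" "fB M 0" "fC1 M 0" "fD1 M 0" "fE M 0" "fC 0"
      "0\<^sub>m (d + nv) d" by (rule youla_plant[OF M sM'])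
    have S: "ssA (fil_loop M 0 nQ Q) \<in> mats (((N + N) + 0) + nQ) (((N + N) + 0) + nQ)"
      "ssB (fil_loop M 0 nQ Q) \<in> mats (((N + N) + 0) + nQ) d"
      using Y.loop_ss_dims[of nQ Q] by (auto simp: ss_dims_def)
    have w0: "w k - m *s (?C *v c k) = 0v d" for k using wc[of k] by (simp add: w_def)
    have X2: "X (Suc k) = ssA (fil_loop M 0 nQ Q) *v X k + 0v (((N + N) + 0) + nQ)" for k
      using X(2) unfolding w0 mult_mat_zero[OF S(2)] by blast
    have Xc: "X k \<in> vecs (((N + N) + 0) + nQ)" for k using X(1) by blast
    have lX: "l2 X"
      by (rule schur_l2[where x = X and d = "\<lambda>_. 0v (((N + N) + 0) + nQ)", OF S(1) Y.schur_loop[OF Q sQ] Xc zero_carrier_vec X2 l2_zero])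
    have "l2 (\<lambda>k. vec_first (vec_first (X k) ((N + N) + 0)) (N + N) @v vec_last (X k) nQ)"
    proof (rule l2_lin[OF _ Xc lX])
      have "lin (((N + N) + 0) + nQ) (N + N) (\<lambda>t. vec_first (vec_first t ((N + N) + 0)) (N + N))"
        using lin_first[of _ "N + N" 0, OF lin_first_id] by simp
      thus "lin (((N + N) + 0) + nQ) ((N + N) + nQ) (\<lambda>t. vec_first (vec_first t ((N + N) + 0)) (N + N) @v vec_last t nQ)"
        by (rule lin_append[OF _ lin_last_id])
    qed
    hence lo: "l2 (\<lambda>k. obs_state nQ (c k))" using X(3) by simp
    \<comment> \<open>A left inverse of \<open>obs_state\<close>, which carries square summability
      back to the closed-loop state.\<close>
    define bk where "bk t = (let h = vec_first t (N + N); a = vec_first h N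
      in vec_last a nG @v (vec_first a d @v ((a - vec_last h N) @v vec_last t nQ)))" for t :: "real vec"
    have li: "lin ((N + N) + nQ) ?n bk" unfolding bk_def Let_def
      by (intro lin_append lin_minus lin_last[OF lin_first[OF lin_first_id]] lin_first[OF lin_first[OF lin_first_id]]
          lin_first[OF lin_first_id] lin_last[OF lin_first_id] lin_last_id)
    have ie: "bk (obs_state nQ (c k)) = c k" for k
    proof -
      obtain y \<xi> xh xq where p: "y \<in> vecs nG" "\<xi> \<in> vecs d" "xh \<in> vecs N" "xq \<in> vecs nQ"
        and ce: "c k = y @v (\<xi> @v (xh @v xq))" using split_cl[OF cc[of k]] by (elim exE conjE) (rule that)
      have ae: "(\<xi> @v y) - ((\<xi> @v y) - xh) = xh" using p by (intro eq_vecI) auto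
      show ?thesis unfolding ce obs_state_append[OF p] bk_def Let_def using p by (simp add: ae)
    qed
    have "l2 (\<lambda>k. bk (obs_state nQ (c k)))"
      by (rule l2_lin[OF li _ lo]) (rule linD(1)[OF lin_obs_state cc])
    then obtain b where b: "\<And>n. (\<Sum>k<n. sq (c k)) \<le> b" unfolding ie l2_def by blast
    have le: "sq (x k) \<le> sq (c k)" for k
    proof -
      have "1 \<le> r ^ k" using \<rho> by (simp add: r_def one_le_power)
      hence "1 \<le> (r ^ k)\<^sup>2" by (rule one_le_power)
      hence "1 * sq (x k) \<le> (r ^ k)\<^sup>2 * sq (x k)" by (rule mult_right_mono) (rule sq_nonneg)
      thus ?thesis by (simp add: c_def sq_smult del: mult_1)
    qed
    have "(\<Sum>k<n. sq (x k)) \<le> b" for n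
      by (rule order_trans[OF sum_mono b[of n]]) (rule le)
    thus "l2 x" unfolding l2_def by (intro exI[of _ b] allI)
  qed
  moreover have dims: "dim_row ?A = ?n" "dim_row ?C = d" by (rule carrier_matD[OF cd(1)] carrier_matD[OF cd(3)])+
  ultimately show ?thesis unfolding detectable_def dims using mB by blast
qed

text \<open>The filtered loop has a storage function by the KYP lemma. Along the given trajectory
  its input is \<open>p\<close> and its output the filtered \<open>s\<close>, so the assumed
  finite-horizon inequality bounds the storage by its initial value, without any summability of the
  signals.\<close>

lemma decay:
  assumes Q: "ss_dims nQ (d + nv) nu Q" and sQ: "schur (ssA Q)"
    and \<Lambda>: "\<Lambda> = map (\<lambda>i. lam i \<cdot>\<^sub>m 1\<^sub>m d) [0..<l + 1]"
    and snr: "SNR d (ss_op (fil_loop (multiplier d l \<Lambda>) (l * d) nQ Q))"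
  obtains b where "b \<ge> 0" "\<forall>c w. (\<forall>k. c k \<in> vecs (nG + (d + (N + nQ)))) \<longrightarrow> (\<forall>k. w k \<in> vecs d) \<longrightarrow>
    (\<forall>k. \<rho> *s c (Suc k) = clA G (ctl nQ Q) *v c k + clB G (ctl nQ Q) *v w k) \<longrightarrow>
    (\<forall>n. 0 \<le> (\<Sum>k<n. (w k - m *s (clC G (ctl nQ Q) *v c k)) \<bullet>
      fir d lam l (\<lambda>k. (L - m) *s (clC G (ctl nQ Q) *v c k) - (w k - m *s (clC G (ctl nQ Q) *v c k))) k)) \<longrightarrow>
    (\<forall>k. sq (clC G (ctl nQ Q) *v c k) \<le> b * sq (c 0))"
proof -
  let ?M = "multiplier d l \<Lambda>" and ?nf = "l * d"
  let ?n = "((N + N) + ?nf) + nQ"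
  let ?S = "fil_loop ?M ?nf nQ Q"
  have M: "ss_dims ?nf d d ?M" and sM': "schur (ssA ?M)" by (rule multiplier_dims[OF \<Lambda>] schur_multiplier[OF \<Lambda>])+
  interpret Y: youla_plant "(N + N) + ?nf" d nu "d + nv" "fA ?M ?nf" "fB1 ?M ?nf" "fB ?M ?nf" "fC1 ?M ?nf" "fD1 ?M ?nf" "fE ?M ?nf" "fC ?nf"
    "0\<^sub>m (d + nv) d" by (rule youla_plant[OF M sM'])
  have S: "ssA ?S \<in> mats ?n ?n" "ssB ?S \<in> mats ?n d" "ssC ?S \<in> mats d ?n" "ssD ?S \<in> mats d d"
    using Y.loop_ss_dims[of nQ Q] by (auto simp: ss_dims_def)
  obtain \<epsilon> where \<epsilon>: "\<epsilon> > 0" "margin_SNR d (ss_op ?S) \<epsilon>" by (rule SNR_finite_support[OF snr])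
  have "ss_op ?S = (\<lambda>w k. ssC ?S *v run (ssA ?S) (ssB ?S) (0v ?n) w k + ssD ?S *v w k)"
    using carrier_matD(1)[OF S(1)] by (intro ext) (simp only: ss_op_def ss_state_eq_run)
  hence "margin_SNR d (\<lambda>w k. ssC ?S *v run (ssA ?S) (ssB ?S) (0v ?n) w k + ssD ?S *v w k) \<epsilon>" using \<epsilon>(2) by simp
  then obtain V \<delta> where V: "strict_storage ?n d (ssA ?S) (ssB ?S) (ssC ?S) (ssD ?S) \<delta> V"
    by (rule kyp[OF S Y.schur_loop[OF Q sQ] \<epsilon>(1)])
  have qV: "qform ?n V" and \<delta>: "\<delta> > 0" and low: "\<And>x. x \<in> vecs ?n \<Longrightarrow> \<delta> * sq x \<le> V x"
    and dis: "\<And>x w. x \<in> vecs ?n \<Longrightarrow> w \<in> vecs d \<Longrightarrow>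
      V (ssA ?S *v x + ssB ?S *v w) + supply_rate (ssC ?S) (ssD ?S) \<delta> x w \<le> V x"
    using V unfolding strict_storage_def by auto
  obtain b1 where b1: "b1 > 0" "\<And>x. x \<in> vecs ?n \<Longrightarrow> \<bar>V x\<bar> \<le> b1 * sq x" by (rule qform_bounded[OF qV], rule that)
  obtain b2 where b2: "b2 > 0" "\<forall>c \<in> vecs (nG + (d + (N + nQ))). sq (clC G (ctl nQ Q) *v c) \<le> b2 * sq (obs_state nQ c)"
    by (rule output_bound[OF Q])
  obtain b3 where b3: "b3 > 0" "\<And>c. c \<in> vecs (nG + (d + (N + nQ))) \<Longrightarrow> sq (obs_state nQ c) \<le> b3 * sq c"
    by (rule lin_bounded[OF lin_obs_state], rule that)
  have lsel: "lin ?n ((N + N) + nQ) (\<lambda>t. vec_first (vec_first t ((N + N) + ?nf)) (N + N) @v vec_last t nQ)"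
    by (rule lin_append[OF lin_first[OF lin_first_id] lin_last_id])
  obtain b4 where b4: "b4 > 0" "\<And>t. t \<in> vecs ?n \<Longrightarrow>
      sq (vec_first (vec_first t ((N + N) + ?nf)) (N + N) @v vec_last t nQ) \<le> b4 * sq t"
    by (rule lin_bounded[OF lsel], rule that)
  show ?thesis
  proof (rule that[of "b2 * (b4 * (b1 * b3 / \<delta>))"], goal_cases)
    case 1 show ?case using b1 b2 b3 b4 \<delta> by simp
  next
    case 2
    show ?case
    proof (intro allI impI)
      fix c w k
      assume c: "\<forall>k. c k \<in> vecs (nG + (d + (N + nQ)))" and w: "\<forall>k. w k \<in> vecs d"
        and step: "\<forall>k. \<rho> *s c (Suc k) = clA G (ctl nQ Q) *v c k + clB G (ctl nQ Q) *v w k"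
        and iqc: "\<forall>n. 0 \<le> (\<Sum>k<n. (w k - m *s (clC G (ctl nQ Q) *v c k)) \<bullet>
          fir d lam l (\<lambda>k. (L - m) *s (clC G (ctl nQ Q) *v c k) - (w k - m *s (clC G (ctl nQ Q) *v c k))) k)"
      define z where "z k = clC G (ctl nQ Q) *v c k" for k
      define p where "p k = w k - m *s z k" for k
      define s where "s k = (L - m) *s z k - p k" for k
      have cc: "c k \<in> vecs (nG + (d + (N + nQ)))" and wc: "w k \<in> vecs d"
        and st: "\<rho> *s c (Suc k) = clA G (ctl nQ Q) *v c k + clB G (ctl nQ Q) *v w k" for k using c w step by auto
      have zc: "z k \<in> vecs d" for k unfolding z_def by (rule mult_mat_vec_carrier[OF closed_loop_dims(3)[OF G ctl_dims] cc])
      have pc: "p k \<in> vecs d" "s k \<in> vecs d" for k using zc wc by (auto simp: p_def s_def)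
      have ssig: "s \<in> signals d" using pc by (simp add: signals_def)
      have ex: "\<exists>X. (\<forall>k. X k \<in> vecs ?n) \<and> (\<forall>k. X (Suc k) = ssA ?S *v X k + ssB ?S *v p k) \<and>
        (\<forall>k. ssC ?S *v X k + ssD ?S *v p k = ss_op ?M s k) \<and>
        (\<forall>k. obs_state nQ (c k) = vec_first (vec_first (X k) ((N + N) + ?nf)) (N + N) @v vec_last (X k) nQ) \<and>
        sq (X 0) = sq (obs_state nQ (c 0))"
        unfolding s_def[abs_def] p_def[abs_def] z_def[abs_def]
        by (rule trajectory[where c = c and w = w, OF Q M sM' cc wc st]) blast
      then obtain X where X: "\<forall>k. X k \<in> vecs ?n" "\<forall>k. X (Suc k) = ssA ?S *v X k + ssB ?S *v p k"
        "\<forall>k. ssC ?S *v X k + ssD ?S *v p k = ss_op ?M s k"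
        "\<forall>k. obs_state nQ (c k) = vec_first (vec_first (X k) ((N + N) + ?nf)) (N + N) @v vec_last (X k) nQ"
        "sq (X 0) = sq (obs_state nQ (c 0))" by (elim exE conjE) (rule that)
      have Xc: "X k \<in> vecs ?n" for k using X(1) by blast
      have "V (X (Suc k)) + 2 * (p k \<bullet> fir d lam l s k) \<le> V (X k) + 0" for k
      proof -
        have "V (X (Suc k)) + (2 * (p k \<bullet> fir d lam l s k) + \<delta> * (sq (X k) + sq (p k))) \<le> V (X k)"
          using dis[OF Xc[of k] pc(1)[of k]] X(2,3) multiplier_op[OF \<Lambda> ssig, of k] unfolding supply_rate_def by simp
        moreover have "\<delta> * (sq (X k) + sq (p k)) \<ge> 0" using \<delta> sq_nonneg[of "X k"] sq_nonneg[of "p k"] by simp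
        ultimately show ?thesis by linarith
      qed
      hence "V (X k) + (\<Sum>j<k. 2 * (p j \<bullet> fir d lam l s j)) \<le> V (X 0) + (\<Sum>j<k. 0)"
        by (rule telescope_le)
      moreover have "0 \<le> (\<Sum>j<k. 2 * (p j \<bullet> fir d lam l s j))"
        using iqc unfolding sum_distrib_left[symmetric] p_def s_def[abs_def] z_def by simp
      \<comment> \<open>The comparison is with time 0 only, since the inequality for the gradient
        concerns sums that start at 0.\<close>
      ultimately have "V (X k) \<le> V (X 0)" by simp
      hence "\<delta> * sq (X k) \<le> b1 * sq (X 0)" using low[OF Xc[of k]] b1(2)[OF Xc[of 0]] by linarith
      also have "\<dots> \<le> b1 * (b3 * sq (c 0))" unfolding X(5) using b3(2)[OF cc[of 0]] b1(1) by simp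
      finally have "sq (X k) \<le> b1 * b3 / \<delta> * sq (c 0)" using \<delta> by (simp add: field_simps)
      hence "b2 * (b4 * sq (X k)) \<le> b2 * (b4 * (b1 * b3 / \<delta> * sq (c 0)))" using b2(1) b4(1) by (intro mult_left_mono) auto
      moreover have "sq (clC G (ctl nQ Q) *v c k) \<le> b2 * (b4 * sq (X k))"
      proof -
        have "sq (obs_state nQ (c k)) \<le> b4 * sq (X k)" using X(4) b4(2)[OF Xc[of k]] by simp
        hence "b2 * sq (obs_state nQ (c k)) \<le> b2 * (b4 * sq (X k))" using b2(1) by simp
        thus ?thesis using b2(2) cc[of k] by fastforce
      qed
      ultimately show "sq (clC G (ctl nQ Q) *v c k) \<le> b2 * (b4 * (b1 * b3 / \<delta>)) * sq (c 0)"
        by (simp add: mult.assoc)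
    qed
  qed
qed

text \<open>The controller built from \<open>Q\<close> gives a detectable loop in integrator form
  that converges with rate \<open>\<rho>\<close>, so \<open>\<rho>\<close> lies in the set whose
  infimum is \<open>rho_ec\<close>.\<close>

theorem rho_ec_bound:
  assumes Q: "ss_dims nQ (d + nv) nu Q" and sQ: "schur (ssA Q)"
    and \<Lambda>: "\<Lambda> = map (\<lambda>i. lam i \<cdot>\<^sub>m 1\<^sub>m d) [0..<l + 1]"
    and lam: "\<forall>i \<in> {1..l}. lam i \<le> 0" "(\<Sum>i\<le>l. lam i * \<rho> ^ i) \<ge> 0" "(\<Sum>i\<le>l. lam i * (1 / \<rho>) ^ i) \<ge> 0"
    and snr: "SNR d (ss_op (fil_loop (multiplier d l \<Lambda>) (l * d) nQ Q))"
  shows "rho_ec d nu nv m L G \<le> ereal \<rho>"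
proof -
  let ?n = "nG + (d + (N + nQ))" and ?K = "ctl nQ Q"
  let ?A = "clA G ?K" and ?B = "clB G ?K" and ?C = "clC G ?K"
  note cd = closed_loop_dims(1-3)[OF G ctl_dims, of nQ Q]
  have dp: "detectable_part d ?A ?B ?C ?n ?A ?B ?C" by (rule detectable_part_self[OF cd closed_loop_schur[OF Q sQ]])
  have B: "?B *v w = 0v nG @v (w @v 0v (N + nQ))" if w: "w \<in> vecs d" for w
    unfolding closed_loop_dims(4)[OF G ctl_dims w] ctl_mult(3)[OF Q zero_carrier_vec zero_carrier_vec zero_carrier_vec zero_carrier_vec w]
    by (simp add: zero_append_zero)
  have "integrator_form d ?n ?A ?B ?C"
  proof (rule integrator_form_by_swap[OF cd _ B])
    fix x \<xi> y :: "real vec" assume x: "x \<in> vecs nG" and \<xi>: "\<xi> \<in> vecs d" and y: "y \<in> vecs (N + nQ)"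
    define xh where "xh = vec_first y N"
    define xq where "xq = vec_last y nQ"
    have c: "xh \<in> vecs N" "xq \<in> vecs nQ" "y = xh @v xq" using y by (auto simp: xh_def xq_def)
    have q: "ssA Q \<in> mats nQ nQ" "ssB Q \<in> mats nQ (d + nv)" using Q by (auto simp: ss_dims_def)
    have xx: "x @v (\<xi> @v y) \<in> vecs ?n" using x \<xi> y by simp
    \<comment> \<open>With zero gradient input, \<open>loop_step\<close> describes \<open>?A\<close>
      alone, and the integrator keeps its value.\<close>
    have "?A *v (x @v (\<xi> @v y)) + ?B *v 0v d = ?A *v (x @v (\<xi> @v y))"
      unfolding mult_mat_zero[OF cd(2)] using mult_mat_vec_carrier[OF cd(1) xx] by simp
    then obtain x' xh' where st: "x' \<in> vecs nG" "xh' \<in> vecs N"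
      "?A *v (x @v (\<xi> @v y)) = x' @v ((\<xi> + 0v d) @v (xh' @v \<rho> *s (ssA Q *v xq + ssB Q *v (gC P *v ((\<xi> @v x) - xh)))))"
      using loop_step[OF Q x \<xi> c(1,2) zero_carrier_vec, folded c(3)] by (metis (no_types, lifting))
    have "gC P *v ((\<xi> @v x) - xh) \<in> vecs (d + nv)"
      by (rule mult_mat_vec_carrier[OF g(7)]) (use x \<xi> c in auto)
    hence "ssA Q *v xq + ssB Q *v (gC P *v ((\<xi> @v x) - xh)) \<in> vecs nQ"
      by (intro add_carrier_vec mult_mat_vec_carrier[OF q(1) c(2)] mult_mat_vec_carrier[OF q(2)])
    thus "\<exists>x' y'. x' \<in> vecs nG \<and> y' \<in> vecs (N + nQ) \<and> ?A *v (x @v (\<xi> @v y)) = x' @v (\<xi> @v y')"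
      using st \<xi> by (intro exI[of _ x'] exI[of _ "xh' @v \<rho> *s (ssA Q *v xq + ssB Q *v (gC P *v ((\<xi> @v x) - xh)))"]) auto
  qed
  moreover have "\<exists>c\<ge>0. \<forall>f \<in> S_class d m L. \<forall>zs xs x.
           is_minimizer d f zs \<and> xs \<in> vecs ?n \<and> xs = ?A *v xs \<and> zs = ?C *v xs \<and>
           gradient_loop d ?n ?A ?B ?C f x \<longrightarrow>
           (\<forall>k. vnorm (?C *v x k - zs) \<le> c * \<rho> ^ k * vnorm (x 0 - xs))"
  proof -
    obtain b where b: "b \<ge> 0" "\<forall>c w. (\<forall>k. c k \<in> vecs ?n) \<longrightarrow> (\<forall>k. w k \<in> vecs d) \<longrightarrow>
      (\<forall>k. \<rho> *s c (Suc k) = ?A *v c k + ?B *v w k) \<longrightarrow>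
      (\<forall>n. 0 \<le> (\<Sum>k<n. (w k - m *s (?C *v c k)) \<bullet>
        fir d lam l (\<lambda>k. (L - m) *s (?C *v c k) - (w k - m *s (?C *v c k))) k)) \<longrightarrow>
      (\<forall>k. sq (?C *v c k) \<le> b * sq (c 0))"
      by (rule decay[OF Q sQ \<Lambda> snr])
    show ?thesis
    proof (intro exI[of _ "sqrt b"] conjI ballI allI impI)
      show "0 \<le> sqrt b" using b(1) by simp
      fix f zs xs x k assume f: "f \<in> S_class d m L"
        and A: "is_minimizer d f zs \<and> xs \<in> vecs ?n \<and> xs = ?A *v xs \<and> zs = ?C *v xs \<and> gradient_loop d ?n ?A ?B ?C f x"
      hence zs: "is_minimizer d f zs" and xs: "xs \<in> vecs ?n" and xsA: "?A *v xs = xs" and zsC: "?C *v xs = zs"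
        and x0: "x 0 \<in> vecs ?n" and xS: "\<And>k. x (Suc k) = ?A *v x k + ?B *v grad d f (?C *v x k)"
        by (auto simp: gradient_loop_def)
      have zsc: "zs \<in> vecs d" using zs by (simp add: is_minimizer_def)
      have gc: "grad d f (?C *v y) \<in> vecs d" if "y \<in> vecs ?n" for y
        by (rule grad_carrier[OF f mult_mat_vec_carrier[OF cd(3) that]])
      have xc: "x k \<in> vecs ?n" for k
      proof (induction k)
        case (Suc k)
        show ?case unfolding xS by (intro add_carrier_vec mult_mat_vec_carrier[OF cd(1) Suc] mult_mat_vec_carrier[OF cd(2) gc[OF Suc]])
      qed (rule x0)
      define a where "a k = ?C *v x k - zs" for k
      have Cx: "?C *v x k \<in> vecs d" for k by (rule mult_mat_vec_carrier[OF cd(3) xc])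
      have ac: "a k \<in> vecs d" for k using Cx zsc by (simp add: a_def)
      have za: "zs + a k = ?C *v x k" for k unfolding a_def by (rule vec_add_diff_cancel[OF zsc Cx])
      define r where "r = 1 / \<rho>"
      have r0: "r > 0" using \<rho> by (simp add: r_def)
      have r: "\<rho> * r ^ Suc k = r ^ k" for k using \<rho>(1) by (simp add: r_def)
      \<comment> \<open>The deviation from the equilibrium, weighted with \<open>\<rho>^-k\<close>.
        As \<open>xs\<close> is fixed by \<open>?A\<close> without input, the gradient enters
        unshifted.\<close>
      define c where "c k = r ^ k *s (x k - xs)" for k
      define gr where "gr k = grad d f (?C *v x k)" for k
      define w where "w k = r ^ k *s gr k" for k
      have grc: "gr k \<in> vecs d" for k unfolding gr_def by (rule gc[OF xc])
      have dc: "x k - xs \<in> vecs ?n" for k using xc[of k] xs by simp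
      have cc: "c k \<in> vecs ?n" for k using dc by (simp add: c_def)
      have wc: "w k \<in> vecs d" for k using grc by (simp add: w_def)
      have Cd: "?C *v (x k - xs) = a k" for k
        unfolding mult_minus_distrib_mat_vec[OF cd(3) xc xs] zsC a_def ..
      have Cc: "?C *v c k = r ^ k *s a k" for k unfolding c_def mult_mat_vec[OF cd(3) dc] Cd ..
      have step: "\<rho> *s c (Suc k) = ?A *v c k + ?B *v w k" for k
      proof -
        have e: "?A *v (x k - xs) = ?A *v x k - xs" unfolding mult_minus_distrib_mat_vec[OF cd(1) xc xs] xsA ..
        have c2: "?A *v x k \<in> vecs ?n" "?B *v gr k \<in> vecs ?n"
          by (rule mult_mat_vec_carrier[OF cd(1) xc] mult_mat_vec_carrier[OF cd(2) grc])+
        define v1 where "v1 = ?A *v x k"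
        define v2 where "v2 = ?B *v gr k"
        have v: "v1 \<in> vecs ?n" "v2 \<in> vecs ?n" using c2 by (simp_all add: v1_def v2_def)
        have "r ^ k *s (v1 + v2 - xs) = r ^ k *s (v1 - xs) + r ^ k *s v2"
          using v xs by (intro eq_vecI) (auto simp: algebra_simps)
        thus ?thesis unfolding c_def smult_smult_assoc r w_def mult_mat_vec[OF cd(1) dc] mult_mat_vec[OF cd(2) grc] e
          unfolding xS gr_def[symmetric] v1_def[symmetric] v2_def[symmetric] .
      qed
      obtain q where q: "\<forall>y \<in> vecs d. 0 \<le> q y \<and> q y \<le> (grad d f (zs + y) - m *s y) \<bullet> ((L - m) *s y - (grad d f (zs + y) - m *s y))"
        "\<forall>y \<in> vecs d. \<forall>y' \<in> vecs d. (grad d f (zs + y) - m *s y) \<bullet> ((L - m) *s y' - (grad d f (zs + y') - m *s y')) \<le>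
          (grad d f (zs + y) - m *s y) \<bullet> ((L - m) *s y - (grad d f (zs + y) - m *s y)) - q y + q y'"
        by (rule S_class_potential[OF f mL zs])
      define p where "p k = gr k - m *s a k" for k
      define s where "s k = (L - m) *s a k - p k" for k
      have pc: "p k \<in> vecs d" "s k \<in> vecs d" for k using grc ac by (auto simp: p_def s_def)
      have pe: "grad d f (zs + a k) - m *s a k = p k" for k unfolding za p_def gr_def ..
      have q1: "0 \<le> q (a k)" "q (a k) \<le> p k \<bullet> s k" for k
        using q(1)[rule_format, OF ac[of k]] unfolding pe s_def[symmetric] by auto
      have q2: "p k \<bullet> s j \<le> p k \<bullet> s k - q (a k) + q (a j)" for k j
        using q(2)[rule_format, OF ac[of k] ac[of j]] unfolding pe s_def[symmetric] .
      have ws: "w k - m *s (?C *v c k) = r ^ k *s p k" for k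
        unfolding Cc w_def p_def using grc[of k] ac[of k] by (intro eq_vecI) (auto simp: algebra_simps)
      have ss: "(L - m) *s (?C *v c k) - (w k - m *s (?C *v c k)) = r ^ k *s s k" for k
        unfolding ws unfolding Cc s_def using pc(1)[of k] ac[of k] by (intro eq_vecI) (auto simp: algebra_simps)
      have "0 \<le> (\<Sum>k<n. (w k - m *s (?C *v c k)) \<bullet>
          fir d lam l (\<lambda>k. (L - m) *s (?C *v c k) - (w k - m *s (?C *v c k))) k)" for n
      proof -
        \<comment> \<open>The weights of the two factors are \<open>r^k\<close> and
          \<open>r^(k - i) = r^k * \<rho>^i\<close>; this is the origin of the factors
          \<open>\<rho>^i\<close> in the Zames-Falb sum.\<close>
        have "(r ^ k *s p k) \<bullet> fir d lam l (\<lambda>k. r ^ k *s s k) k =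
            (1 / \<rho>) ^ (2 * k) * (\<Sum>i\<le>l. lam i * \<rho> ^ i * (if i \<le> k then p k \<bullet> s (k - i) else 0))" for k
        proof -
          have t: "lam i * (if i \<le> k then (r ^ k *s p k) \<bullet> (r ^ (k - i) *s s (k - i)) else 0) =
              r ^ (2 * k) * (lam i * \<rho> ^ i * (if i \<le> k then p k \<bullet> s (k - i) else 0))" for i
          proof (cases "i \<le> k")
            case True
            have "r ^ i * \<rho> ^ i = 1" using \<rho>(1) by (simp add: r_def power_one_over)
            hence "r ^ (k - i) = r ^ (k - i) * (r ^ i * \<rho> ^ i)" by simp
            also have "\<dots> = r ^ k * \<rho> ^ i" using True by (simp add: mult.assoc[symmetric] power_add[symmetric])
            finally have e: "r ^ (k - i) = r ^ k * \<rho> ^ i" .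
            have "(r ^ k *s p k) \<bullet> (r ^ (k - i) *s s (k - i)) = r ^ k * (r ^ k * \<rho> ^ i) * (p k \<bullet> s (k - i))"
              unfolding e using pc(1)[of k] pc(2)[of "k - i"] by simp
            thus ?thesis using True by (simp add: mult_2 power_add)
          qed simp
          have rp: "r ^ k *s p k \<in> vecs d" and rs: "\<And>k. r ^ k *s s k \<in> vecs d" using pc by auto
          show ?thesis unfolding scalar_prod_fir[where w = "\<lambda>k. r ^ k *s s k", OF rp rs] t sum_distrib_left[symmetric]
            unfolding r_def ..
        qed
        thus ?thesis unfolding ss unfolding ws
          using zames_falb[OF \<rho>(1) lam, of "\<lambda>k. q (a k)" "\<lambda>k j. p k \<bullet> s j" n] q1 q2 by simp
      qed
      hence "sq (?C *v c k) \<le> b * sq (c 0)" using b(2) cc wc step by blast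
      hence "(r ^ k)\<^sup>2 * sq (a k) \<le> b * sq (x 0 - xs)" unfolding Cc sq_smult by (simp add: c_def)
      hence "(\<rho> ^ k)\<^sup>2 * ((r ^ k)\<^sup>2 * sq (a k)) \<le> (\<rho> ^ k)\<^sup>2 * (b * sq (x 0 - xs))" by (rule mult_left_mono) simp
      moreover have "(\<rho> ^ k)\<^sup>2 * (r ^ k)\<^sup>2 = 1"
        using \<rho>(1) by (simp add: r_def power_mult_distrib[symmetric])
      ultimately have "sq (a k) \<le> (\<rho> ^ k)\<^sup>2 * (b * sq (x 0 - xs))" by (simp add: mult.assoc[symmetric])
      hence "(vnorm (a k))\<^sup>2 \<le> (sqrt b * \<rho> ^ k * vnorm (x 0 - xs))\<^sup>2"
        unfolding power_mult_distrib vnorm_power2 using b(1) by (simp add: mult_ac)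
      thus "vnorm (?C *v x k - zs) \<le> sqrt b * \<rho> ^ k * vnorm (x 0 - xs)"
        unfolding a_def by (rule power2_le_imp_le) (use b(1) \<rho> in \<open>simp add: vnorm_def sq_nonneg\<close>)
    qed
  qed
  ultimately have "achieves_convergence d m L G \<rho> ?K" unfolding achieves_convergence_def using dp by blast
  thus ?thesis unfolding rho_ec_def using \<rho> ctl_dims[of nQ Q] by (intro Inf_lower) blast
qed

end

section \<open>Inversion of the multiplier\<close>

text \<open>In dimension 0 all inner products vanish, so stability is all that is required.\<close>

lemma SNR_zero_dim:
  assumes "ss_dims n 0 0 S" "schur (ssA S)" shows "SNR 0 (ss_op S)"
proof -
  have "inner_l2 x w = 0" if "w \<in> l2_signals 0" for x w
  proof -
    have "w k \<in> vecs 0" for k using that by (simp add: l2_signals_def signals_def)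
    hence "dim_vec (w k) = 0" for k by (rule carrier_vecD)
    thus ?thesis by (simp add: inner_l2_def scalar_prod_def)
  qed
  moreover have "stable_op 0 0 (ss_op S)" unfolding stable_op_def using assms by blast
  ultimately show ?thesis unfolding SNR_def by (intro conjI exI[of _ 1]) auto
qed

lemma ss_op_0: "ss_dims n p q G \<Longrightarrow> w \<in> signals p \<Longrightarrow> ss_op G w 0 = ssD G *v w 0"
proof -
  assume G: "ss_dims n p q G" and w: "w \<in> signals p"
  have d: "ssA G \<in> mats n n" "ssC G \<in> mats q n" "ssD G \<in> mats q p" using G by (auto simp: ss_dims_def)
  have "w 0 \<in> vecs p" using w by (simp add: signals_def)
  hence "ssD G *v w 0 \<in> vecs q" by (rule mult_mat_vec_carrier[OF d(3)])
  thus ?thesis using d by (simp add: ss_op_def mult_mat_zero[OF d(2)])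
qed

lemma fir_0:
  assumes "w 0 \<in> vecs n" shows "fir n lam l w 0 = lam 0 *s w 0"
proof (rule eq_vecI)
  fix j assume "j < dim_vec (lam 0 *s w 0)"
  hence j: "j < n" using assms by simp
  have "(\<Sum>i\<le>l. lam i * (if i \<le> 0 then w (0 - i) $ j else 0)) = (\<Sum>i\<le>l. if i = 0 then lam 0 * w 0 $ j else 0)"
    by (intro sum.cong) auto
  thus "fir n lam l w 0 $ j = (lam 0 *s w 0) $ j" using j assms by (simp add: fir_def)
qed (use assms in simp)

text \<open>The filter equation is solved for its current input, which is possible as
  \<open>lam 0\<close> is nonzero. \<open>Q\<close> runs a copy of the filter on its own output next
  to \<open>Z\<close>; its stability is a consequence of \<open>fir_l2\<close>.\<close>

lemma inverse_multiplier:
  assumes lam: "\<forall>i \<in> {1..l}. lam i \<le> 0" and pos: "(\<Sum>i\<le>l. lam i) > 0" and l0: "lam 0 > 0"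
    and Z: "ss_dims nZ p n Z" and sZ: "schur (ssA Z)"
  obtains nQ Q where "ss_dims nQ p n Q" "schur (ssA Q)"
    "\<forall>y \<in> signals p. \<forall>k. fir n lam l (ss_op Q y) k = ss_op Z y k"
proof -
  define \<Lambda> where "\<Lambda> = map (\<lambda>i. lam i \<cdot>\<^sub>m 1\<^sub>m n) [0..<l + 1]"
  define M where "M = multiplier n l \<Lambda>"
  define k where "k = l * n"
  have M: "ss_dims k n n M" unfolding M_def k_def by (rule multiplier_dims[OF \<Lambda>_def])
  have md: "ssA M \<in> mats k k" "ssB M \<in> mats k n" "ssC M \<in> mats n k" using M by (auto simp: ss_dims_def)
  have "\<Lambda> ! 0 = lam 0 \<cdot>\<^sub>m 1\<^sub>m n" unfolding \<Lambda>_def by (subst nth_map) (auto simp del: upt_Suc)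
  hence D: "ssD M *v u = lam 0 *s u" if "u \<in> vecs n" for u
    using that by (simp add: M_def multiplier_def mk_ss_def smult_mat_mult_vec[of _ n n])
  have zd: "ssA Z \<in> mats nZ nZ" "ssB Z \<in> mats nZ p" "ssC Z \<in> mats n nZ" "ssD Z \<in> mats n p"
    using Z by (auto simp: ss_dims_def)
  define U where "U xf \<zeta> y = (1 / lam 0) *s (ssC Z *v \<zeta> + ssD Z *v y - ssC M *v xf)" for xf \<zeta> y
  define X where "X xf \<zeta> y = (ssA M *v xf + ssB M *v U xf \<zeta> y) @v (ssA Z *v \<zeta> + ssB Z *v y)" for xf \<zeta> y
  define u where "u s y = U (vec_first s k) (vec_last s nZ) y" for s y
  define x where "x s y = X (vec_first s k) (vec_last s nZ) y" for s y
  have Uc: "U xf \<zeta> y \<in> vecs n" if "xf \<in> vecs k" "\<zeta> \<in> vecs nZ" "y \<in> vecs p" for xf \<zeta> y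
    unfolding U_def using that
    by (intro smult_carrier_vec[THEN iffD2] minus_carrier_vec add_carrier_vec mult_mat_vec_carrier[OF zd(3)] mult_mat_vec_carrier[OF zd(4)]
        mult_mat_vec_carrier[OF md(3)])
  have lU: "lin j n (\<lambda>t. U (f t) (h t) (i t))" if "lin j k f" "lin j nZ h" "lin j p i" for j f h i
    unfolding U_def by (intro lin_smult lin_minus lin_add lin_mat[OF zd(3)] lin_mat[OF zd(4)] lin_mat[OF md(3)] that)
  have lX: "lin j (k + nZ) (\<lambda>t. X (f t) (h t) (i t))" if "lin j k f" "lin j nZ h" "lin j p i" for j f h i
    unfolding X_def by (intro lin_append lin_add lU lin_mat[OF md(1)] lin_mat[OF md(2)] lin_mat[OF zd(1)] lin_mat[OF zd(2)] that)
  have lu: "lin ((k + nZ) + p) n (\<lambda>t. u (vec_first t (k + nZ)) (vec_last t p))"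
    unfolding u_def by (rule lU[OF lin_first[OF lin_first_id] lin_last[OF lin_first_id] lin_last_id])
  have lx: "lin ((k + nZ) + p) (k + nZ) (\<lambda>t. x (vec_first t (k + nZ)) (vec_last t p))"
    unfolding x_def by (rule lX[OF lin_first[OF lin_first_id] lin_last[OF lin_first_id] lin_last_id])
  define Q where "Q = mk_ss (matf (k + nZ) (k + nZ) (\<lambda>s. x s (0v p))) (matf p (k + nZ) (\<lambda>y. x (0v (k + nZ)) y))
    (matf (k + nZ) n (\<lambda>s. u s (0v p))) (matf p n (\<lambda>y. u (0v (k + nZ)) y))"
  have Qd: "ss_dims (k + nZ) p n Q" by (simp add: Q_def mk_ss_def ss_dims_def)
  have ux: "u (xf @v \<zeta>) y = U xf \<zeta> y" "x (xf @v \<zeta>) y = X xf \<zeta> y" if "xf \<in> vecs k" "\<zeta> \<in> vecs nZ" for xf \<zeta> y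
    using that by (simp_all add: u_def x_def)
  have Qm: "ssA Q *v (xf @v \<zeta>) + ssB Q *v y = X xf \<zeta> y" "ssC Q *v (xf @v \<zeta>) + ssD Q *v y = U xf \<zeta> y"
    "ssA Q *v (xf @v \<zeta>) = X xf \<zeta> (0v p)"
    if c: "xf \<in> vecs k" "\<zeta> \<in> vecs nZ" "y \<in> vecs p" for xf \<zeta> y
  proof -
    have s: "xf @v \<zeta> \<in> vecs (k + nZ)" using c by simp
    show "ssA Q *v (xf @v \<zeta>) + ssB Q *v y = X xf \<zeta> y"
      unfolding Q_def mk_ss_def state_space.simps matf_lin2(1)[OF lx s c(3)] ux[OF c(1,2)] ..
    show "ssA Q *v (xf @v \<zeta>) = X xf \<zeta> (0v p)"
      unfolding Q_def mk_ss_def state_space.simps matf_lin2(2)[OF lx s c(3)] ux[OF c(1,2)] ..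
    show "ssC Q *v (xf @v \<zeta>) + ssD Q *v y = U xf \<zeta> y"
      unfolding Q_def mk_ss_def state_space.simps matf_lin2(1)[OF lu s c(3)] ux[OF c(1,2)] ..
  qed
  have defU: "ssC M *v xf + lam 0 *s U xf \<zeta> y = ssC Z *v \<zeta> + ssD Z *v y"
    if c: "xf \<in> vecs k" "\<zeta> \<in> vecs nZ" "y \<in> vecs p" for xf \<zeta> y
  proof -
    define a where "a = ssC M *v xf"
    define b where "b = ssC Z *v \<zeta> + ssD Z *v y"
    have "a \<in> vecs n" "b \<in> vecs n" unfolding a_def b_def
      by (intro add_carrier_vec mult_mat_vec_carrier[OF md(3)] mult_mat_vec_carrier[OF zd(3)] mult_mat_vec_carrier[OF zd(4)] c)+
    thus ?thesis unfolding U_def a_def[symmetric] b_def[symmetric] using l0 by (intro eq_vecI) auto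
  qed
  have inv: "fir n lam l (ss_op Q y) j = ss_op Z y j" if y: "y \<in> signals p" for y j
  proof -
    have yk: "y j \<in> vecs p" for j using y by (simp add: signals_def)
    define v where "v = ss_op Q y"
    have vdef: "v j = ssC Q *v ss_state Q y j + ssD Q *v y j" for j by (simp add: v_def ss_op_def)
    have v: "v \<in> signals n" unfolding v_def by (rule ss_op_signal[OF Qd y])
    have Mc: "ss_state M v j \<in> vecs k" for j by (rule ss_state_carrier[OF M v])
    have Zc: "ss_state Z y j \<in> vecs nZ" for j by (rule ss_state_carrier[OF Z y])
    have st: "ss_state Q y j = ss_state M v j @v ss_state Z y j" for j
    proof (induction j)
      case 0
      have "ssA Q \<in> mats (k + nZ) (k + nZ)" using Qd by (simp add: ss_dims_def)
      thus ?case using md(1) zd(1) by (simp add: zero_append_zero)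
    next
      case (Suc j)
      have "v j = U (ss_state M v j) (ss_state Z y j) (y j)"
        using vdef[of j, unfolded Suc] Qm(2)[OF Mc Zc yk, of j j j] by (rule trans)
      thus ?case unfolding ss_state.simps(2) Suc Qm(1)[OF Mc Zc yk] X_def by simp
    qed
    have vj: "v j = U (ss_state M v j) (ss_state Z y j) (y j)"
      using vdef[of j, unfolded st] Qm(2)[OF Mc Zc yk, of j j j] by (rule trans)
    have vc: "v j \<in> vecs n" using v by (simp add: signals_def)
    have "fir n lam l v j = ssC M *v ss_state M v j + lam 0 *s v j"
      using multiplier_op[OF \<Lambda>_def v, of j] D[OF vc] by (simp add: M_def ss_op_def)
    also have "\<dots> = ss_op Z y j" unfolding ss_op_def[of Z] defU[OF Mc Zc yk, of j j j, symmetric] vj[symmetric] ..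
    finally show ?thesis by (simp add: v_def)
  qed
  have "schur (ssA Q)"
  proof (rule schur_iff_l2[of _ "k + nZ"])
    show "ssA Q \<in> mats (k + nZ) (k + nZ)" using Qd by (simp add: ss_dims_def)
    fix s assume s: "\<And>j. s j \<in> vecs (k + nZ)" "\<And>j. s (Suc j) = ssA Q *v s j"
    define xf where "xf j = vec_first (s j) k" for j
    define \<zeta> where "\<zeta> j = vec_last (s j) nZ" for j
    have c: "xf j \<in> vecs k" "\<zeta> j \<in> vecs nZ" for j by (auto simp: xf_def \<zeta>_def)
    have se: "s j = xf j @v \<zeta> j" for j using s(1)[of j] by (simp add: xf_def \<zeta>_def)
    define v where "v j = U (xf j) (\<zeta> j) (0v p)" for j
    have vc: "v j \<in> vecs n" for j unfolding v_def by (rule Uc[OF c zero_carrier_vec])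
    hence vs: "v \<in> signals n" by (simp add: signals_def)
    have st: "s (Suc j) = (ssA M *v xf j + ssB M *v v j) @v (ssA Z *v \<zeta> j + 0v nZ)" for j
      unfolding s(2) se[of j] Qm(3)[OF c zero_carrier_vec] X_def v_def mult_mat_zero[OF zd(2)] ..
    have zc: "ssA Z *v \<zeta> j \<in> vecs nZ" for j by (rule mult_mat_vec_carrier[OF zd(1) c(2)])
    have mc: "ssA M *v xf j + ssB M *v v j \<in> vecs k" for j
      by (intro add_carrier_vec mult_mat_vec_carrier[OF md(1) c(1)] mult_mat_vec_carrier[OF md(2) vc])
    have step: "xf (Suc j) = ssA M *v xf j + ssB M *v v j" "\<zeta> (Suc j) = ssA Z *v \<zeta> j + 0v nZ" for j
      using mc[of j] zc[of j] md zd unfolding xf_def[of "Suc j"] \<zeta>_def[of "Suc j"] st by simp_all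
    have l\<zeta>: "l2 \<zeta>" by (rule schur_l2[where x = \<zeta> and d = "\<lambda>_. 0v nZ", OF zd(1) sZ c(2) zero_carrier_vec step(2) l2_zero])
    have sM: "schur (ssA M)" unfolding M_def by (rule schur_multiplier[OF \<Lambda>_def])
    \<comment> \<open>The free response of the filter copy dies out. After its subtraction the
      filter starts from 0, and the convolution formula for \<open>fir\<close> applies to
      \<open>v\<close>.\<close>
    define f where "f j = run (ssA M) (ssB M) (xf 0) (\<lambda>_. 0v n) j" for j
    have z: "(\<lambda>_. 0v n) \<in> signals n" by (simp add: signals_def)
    have fc: "f j \<in> vecs k" for j unfolding f_def by (rule run_carrier[OF md(1,2) c(1) z])
    have lf: "l2 f" by (rule schur_l2[where x = f and d = "\<lambda>_. 0v k", OF md(1) sM fc zero_carrier_vec _ l2_zero])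
        (simp add: f_def mult_mat_zero[OF md(2)])
    have xr: "xf j = run (ssA M) (ssB M) (xf 0) v j" for j by (induction j) (auto simp: step)
    have r0: "ss_state M v j = run (ssA M) (ssB M) (0v k) v j" for j unfolding ss_state_eq_run using md by simp
    have Mc: "ss_state M v j \<in> vecs k" for j by (rule ss_state_carrier[OF M vs])
    have xs: "xf j = f j + ss_state M v j" for j
      using run_superposition[OF md(1,2) c(1) vs, of 0 j] by (simp add: f_def xr[of j] r0)
    have fe: "fir n lam l v j = ssC Z *v \<zeta> j - ssC M *v f j" for j
    proof -
      define a where "a = ssC M *v ss_state M v j"
      define b where "b = ssC M *v f j"
      define e where "e = ssC Z *v \<zeta> j"
      have ac: "a \<in> vecs n" "b \<in> vecs n" "e \<in> vecs n" unfolding a_def b_def e_def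
        by (rule mult_mat_vec_carrier[OF md(3) Mc] mult_mat_vec_carrier[OF md(3) fc] mult_mat_vec_carrier[OF zd(3) c(2)])+
      have "ssC M *v xf j + lam 0 *s v j = e"
        using defU[OF c zero_carrier_vec, of j j] ac(3) by (simp add: v_def e_def mult_mat_zero[OF zd(4)])
      hence h: "(b + a) + lam 0 *s v j = e"
        unfolding xs mult_add_distrib_mat_vec[OF md(3) fc Mc] a_def b_def .
      have "fir n lam l v j = a + lam 0 *s v j"
        using multiplier_op[OF \<Lambda>_def vs, of j] D[OF vc] by (simp add: M_def ss_op_def a_def)
      also have "\<dots> = e - b" unfolding h[symmetric] using ac vc[of j] by (intro eq_vecI) auto
      finally show ?thesis by (simp add: e_def b_def)
    qed
    have "l2 (\<lambda>j. ssC Z *v vec_first (\<zeta> j @v f j) nZ - ssC M *v vec_last (\<zeta> j @v f j) k)"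
      by (rule l2_lin[where x = "\<lambda>j. \<zeta> j @v f j", OF lin_minus[OF lin_mat[OF zd(3) lin_first_id] lin_mat[OF md(3) lin_last_id]] _
            l2_append[where x = \<zeta> and y = f, OF c(2) l\<zeta> fc lf]])
        (use c fc in simp)
    hence "l2 (fir n lam l v)" using carrier_vecD[OF c(2)] carrier_vecD[OF fc] by (simp add: fe[abs_def])
    hence lv: "l2 v" by (rule fir_l2[OF lam pos vs])
    have "l2 xf" by (rule schur_l2[where x = xf and d = "\<lambda>j. ssB M *v v j", OF md(1) sM c(1) _ step(1) l2_mat[where x = v, OF md(2) vc lv]])
        (rule mult_mat_vec_carrier[OF md(2) vc])
    hence "l2 (\<lambda>j. xf j @v \<zeta> j)" by (rule l2_append[where x = xf and y = \<zeta>, OF c(1) _ c(2) l\<zeta>])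
    thus "l2 s" by (simp add: se[abs_def])
  qed
  thus ?thesis using that[OF Qd] inv by blast
qed

section \<open>Identification of the filtered loop with the operator of the SNR condition\<close>

context observer_loop
begin

text \<open>Separates the formulas behind \<open>hx\<close> and \<open>hz\<close> into the part of
  \<open>T1\<close>, with state \<open>a\<close>, observer error and input \<open>p\<close>, and the
  part of \<open>T2\<close>, with state \<open>b\<close> and input \<open>q\<close>.\<close>

lemma state_superposition:
  assumes S: "S \<in> mats j N" and B: "B \<in> mats j nu" and F: "F \<in> mats j d"
    and c: "a \<in> vecs N" "e \<in> vecs N" "b \<in> vecs N" "q \<in> vecs nu" "p \<in> vecs d"
  shows "S *v (a + b) + B *v (Mt *v ((a + b) - e) + q) + F *v p =
      (((S + B * Mt) *v a + (- (B * Mt)) *v e) + F *v p) + ((S + B * Mt) *v b + B *v q)"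
proof -
  have BM: "B * Mt \<in> mats j N" using B Mt by simp
  have mc: "Mt *v a \<in> vecs nu" "Mt *v b \<in> vecs nu" "Mt *v e \<in> vecs nu"
    using mult_mat_vec_carrier[OF Mt] c by auto
  have ab: "a + b \<in> vecs N" using c by simp
  have n: "(- (B * Mt)) *v e = - (B *v (Mt *v e))"
  proof -
    have "(- (B * Mt)) *v e = - ((B * Mt) *v e)"
      using carrier_matD(2)[OF BM] carrier_vecD[OF c(2)] by (intro eq_vecI) (auto simp del: index_mult_mat)
    thus ?thesis using assoc_mult_mat_vec[OF B Mt c(2)] by simp
  qed
  have s: "(S + B * Mt) *v x = S *v x + B *v (Mt *v x)" if "x \<in> vecs N" for x
    using add_mult_distrib_mat_vec[OF S BM that] assoc_mult_mat_vec[OF B Mt that] by simp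
  have m: "Mt *v ((a + b) - e) = Mt *v a + Mt *v b - Mt *v e"
    unfolding mult_minus_distrib_mat_vec[OF Mt ab c(2)] mult_add_distrib_mat_vec[OF Mt c(1,3)] ..
  have t: "B *v (Mt *v ((a + b) - e) + q) = B *v (Mt *v a) + B *v (Mt *v b) - B *v (Mt *v e) + B *v q"
    unfolding m using mc c(4) mult_add_distrib_mat_vec[OF B, of "Mt *v a + Mt *v b - Mt *v e" q]
      mult_minus_distrib_mat_vec[OF B add_carrier_vec[OF mc(1,2)] mc(3)] mult_add_distrib_mat_vec[OF B mc(1,2)] by simp
  define b1 b2 b3 b4 b5 b6 b7 where "b1 = S *v a" and "b2 = S *v b" and "b3 = B *v (Mt *v a)" and "b4 = B *v (Mt *v b)"
    and "b5 = B *v (Mt *v e)" and "b6 = B *v q" and "b7 = F *v p"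
  have "b1 \<in> vecs j" "b2 \<in> vecs j" "b3 \<in> vecs j" "b4 \<in> vecs j" "b5 \<in> vecs j" "b6 \<in> vecs j" "b7 \<in> vecs j"
    unfolding b1_def b2_def b3_def b4_def b5_def b6_def b7_def
    using mult_mat_vec_carrier[OF S] mult_mat_vec_carrier[OF B] mult_mat_vec_carrier[OF F] mc c by auto
  thus ?thesis unfolding t n s[OF c(1)] s[OF c(3)] mult_add_distrib_mat_vec[OF S c(1,3)]
    unfolding b1_def[symmetric] b2_def[symmetric] b3_def[symmetric] b4_def[symmetric] b5_def[symmetric] b6_def[symmetric] b7_def[symmetric]
    by (intro eq_vecI) auto
qed

text \<open>Without the filter, the loop with \<open>Q\<close> is \<open>T1 + T2 Q T3\<close>.
  Applying the multiplier and moving it past \<open>T2\<close> leaves the filtered \<open>Q\<close>,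
  which is \<open>Z\<close> by \<open>inv\<close>.\<close>

lemma filtered_operator:
  assumes Q: "ss_dims nQ (d + nv) nu Q" and Z: "ss_dims nZ (d + nv) nu Z"
    and \<Lambda>: "\<Lambda> = map (\<lambda>i. lam i \<cdot>\<^sub>m 1\<^sub>m d) [0..<l + 1]"
    and inv: "\<forall>y \<in> signals (d + nv). \<forall>k. fir nu lam l (ss_op Q y) k = ss_op Z y k"
    and w: "w \<in> signals d"
  shows "ss_op (fil_loop (multiplier d l \<Lambda>) (l * d) nQ Q) w =
    add_op (ss_op (multiplier d l \<Lambda>) \<circ> ss_op (T1_ss P Mt Lt)) (ss_op (T2_ss P Mt) \<circ> ss_op Z \<circ> ss_op (T3_ss P Lt)) w"
proof
  fix k0
  let ?M = "multiplier d l \<Lambda>" and ?nf = "l * d"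
  have M: "ss_dims ?nf d d ?M" and sM': "schur (ssA ?M)" by (rule multiplier_dims[OF \<Lambda>] schur_multiplier[OF \<Lambda>])+
  interpret Y: youla_plant "(N + N) + ?nf" d nu "d + nv" "fA ?M ?nf" "fB1 ?M ?nf" "fB ?M ?nf" "fC1 ?M ?nf" "fD1 ?M ?nf" "fE ?M ?nf" "fC ?nf"
    "0\<^sub>m (d + nv) d" by (rule youla_plant[OF M sM'])
  note T = T_dims[OF G P Mt Lt]
  define y where "y = ss_op (T3_ss P Lt) w"
  define u where "u = ss_op Q y"
  have ys: "y \<in> signals (d + nv)" unfolding y_def by (rule ss_op_signal[OF T(3) w])
  have us: "u \<in> signals nu" unfolding u_def by (rule ss_op_signal[OF Q ys])
  have wk: "w k \<in> vecs d" and uk: "u k \<in> vecs nu" for k using w us by (auto simp: signals_def)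
  define t where "t = ss_state (T3_ss P Lt) w"
  define b where "b = ss_state (T2_ss P Mt) u"
  define a where "a k = vec_first (ss_state (T1_ss P Mt Lt) w k) N" for k
  have tc: "t k \<in> vecs N" and bc: "b k \<in> vecs N" and ac: "a k \<in> vecs N" for k
    unfolding t_def b_def a_def using ss_state_carrier[OF T(3) w] ss_state_carrier[OF T(2) us] by auto
  have s1c: "ss_state (T1_ss P Mt Lt) w k \<in> vecs (N + N)" for k by (rule ss_state_carrier[OF T(1) w])
  have mats: "gA P + gB P * Mt \<in> mats N N" "- (gB P * Mt) \<in> mats N N" "gA P + Lt * gC P \<in> mats N N"
    "gB1 P + Lt * gF P \<in> mats N d" "gC1 P + gE P * Mt \<in> mats d N" "- (gE P * Mt) \<in> mats d N"
    "Lt * gF P \<in> mats N d"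
    using g Mt Lt by auto
  have F0: "(gB1 P + Lt * gF P) *v v = gB1 P *v v" if v: "v \<in> vecs d" for v
  proof -
    have "(Lt * gF P) *v v = 0v N"
      using assoc_mult_mat_vec[OF Lt g(8) v] gen_plant_mult(8)[OF G P zero_carrier_vec zero_carrier_vec v zero_carrier_vec]
      by (simp add: mult_mat_zero[OF Lt])
    thus ?thesis using add_mult_distrib_mat_vec[OF g(2) mats(7) v] mult_mat_vec_carrier[OF g(2) v] by simp
  qed
  have he_eq: "he e v = (gA P + Lt * gC P) *v e + gB1 P *v v" if e: "e \<in> vecs N" and v: "v \<in> vecs d" for e v
    unfolding he_def he_alt[OF e, symmetric] mult_mat_zero[OF g(2)]
    using mult_mat_vec_carrier[OF g(1) e] mult_mat_vec_carrier[OF Lt mult_mat_vec_carrier[OF g(7) e]] by simp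
  have t_step: "t (Suc k) = he (t k) (w k)" for k
    unfolding he_eq[OF tc wk] unfolding t_def by (simp add: T3_ss_def mk_ss_def F0[OF wk])
  have t0: "t 0 = 0v N" "b 0 = 0v N" using Lt g(3) by (simp_all add: t_def b_def T3_ss_def T2_ss_def mk_ss_def)
  have y_eq: "y k = gC P *v t k" for k
  proof -
    have "gF P *v w k = 0v (d + nv)" by (rule gen_plant_mult(8)[OF G P zero_carrier_vec zero_carrier_vec wk zero_carrier_vec])
    thus ?thesis using mult_mat_vec_carrier[OF g(7) tc[of k]]
      by (simp add: y_def ss_op_def t_def[symmetric] T3_ss_def mk_ss_def) (simp add: t_def T3_ss_def mk_ss_def)
  qed
  have b_step: "b (Suc k) = (gA P + gB P * Mt) *v b k + gB P *v u k" for k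
    by (simp add: b_def T2_ss_def mk_ss_def)
  have b_out: "ss_op (T2_ss P Mt) u k = (gC1 P + gE P * Mt) *v b k + gE P *v u k" for k
    by (simp add: b_def T2_ss_def mk_ss_def ss_op_def)
  define an where "an k = ((gA P + gB P * Mt) *v a k + (- (gB P * Mt)) *v t k) + gB1 P *v w k" for k
  have anc: "an k \<in> vecs N" for k unfolding an_def
    by (intro add_carrier_vec mult_mat_vec_carrier[OF mats(1) ac] mult_mat_vec_carrier[OF mats(2) tc] mult_mat_vec_carrier[OF g(2) wk])
  have s1: "ss_state (T1_ss P Mt Lt) w k = a k @v t k \<and> (k > 0 \<longrightarrow> a k = an (k - 1))" for k
  proof (induction k)
    case 0
    have "ssA (T1_ss P Mt Lt) \<in> mats (N + N) (N + N)" using T(1) by (simp add: ss_dims_def)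
    hence "ss_state (T1_ss P Mt Lt) w 0 = 0v N @v 0v N" by (simp add: zero_append_zero)
    thus ?case by (simp add: a_def t0)
  next
    case (Suc k)
    have dA: "dim_row (gA P) = N" "dim_col (gA P) = N" using g(1) by auto
    have "ss_state (T1_ss P Mt Lt) w (Suc k) =
        four_block_mat (gA P + gB P * Mt) (- (gB P * Mt)) (0\<^sub>m N N) (gA P + Lt * gC P) *v (a k @v t k) +
        (gB1 P @\<^sub>r (gB1 P + Lt * gF P)) *v w k"
      using Suc by (simp add: T1_ss_def mk_ss_def dA)
    also have "four_block_mat (gA P + gB P * Mt) (- (gB P * Mt)) (0\<^sub>m N N) (gA P + Lt * gC P) *v (a k @v t k) =
        ((gA P + gB P * Mt) *v a k + (- (gB P * Mt)) *v t k) @v ((gA P + Lt * gC P) *v t k)"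
      unfolding four_block_mat_mult_vec[OF mats(1,2) zero_carrier_mat mats(3) ac tc] zero_mat_mult_vec[OF ac]
      using mult_mat_vec_carrier[OF mats(3) tc] by simp
    also have "(gB1 P @\<^sub>r (gB1 P + Lt * gF P)) *v w k = (gB1 P *v w k) @v (gB1 P *v w k)"
      unfolding mat_mult_append[OF g(2) mats(4) wk] F0[OF wk] ..
    also have "(((gA P + gB P * Mt) *v a k + (- (gB P * Mt)) *v t k) @v ((gA P + Lt * gC P) *v t k)) + ((gB1 P *v w k) @v (gB1 P *v w k)) =
        an k @v he (t k) (w k)"
      unfolding an_def he_eq[OF tc wk]
      by (rule append_vec_add[of _ N _ _ N])
        (intro add_carrier_vec mult_mat_vec_carrier[OF mats(1) ac] mult_mat_vec_carrier[OF mats(2) tc] mult_mat_vec_carrier[OF g(2) wk]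
          mult_mat_vec_carrier[OF mats(3) tc])+
    finally show ?case using anc[of k] by (simp add: t_step a_def)
  qed
  have a_step: "a (Suc k) = an k" for k using s1[of "Suc k"] by simp
  have "ssA (T1_ss P Mt Lt) \<in> mats (N + N) (N + N)" using T(1) by (simp add: ss_dims_def)
  hence a0: "a 0 = 0v N" by (auto simp: a_def vec_first_def intro!: eq_vecI)
  have x_step: "a (Suc k) + b (Suc k) = hx (a k + b k) (t k) (u k) (w k)" for k
    unfolding hx_def state_superposition[OF g(1,3,2) ac tc bc uk wk] a_step an_def b_step ..
  have z1: "ss_op (T1_ss P Mt Lt) w k = ((gC1 P + gE P * Mt) *v a k + (- (gE P * Mt)) *v t k) + gD1 P *v w k" for k
    unfolding ss_op_def conjunct1[OF s1] by (simp add: T1_ss_def mk_ss_def append_columns_mult[OF mats(5,6) ac tc])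
  define z where "z k = ss_op (T1_ss P Mt Lt) w k + ss_op (T2_ss P Mt) u k" for k
  have z_eq: "z k = hz (a k + b k) (t k) (u k) (w k)" for k
    unfolding hz_def state_superposition[OF g(4,6,5) ac tc bc uk wk] z_def z1 b_out ..
  have z1s: "ss_op (T1_ss P Mt Lt) w \<in> signals d" and z2s: "ss_op (T2_ss P Mt) u \<in> signals d"
    by (rule ss_op_signal[OF T(1) w] ss_op_signal[OF T(2) us])+
  hence zs: "z \<in> signals d" by (simp add: z_def signals_def)
  have zk: "z k \<in> vecs d" for k using zs by (simp add: signals_def)
  define xf where "xf = ss_state ?M z"
  have xfc: "xf k \<in> vecs ?nf" for k unfolding xf_def by (rule ss_state_carrier[OF M zs])
  have "ssA ?M \<in> mats ?nf ?nf" using M by (simp add: ss_dims_def)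
  hence xf0: "xf 0 = 0v ?nf" by (simp add: xf_def)
  define x where "x k = ((a k + b k) @v t k) @v xf k" for k
  have abc: "a k + b k \<in> vecs N" for k using ac bc by simp
  have xc: "x k \<in> vecs ((N + N) + ?nf)" for k using abc tc xfc by (simp add: x_def)
  have "ss_op (Y.loop_ss nQ Q) w k0 = fC1 ?M ?nf *v x k0 + fD1 ?M ?nf *v w k0 + fE ?M ?nf *v ss_op Q y k0"
  proof (rule Y.loop_ss_op[where x = x, OF Q w xc])
    show "x 0 = 0v ((N + N) + ?nf)" by (simp add: x_def a0 t0 xf0 zero_append_zero)
    fix k
    show "y k = fC ?nf *v x k + 0\<^sub>m (d + nv) d *v w k"
      unfolding fil_mult(3)[OF M xc wk uk] zero_mat_mult_vec[OF wk] y_eq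
      using bc[of k] tc[of k] xfc[of k] mult_mat_vec_carrier[OF g(7) tc[of k]] by (simp add: x_def)
    show "x (Suc k) = fA ?M ?nf *v x k + fB1 ?M ?nf *v w k + fB ?M ?nf *v ss_op Q y k"
      unfolding u_def[symmetric] fil_mult(1)[OF M xc wk uk] unfolding x_def fil_append(1)[OF abc tc xfc]
      by (simp add: x_step t_step xf_def z_eq)
  qed
  also have "\<dots> = ss_op ?M z k0"
    unfolding u_def[symmetric] fil_mult(2)[OF M xc wk uk] unfolding x_def fil_append(2)[OF abc tc xfc]
    by (simp add: ss_op_def xf_def z_eq)
  also have "\<dots> = fir d lam l (ss_op (T1_ss P Mt Lt) w) k0 + fir d lam l (ss_op (T2_ss P Mt) u) k0"
    unfolding multiplier_op[OF \<Lambda> zs] unfolding z_def[abs_def] by (rule fir_add[OF z1s z2s])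
  \<comment> \<open>The filter moves from the \<open>d\<close> outputs of \<open>T2\<close> to its
    \<open>nu\<close> inputs; this change of dimension makes sense only for scalar
    coefficients.\<close>
  also have "fir d lam l (ss_op (T2_ss P Mt) u) k0 = ss_op (T2_ss P Mt) (fir nu lam l u) k0" by (rule fir_commute[OF T(2) us])
  also have "fir nu lam l u = ss_op Z y" using inv ys unfolding u_def by (intro ext) blast
  also have "fir d lam l (ss_op (T1_ss P Mt Lt) w) k0 = ss_op ?M (ss_op (T1_ss P Mt Lt) w) k0"
    by (rule multiplier_op[OF \<Lambda> z1s, symmetric])
  finally show "ss_op (Y.loop_ss nQ Q) w k0 = add_op (ss_op ?M \<circ> ss_op (T1_ss P Mt Lt))
      (ss_op (T2_ss P Mt) \<circ> ss_op Z \<circ> ss_op (T3_ss P Lt)) w k0"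
    by (simp add: add_op_def y_def)
qed

text \<open>The generalized plant has \<open>F = 0\<close> and \<open>D\<^sub>1 = - I\<close>, so that the response to an impulse starts with
  \<open>- \<lambda>\<^sub>0\<close> times the impulse.\<close>

lemma lam0_pos:
  assumes d: "d > 0" and \<Lambda>: "\<Lambda> = map (\<lambda>i. lam i \<cdot>\<^sub>m 1\<^sub>m d) [0..<l + 1]" and Z: "ss_dims nZ (d + nv) nu Z"
    and snr: "SNR d (add_op (ss_op (multiplier d l \<Lambda>) \<circ> ss_op (T1_ss P Mt Lt)) (ss_op (T2_ss P Mt) \<circ> ss_op Z \<circ> ss_op (T3_ss P Lt)))"
  shows "lam 0 > 0"
proof -
  let ?H = "add_op (ss_op (multiplier d l \<Lambda>) \<circ> ss_op (T1_ss P Mt Lt)) (ss_op (T2_ss P Mt) \<circ> ss_op Z \<circ> ss_op (T3_ss P Lt))"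
  note T = T_dims[OF G P Mt Lt]
  obtain \<epsilon> where \<epsilon>: "\<epsilon> > 0" "margin_SNR d ?H \<epsilon>" by (rule SNR_finite_support[OF snr])
  define w where "w k = (if k = 0 then unit_vec d 0 else 0v d :: real vec)" for k :: nat
  have w: "w \<in> signals d" by (simp add: w_def signals_def)
  have wk: "w k \<in> vecs d" for k by (simp add: w_def)
  define y where "y = ss_op (T3_ss P Lt) w"
  have ys: "y \<in> signals (d + nv)" unfolding y_def by (rule ss_op_signal[OF T(3) w])
  define u where "u = ss_op Z y"
  have us: "u \<in> signals nu" unfolding u_def by (rule ss_op_signal[OF Z ys])
  have y0: "y 0 = 0v (d + nv)"
    unfolding y_def ss_op_0[OF T(3) w]
    using gen_plant_mult(8)[OF G P zero_carrier_vec zero_carrier_vec wk zero_carrier_vec] by (simp add: T3_ss_def mk_ss_def)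
  have u0: "u 0 = 0v nu"
    unfolding u_def ss_op_0[OF Z ys] y0 using Z by (intro mult_mat_zero) (simp add: ss_dims_def)
  have z2: "ss_op (T2_ss P Mt) u 0 = 0v d"
    unfolding ss_op_0[OF T(2) us] u0 by (simp add: T2_ss_def mk_ss_def mult_mat_zero[OF g(6)])
  have z1s: "ss_op (T1_ss P Mt Lt) w \<in> signals d" by (rule ss_op_signal[OF T(1) w])
  have z1: "ss_op (T1_ss P Mt Lt) w 0 = - w 0"
    unfolding ss_op_0[OF T(1) w]
    using gen_plant_mult(5)[OF G P zero_carrier_vec zero_carrier_vec wk zero_carrier_vec] by (simp add: T1_ss_def mk_ss_def)
  have "ss_op (multiplier d l \<Lambda>) (ss_op (T1_ss P Mt Lt) w) 0 = lam 0 *s (- w 0)"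
    unfolding multiplier_op[OF \<Lambda> z1s] using fir_0[of "ss_op (T1_ss P Mt Lt) w" d lam l] wk[of 0] by (simp add: z1)
  hence "?H w 0 = lam 0 *s (- w 0)" using wk[of 0] z2 by (simp add: add_op_def y_def u_def)
  moreover have "sq (w 0) = 1" using d by (simp add: w_def)
  ultimately have H: "?H w 0 \<bullet> w 0 = - lam 0" using wk[of 0] by simp
  have "(\<Sum>k<(1::nat). ?H w k \<bullet> w k) \<le> - \<epsilon> * (\<Sum>k<(1::nat). sq (w k))"
    by (rule \<epsilon>(2)[unfolded margin_SNR_def, rule_format, OF w]) (simp add: w_def)
  thus ?thesis using H \<open>sq (w 0) = 1\<close> \<epsilon>(1) by simp
qed

end

lemma schur_trivial: "schur (0\<^sub>m 0 0)"
proof (rule schur_iff_l2[of _ 0])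
  fix x :: signal assume x: "\<And>k. x k \<in> vecs 0"
  have "sq (x k) = 0" for k using carrier_vecD[OF x[of k]] by (simp add: scalar_prod_def)
  thus "l2 x" unfolding l2_def by (intro exI[of _ 0]) simp
qed simp

text \<open>For \<open>i \<ge> 1\<close> the power \<open>(1 / \<rho>)^i\<close> is at least
  \<open>1 / \<rho>\<close> while \<open>lam i \<le> 0\<close>, so \<open>lam 0\<close> plus
  \<open>1 / \<rho>\<close> times the remaining sum is nonnegative. Multiplication by
  \<open>\<rho> < 1\<close> shrinks \<open>lam 0 > 0\<close> strictly, which makes the plain sum
  positive.\<close>

lemma lam_sum_pos:
  fixes lam :: "nat \<Rightarrow> real"
  assumes \<rho>: "0 < \<rho>" "\<rho> < 1" and lam: "\<forall>i \<in> {1..l}. lam i \<le> 0" and s: "(\<Sum>i\<le>l. lam i * (1 / \<rho>) ^ i) \<ge> 0"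
    and l0: "lam 0 > 0"
  shows "(\<Sum>i\<le>l. lam i) > 0"
proof -
  have split: "{..l} = insert 0 {1..l}" by auto
  have "(\<Sum>i\<in>{1..l}. lam i * (1 / \<rho>) ^ i) \<le> (\<Sum>i\<in>{1..l}. lam i * (1 / \<rho>))"
  proof (intro sum_mono mult_left_mono_neg)
    fix i assume i: "i \<in> {1..l}"
    show "lam i \<le> 0" using lam i by blast
    have "(1 / \<rho>) ^ 1 \<le> (1 / \<rho>) ^ i" by (rule power_increasing) (use i \<rho> in auto)
    thus "1 / \<rho> \<le> (1 / \<rho>) ^ i" by simp
  qed
  hence "0 \<le> lam 0 + (\<Sum>i\<in>{1..l}. lam i) * (1 / \<rho>)" using s unfolding split sum_distrib_right by simp
  hence "0 \<le> \<rho> * (lam 0 + (\<Sum>i\<in>{1..l}. lam i) * (1 / \<rho>))" using \<rho> by simp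
  also have "\<dots> = \<rho> * lam 0 + (\<Sum>i\<in>{1..l}. lam i)" using \<rho> by (simp add: distrib_left)
  also have "\<dots> < lam 0 + (\<Sum>i\<in>{1..l}. lam i)" using \<rho> l0 by simp
  finally show ?thesis unfolding split by simp
qed

section \<open>The bound on the extremum control rate\<close>

context observer_loop
begin

lemma rho_ec_le:
  assumes "SNR_condition d l nu nv \<rho> P Mt Lt"
  shows "rho_ec d nu nv m L G \<le> ereal \<rho>"
proof -
  let ?op = "\<lambda>\<Lambda> Z. add_op (ss_op (multiplier d l \<Lambda>) \<circ> ss_op (T1_ss P Mt Lt)) (ss_op (T2_ss P Mt) \<circ> ss_op Z \<circ> ss_op (T3_ss P Lt))"
  obtain \<Lambda> nZ Z where \<Lambda>r: "\<Lambda> \<in> Lambda_r d l \<rho>" and Z: "ss_dims nZ (d + nv) nu Z" "schur (ssA Z)" and snr: "SNR d (?op \<Lambda> Z)"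
    using assms unfolding SNR_condition_def by blast
  obtain lam where \<Lambda>: "\<Lambda> = map (\<lambda>i. lam i \<cdot>\<^sub>m 1\<^sub>m d) [0..<l + 1]" and lam: "\<forall>i \<in> {1..l}. lam i \<le> 0"
    "(\<Sum>i\<le>l. lam i * \<rho> ^ i) \<ge> 0" "(\<Sum>i\<le>l. lam i * (1 / \<rho>) ^ i) \<ge> 0" using \<Lambda>r unfolding Lambda_r_def by blast
  show ?thesis
  proof (cases "d = 0")
    \<comment> \<open>No unit impulse exists here to show \<open>lam 0 > 0\<close>, but every stable
      loop is SNR, so the zero Youla parameter without states will do.\<close>
    case True
    define Q where "Q = mk_ss (0\<^sub>m 0 0) (0\<^sub>m 0 (d + nv)) (0\<^sub>m nu 0) (0\<^sub>m nu (d + nv))"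
    have Q: "ss_dims 0 (d + nv) nu Q" "schur (ssA Q)" by (simp_all add: Q_def mk_ss_def ss_dims_def schur_trivial)
    let ?M = "multiplier d l \<Lambda>" and ?nf = "l * d"
    have M: "ss_dims ?nf d d ?M" and sM': "schur (ssA ?M)" by (rule multiplier_dims[OF \<Lambda>] schur_multiplier[OF \<Lambda>])+
    interpret Y: youla_plant "(N + N) + ?nf" d nu "d + nv" "fA ?M ?nf" "fB1 ?M ?nf" "fB ?M ?nf" "fC1 ?M ?nf" "fD1 ?M ?nf" "fE ?M ?nf" "fC ?nf"
      "0\<^sub>m (d + nv) d" by (rule youla_plant[OF M sM'])
    have "SNR d (ss_op (fil_loop ?M ?nf 0 Q))"
      using SNR_zero_dim[OF _ Y.schur_loop[OF Q]] Y.loop_ss_dims[of 0 Q] True by simp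
    thus ?thesis by (rule rho_ec_bound[OF Q \<Lambda> lam])
  next
    case False
    hence l0: "lam 0 > 0" using lam0_pos[OF _ \<Lambda> Z(1) snr] by simp
    obtain nQ Q where Q: "ss_dims nQ (d + nv) nu Q" "schur (ssA Q)"
      "\<forall>y \<in> signals (d + nv). \<forall>k. fir nu lam l (ss_op Q y) k = ss_op Z y k"
      by (rule inverse_multiplier[OF lam(1) lam_sum_pos[OF \<rho> lam(1,3) l0] l0 Z])
    have "SNR d (ss_op (fil_loop (multiplier d l \<Lambda>) (l * d) nQ Q))"
      using SNR_cong[OF filtered_operator[OF Q(1) Z(1) \<Lambda> Q(3)]] snr by simp
    thus ?thesis by (rule rho_ec_bound[OF Q(1,2) \<Lambda> lam])
  qed
qed

end

theorem theorem5p4: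
  fixes m L \<rho> :: real and d l nG nu nv n1 n2 :: nat
    and G :: plant and P :: gen_plant and Mt Lt U V1 V2 V :: "real mat"
    and R :: realization
  assumes "0 < m" and "m < L"
    and "plant_dims nG nu nv d G"
    and "0 < \<rho>" and "\<rho> < 1"
    and "P = gen_plant_of nG nv d m L \<rho> G"
    and "Mt \<in> carrier_mat nu (d + nG)" and "schur (gA P + gB P * Mt)"
    and "Lt \<in> carrier_mat (d + nG) (d + nv)" and "schur (gA P + Lt * gC P)"
    and "realization_dims d l nu nv n1 n2 R"
    and "schur (rA1 R)" and "schur (rA2 R)"
    and "affine_in_tuple d l (rC11 R)" and "affine_in_tuple d l (rD1 R)"
    and "is_realization d l nu P Mt Lt R"
    and "kernel_basis_mat (rC R @\<^sub>c rF R) U"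
    and "dim_row V1 = n2" and "dim_row V2 = d" and "dim_col V1 = dim_col V2"
    and "kernel_basis_mat (transpose_mat (rB22 R) @\<^sub>c transpose_mat (rE R)) (V1 @\<^sub>r V2)"
    and "V = four_block_mat (1\<^sub>m n1) (0\<^sub>m n1 (dim_col V1)) (0\<^sub>m (n2 + d) n1) (V1 @\<^sub>r V2)"
  shows "(SNR_condition d l nu nv \<rho> P Mt Lt \<longleftrightarrow> LMI_condition d l n1 n2 \<rho> R U V) \<and>
         (SNR_condition d l nu nv \<rho> P Mt Lt \<longrightarrow> rho_ec d nu nv m L G \<le> ereal \<rho>) \<and>
         (LMI_condition d l n1 n2 \<rho> R U V \<longrightarrow> rho_ec d nu nv m L G \<le> ereal \<rho>)"
proof -
  interpret R: structured_realization d l nu nv n1 n2 R by unfold_locales (rule assms)+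
  interpret C: observer_loop nG nu nv d m L \<rho> G P Mt Lt by unfold_locales (rule assms)+
  have "SNR_condition d l nu nv \<rho> P Mt Lt \<longleftrightarrow> LMI_condition d l n1 n2 \<rho> R U V"
    by (rule R.SNR_iff_LMI[OF assms(3,6,7,9,16-22)])
  thus ?thesis using C.rho_ec_le by blast
qed

end
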